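(* Assume that for any $\epsilon>0$ $$\lim_{n\to\infty}\frac{\overline\phi_n}{n^{\epsilon}}=0,\qquad\lim_{n\to\infty}\frac{\nu_n}{n^{\epsilon}}=0,\qquad\lim_{n\to\infty}\frac{|\Lambda|_n}{n^{1/2+\epsilon}}=0 .$$ Then there exist terms $B_n$, $n\ge2$, independent of $S$, with $\lim_{n\to\infty}B_n/n^{\epsilon}=0$ for any $\epsilon>0$, such that for any $n\ge2$, any $0<\delta<1/2$ and any continuously differentiable 1-periodic function $S$, the model selection estimator $S^*$ satisfies $$\mathcal R_n^*(S^*,S)\le\frac{1+5\delta}{1-\delta}\min_{\lambda\in\Lambda}\mathcal R_n^*(S^*_\lambda,S)+\frac{B_n(1+\|\dot S\|^2)}{n\delta},$$ where $\dot S$ is the derivative of $S$.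
   Context: Model. Let $\Pi$ be a fixed positive (Lévy) measure on $\mathbb R_0=\mathbb R\setminus\{0\}$ with $\int x^2\,\Pi(dx)=1$ and $\int x^6\,\Pi(dx)<\infty$ ($\Pi(\mathbb R_0)=+\infty$ is allowed). Let $(w_t)$ be a standard Brownian motion and $\mu(ds\,dx)$ a jump (Poisson random) measure independent of $w$ with deterministic compensator $\widetilde\mu(ds\,dx)=ds\,\Pi(dx)$. Put $z_t=\int_0^t\int_{\mathbb R_0}x\,(\mu-\widetilde\mu)(ds\,dx)$ and $\xi_t=\sigma_1w_t+\sigma_2z_t$ with constants $\sigma_1,\sigma_2$. One observes $(y_t)_{0\le t\le n}$ with $dy_t=S(t)\,dt+d\xi_t$, where $S:\mathbb R\to\mathbb R$ is an unknown 1-periodic function. $Q$ denotes the law of $(\xi_t)_{0\le t\le n}$ on the Skorokhod space $D[0,n]$, and $\mathcal Q_n$ is the family of all such laws with $0<\underline\sigma_n\le\sigma_1^2$ and $\sigma:=\sigma_1^2+\sigma_2^2\le\overline\sigma_n$, where $0<\underline\sigma_n\le\overline\sigma_n$ are given and satisfy, for every $\epsilon>0$, $\liminf_{n\to\infty} n^{\epsilon}\underline\sigma_n>0$ and $\lim_{n\to\infty} n^{-\epsilon}\overline\sigma_n=0$. $\mathbf E_{Q,S}$ is the expectation under the law of $y$ for noise law $Q$ and signal $S$; $\|f\|^2=\int_0^1f^2(t)\,dt$. For an estimator $\widehat S$, $\mathcal R_Q(\widehat S,S)=\mathbf E_{Q,S}\|\widehat S-S\|^2$ and the robust risk is $\mathcal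 R_n^*(\widehat S,S)=\sup_{Q\in\mathcal Q_n}\mathcal R_Q(\widehat S,S)$. Estimators. $(\phi_j)_{j\ge1}$ is an orthonormal basis of $L_2[0,1]$, extended 1-periodically to $\mathbb R$, with $\sup_{1\le j\le n}\sup_{0\le t\le1}|\phi_j(t)|\le\overline\phi_n<\infty$ ($\overline\phi_n>0$ may depend on $n$). $\widehat\theta_j=\frac1n\int_0^n\phi_j(t)\,dy_t$. For each $n$, $\Lambda=\Lambda_n\subset[0,1]^n$ is a finite set of weight vectors $\lambda=(\lambda(j))_{1\le j\le n}$ such that for every $\lambda\in\Lambda$ there is an integer $d=d(\lambda)$, $1\le d\le n$, with $\lambda(j)=1$ for $1\le j\le d$. Put $\nu_n=\mathrm{card}(\Lambda)$ and $|\Lambda|_n=\max_{\lambda\in\Lambda}\sum_{j=1}^n\lambda(j)$. The shrinkage estimator is $S^*_\lambda=\sum_{j=1}^n\lambda(j)\theta^*_{\lambda,j}\phi_j$ with $\theta^*_{\lambda,j}=(1-g_\lambda(j))\widehat\theta_j$, $g_\lambda(j)=\frac{c_n(\lambda)}{|\widetilde\theta_n|_d}\mathbf 1_{\{1\le j\le d\}}$, $\widetilde\theta_n=(\widehat\theta_j)_{1\le j\le d}$, $|x|_d^2=\sum_{j=1}^dx_j^2$, and $c_n(\lambda)=\frac{(d-1)\underline\sigma_n}{(r_n+\sqrt{d\,\overline\sigma_n/n})\,n}$, where $r_n>0$ satisfies $r_n\to\infty$ and $r_n/n^{\epsilon}\to0$ for every $\epsilon>0$. Model selection procedure. Let $\mathrm{Tr}_1\equiv1$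 and, for $j\ge2$, $\mathrm{Tr}_j(x)=\sqrt2\cos(2\pi[j/2]x)$ for even $j$, $\mathrm{Tr}_j(x)=\sqrt2\sin(2\pi[j/2]x)$ for odd $j$ ($[a]$ is the integer part of $a$). Let $\widehat\sigma_n=\sum_{j=[\sqrt n]+1}^n\widehat t_j^{\,2}$ with $\widehat t_j=\frac1n\int_0^n\mathrm{Tr}_j(t)\,dy_t$. For $\delta>0$ let $$J_n(\lambda)=\sum_{j=1}^n\lambda^2(j)(\theta^*_{\lambda,j})^2-2\sum_{j=1}^n\lambda(j)\Big(\theta^*_{\lambda,j}\widehat\theta_j-\frac{\widehat\sigma_n}n\Big)+\delta\,\frac{\widehat\sigma_n|\lambda|_n^2}{n},\qquad|\lambda|_n^2=\sum_{j=1}^n\lambda^2(j),$$ and $S^*=S^*_{\lambda^*}$ with $\lambda^*\in\operatorname{argmin}_{\lambda\in\Lambda}J_n(\lambda)$ (any minimizer). *)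

theory Defs
  imports "HOL-Probability.Probability"
begin

section \<open>The noise process\<close>

definition levy_measure :: "real measure \<Rightarrow> bool" where
  "levy_measure \<nu> \<longleftrightarrow>
     sets \<nu> = sets borel \<and> emeasure \<nu> {0} = 0 \<and>
     (\<integral>\<^sup>+ x. ennreal (x ^ 2) \<partial>\<nu>) = 1 \<and> (\<integral>\<^sup>+ x. ennreal (x ^ 6) \<partial>\<nu>) < \<infinity>"

definition brownian_motion :: "'a measure \<Rightarrow> (real \<Rightarrow> 'a \<Rightarrow> real) \<Rightarrow> bool" where
  "brownian_motion M w \<longleftrightarrow>
     (\<forall>t\<ge>0. w t \<in> borel_measurable M) \<and>
     (\<forall>\<omega>\<in>space M. w 0 \<omega> = 0 \<and> continuous_on {0..} (\<lambda>t. w t \<omega>)) \<and>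
     (\<forall>s t. 0 \<le> s \<and> s < t \<longrightarrow>
        distributed M lborel (\<lambda>\<omega>. w t \<omega> - w s \<omega>) (\<lambda>x. ennreal (normal_density 0 (sqrt (t - s)) x))) \<and>
     (\<forall>(k::nat) (u::nat \<Rightarrow> real). 0 \<le> u 0 \<and> (\<forall>i<k. u i < u (Suc i)) \<longrightarrow>
        prob_space.indep_vars M (\<lambda>_. borel) (\<lambda>i \<omega>. w (u (Suc i)) \<omega> - w (u i) \<omega>) {..<k})"

text \<open>The compensator \<open>ds \<nu>(dx)\<close>, with first coordinate time (in \<open>[0,\<infinity>)\<close>) and second
  coordinate jump size.\<close>

definition jump_intensity :: "real measure \<Rightarrow> (real \<times> real) measure" where
  "jump_intensity \<nu> = density lborel (indicator {0..}) \<Otimes>\<^sub>M \<nu>"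

definition poisson_random_measure ::
  "'a measure \<Rightarrow> (real \<times> real) measure \<Rightarrow> ('a \<Rightarrow> (real \<times> real) measure) \<Rightarrow> bool" where
  "poisson_random_measure M \<Gamma> N \<longleftrightarrow>
     (\<forall>\<omega>\<in>space M. sets (N \<omega>) = sets \<Gamma>) \<and>
     (\<forall>A\<in>sets \<Gamma>. (\<lambda>\<omega>. emeasure (N \<omega>) A) \<in> borel_measurable M) \<and>
     (\<forall>A\<in>sets \<Gamma>. emeasure \<Gamma> A < \<infinity> \<longrightarrow>
        (\<forall>k::nat. measure M {\<omega>\<in>space M. emeasure (N \<omega>) A = of_nat k} =
                  exp (- measure \<Gamma> A) * measure \<Gamma> A ^ k / fact k)) \<and>
     (\<forall>(m::nat) A. A ` {..<m} \<subseteq> sets \<Gamma> \<and> disjoint_family_on A {..<m} \<longrightarrow>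
        prob_space.indep_vars M (\<lambda>_. borel) (\<lambda>i \<omega>. emeasure (N \<omega>) (A i)) {..<m})"

definition indep_noise_sources ::
  "'a measure \<Rightarrow> (real \<times> real) measure \<Rightarrow> (real \<Rightarrow> 'a \<Rightarrow> real) \<Rightarrow>
   ('a \<Rightarrow> (real \<times> real) measure) \<Rightarrow> bool" where
  "indep_noise_sources M \<Gamma> w N \<longleftrightarrow>
     prob_space.indep_set M
       (sets (vimage_algebra (space M) (\<lambda>\<omega>. \<lambda>t\<in>{0..}. w t \<omega>) (PiM {0..} (\<lambda>_. borel))))
       (sets (vimage_algebra (space M) (\<lambda>\<omega>. \<lambda>A\<in>sets \<Gamma>. emeasure (N \<omega>) A)
                (PiM (sets \<Gamma>) (\<lambda>_. borel))))"

definition compensated_large_jumps ::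
  "real measure \<Rightarrow> ('a \<Rightarrow> (real \<times> real) measure) \<Rightarrow> real \<Rightarrow> real \<Rightarrow> 'a \<Rightarrow> real" where
  "compensated_large_jumps \<nu> N e t \<omega> =
     (LINT p:{0<..t} \<times> {x. e < \<bar>x\<bar>}|N \<omega>. snd p) - t * (LINT x:{x. e < \<bar>x\<bar>}|\<nu>. x)"

text \<open>Right continuity at \<open>t < T\<close> and existence of left limits at \<open>t > 0\<close>.\<close>

definition cadlag_on :: "real \<Rightarrow> (real \<Rightarrow> real) \<Rightarrow> bool" where
  "cadlag_on T y \<longleftrightarrow>
     (\<forall>t\<in>{0..<T}. (y \<longlongrightarrow> y t) (at_right t)) \<and>
     (\<forall>t\<in>{0<..T}. \<exists>l. (y \<longlongrightarrow> l) (at_left t))"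

text \<open>\<open>z t = \<integral>\<^sub>0\<^sup>t \<integral> x (N(ds dx) - ds \<nu>(dx))\<close>: the \<open>L\<^sup>2\<close> limit of the compensated sums of the jumps
  larger than \<open>e\<close> as \<open>e\<close> tends to 0, in its cadlag version.\<close>

definition compensated_jump_process ::
  "'a measure \<Rightarrow> real measure \<Rightarrow> ('a \<Rightarrow> (real \<times> real) measure) \<Rightarrow> (real \<Rightarrow> 'a \<Rightarrow> real) \<Rightarrow> bool" where
  "compensated_jump_process M \<nu> N z \<longleftrightarrow>
     (\<forall>t\<ge>0. z t \<in> borel_measurable M) \<and>
     (\<forall>\<omega>\<in>space M. \<forall>T>0. cadlag_on T (\<lambda>t. z t \<omega>)) \<and>
     (\<forall>t\<ge>0. ((\<lambda>e. \<integral>\<^sup>+ \<omega>. ennreal ((compensated_large_jumps \<nu> N e t \<omega> - z t \<omega>)\<^sup>2) \<partial>M)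
              \<longlongrightarrow> 0) (at_right 0))"


section \<open>Laws on the path space and observations\<close>

text \<open>\<open>D[0,n]\<close>. The Borel sets of the Skorokhod topology are generated by the coordinate maps,
  so the \<open>\<sigma>\<close>-algebra is the trace of the product \<open>\<sigma>\<close>-algebra.\<close>

definition skorokhod_space :: "nat \<Rightarrow> (real \<Rightarrow> real) measure" where
  "skorokhod_space n =
     restrict_space (PiM {0..real n} (\<lambda>_. borel)) {y. cadlag_on (real n) y}"

definition noise_law ::
  "'a measure \<Rightarrow> (real \<Rightarrow> 'a \<Rightarrow> real) \<Rightarrow> (real \<Rightarrow> 'a \<Rightarrow> real) \<Rightarrow> nat \<Rightarrow> real \<Rightarrow> real \<Rightarrow>
   (real \<Rightarrow> real) measure" where
  "noise_law M w z n \<sigma>1 \<sigma>2 =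
     distr M (skorokhod_space n) (\<lambda>\<omega>. \<lambda>t\<in>{0..real n}. \<sigma>1 * w t \<omega> + \<sigma>2 * z t \<omega>)"

text \<open>As \<open>\<nu>\<close> is fixed, the law of the noise depends only on \<open>\<sigma>1\<close> and \<open>\<sigma>2\<close>, so one pair \<open>(w, z)\<close>
  realises the whole family.\<close>

definition noise_family ::
  "'a measure \<Rightarrow> (real \<Rightarrow> 'a \<Rightarrow> real) \<Rightarrow> (real \<Rightarrow> 'a \<Rightarrow> real) \<Rightarrow> (nat \<Rightarrow> real) \<Rightarrow> (nat \<Rightarrow> real) \<Rightarrow>
   nat \<Rightarrow> (real \<Rightarrow> real) measure set" where
  "noise_family M w z \<sigma>lo \<sigma>up n =
     {noise_law M w z n \<sigma>1 \<sigma>2 | \<sigma>1 \<sigma>2. \<sigma>lo n \<le> \<sigma>1\<^sup>2 \<and> \<sigma>1\<^sup>2 + \<sigma>2\<^sup>2 \<le> \<sigma>up n}"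

definition observation_law ::
  "nat \<Rightarrow> (real \<Rightarrow> real) measure \<Rightarrow> (real \<Rightarrow> real) \<Rightarrow> (real \<Rightarrow> real) measure" where
  "observation_law n Q S =
     distr Q (skorokhod_space n) (\<lambda>x. \<lambda>t\<in>{0..real n}. (LINT s:{0..t}|lborel. S s) + x t)"

definition periodic_C1 :: "(real \<Rightarrow> real) \<Rightarrow> bool" where
  "periodic_C1 S \<longleftrightarrow>
     (\<forall>t. S (t + 1) = S t) \<and> (\<forall>t. S differentiable (at t)) \<and> continuous_on UNIV (deriv S)"

text \<open>A step function is given by breakpoints \<open>u 0 \<le> \<dots> \<le> u k\<close> and its value \<open>c i\<close> on
  \<open>(u i, u (i + 1)]\<close>.\<close>

definition step_fun :: "nat \<Rightarrow> (nat \<Rightarrow> real) \<Rightarrow> (nat \<Rightarrow> real) \<Rightarrow> real \<Rightarrow> real" where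
  "step_fun k u c s = (\<Sum>i<k. c i * indicator {u i<..u (Suc i)} s)"

definition step_integral ::
  "nat \<Rightarrow> (nat \<Rightarrow> real) \<Rightarrow> (nat \<Rightarrow> real) \<Rightarrow> (real \<Rightarrow> real) \<Rightarrow> real" where
  "step_integral k u c y = (\<Sum>i<k. c i * (y (u (Suc i)) - y (u i)))"

text \<open>The functional \<open>I\<close> of the path \<open>y\<close> is a version of \<open>\<integral>\<^sub>0\<^sup>n f(t) dy\<^sub>t\<close> when \<open>y\<close> has law \<open>P\<close>.\<close>

definition is_stoch_integral ::
  "nat \<Rightarrow> (real \<Rightarrow> real) measure \<Rightarrow> (real \<Rightarrow> real) \<Rightarrow> ((real \<Rightarrow> real) \<Rightarrow> real) \<Rightarrow> bool" where
  "is_stoch_integral n P f I \<longleftrightarrow>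
     I \<in> borel_measurable (skorokhod_space n) \<and>
     (\<exists>k u c.
        (\<forall>m::nat. u m (0::nat) = 0 \<and> u m (k m) = real n \<and> (\<forall>i<k m. u m i \<le> u m (Suc i))) \<and>
        (\<lambda>m. \<integral>\<^sup>+ s\<in>{0..real n}. ennreal ((step_fun (k m) (u m) (c m) s - f s)\<^sup>2) \<partial>lborel)
           \<longlonglongrightarrow> 0 \<and>
        (\<lambda>m. \<integral>\<^sup>+ y. ennreal ((step_integral (k m) (u m) (c m) y - I y)\<^sup>2) \<partial>P) \<longlonglongrightarrow> 0)"

definition L2_on :: "real \<Rightarrow> (real \<Rightarrow> real) \<Rightarrow> bool" where
  "L2_on T f \<longleftrightarrow> f \<in> borel_measurable borel \<and> set_integrable lborel {0..T} (\<lambda>t. (f t)\<^sup>2)"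

text \<open>The estimators need stochastic integrals as functionals of the observed path alone.
  \<open>SI n f\<close> is one path functional that is a version of \<open>\<integral>\<^sub>0\<^sup>n f(t) dy\<^sub>t\<close> under every law of the
  model. Such functionals exist: the elementary integrals along step functions \<open>f\<^sub>m\<close> with
  \<open>\<parallel>f\<^sub>m - f\<parallel> \<le> 4 powr (-m)\<close> converge almost surely under each of these laws.\<close>

definition model_stoch_integrals ::
  "'a measure \<Rightarrow> (real \<Rightarrow> 'a \<Rightarrow> real) \<Rightarrow> (real \<Rightarrow> 'a \<Rightarrow> real) \<Rightarrow> (nat \<Rightarrow> real) \<Rightarrow> (nat \<Rightarrow> real) \<Rightarrow>
   (nat \<Rightarrow> (real \<Rightarrow> real) \<Rightarrow> (real \<Rightarrow> real) \<Rightarrow> real) \<Rightarrow> bool" where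
  "model_stoch_integrals M w z \<sigma>lo \<sigma>up SI \<longleftrightarrow>
     (\<forall>n\<ge>1. \<forall>f. L2_on (real n) f \<longrightarrow>
        (\<forall>Q\<in>noise_family M w z \<sigma>lo \<sigma>up n. \<forall>S. periodic_C1 S \<longrightarrow>
           is_stoch_integral n (observation_law n Q S) f (SI n f)))"


section \<open>Risks\<close>

definition risk ::
  "nat \<Rightarrow> (real \<Rightarrow> real) measure \<Rightarrow> ((real \<Rightarrow> real) \<Rightarrow> real \<Rightarrow> real) \<Rightarrow> (real \<Rightarrow> real) \<Rightarrow> ennreal" where
  "risk n Q Shat S =
     (\<integral>\<^sup>+ y. (\<integral>\<^sup>+ t\<in>{0..1}. ennreal ((Shat y t - S t)\<^sup>2) \<partial>lborel) \<partial>(observation_law n Q S))"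

definition robust_risk ::
  "(real \<Rightarrow> real) measure set \<Rightarrow> nat \<Rightarrow> ((real \<Rightarrow> real) \<Rightarrow> real \<Rightarrow> real) \<Rightarrow> (real \<Rightarrow> real) \<Rightarrow> ennreal" where
  "robust_risk \<Q> n Shat S = (SUP Q\<in>\<Q>. risk n Q Shat S)"


section \<open>Estimators\<close>

text \<open>Basis functions are indexed from 1.\<close>

definition orthonormal_basis_L2 :: "(nat \<Rightarrow> real \<Rightarrow> real) \<Rightarrow> bool" where
  "orthonormal_basis_L2 \<phi> \<longleftrightarrow>
     (\<forall>j\<ge>1. L2_on 1 (\<phi> j)) \<and>
     (\<forall>i\<ge>1. \<forall>j\<ge>1. (LINT t:{0..1}|lborel. \<phi> i t * \<phi> j t) = (if i = j then 1 else 0)) \<and>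
     (\<forall>f. L2_on 1 f \<longrightarrow>
        (\<lambda>m. LINT t:{0..1}|lborel.
               (f t - (\<Sum>j=1..m. (LINT s:{0..1}|lborel. f s * \<phi> j s) * \<phi> j t))\<^sup>2) \<longlonglongrightarrow> 0)"

definition theta_hat ::
  "(nat \<Rightarrow> (real \<Rightarrow> real) \<Rightarrow> (real \<Rightarrow> real) \<Rightarrow> real) \<Rightarrow> (nat \<Rightarrow> real \<Rightarrow> real) \<Rightarrow> nat \<Rightarrow> nat \<Rightarrow>
   (real \<Rightarrow> real) \<Rightarrow> real" where
  "theta_hat SI \<phi> n j y = SI n (\<phi> j) y / real n"

definition shrink_const :: "(nat \<Rightarrow> real) \<Rightarrow> (nat \<Rightarrow> real) \<Rightarrow> (nat \<Rightarrow> real) \<Rightarrow> nat \<Rightarrow> nat \<Rightarrow> real" where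
  "shrink_const \<sigma>lo \<sigma>up r n d =
     (real d - 1) * \<sigma>lo n / ((r n + sqrt (real d * \<sigma>up n / real n)) * real n)"

text \<open>Below, \<open>c\<close> and \<open>d\<close> stand for \<open>c\<^sub>n(\<lambda>)\<close> and \<open>d(\<lambda>)\<close>; weight vectors are written \<open>l\<close>.\<close>

definition theta_star ::
  "(nat \<Rightarrow> (real \<Rightarrow> real) \<Rightarrow> (real \<Rightarrow> real) \<Rightarrow> real) \<Rightarrow> (nat \<Rightarrow> real \<Rightarrow> real) \<Rightarrow> nat \<Rightarrow> real \<Rightarrow> nat \<Rightarrow>
   nat \<Rightarrow> (real \<Rightarrow> real) \<Rightarrow> real" where
  "theta_star SI \<phi> n c d j y =
     (1 - (if 1 \<le> j \<and> j \<le> d then c / sqrt (\<Sum>i=1..d. (theta_hat SI \<phi> n i y)\<^sup>2) else 0))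
       * theta_hat SI \<phi> n j y"

definition shrinkage_estimator ::
  "(nat \<Rightarrow> (real \<Rightarrow> real) \<Rightarrow> (real \<Rightarrow> real) \<Rightarrow> real) \<Rightarrow> (nat \<Rightarrow> real \<Rightarrow> real) \<Rightarrow> nat \<Rightarrow>
   ((nat \<Rightarrow> real) \<Rightarrow> real) \<Rightarrow> ((nat \<Rightarrow> real) \<Rightarrow> nat) \<Rightarrow> (nat \<Rightarrow> real) \<Rightarrow>
   (real \<Rightarrow> real) \<Rightarrow> real \<Rightarrow> real" where
  "shrinkage_estimator SI \<phi> n c d l y t =
     (\<Sum>j=1..n. l j * theta_star SI \<phi> n (c l) (d l) j y * \<phi> j t)"

definition trig_basis :: "nat \<Rightarrow> real \<Rightarrow> real" where
  "trig_basis j x =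
     (if j = 1 then 1
      else if even j then sqrt 2 * cos (2 * pi * real (j div 2) * x)
      else sqrt 2 * sin (2 * pi * real (j div 2) * x))"

definition sigma_hat ::
  "(nat \<Rightarrow> (real \<Rightarrow> real) \<Rightarrow> (real \<Rightarrow> real) \<Rightarrow> real) \<Rightarrow> nat \<Rightarrow> (real \<Rightarrow> real) \<Rightarrow> real" where
  "sigma_hat SI n y =
     (\<Sum>j = nat \<lfloor>sqrt (real n)\<rfloor> + 1..n. (theta_hat SI trig_basis n j y)\<^sup>2)"

definition cost_fun ::
  "(nat \<Rightarrow> (real \<Rightarrow> real) \<Rightarrow> (real \<Rightarrow> real) \<Rightarrow> real) \<Rightarrow> (nat \<Rightarrow> real \<Rightarrow> real) \<Rightarrow> nat \<Rightarrow>
   ((nat \<Rightarrow> real) \<Rightarrow> real) \<Rightarrow> ((nat \<Rightarrow> real) \<Rightarrow> nat) \<Rightarrow> real \<Rightarrow> (real \<Rightarrow> real) \<Rightarrow>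
   (nat \<Rightarrow> real) \<Rightarrow> real" where
  "cost_fun SI \<phi> n c d \<delta> y l =
     (\<Sum>j=1..n. (l j)\<^sup>2 * (theta_star SI \<phi> n (c l) (d l) j y)\<^sup>2)
     - 2 * (\<Sum>j=1..n. l j * (theta_star SI \<phi> n (c l) (d l) j y * theta_hat SI \<phi> n j y
                              - sigma_hat SI n y / real n))
     + \<delta> * (sigma_hat SI n y * (\<Sum>j=1..n. (l j)\<^sup>2) / real n)"

text \<open>A measurable choice, from the observed path, of a minimiser of the cost over \<open>L\<close>.\<close>

definition model_selector ::
  "(nat \<Rightarrow> (real \<Rightarrow> real) \<Rightarrow> (real \<Rightarrow> real) \<Rightarrow> real) \<Rightarrow> (nat \<Rightarrow> real \<Rightarrow> real) \<Rightarrow> nat \<Rightarrow>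
   ((nat \<Rightarrow> real) \<Rightarrow> real) \<Rightarrow> ((nat \<Rightarrow> real) \<Rightarrow> nat) \<Rightarrow> (nat \<Rightarrow> real) set \<Rightarrow> real \<Rightarrow>
   ((real \<Rightarrow> real) \<Rightarrow> nat \<Rightarrow> real) \<Rightarrow> bool" where
  "model_selector SI \<phi> n c d L \<delta> sel \<longleftrightarrow>
     sel \<in> measurable (skorokhod_space n) (count_space L) \<and>
     (\<forall>y\<in>space (skorokhod_space n).
        is_arg_min (cost_fun SI \<phi> n c d \<delta> y) (\<lambda>l. l \<in> L) (sel y))"

end

theory Submission
  imports Defs
begin

text \<open>
  A deterministic integrand turns the observations into Gaussian-plus-Poisson noise, so the
  coordinate noises \<open>e\<^sub>j\<close> satisfy \<open>E (\<Sum> x\<^sub>j e\<^sub>j)\<^sup>2 \<le> \<tau> \<Sum> x\<^sub>j\<^sup>2\<close> and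
  \<open>E (\<Sum> x\<^sub>j (e\<^sub>j\<^sup>2 - \<tau>))\<^sup>2 \<le> C \<tau>\<^sup>2 \<Sum> x\<^sub>j\<^sup>2\<close> with \<open>\<tau> = \<sigma>/n\<close>, where \<open>C\<close> involves only the fourth
  moment of the jumps and the sup norm of the basis. These bounds are obtained for step integrands and
  jumps taking finitely many values away from 0, where the noise is a linear form in independent Gaussian
  and centred Poisson variables, and pass to the limit by Fatou's lemma.

  On a fixed path, comparing the cost of the selected weights with that of any other weights bounds the
  difference of the two losses by linear and quadratic forms in the \<open>e\<^sub>j\<close>, by the shrinkage constant and
  by the error of the variance estimator. Each form is split by \<open>2ab \<le> \<epsilon>a\<^sup>2 + b\<^sup>2/\<epsilon>\<close>: one part is absorbed in the
  losses, the other is a square divided by its own variance. Summing these normalised squares over the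
  finite set of weights removes the dependence on the random selection and costs only a factor
  \<open>card \<Lambda>\<close>. The variance estimator is controlled by the decay of the trigonometric
  coefficients of \<open>S\<close>, which is where \<open>\<parallel>S'\<parallel>\<^sup>2\<close> enters.
\<close>

section \<open>Second moments of quadratic forms in independent Gaussian and Poisson
  variables\<close>

section \<open>Square integrable random variables\<close>

text \<open>Two scales decide that the remainder is of order 1/n up to subpolynomial factors. The
  shrinkage constant is at most |\<Lambda>|_n * \<sigma>up / (r_n n); since |\<Lambda>|_n is about
  sqrt n, its square is of order 1/n. The variance estimator divided by n misses \<sigma>/n by an
  amount of mean order n^(-3/2): leaving out sqrt n coordinates costs a bias of that order, and
  beyond them the energy of S is at most ||S'||^2 / n. This error enters multiplied by
  |\<Lambda>|_n, which again gives 1/n.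

  The penalty with factor \<delta> pays for the noise at the selected weights: there it has a
  negative sign, while at the competing weights it is bounded by the loss itself. Hence all
  splittings use weights proportional to \<delta>, which leaves 1 + O(\<delta>) in front of the loss
  and 1/\<delta> in the remainder.

  An infinite jump measure forbids counting jumps, so moments are computed for jumps cut off near 0,
  with bounds that do not see the cut-off. The law of the noise enters the final bound only through
  \<sigma> and the fourth moment of the fixed jump measure, so the supremum over laws is taken
  last.\<close>

definition square_integrable :: "'a measure \<Rightarrow> ('a \<Rightarrow> real) \<Rightarrow> bool" where
  "square_integrable M X \<longleftrightarrow> X \<in> borel_measurable M \<and> integrable M (\<lambda>\<omega>. (X \<omega>)\<^sup>2)"

lemma square_integrableD [dest]:
  assumes "square_integrable M X"
  shows "X \<in> borel_measurable M" "integrable M (\<lambda>\<omega>. (X \<omega>)\<^sup>2)"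
  using assms by (auto simp: square_integrable_def)

lemma square_integrable_mult:
  assumes "square_integrable M X" "square_integrable M Y"
  shows "integrable M (\<lambda>\<omega>. X \<omega> * Y \<omega>)"
proof -
  note [measurable] = square_integrableD(1)[OF assms(1)] square_integrableD(1)[OF assms(2)]
  have "integrable M (\<lambda>\<omega>. (X \<omega>)\<^sup>2 + (Y \<omega>)\<^sup>2)"
    using assms by auto
  then show ?thesis
  proof (rule Bochner_Integration.integrable_bound)
    show "AE \<omega> in M. norm (X \<omega> * Y \<omega>) \<le> norm ((X \<omega>)\<^sup>2 + (Y \<omega>)\<^sup>2)"
    proof (rule AE_I2)
      fix \<omega>
      have "0 \<le> (\<bar>X \<omega>\<bar> - \<bar>Y \<omega>\<bar>)\<^sup>2" "0 \<le> \<bar>X \<omega>\<bar> * \<bar>Y \<omega>\<bar>" "0 \<le> (X \<omega>)\<^sup>2" "0 \<le> (Y \<omega>)\<^sup>2" by simp_all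
      then show "norm (X \<omega> * Y \<omega>) \<le> norm ((X \<omega>)\<^sup>2 + (Y \<omega>)\<^sup>2)"
        by (simp add: power2_diff abs_mult del: zero_le_power2 mult_nonneg_nonneg abs_ge_zero)
    qed
  qed measurable
qed

lemma square_integrable_add:
  assumes "square_integrable M X" "square_integrable M Y"
  shows "square_integrable M (\<lambda>\<omega>. X \<omega> + Y \<omega>)"
  using assms square_integrable_mult[OF assms]
  by (auto simp: square_integrable_def power2_sum mult.assoc)

lemma square_integrable_cmult:
  "square_integrable M X \<Longrightarrow> square_integrable M (\<lambda>\<omega>. c * X \<omega>)"
  by (auto simp: square_integrable_def power_mult_distrib)

context prob_space
begin

lemma square_integrable_const [simp]: "square_integrable M (\<lambda>_. c)"
  by (simp add: square_integrable_def)

lemma square_integrable_integrable: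
  "square_integrable M X \<Longrightarrow> integrable M X"
  using square_integrable_mult[of M X "\<lambda>_. 1"] by simp

section \<open>Quadratic forms in independent variables\<close>

text \<open>Linear and quadratic forms are built up one index at a time; this detaches the new
  variable \<open>X p\<close> from anything computed from the old ones. Giving \<open>F\<close>
  through a pointwise equation lets it be stated without the restricted family.\<close>

lemma indep_vars_split:
  fixes X :: "'i \<Rightarrow> 'a \<Rightarrow> real"
  assumes ind: "indep_vars (\<lambda>_. borel) X (insert p I)" and p: "p \<notin> I"
    and h: "h \<in> borel_measurable borel" and f: "f \<in> borel_measurable (PiM I (\<lambda>_. borel))"
    and F: "\<And>\<omega>. F \<omega> = f (\<lambda>i\<in>I. X i \<omega>)"
    and int: "integrable M (\<lambda>\<omega>. h (X p \<omega>))" "integrable M F"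
  shows "integrable M (\<lambda>\<omega>. h (X p \<omega>) * F \<omega> :: real)"
    and "expectation (\<lambda>\<omega>. h (X p \<omega>) * F \<omega>) = expectation (\<lambda>\<omega>. h (X p \<omega>)) * expectation F"
proof -
  have [measurable]: "h \<in> borel_measurable borel" by fact
  have *: "indep_var borel ((\<lambda>g. h (g p)) \<circ> (\<lambda>\<omega>. restrict (\<lambda>i. X i \<omega>) {p}))
    borel (f \<circ> (\<lambda>\<omega>. restrict (\<lambda>i. X i \<omega>) I))"
    using p f by (intro indep_var_compose[OF indep_var_restrict[OF ind]]) auto
  have "((\<lambda>g. h (g p)) \<circ> (\<lambda>\<omega>. restrict (\<lambda>i. X i \<omega>) {p})) = (\<lambda>\<omega>. h (X p \<omega>))"
    "f \<circ> (\<lambda>\<omega>. restrict (\<lambda>i. X i \<omega>) I) = F"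
    using F by auto
  with * have i: "indep_var borel (\<lambda>\<omega>. h (X p \<omega>)) borel F" by simp
  show "integrable M (\<lambda>\<omega>. h (X p \<omega>) * F \<omega>)"
    by (rule indep_var_integrable[OF i int])
  show "expectation (\<lambda>\<omega>. h (X p \<omega>) * F \<omega>) = expectation (\<lambda>\<omega>. h (X p \<omega>)) * expectation F"
    by (rule indep_var_lebesgue_integral[OF i int])
qed

lemma indep_linear_form:
  fixes X :: "'i \<Rightarrow> 'a \<Rightarrow> real"
  assumes "finite I" "indep_vars (\<lambda>_. borel) X I"
    and "\<And>i. i \<in> I \<Longrightarrow> square_integrable M (X i)"
    and "\<And>i. i \<in> I \<Longrightarrow> expectation (X i) = 0"
    and "\<And>i. i \<in> I \<Longrightarrow> expectation (\<lambda>\<omega>. (X i \<omega>)\<^sup>2) = v i"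
  shows "square_integrable M (\<lambda>\<omega>. \<Sum>i\<in>I. a i * X i \<omega>)
    \<and> expectation (\<lambda>\<omega>. \<Sum>i\<in>I. a i * X i \<omega>) = 0
    \<and> expectation (\<lambda>\<omega>. (\<Sum>i\<in>I. a i * X i \<omega>)\<^sup>2) = (\<Sum>i\<in>I. (a i)\<^sup>2 * v i)"
  using assms
proof (induction I rule: finite_induct)
  case empty
  then show ?case by simp
next
  case (insert p I)
  define L where "L = (\<lambda>\<omega>. \<Sum>i\<in>I. a i * X i \<omega>)"
  have ind: "indep_vars (\<lambda>_. borel) X I"
    using insert.prems(1) by (rule indep_vars_subset) auto
  have L: "square_integrable M L" "expectation L = 0"
      "expectation (\<lambda>\<omega>. (L \<omega>)\<^sup>2) = (\<Sum>i\<in>I. (a i)\<^sup>2 * v i)"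
    using insert.IH[OF ind] insert.prems by (auto simp: L_def)
  have p: "square_integrable M (X p)" "expectation (X p) = 0" "expectation (\<lambda>\<omega>. (X p \<omega>)\<^sup>2) = v p"
    using insert.prems by auto
  have sum: "(\<Sum>i\<in>insert p I. a i * X i \<omega>) = a p * X p \<omega> + L \<omega>" for \<omega>
    using insert by (simp add: L_def)
  have si: "square_integrable M (\<lambda>\<omega>. a p * X p \<omega> + L \<omega>)"
    by (intro square_integrable_add square_integrable_cmult p L)
  note pi = square_integrable_integrable[OF p(1)] and Li = square_integrable_integrable[OF L(1)]
  have cross: "expectation (\<lambda>\<omega>. X p \<omega> * L \<omega>) = 0" "integrable M (\<lambda>\<omega>. X p \<omega> * L \<omega>)"
    using indep_vars_split[OF insert.prems(1) insert.hyps(2), of "\<lambda>x. x" "\<lambda>g. \<Sum>i\<in>I. a i * g i" L] pi Li p(2)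
    by (auto simp: L_def)
  have "expectation (\<lambda>\<omega>. (a p * X p \<omega> + L \<omega>)\<^sup>2)
      = expectation (\<lambda>\<omega>. (a p)\<^sup>2 * (X p \<omega>)\<^sup>2 + (L \<omega>)\<^sup>2 + (2 * a p) * (X p \<omega> * L \<omega>))"
    by (simp add: power2_sum power_mult_distrib mult_ac)
  also have "\<dots> = (a p)\<^sup>2 * v p + (\<Sum>i\<in>I. (a i)\<^sup>2 * v i)"
    using p L cross by (simp add: square_integrable_def)
  finally show ?case
    using insert si p L(2) pi Li unfolding sum by simp
qed

text \<open>Adding an index \<open>p\<close> turns the centred form \<open>Q\<close> into
  \<open>Q + 2 * (X p * L) + c * Y\<close>, where \<open>L\<close> is linear in the old variables
  and \<open>Y\<close> is the centred square of \<open>X p\<close>. All mixed products have mean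
  zero by independence: one through \<open>X p\<close>, one through \<open>Y\<close>, and the
  product \<open>X p * Y * L\<close> through \<open>L\<close>, even though the third moment of
  \<open>X p\<close> may be nonzero. So second moments add up, and \<open>\<kappa>\<close>, an upper
  bound for the fourth cumulant, appears on the diagonal only.\<close>

lemma indep_quadratic_form:
  fixes X :: "'i \<Rightarrow> 'a \<Rightarrow> real"
  assumes "finite I" "indep_vars (\<lambda>_. borel) X I"
    and "\<And>i. i \<in> I \<Longrightarrow> integrable M (\<lambda>\<omega>. (X i \<omega>)^4)"
    and "\<And>i. i \<in> I \<Longrightarrow> expectation (X i) = 0"
    and "\<And>i. i \<in> I \<Longrightarrow> expectation (\<lambda>\<omega>. (X i \<omega>)\<^sup>2) = v i"
    and "\<And>i. i \<in> I \<Longrightarrow> expectation (\<lambda>\<omega>. (X i \<omega>)^4) \<le> 3 * (v i)\<^sup>2 + \<kappa> i"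
    and sym: "\<And>i j. A i j = A j i"
  shows "square_integrable M (\<lambda>\<omega>. (\<Sum>i\<in>I. \<Sum>j\<in>I. A i j * X i \<omega> * X j \<omega>) - (\<Sum>i\<in>I. A i i * v i))
    \<and> expectation (\<lambda>\<omega>. ((\<Sum>i\<in>I. \<Sum>j\<in>I. A i j * X i \<omega> * X j \<omega>) - (\<Sum>i\<in>I. A i i * v i))\<^sup>2)
      \<le> 2 * (\<Sum>i\<in>I. \<Sum>j\<in>I. (A i j)\<^sup>2 * v i * v j) + (\<Sum>i\<in>I. (A i i)\<^sup>2 * \<kappa> i)"
  using assms(1-6)
proof (induction I rule: finite_induct)
  case empty
  then show ?case by simp
next
  case (insert p I)
  have rv [measurable]: "random_variable borel (X i)" if "i \<in> insert p I" for i
    using insert.prems(1) that by (auto simp: indep_vars_def)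
  note [measurable] = rv[OF insertI1]
  have sqX: "square_integrable M (\<lambda>\<omega>. (X i \<omega>)\<^sup>2)" if "i \<in> insert p I" for i
    using insert.prems(2)[OF that] rv[OF that] by (simp add: square_integrable_def flip: power_mult)
  have sX: "square_integrable M (X i)" if "i \<in> insert p I" for i
    using square_integrable_integrable[OF sqX[OF that]] rv[OF that] by (simp add: square_integrable_def)
  define L where "L = (\<lambda>\<omega>. \<Sum>i\<in>I. A i p * X i \<omega>)"
  define Q where "Q = (\<lambda>\<omega>. (\<Sum>i\<in>I. \<Sum>j\<in>I. A i j * X i \<omega> * X j \<omega>) - (\<Sum>i\<in>I. A i i * v i))"
  define Y where "Y = (\<lambda>\<omega>. (X p \<omega>)\<^sup>2 - v p)"
  define c where "c = A p p"
  have ind: "indep_vars (\<lambda>_. borel) X I"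
    using insert.prems(1) by (rule indep_vars_subset) auto
  have L: "square_integrable M L" "expectation L = 0"
      "expectation (\<lambda>\<omega>. (L \<omega>)\<^sup>2) = (\<Sum>i\<in>I. (A i p)\<^sup>2 * v i)"
    using indep_linear_form[OF insert.hyps(1) ind, of v "\<lambda>i. A i p"] sX insert.prems
    by (auto simp: L_def)
  have Q: "square_integrable M Q"
      "expectation (\<lambda>\<omega>. (Q \<omega>)\<^sup>2) \<le> 2 * (\<Sum>i\<in>I. \<Sum>j\<in>I. (A i j)\<^sup>2 * v i * v j) + (\<Sum>i\<in>I. (A i i)\<^sup>2 * \<kappa> i)"
    using insert.IH[OF ind] insert.prems by (auto simp: Q_def)
  have p: "square_integrable M (X p)" "expectation (X p) = 0" "expectation (\<lambda>\<omega>. (X p \<omega>)\<^sup>2) = v p"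
    using insert.prems sX by auto
  note sp = sqX[OF insertI1]
  have p2: "integrable M (\<lambda>\<omega>. (X p \<omega>)\<^sup>2)" using p(1) by auto
  have Y: "square_integrable M Y" "expectation Y = 0"
    unfolding Y_def using square_integrable_add[OF sp square_integrable_const[of "- v p"]]
      p2 p(3) by (auto simp: prob_space)
  have "(Y \<omega>)\<^sup>2 = (X p \<omega>)^4 - 2 * v p * (X p \<omega>)\<^sup>2 + (v p)\<^sup>2" for \<omega>
    unfolding Y_def by (simp add: power2_diff power_mult[symmetric])
  then have Y2: "expectation (\<lambda>\<omega>. (Y \<omega>)\<^sup>2) \<le> 2 * (v p)\<^sup>2 + \<kappa> p"
    using insert.prems(2,5)[of p] p p2
    by (simp add: prob_space power2_eq_square)
  have fL: "(\<lambda>g. \<Sum>i\<in>I. A i p * g i) \<in> borel_measurable (PiM I (\<lambda>_. borel))"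
    by measurable
  define q where "q = (\<lambda>g. (\<Sum>i\<in>I. \<Sum>j\<in>I. A i j * g i * g j) - (\<Sum>i\<in>I. A i i * v i))"
  have fQ: "q \<in> borel_measurable (PiM I (\<lambda>_. borel))"
    unfolding q_def by measurable
  have Lr: "L \<omega> = (\<lambda>g. \<Sum>i\<in>I. A i p * g i) (\<lambda>i\<in>I. X i \<omega>)" for \<omega>
    by (simp add: L_def)
  have Qr: "Q \<omega> = q (\<lambda>i\<in>I. X i \<omega>)" for \<omega>
    by (auto simp: Q_def q_def intro!: sum.cong)
  note split = indep_vars_split[OF insert.prems(1) insert.hyps(2)]
  have hY: "(\<lambda>x. x\<^sup>2 - v p) \<in> borel_measurable borel" by measurable
  have QL: "expectation (\<lambda>\<omega>. X p \<omega> * (Q \<omega> * L \<omega>)) = 0" "integrable M (\<lambda>\<omega>. X p \<omega> * (Q \<omega> * L \<omega>))"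
    using split[of "\<lambda>x. x" "\<lambda>g. q g * (\<Sum>i\<in>I. A i p * g i)" "\<lambda>\<omega>. Q \<omega> * L \<omega>"] fL fQ
      square_integrable_integrable[OF p(1)] square_integrable_mult[OF Q(1) L(1)] p(2)
    by (auto simp: Lr Qr)
  have YQ: "expectation (\<lambda>\<omega>. Y \<omega> * Q \<omega>) = 0" "integrable M (\<lambda>\<omega>. Y \<omega> * Q \<omega>)"
    using split[OF hY fQ Qr] square_integrable_integrable[OF Y(1)] square_integrable_integrable[OF Q(1)]
      Y(2) by (auto simp: Y_def)
  have iXY: "integrable M (\<lambda>\<omega>. X p \<omega> * Y \<omega>)"
    by (rule square_integrable_mult[OF p(1) Y(1)])
  have XYL: "expectation (\<lambda>\<omega>. (X p \<omega> * Y \<omega>) * L \<omega>) = 0" "integrable M (\<lambda>\<omega>. (X p \<omega> * Y \<omega>) * L \<omega>)"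
    using split[OF _ fL Lr, of "\<lambda>x. x * (x\<^sup>2 - v p)"] iXY L(2) square_integrable_integrable[OF L(1)]
    by (auto simp: Y_def)
  \<comment> \<open>The product of two independent square integrable variables is square integrable;
    second moments of \<open>L\<close> are enough here.\<close>
  have XL: "expectation (\<lambda>\<omega>. (X p \<omega>)\<^sup>2 * (L \<omega>)\<^sup>2) = v p * (\<Sum>i\<in>I. (A i p)\<^sup>2 * v i)"
      "integrable M (\<lambda>\<omega>. (X p \<omega>)\<^sup>2 * (L \<omega>)\<^sup>2)"
    using split[of "\<lambda>x. x\<^sup>2" "\<lambda>g. (\<Sum>i\<in>I. A i p * g i)\<^sup>2" "\<lambda>\<omega>. (L \<omega>)\<^sup>2"] fL p2 p(3) L
      square_integrableD(2)[OF L(1)]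
    by (auto simp: Lr)
  have sXL: "square_integrable M (\<lambda>\<omega>. X p \<omega> * L \<omega>)"
    using XL(2) L(1) rv by (auto simp: square_integrable_def power_mult_distrib)
  have eq: "(\<Sum>i\<in>insert p I. \<Sum>j\<in>insert p I. A i j * X i \<omega> * X j \<omega>) - (\<Sum>i\<in>insert p I. A i i * v i)
      = Q \<omega> + 2 * (X p \<omega> * L \<omega>) + c * Y \<omega>" for \<omega>
  proof -
    have "(\<Sum>i\<in>insert p I. \<Sum>j\<in>insert p I. A i j * X i \<omega> * X j \<omega>)
       = A p p * (X p \<omega>)\<^sup>2 + (\<Sum>j\<in>I. A p j * X p \<omega> * X j \<omega>)
         + ((\<Sum>i\<in>I. A i p * X i \<omega> * X p \<omega>) + (\<Sum>i\<in>I. \<Sum>j\<in>I. A i j * X i \<omega> * X j \<omega>))"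
      using insert.hyps by (simp add: sum.distrib power2_eq_square)
    moreover have "(\<Sum>j\<in>I. A p j * X p \<omega> * X j \<omega>) = X p \<omega> * L \<omega>"
      "(\<Sum>i\<in>I. A i p * X i \<omega> * X p \<omega>) = X p \<omega> * L \<omega>"
      by (auto simp: L_def sum_distrib_left sym[of p] mult_ac)
    ultimately show ?thesis
      using insert.hyps by (simp add: Q_def Y_def c_def algebra_simps)
  qed
  have eq2: "(Q \<omega> + 2 * (X p \<omega> * L \<omega>) + c * Y \<omega>)\<^sup>2 = (Q \<omega>)\<^sup>2 + 4 * ((X p \<omega>)\<^sup>2 * (L \<omega>)\<^sup>2) + c\<^sup>2 * (Y \<omega>)\<^sup>2
      + 4 * (X p \<omega> * (Q \<omega> * L \<omega>)) + (2 * c) * (Y \<omega> * Q \<omega>) + (4 * c) * ((X p \<omega> * Y \<omega>) * L \<omega>)" for \<omega>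
    by (simp add: power2_eq_square algebra_simps)
  have "expectation (\<lambda>\<omega>. (Q \<omega> + 2 * (X p \<omega> * L \<omega>) + c * Y \<omega>)\<^sup>2)
      = expectation (\<lambda>\<omega>. (Q \<omega>)\<^sup>2) + 4 * (v p * (\<Sum>i\<in>I. (A i p)\<^sup>2 * v i)) + c\<^sup>2 * expectation (\<lambda>\<omega>. (Y \<omega>)\<^sup>2)"
    unfolding eq2 using QL YQ XYL XL square_integrableD(2)[OF Q(1)] square_integrableD(2)[OF Y(1)] by simp
  also have "\<dots> \<le> (2 * (\<Sum>i\<in>I. \<Sum>j\<in>I. (A i j)\<^sup>2 * v i * v j) + (\<Sum>i\<in>I. (A i i)\<^sup>2 * \<kappa> i))
      + 4 * (v p * (\<Sum>i\<in>I. (A i p)\<^sup>2 * v i)) + c\<^sup>2 * (2 * (v p)\<^sup>2 + \<kappa> p)"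
    by (intro add_mono order_refl Q(2) mult_left_mono Y2) simp_all
  also have "\<dots> = 2 * (\<Sum>i\<in>insert p I. \<Sum>j\<in>insert p I. (A i j)\<^sup>2 * v i * v j)
      + (\<Sum>i\<in>insert p I. (A i i)\<^sup>2 * \<kappa> i)"
  proof -
    have "(\<Sum>i\<in>insert p I. \<Sum>j\<in>insert p I. (A i j)\<^sup>2 * v i * v j)
       = (A p p)\<^sup>2 * (v p)\<^sup>2 + (\<Sum>j\<in>I. (A p j)\<^sup>2 * v p * v j)
         + ((\<Sum>i\<in>I. (A i p)\<^sup>2 * v i * v p) + (\<Sum>i\<in>I. \<Sum>j\<in>I. (A i j)\<^sup>2 * v i * v j))"
      using insert.hyps by (simp add: sum.distrib power2_eq_square)
    moreover have "(\<Sum>j\<in>I. (A p j)\<^sup>2 * v p * v j) = v p * (\<Sum>i\<in>I. (A i p)\<^sup>2 * v i)"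
      "(\<Sum>i\<in>I. (A i p)\<^sup>2 * v i * v p) = v p * (\<Sum>i\<in>I. (A i p)\<^sup>2 * v i)"
      by (auto simp: sum_distrib_left sym[of p] mult_ac)
    ultimately show ?thesis
      using insert.hyps by (simp add: c_def algebra_simps)
  qed
  finally have "expectation (\<lambda>\<omega>. (Q \<omega> + 2 * (X p \<omega> * L \<omega>) + c * Y \<omega>)\<^sup>2)
     \<le> 2 * (\<Sum>i\<in>insert p I. \<Sum>j\<in>insert p I. (A i j)\<^sup>2 * v i * v j) + (\<Sum>i\<in>insert p I. (A i i)\<^sup>2 * \<kappa> i)" .
  moreover have "square_integrable M (\<lambda>\<omega>. Q \<omega> + 2 * (X p \<omega> * L \<omega>) + c * Y \<omega>)"
    by (intro square_integrable_add square_integrable_cmult Q(1) sXL Y(1))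
  ultimately show ?case
    unfolding eq by blast
qed

end

section \<open>Gaussian and Poisson moments\<close>

context prob_space
begin

lemma normal_central_moments:
  assumes h: "0 < h"
    and D: "distributed M lborel X (\<lambda>x. ennreal (normal_density 0 (sqrt h) x))"
  shows "integrable M (\<lambda>\<omega>. (X \<omega>)^4)" "expectation X = 0"
    "expectation (\<lambda>\<omega>. (X \<omega>)\<^sup>2) = h" "expectation (\<lambda>\<omega>. (X \<omega>)^4) = 3 * h\<^sup>2"
proof -
  have s: "0 < sqrt h" using h by simp
  show "expectation X = 0"
    using normal_distributed_expectation[OF s D] .
  show "integrable M (\<lambda>\<omega>. (X \<omega>)^4)"
    by (rule distributed_integrable[OF D, of "\<lambda>x. x^4", THEN iffD1])
       (use integrable_normal_moment[OF s, of 0 4] in auto)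
  have "expectation (\<lambda>\<omega>. (X \<omega>)^(2*k)) = fact (2 * k) / ((2 / (sqrt h)\<^sup>2)^k * fact k)" for k
    using distributed_integral[OF D, of "\<lambda>x. x^(2*k)"] integral_normal_moment_even[OF s, of 0 k] by simp
  from this[of 1] this[of 2] show "expectation (\<lambda>\<omega>. (X \<omega>)\<^sup>2) = h" "expectation (\<lambda>\<omega>. (X \<omega>)^4) = 3 * h\<^sup>2"
    using h by (simp_all add: fact_numeral field_simps power2_eq_square)
qed

end

text \<open>The falling factorial vanishes for \<open>k < j\<close> and otherwise cancels against
  \<open>fact k\<close>, so what remains is the exponential series shifted by
  \<open>j\<close>.\<close>

lemma poisson_factorial_moment_sums:
  fixes a :: real
  shows "(\<lambda>k. (\<Prod>i<j. real k - real i) * (a ^ k / fact k)) sums (a ^ j * exp a)"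
proof -
  have e: "(\<lambda>k. a ^ k / fact k) sums exp a"
    using exp_converges[of a] by (simp add: field_simps scaleR_conv_of_real)
  let ?f = "\<lambda>k. (\<Prod>i<j. real k - real i) * (a ^ k / fact k)"
  have shift: "?f (k + j) = a ^ j * (a ^ k / fact k)" for k
  proof -
    have "(\<Prod>i<j. real (k + j) - real i) * fact k = fact (k + j)"
    proof (induction j)
      case 0
      then show ?case by simp
    next
      case (Suc j)
      have "(\<Prod>i<Suc j. real (k + Suc j) - real i) = real (k + Suc j) * (\<Prod>i<j. real (k + j) - real i)"
        by (subst prod.lessThan_Suc_shift) simp
      with Suc show ?case by (simp add: mult.assoc)
    qed
    then have "(\<Prod>i<j. real (k + j) - real i) = fact (k + j) / fact k"
      by (simp add: field_simps)
    then show ?thesis by (simp add: power_add)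
  qed
  have "(\<lambda>k. ?f (k + j)) sums (a ^ j * exp a)"
    unfolding shift by (intro sums_mult e)
  moreover have "(\<Sum>k<j. ?f k) = 0"
    by (intro sum.neutral) auto
  ultimately show ?thesis
    using sums_iff_shift'[of ?f j "a ^ j * exp a"] by simp
qed

lemma poisson_central_moment_sums:
  fixes a :: real
  defines "p k \<equiv> a ^ k / fact k * exp (- a)"
  shows "(\<lambda>k. (real k - a) * p k) sums 0"
    "(\<lambda>k. (real k - a)\<^sup>2 * p k) sums a"
    "(\<lambda>k. (real k - a)^4 * p k) sums (3 * a\<^sup>2 + a)"
proof -
  have f: "(\<lambda>k. (\<Prod>i<j. real k - real i) * p k) sums (a ^ j)" for j
    using sums_mult2[OF poisson_factorial_moment_sums[of j a], of "exp (- a)"]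
    by (simp add: p_def mult_ac exp_minus field_simps)
  note f0 = f[of 0, simplified] and f1 = f[of 1, simplified]
    and f2 = f[of 2, simplified numeral_eq_Suc, simplified]
  have f3: "(\<lambda>k. (real k * (real k - 1) * (real k - 2)) * p k) sums (a ^ 3)"
    using f[of 3] by (simp add: eval_nat_numeral lessThan_Suc mult_ac)
  have f4: "(\<lambda>k. (real k * (real k - 1) * (real k - 2) * (real k - 3)) * p k) sums (a ^ 4)"
    using f[of 4] by (simp add: eval_nat_numeral lessThan_Suc mult_ac)
  have "(\<lambda>k. real k * p k + (- a) * p k) sums (a + (- a) * 1)"
    by (intro sums_add sums_mult f0 f1)
  then show "(\<lambda>k. (real k - a) * p k) sums 0"
    by (simp add: algebra_simps)
  have "(\<lambda>k. (real k * (real k - 1)) * p k + (1 - 2 * a) * (real k * p k) + a\<^sup>2 * p k)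
      sums (a * a + (1 - 2 * a) * a + a\<^sup>2 * 1)"
    using f2 by (intro sums_add sums_mult f0 f1) simp
  then show "(\<lambda>k. (real k - a)\<^sup>2 * p k) sums a"
    by (simp add: algebra_simps power2_eq_square)
  \<comment> \<open>Expansion in falling factorials, whose sums are known; at \<open>a = 0\<close>
    the coefficients 1, 6, 7, 1 are Stirling numbers of the second kind.\<close>
  have id: "(x - a)^4 = x * (x - 1) * (x - 2) * (x - 3) + (6 - 4 * a) * (x * (x - 1) * (x - 2))
     + (7 - 12 * a + 6 * a\<^sup>2) * (x * (x - 1)) + (1 - 4 * a + 6 * a\<^sup>2 - 4 * a^3) * x + a^4" for x :: real
    by (simp add: power4_eq_xxxx power3_eq_cube power2_eq_square algebra_simps)
  have "(\<lambda>k. (real k * (real k - 1) * (real k - 2) * (real k - 3)) * p k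
      + (6 - 4 * a) * ((real k * (real k - 1) * (real k - 2)) * p k)
      + (7 - 12 * a + 6 * a\<^sup>2) * ((real k * (real k - 1)) * p k)
      + (1 - 4 * a + 6 * a\<^sup>2 - 4 * a^3) * (real k * p k) + a^4 * p k)
      sums (a^4 + (6 - 4 * a) * a^3 + (7 - 12 * a + 6 * a\<^sup>2) * a\<^sup>2
        + (1 - 4 * a + 6 * a\<^sup>2 - 4 * a^3) * a + a^4 * 1)"
    using f2
    by (intro sums_add sums_mult f0 f1 f3 f4)
       (simp_all add: power4_eq_xxxx power3_eq_cube power2_eq_square mult_ac)
  moreover have "a^4 + (6 - 4 * a) * a^3 + (7 - 12 * a + 6 * a\<^sup>2) * a\<^sup>2
        + (1 - 4 * a + 6 * a\<^sup>2 - 4 * a^3) * a + a^4 * 1 = 3 * a\<^sup>2 + a"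
    by (simp add: power4_eq_xxxx power3_eq_cube power2_eq_square algebra_simps)
  ultimately show "(\<lambda>k. (real k - a)^4 * p k) sums (3 * a\<^sup>2 + a)"
    unfolding id by (simp add: distrib_right mult.assoc)
qed

context prob_space
begin

text \<open>The probabilities of the finite integers already sum to 1, so the value infinity, which
  the type \<open>ennreal\<close> admits, has probability 0.\<close>

lemma poisson_counts_AE:
  fixes X :: "'a \<Rightarrow> ennreal"
  assumes [measurable]: "X \<in> borel_measurable M" and a: "0 \<le> a"
    and P: "\<And>k::nat. prob {\<omega>\<in>space M. X \<omega> = of_nat k} = exp (- a) * a ^ k / fact k"
  shows "AE \<omega> in M. \<exists>k::nat. X \<omega> = of_nat k"
proof -
  have m: "{\<omega>\<in>space M. X \<omega> = of_nat k} \<in> events" for k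
    by measurable
  have "(\<lambda>k. prob {\<omega>\<in>space M. X \<omega> = of_nat k}) sums prob (\<Union>k. {\<omega>\<in>space M. X \<omega> = of_nat k})"
    using m by (intro finite_measure_UNION) (auto simp: disjoint_family_on_def)
  moreover have "(\<lambda>k. prob {\<omega>\<in>space M. X \<omega> = of_nat k}) sums 1"
    using sums_mult2[OF poisson_factorial_moment_sums[of 0 a], of "exp (- a)"]
    by (simp add: P mult_ac exp_minus field_simps)
  ultimately have "prob (\<Union>k. {\<omega>\<in>space M. X \<omega> = of_nat k}) = 1"
    using sums_unique2 by blast
  then have "AE \<omega> in M. \<omega> \<in> (\<Union>k. {\<omega>\<in>space M. X \<omega> = of_nat k})"
    by (rule prob_eq_1[THEN iffD1, rotated]) (use m in auto)
  then show ?thesis by auto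
qed

lemma poisson_central_moments:
  fixes X :: "'a \<Rightarrow> ennreal"
  assumes mX [measurable]: "X \<in> borel_measurable M" and a: "0 \<le> a"
    and P: "\<And>k::nat. prob {\<omega>\<in>space M. X \<omega> = of_nat k} = exp (- a) * a ^ k / fact k"
  defines "Y \<equiv> (\<lambda>\<omega>. enn2real (X \<omega>) - a)"
  shows "integrable M (\<lambda>\<omega>. (Y \<omega>)^4)" "expectation Y = 0"
    "expectation (\<lambda>\<omega>. (Y \<omega>)\<^sup>2) = a" "expectation (\<lambda>\<omega>. (Y \<omega>)^4) = 3 * a\<^sup>2 + a"
proof -
  note ae = poisson_counts_AE[OF mX a P]
  define p where "p k = a ^ k / fact k * exp (- a)" for k
  have p0: "0 \<le> p k" for k using a by (simp add: p_def)
  define K where "K \<omega> = nat \<lfloor>enn2real (X \<omega>)\<rfloor>" for \<omega>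
  have [measurable]: "K \<in> measurable M (count_space UNIV)"
    unfolding K_def by measurable
  have aeK: "AE \<omega> in M. X \<omega> = of_nat (K \<omega>)"
    using ae by eventually_elim (auto simp: K_def)
  have PK: "prob (K -` {k} \<inter> space M) = p k" for k
  proof -
    have "prob (K -` {k} \<inter> space M) = prob {\<omega>\<in>space M. X \<omega> = of_nat k}"
      using aeK by (intro finite_measure_eq_AE) auto
    then show ?thesis by (simp add: P p_def)
  qed
  have D: "distr M (count_space UNIV) K = density (count_space UNIV) (\<lambda>k. ennreal (p k))"
  proof (rule measure_eqI_countable[of _ UNIV])
    fix k :: nat assume "k \<in> UNIV"
    show "emeasure (distr M (count_space UNIV) K) {k}
      = emeasure (density (count_space UNIV) (\<lambda>k. ennreal (p k))) {k}"
      using PK[of k]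
      by (simp add: emeasure_distr emeasure_density emeasure_eq_measure nn_integral_count_space_indicator[symmetric])
  qed auto
  \<comment> \<open>A convergent series does not give integrability over the counting measure, so
    absolute summability is supplied separately through the majorant \<open>b\<close>.\<close>
  have mom: "integrable M (\<lambda>\<omega>. g (enn2real (X \<omega>))) \<and> expectation (\<lambda>\<omega>. g (enn2real (X \<omega>))) = s"
    if g: "\<And>k. \<bar>g (real k)\<bar> \<le> b (real k)" and b: "summable (\<lambda>k. b (real k) * p k)"
    and s: "(\<lambda>k. g (real k) * p k) sums s" and [measurable]: "g \<in> borel_measurable borel"
    for g b s
  proof -
    have i: "integrable (count_space UNIV) (\<lambda>k. p k * g (real k))"
    proof (subst integrable_count_space_nat_iff)
      show "summable (\<lambda>k. norm (p k * g (real k)))"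
      proof (rule summable_comparison_test[OF _ b], intro exI allI impI)
        fix k
        show "norm (norm (p k * g (real k))) \<le> b (real k) * p k"
          using mult_right_mono[OF g[of k] p0[of k]] p0[of k] by (simp add: abs_mult mult.commute)
      qed
    qed
    have "integrable (distr M (count_space UNIV) K) (\<lambda>k. g (real k))"
      unfolding D using p0 i by (subst integrable_density) auto
    then have i1: "integrable M (\<lambda>\<omega>. g (real (K \<omega>)))"
      by (subst (asm) integrable_distr_eq) auto
    have "expectation (\<lambda>\<omega>. g (real (K \<omega>))) = integral\<^sup>L (distr M (count_space UNIV) K) (\<lambda>k. g (real k))"
      by (subst integral_distr) auto
    also have "\<dots> = integral\<^sup>L (count_space UNIV) (\<lambda>k. p k * g (real k))"
      unfolding D using p0 by (subst integral_density) auto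
    also have "\<dots> = s"
      using integral_count_space_nat[OF i] s by (simp add: sums_iff mult.commute)
    finally have e1: "expectation (\<lambda>\<omega>. g (real (K \<omega>))) = s" .
    have ae': "AE \<omega> in M. g (real (K \<omega>)) = g (enn2real (X \<omega>))"
      using aeK by eventually_elim simp
    have [measurable]: "random_variable borel (\<lambda>\<omega>. g (enn2real (X \<omega>)))" by measurable
    show ?thesis
      using i1 e1 integrable_cong_AE[OF _ _ ae'] integral_cong_AE[OF _ _ ae'] by simp
  qed
  note sums = poisson_central_moment_sums[of a, folded p_def]
  \<comment> \<open>Majorant for the first moment: it reduces absolute summability to the fourth
    moment and the total mass.\<close>
  have a4: "\<bar>x\<bar> \<le> x^4 + 1" for x :: real
  proof -
    have "0 \<le> (x\<^sup>2 - 1/2)\<^sup>2" "0 \<le> (\<bar>x\<bar> - 1/2)\<^sup>2" by simp_all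
    then show ?thesis by (simp add: power2_diff power_mult[symmetric] power_divide)
  qed
  have "(\<lambda>k. 1 * p k) sums 1"
    using sums_mult2[OF poisson_factorial_moment_sums[of 0 a], of "exp (- a)"]
    by (simp add: p_def exp_minus field_simps)
  then have b1: "summable (\<lambda>k. ((real k - a)^4 + 1) * p k)"
    using sums(3) by (auto simp: distrib_right sums_iff intro!: summable_add)
  show "expectation Y = 0"
    using mom[of "\<lambda>x. x - a" "\<lambda>x. (x - a)^4 + 1" 0] a4 b1 sums(1) by (simp add: Y_def)
  show "expectation (\<lambda>\<omega>. (Y \<omega>)\<^sup>2) = a"
    using mom[of "\<lambda>x. (x - a)\<^sup>2" "\<lambda>x. (x - a)\<^sup>2" a] sums(2) by (simp add: Y_def sums_iff)
  show "integrable M (\<lambda>\<omega>. (Y \<omega>)^4)" "expectation (\<lambda>\<omega>. (Y \<omega>)^4) = 3 * a\<^sup>2 + a"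
    using mom[of "\<lambda>x. (x - a)^4" "\<lambda>x. (x - a)^4" "3 * a\<^sup>2 + a"] sums(3) by (auto simp: Y_def sums_iff)
qed

section \<open>Joint independence of two independent families\<close>

text \<open>A finite intersection of events from both families is the intersection of one event of
  \<open>\<A>\<close> and one of \<open>\<B>\<close>; independence of the two \<sigma>-algebras
  splits the probability, and independence inside each family splits the two factors.\<close>

lemma indep_vars_Plus:
  assumes F: "indep_vars (\<lambda>_. borel) X I" and G: "indep_vars (\<lambda>_. borel) Y J"
    and ind: "indep_set \<A> \<B>"
    and X: "\<And>i A. i \<in> I \<Longrightarrow> A \<in> sets borel \<Longrightarrow> X i -` A \<inter> space M \<in> \<A>"
    and Y: "\<And>i A. i \<in> J \<Longrightarrow> A \<in> sets borel \<Longrightarrow> Y i -` A \<inter> space M \<in> \<B>"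
    and \<A>: "sigma_algebra (space M) \<A>" and \<B>: "sigma_algebra (space M) \<B>"
  shows "indep_vars (\<lambda>_. borel) (case_sum X Y) (I <+> J)"
  unfolding indep_vars_def2
proof (intro conjI ballI indep_setsI)
  interpret A: sigma_algebra "space M" \<A> by fact
  interpret B: sigma_algebra "space M" \<B> by fact
  have mX: "random_variable borel (X i)" if "i \<in> I" for i using F that by (auto simp: indep_vars_def)
  have mY: "random_variable borel (Y i)" if "i \<in> J" for i using G that by (auto simp: indep_vars_def)
  show rv: "random_variable borel (case_sum X Y i)" if "i \<in> I <+> J" for i
    using that mX mY by (auto simp: Plus_def)
  show "{case_sum X Y i -` A \<inter> space M |A. A \<in> sets borel} \<subseteq> events" if "i \<in> I <+> J" for i
    using rv[OF that] by (auto intro: measurable_sets)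
  fix A K assume K: "K \<noteq> {}" "K \<subseteq> I <+> J" "finite K"
    and A: "\<forall>j\<in>K. A j \<in> {case_sum X Y j -` A \<inter> space M |A. A \<in> sets borel}"
  define KI where "KI = Inl -` K"
  define KJ where "KJ = Inr -` K"
  have fin: "finite KI" "finite KJ"
    using K(3) by (auto simp: KI_def KJ_def intro!: finite_vimageI)
  have sub: "KI \<subseteq> I" "KJ \<subseteq> J" using K(2) by (auto simp: KI_def KJ_def)
  have Keq: "K = Inl ` KI \<union> Inr ` KJ"
  proof (intro set_eqI)
    fix x show "x \<in> K \<longleftrightarrow> x \<in> Inl ` KI \<union> Inr ` KJ" by (cases x) (auto simp: KI_def KJ_def)
  qed
  have AI: "\<forall>i\<in>KI. A (Inl i) \<in> {X i -` A \<inter> space M |A. A \<in> sets borel}"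
    and AJ: "\<forall>i\<in>KJ. A (Inr i) \<in> {Y i -` A \<inter> space M |A. A \<in> sets borel}"
    using bspec[OF A, of "Inl _"] bspec[OF A, of "Inr _"] by (simp_all add: KI_def KJ_def)
  have memAI: "A (Inl i) \<in> \<A>" if "i \<in> KI" for i
    using bspec[OF AI that] X[of i] sub that by force
  have memAJ: "A (Inr i) \<in> \<B>" if "i \<in> KJ" for i
    using bspec[OF AJ that] Y[of i] sub that by force
  \<comment> \<open>An intersection over no index is \<open>UNIV\<close>; cutting with
    \<open>space M\<close> makes it the sure event when \<open>K\<close> meets only one of the two
    families.\<close>
  define P where "P = (\<Inter>i\<in>KI. A (Inl i)) \<inter> space M"
  define R where "R = (\<Inter>i\<in>KJ. A (Inr i)) \<inter> space M"
  have memP: "P \<in> \<A>"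
  proof (cases "KI = {}")
    case False
    then have "(\<Inter>i\<in>KI. A (Inl i)) \<in> \<A>"
      using memAI fin by (intro A.finite_INT) auto
    then show ?thesis by (simp add: P_def A.Int)
  qed (simp add: P_def)
  have memR: "R \<in> \<B>"
  proof (cases "KJ = {}")
    case False
    then have "(\<Inter>i\<in>KJ. A (Inr i)) \<in> \<B>"
      using memAJ fin by (intro B.finite_INT) auto
    then show ?thesis by (simp add: R_def B.Int)
  qed (simp add: R_def)
  have pP: "prob P = (\<Prod>i\<in>KI. prob (A (Inl i)))"
  proof (cases "KI = {}")
    case False
    then have "P = (\<Inter>i\<in>KI. A (Inl i))" using AI by (auto simp: P_def)
    moreover have "prob (\<Inter>i\<in>KI. A (Inl i)) = (\<Prod>i\<in>KI. prob (A (Inl i)))"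
      using F AI sub fin False unfolding indep_vars_def2 by (intro indep_setsD) auto
    ultimately show ?thesis by simp
  qed (simp add: P_def prob_space)
  have pR: "prob R = (\<Prod>i\<in>KJ. prob (A (Inr i)))"
  proof (cases "KJ = {}")
    case False
    then have "R = (\<Inter>i\<in>KJ. A (Inr i))" using AJ by (auto simp: R_def)
    moreover have "prob (\<Inter>i\<in>KJ. A (Inr i)) = (\<Prod>i\<in>KJ. prob (A (Inr i)))"
      using G AJ sub fin False unfolding indep_vars_def2 by (intro indep_setsD) auto
    ultimately show ?thesis by simp
  qed (simp add: R_def prob_space)
  have "\<And>j. j \<in> K \<Longrightarrow> A j \<subseteq> space M" using A by auto
  then have "(\<Inter>j\<in>K. A j) = (\<Inter>j\<in>K. A j) \<inter> space M"
    using K(1) by blast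
  also have "\<dots> = P \<inter> R"
    unfolding P_def R_def Keq by auto
  finally have "(\<Inter>j\<in>K. A j) = P \<inter> R" .
  then have "prob (\<Inter>j\<in>K. A j) = prob P * prob R"
    using indep_setD[OF ind memP memR] by simp
  also have "\<dots> = (\<Prod>j\<in>K. prob (A j))"
    unfolding Keq pP pR using fin
    by (subst prod.union_disjoint) (auto simp: prod.reindex inj_on_def)
  finally show "prob (\<Inter>j\<in>K. A j) = (\<Prod>j\<in>K. prob (A j))" .
qed

end

section \<open>Limits of second moments\<close>

text \<open>Fatou's lemma: moment bounds survive almost everywhere convergence, with no convergence
  of the moments themselves.\<close>

lemma nn_integral_le_limit:
  fixes u :: "nat \<Rightarrow> 'a \<Rightarrow> real"
  assumes "\<And>l. u l \<in> borel_measurable M"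
    and lim: "AE \<omega> in M. (\<lambda>l. u l \<omega>) \<longlonglongrightarrow> v \<omega>"
    and le: "\<And>l. (\<integral>\<^sup>+ \<omega>. ennreal (u l \<omega>) \<partial>M) \<le> ennreal (b l)"
    and b: "b \<longlonglongrightarrow> b0"
  shows "(\<integral>\<^sup>+ \<omega>. ennreal (v \<omega>) \<partial>M) \<le> ennreal b0"
proof -
  have "(\<integral>\<^sup>+ \<omega>. ennreal (v \<omega>) \<partial>M) = (\<integral>\<^sup>+ \<omega>. liminf (\<lambda>l. ennreal (u l \<omega>)) \<partial>M)"
  proof (rule nn_integral_cong_AE)
    show "AE \<omega> in M. ennreal (v \<omega>) = liminf (\<lambda>l. ennreal (u l \<omega>))"
      using lim
    proof eventually_elim
      case (elim \<omega>)
      then have "(\<lambda>l. ennreal (u l \<omega>)) \<longlonglongrightarrow> ennreal (v \<omega>)" by (rule tendsto_ennrealI)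
      then show ?case by (rule lim_imp_Liminf[OF sequentially_bot, symmetric])
    qed
  qed
  also have "\<dots> \<le> liminf (\<lambda>l. \<integral>\<^sup>+ \<omega>. ennreal (u l \<omega>) \<partial>M)"
    using assms(1) by (intro nn_integral_liminf) auto
  also have "\<dots> \<le> liminf (\<lambda>l. ennreal (b l))"
    using le by (intro Liminf_mono) auto
  also have "\<dots> = ennreal b0"
    using b by (intro lim_imp_Liminf sequentially_bot tendsto_ennrealI)
  finally show ?thesis .
qed

text \<open>For use with random measures, where \<open>N \<omega>\<close> has the right measurable
  sets only for \<open>\<omega>\<close> in \<open>space M\<close>, so that identities hold only
  there.\<close>

lemma nn_integral_congI:
  assumes "\<And>\<omega>. \<omega> \<in> space M \<Longrightarrow> f \<omega> = g \<omega>"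
    and "g \<in> borel_measurable M" "(\<integral>\<^sup>+ \<omega>. g \<omega> \<partial>M) = c"
  shows "f \<in> borel_measurable M \<and> (\<integral>\<^sup>+ \<omega>. f \<omega> \<partial>M) = c"
proof
  show "f \<in> borel_measurable M"
    by (subst measurable_cong[of M f g]) (use assms in auto)
  show "(\<integral>\<^sup>+ \<omega>. f \<omega> \<partial>M) = c"
    by (subst nn_integral_cong[of M f g]) (use assms in auto)
qed

lemma nn_integral_square_sum_le:
  fixes X Y :: "'a \<Rightarrow> real"
  assumes [measurable]: "X \<in> borel_measurable M" "Y \<in> borel_measurable M"
  shows "(\<integral>\<^sup>+ \<omega>. ennreal ((X \<omega> + Y \<omega>)\<^sup>2) \<partial>M)
    \<le> 2 * (\<integral>\<^sup>+ \<omega>. ennreal ((X \<omega>)\<^sup>2) \<partial>M) + 2 * (\<integral>\<^sup>+ \<omega>. ennreal ((Y \<omega>)\<^sup>2) \<partial>M)"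
proof -
  have "ennreal ((X \<omega> + Y \<omega>)\<^sup>2) \<le> 2 * ennreal ((X \<omega>)\<^sup>2) + 2 * ennreal ((Y \<omega>)\<^sup>2)" for \<omega>
  proof -
    have "(X \<omega> + Y \<omega>)\<^sup>2 \<le> 2 * (X \<omega>)\<^sup>2 + 2 * (Y \<omega>)\<^sup>2"
      using zero_le_power2[of "X \<omega> - Y \<omega>"] by (simp add: power2_diff power2_sum)
    then have "ennreal ((X \<omega> + Y \<omega>)\<^sup>2) \<le> ennreal (2 * (X \<omega>)\<^sup>2 + 2 * (Y \<omega>)\<^sup>2)"
      by (rule ennreal_leI)
    then show ?thesis by (simp add: ennreal_mult)
  qed
  then have "(\<integral>\<^sup>+ \<omega>. ennreal ((X \<omega> + Y \<omega>)\<^sup>2) \<partial>M)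
      \<le> (\<integral>\<^sup>+ \<omega>. 2 * ennreal ((X \<omega>)\<^sup>2) + 2 * ennreal ((Y \<omega>)\<^sup>2) \<partial>M)"
    by (intro nn_integral_mono)
  also have "\<dots> = 2 * (\<integral>\<^sup>+ \<omega>. ennreal ((X \<omega>)\<^sup>2) \<partial>M) + 2 * (\<integral>\<^sup>+ \<omega>. ennreal ((Y \<omega>)\<^sup>2) \<partial>M)"
    by (simp add: nn_integral_add nn_integral_cmult)
  finally show ?thesis .
qed

text \<open>A Poisson random measure provides independence for families indexed by initial segments
  of the naturals; this carries it to other finite index sets.\<close>

lemma (in prob_space) indep_vars_reindex_bij:
  assumes h: "bij_betw h I J" and ind: "indep_vars (\<lambda>_. N) (\<lambda>i. X (h i)) I"
  shows "indep_vars (\<lambda>_. N) X J"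
  unfolding indep_vars_def2
proof (intro conjI ballI indep_setsI)
  have mJ: "\<exists>i\<in>I. j = h i" if "j \<in> J" for j
    using h that by (auto simp: bij_betw_def)
  show rv: "random_variable N (X j)" if "j \<in> J" for j
    using mJ[OF that] ind by (auto simp: indep_vars_def)
  show "{X j -` A \<inter> space M |A. A \<in> sets N} \<subseteq> events" if "j \<in> J" for j
    using rv[OF that] by (auto intro: measurable_sets)
  fix A K assume K: "K \<noteq> {}" "K \<subseteq> J" "finite K"
    and A: "\<forall>j\<in>K. A j \<in> {X j -` A \<inter> space M |A. A \<in> sets N}"
  define K' where "K' = h -` K \<inter> I"
  have inj: "inj_on h K'" using h by (auto simp: K'_def bij_betw_def inj_on_def)
  have K_eq: "K = h ` K'" using K(2) mJ by (fastforce simp: K'_def)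
  have fin: "finite K'" using K(3) inj K_eq by (metis finite_imageD)
  have ind': "indep_sets (\<lambda>i. {X (h i) -` A \<inter> space M |A. A \<in> sets N}) I"
    using ind unfolding indep_vars_def2 by blast
  have "\<forall>i\<in>K'. A (h i) \<in> {X (h i) -` B \<inter> space M |B. B \<in> sets N}"
    using A unfolding K_eq by blast
  moreover have "K' \<subseteq> I" by (auto simp: K'_def)
  moreover have "K' \<noteq> {}" using K(1) K_eq by blast
  ultimately have "prob (\<Inter>i\<in>K'. A (h i)) = (\<Prod>i\<in>K'. prob (A (h i)))"
    using indep_setsD[OF ind', of K' "\<lambda>i. A (h i)"] fin by blast
  then show "prob (\<Inter>j\<in>K. A j) = (\<Prod>j\<in>K. prob (A j))"
    unfolding K_eq using inj by (simp add: prod.reindex)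
qed

section \<open>From the Poisson random measure to finite sums of centred counts\<close>

section \<open>Integrals with respect to the jump measure\<close>

definition jump_integral ::
  "real measure \<Rightarrow> ('a \<Rightarrow> (real \<times> real) measure) \<Rightarrow> (real \<Rightarrow> real) \<Rightarrow> real \<Rightarrow> real \<Rightarrow> 'a \<Rightarrow> real" where
  "jump_integral \<nu> N g s t \<omega> =
     (LINT p|N \<omega>. indicator {s<..t} (fst p) * g (snd p)) - (t - s) * (LINT x|\<nu>. g x)"

definition centred_count ::
  "(real \<times> real) measure \<Rightarrow> ('a \<Rightarrow> (real \<times> real) measure) \<Rightarrow> (real \<times> real) set \<Rightarrow> 'a \<Rightarrow> real" where
  "centred_count \<Gamma> N R \<omega> = enn2real (emeasure (N \<omega>) R) - measure \<Gamma> R"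

definition large_jumps :: "real \<Rightarrow> real set" where
  "large_jumps e = {x. e < \<bar>x\<bar>}"

text \<open>Vanishing near 0 gives every nonzero level set finite mass even when
  \<open>\<nu>\<close> is infinite, and finitely many values turn integrals against the jump measure
  into finite combinations of Poisson counts.\<close>

definition simple_jump_function :: "real \<Rightarrow> (real \<Rightarrow> real) \<Rightarrow> bool" where
  "simple_jump_function e g \<longleftrightarrow> g \<in> borel_measurable borel \<and> finite (range g) \<and>
     (\<forall>x. x \<notin> large_jumps e \<longrightarrow> g x = 0)"

lemma large_jumps_borel [measurable]: "large_jumps e \<in> sets borel"
  unfolding large_jumps_def by measurable

locale jump_noise = prob_space M
  for M :: "'a measure" +
  fixes \<nu> :: "real measure" and N :: "'a \<Rightarrow> (real \<times> real) measure"
  assumes levy: "levy_measure \<nu>"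
    and prm: "poisson_random_measure M (jump_intensity \<nu>) N"
begin

abbreviation "\<Gamma> \<equiv> jump_intensity \<nu>"

lemma sets_\<nu> [measurable_cong, simp]: "sets \<nu> = sets borel"
  using levy by (simp add: levy_measure_def)

lemma space_\<nu> [simp]: "space \<nu> = UNIV"
  using sets_eq_imp_space_eq[OF sets_\<nu>] by simp

lemma sets_\<Gamma> [simp, measurable_cong]: "sets \<Gamma> = sets (borel :: (real \<times> real) measure)"
  unfolding jump_intensity_def borel_prod[symmetric] by (intro sets_pair_measure_cong) auto

lemma space_\<Gamma> [simp]: "space \<Gamma> = UNIV"
  using sets_eq_imp_space_eq[OF sets_\<Gamma>] by simp

lemma sets_N: "\<omega> \<in> space M \<Longrightarrow> sets (N \<omega>) = sets (borel :: (real \<times> real) measure)"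
  using prm by (simp add: poisson_random_measure_def)

lemma measurable_N [measurable]:
  "A \<in> sets borel \<Longrightarrow> (\<lambda>\<omega>. emeasure (N \<omega>) A) \<in> borel_measurable M"
  using prm by (simp add: poisson_random_measure_def)

lemma nn_square_\<nu>: "(\<integral>\<^sup>+ x. ennreal (x\<^sup>2) \<partial>\<nu>) = 1"
  using levy by (simp add: levy_measure_def)

lemma integrable_square_\<nu>: "integrable \<nu> (\<lambda>x. x\<^sup>2)" "(LINT x|\<nu>. x\<^sup>2) = 1"
proof -
  show "integrable \<nu> (\<lambda>x. x\<^sup>2)"
    by (rule integrableI_nonneg) (auto simp: nn_square_\<nu>)
  then show "(LINT x|\<nu>. x\<^sup>2) = 1"
    using nn_integral_eq_integral[of \<nu> "\<lambda>x. x\<^sup>2"] nn_square_\<nu> by (simp add: ennreal_eq_1)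
qed

text \<open>The fourth moment is dominated by the sum of the second and the sixth.\<close>

lemma integrable_fourth_\<nu>: "integrable \<nu> (\<lambda>x. x^4)"
proof -
  have "integrable \<nu> (\<lambda>x. x^6)"
    using levy by (intro integrableI_nonneg) (auto simp: levy_measure_def)
  then have "integrable \<nu> (\<lambda>x. x\<^sup>2 + x^6)"
    using integrable_square_\<nu>(1) by auto
  then show ?thesis
  proof (rule Bochner_Integration.integrable_bound)
    have "x^4 \<le> x\<^sup>2 + x^6" for x :: real
    proof -
      have "0 \<le> x\<^sup>2 * (x\<^sup>2 - 1/2)\<^sup>2" by simp
      then have "x^4 \<le> x^6 + x\<^sup>2 / 4"
        by (simp add: power2_diff algebra_simps power_divide flip: power_add power_mult)
      moreover have "x\<^sup>2 / 4 \<le> x\<^sup>2" by simp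
      ultimately show ?thesis by linarith
    qed
    then show "AE x in \<nu>. norm (x^4) \<le> norm (x\<^sup>2 + x^6)" by simp
  qed simp
qed

text \<open>Chebyshev's inequality with the second moment, which is 1.\<close>

lemma emeasure_large_jumps:
  assumes "0 < e"
  shows "emeasure \<nu> (large_jumps e) < \<infinity>"
proof -
  have "emeasure \<nu> (large_jumps e) \<le> (\<integral>\<^sup>+ x. ennreal (1 / e\<^sup>2) * ennreal (x\<^sup>2) \<partial>\<nu>)"
  proof (subst nn_integral_indicator[symmetric])
    show "(\<integral>\<^sup>+ x. indicator (large_jumps e) x \<partial>\<nu>) \<le> (\<integral>\<^sup>+ x. ennreal (1 / e\<^sup>2) * ennreal (x\<^sup>2) \<partial>\<nu>)"
    proof (rule nn_integral_mono)
      fix x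
      show "indicator (large_jumps e) x \<le> ennreal (1 / e\<^sup>2) * ennreal (x\<^sup>2)"
      proof (cases "x \<in> large_jumps e")
        case True
        then have "e\<^sup>2 \<le> x\<^sup>2" using assms by (auto simp: large_jumps_def abs_le_square_iff[symmetric])
        then have "1 \<le> 1 / e\<^sup>2 * x\<^sup>2" using assms by (simp add: field_simps)
        then show ?thesis using True by (simp add: ennreal_mult[symmetric])
      qed simp
    qed
  qed simp
  also have "\<dots> = ennreal (1 / e\<^sup>2)"
    by (subst nn_integral_cmult) (auto simp: nn_square_\<nu>)
  finally show ?thesis by (simp add: order_le_less_trans)
qed

text \<open>The sets of jumps larger than 1/(n+1) have finite mass and cover everything but 0; the
  point 0 has mass 0 and is added as one more set.\<close>

sublocale \<nu>: sigma_finite_measure \<nu>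
proof
  let ?A = "insert {0} (range (\<lambda>n. large_jumps (1 / real (Suc n))))"
  have "x \<in> \<Union>?A" for x
  proof (cases "x = 0")
    case False
    then obtain n where "1 / real (Suc n) < \<bar>x\<bar>"
      using reals_Archimedean[of "\<bar>x\<bar>"] by (auto simp: inverse_eq_divide)
    then show ?thesis by (auto simp: large_jumps_def)
  qed simp
  moreover have "emeasure \<nu> a \<noteq> \<infinity>" if "a \<in> ?A" for a
    using that levy emeasure_large_jumps[of "1 / real (Suc _)"]
    by (auto simp: levy_measure_def less_top)
  ultimately show "\<exists>A. countable A \<and> A \<subseteq> sets \<nu> \<and> \<Union>A = space \<nu> \<and> (\<forall>a\<in>A. emeasure \<nu> a \<noteq> \<infinity>)"
    by (intro exI[of _ ?A]) auto
qed

lemma emeasure_\<Gamma>_rect: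
  assumes "0 \<le> s" "s \<le> t" "B \<in> sets borel"
  shows "emeasure \<Gamma> ({s<..t} \<times> B) = ennreal (t - s) * emeasure \<nu> B"
proof -
  have "emeasure \<Gamma> ({s<..t} \<times> B) = emeasure (density lborel (indicator {0..})) {s<..t} * emeasure \<nu> B"
    unfolding jump_intensity_def using assms by (intro \<nu>.emeasure_pair_measure_Times) auto
  also have "emeasure (density lborel (indicator {0..})) {s<..t} = ennreal (t - s)"
  proof -
    have "emeasure (density lborel (indicator {0..})) {s<..t}
        = (\<integral>\<^sup>+ x. indicator {0..} x * indicator {s<..t} x \<partial>lborel)"
      by (simp add: emeasure_density)
    also have "\<dots> = (\<integral>\<^sup>+ x. indicator {s<..t} x \<partial>lborel)"
      using assms by (intro nn_integral_cong) (auto simp: indicator_def)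
    finally show ?thesis using assms by simp
  qed
  finally show ?thesis .
qed

lemma rect_borel [measurable]:
  "B \<in> sets borel \<Longrightarrow> {s<..t} \<times> B \<in> sets (borel :: (real \<times> real) measure)" for s t :: real
  using pair_measureI[of "{s<..t}" borel B borel] unfolding borel_prod by simp

lemma centred_count_moments:
  assumes R: "R \<in> sets borel" "emeasure \<Gamma> R < \<infinity>"
  shows "integrable M (\<lambda>\<omega>. (centred_count \<Gamma> N R \<omega>)^4)" "expectation (centred_count \<Gamma> N R) = 0"
    "expectation (\<lambda>\<omega>. (centred_count \<Gamma> N R \<omega>)\<^sup>2) = measure \<Gamma> R"
    "expectation (\<lambda>\<omega>. (centred_count \<Gamma> N R \<omega>)^4) = 3 * (measure \<Gamma> R)\<^sup>2 + measure \<Gamma> R"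
    "AE \<omega> in M. emeasure (N \<omega>) R < \<infinity>"
proof -
  have P: "prob {\<omega>\<in>space M. emeasure (N \<omega>) R = of_nat k} = exp (- measure \<Gamma> R) * measure \<Gamma> R ^ k / fact k" for k
    using prm R unfolding poisson_random_measure_def by simp
  note m = poisson_central_moments[OF measurable_N[OF R(1)] measure_nonneg P]
  show "integrable M (\<lambda>\<omega>. (centred_count \<Gamma> N R \<omega>)^4)" "expectation (centred_count \<Gamma> N R) = 0"
    "expectation (\<lambda>\<omega>. (centred_count \<Gamma> N R \<omega>)\<^sup>2) = measure \<Gamma> R"
    "expectation (\<lambda>\<omega>. (centred_count \<Gamma> N R \<omega>)^4) = 3 * (measure \<Gamma> R)\<^sup>2 + measure \<Gamma> R"
    using m unfolding centred_count_def[abs_def] by blast+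
  show "AE \<omega> in M. emeasure (N \<omega>) R < \<infinity>"
    using poisson_counts_AE[OF measurable_N[OF R(1)] measure_nonneg P]
    by eventually_elim (auto simp: less_top of_nat_less_top)
qed

lemma centred_count_measurable [measurable]:
  "R \<in> sets borel \<Longrightarrow> centred_count \<Gamma> N R \<in> borel_measurable M"
  unfolding centred_count_def[abs_def]
  by (intro borel_measurable_diff borel_measurable_const borel_measurable_enn2real measurable_N)

lemma centred_count_square_integrable:
  assumes R: "R \<in> sets borel" "emeasure \<Gamma> R < \<infinity>"
  shows "square_integrable M (centred_count \<Gamma> N R)"
proof -
  have "square_integrable M (\<lambda>\<omega>. (centred_count \<Gamma> N R \<omega>)\<^sup>2)"
    using centred_count_moments(1)[OF R] R by (simp add: square_integrable_def flip: power_mult)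
  from square_integrable_integrable[OF this] show ?thesis
    using R by (simp add: square_integrable_def)
qed

lemma centred_counts_indep:
  assumes J: "finite J" "disjoint_family_on R J" "\<And>j. j \<in> J \<Longrightarrow> R j \<in> sets borel"
  shows "indep_vars (\<lambda>_. borel) (\<lambda>j. centred_count \<Gamma> N (R j)) J"
proof -
  obtain h where h: "bij_betw h {..<card J} J"
    using ex_bij_betw_nat_finite[OF J(1)] by (auto simp: atLeast0LessThan)
  have hJ: "h i \<in> J" if "i < card J" for i using h that by (auto simp: bij_betw_def)
  have "disjoint_family_on (\<lambda>i. R (h i)) {..<card J}"
    using J(2) h unfolding disjoint_family_on_def bij_betw_def inj_on_def by blast
  moreover have "(\<lambda>i. R (h i)) ` {..<card J} \<subseteq> sets \<Gamma>"
    using hJ J(3) by auto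
  ultimately have "indep_vars (\<lambda>_. borel) (\<lambda>i \<omega>. emeasure (N \<omega>) (R (h i))) {..<card J}"
    using prm unfolding poisson_random_measure_def by blast
  then have "indep_vars (\<lambda>_. borel) (\<lambda>i \<omega>. (\<lambda>x. enn2real x - measure \<Gamma> (R (h i))) (emeasure (N \<omega>) (R (h i)))) {..<card J}"
    by (rule indep_vars_compose2) measurable
  then have "indep_vars (\<lambda>_. borel) (\<lambda>i. centred_count \<Gamma> N (R (h i))) {..<card J}"
    by (simp add: centred_count_def[abs_def])
  with h show ?thesis by (rule indep_vars_reindex_bij)
qed

text \<open>Campbell's formula. For indicators it says that a Poisson count has its parameter as
  mean, and monotone class induction does the rest. Cutting to a set \<open>R\<close> of finite
  intensity keeps every count in the range where the Poisson law is prescribed. It serves to show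
  that the absolute large jumps have an almost surely finite sum.\<close>

lemma campbell:
  assumes R [measurable]: "R \<in> sets borel" "emeasure \<Gamma> R < \<infinity>"
    and h: "h \<in> borel_measurable (borel :: (real \<times> real) measure)"
  shows "(\<lambda>\<omega>. \<integral>\<^sup>+ p. h p * indicator R p \<partial>N \<omega>) \<in> borel_measurable M \<and>
    (\<integral>\<^sup>+ \<omega>. (\<integral>\<^sup>+ p. h p * indicator R p \<partial>N \<omega>) \<partial>M) = (\<integral>\<^sup>+ p. h p * indicator R p \<partial>\<Gamma>)"
  using h
proof (induction rule: borel_measurable_induct)
  case (cong f g)
  then have "f = g" by auto
  then show ?case using cong by simp
next
  case (set A)
  have [measurable]: "A \<in> sets borel" by fact
  have fin: "emeasure \<Gamma> (A \<inter> R) < \<infinity>"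
    using emeasure_mono[of "A \<inter> R" R \<Gamma>] R(2) by (auto intro: order_le_less_trans)
  have eqN: "(\<integral>\<^sup>+ p. indicator A p * indicator R p \<partial>N \<omega>) = emeasure (N \<omega>) (A \<inter> R)" if "\<omega> \<in> space M" for \<omega>
    by (simp add: indicator_inter_arith[symmetric] sets_N[OF that])
  have eqG: "(\<integral>\<^sup>+ p. indicator A p * indicator R p \<partial>\<Gamma>) = emeasure \<Gamma> (A \<inter> R)"
    by (simp add: indicator_inter_arith[symmetric])
  note m = centred_count_moments[of "A \<inter> R"] and si = centred_count_square_integrable[of "A \<inter> R"]
  have iC: "integrable M (centred_count \<Gamma> N (A \<inter> R))"
    using si fin by (intro square_integrable_integrable) auto
  have "integrable M (\<lambda>\<omega>. centred_count \<Gamma> N (A \<inter> R) \<omega> + measure \<Gamma> (A \<inter> R))"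
    using iC by auto
  moreover have "expectation (\<lambda>\<omega>. centred_count \<Gamma> N (A \<inter> R) \<omega> + measure \<Gamma> (A \<inter> R)) = measure \<Gamma> (A \<inter> R)"
    using iC m(2) fin by (simp add: prob_space)
  ultimately have i: "integrable M (\<lambda>\<omega>. enn2real (emeasure (N \<omega>) (A \<inter> R)))"
    and e: "expectation (\<lambda>\<omega>. enn2real (emeasure (N \<omega>) (A \<inter> R))) = measure \<Gamma> (A \<inter> R)"
    by (simp_all add: centred_count_def)
  have "(\<integral>\<^sup>+ \<omega>. (\<integral>\<^sup>+ p. indicator A p * indicator R p \<partial>N \<omega>) \<partial>M) = (\<integral>\<^sup>+ \<omega>. emeasure (N \<omega>) (A \<inter> R) \<partial>M)"
    by (intro nn_integral_cong eqN)
  also have "\<dots> = (\<integral>\<^sup>+ \<omega>. ennreal (enn2real (emeasure (N \<omega>) (A \<inter> R))) \<partial>M)"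
    using m(5) fin by (intro nn_integral_cong_AE) auto
  also have "\<dots> = emeasure \<Gamma> (A \<inter> R)"
    using nn_integral_eq_integral[OF i] e fin by (simp add: emeasure_eq_ennreal_measure less_top)
  finally show ?case
    using eqG measurable_cong[of M, OF eqN] by simp
next
  case (mult u c)
  then have [measurable]: "u \<in> borel_measurable borel" by simp
  have eqN: "(\<integral>\<^sup>+ p. c * u p * indicator R p \<partial>N \<omega>) = c * (\<integral>\<^sup>+ p. u p * indicator R p \<partial>N \<omega>)" if "\<omega> \<in> space M" for \<omega>
    by (subst nn_integral_cmult[symmetric]) (auto simp: measurable_cong_sets[OF sets_N[OF that] refl] mult.assoc)
  have eqG: "(\<integral>\<^sup>+ p. c * u p * indicator R p \<partial>\<Gamma>) = c * (\<integral>\<^sup>+ p. u p * indicator R p \<partial>\<Gamma>)"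
    by (subst nn_integral_cmult[symmetric]) (auto simp: measurable_cong_sets[OF sets_\<Gamma> refl] mult.assoc)
  show ?case
    unfolding eqG using mult
    by (intro nn_integral_congI[OF eqN]) (auto simp: nn_integral_cmult)
next
  case (add u v)
  then have [measurable]: "u \<in> borel_measurable borel" "v \<in> borel_measurable borel" by simp_all
  have eqN: "(\<integral>\<^sup>+ p. (v p + u p) * indicator R p \<partial>N \<omega>)
      = (\<integral>\<^sup>+ p. v p * indicator R p \<partial>N \<omega>) + (\<integral>\<^sup>+ p. u p * indicator R p \<partial>N \<omega>)" if "\<omega> \<in> space M" for \<omega>
    by (subst nn_integral_add[symmetric]) (auto simp: measurable_cong_sets[OF sets_N[OF that] refl] distrib_right)
  have eqG: "(\<integral>\<^sup>+ p. (v p + u p) * indicator R p \<partial>\<Gamma>)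
      = (\<integral>\<^sup>+ p. v p * indicator R p \<partial>\<Gamma>) + (\<integral>\<^sup>+ p. u p * indicator R p \<partial>\<Gamma>)"
    by (subst nn_integral_add[symmetric]) (auto simp: measurable_cong_sets[OF sets_\<Gamma> refl] distrib_right)
  have IH: "(\<lambda>\<omega>. \<integral>\<^sup>+ p. u p * indicator R p \<partial>N \<omega>) \<in> borel_measurable M"
      "(\<lambda>\<omega>. \<integral>\<^sup>+ p. v p * indicator R p \<partial>N \<omega>) \<in> borel_measurable M"
      "(\<integral>\<^sup>+ \<omega>. (\<integral>\<^sup>+ p. u p * indicator R p \<partial>N \<omega>) \<partial>M) = (\<integral>\<^sup>+ p. u p * indicator R p \<partial>\<Gamma>)"
      "(\<integral>\<^sup>+ \<omega>. (\<integral>\<^sup>+ p. v p * indicator R p \<partial>N \<omega>) \<partial>M) = (\<integral>\<^sup>+ p. v p * indicator R p \<partial>\<Gamma>)"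
    using add by blast+
  show ?case
    unfolding eqG
    by (rule nn_integral_congI[OF eqN])
      (simp_all only: nn_integral_add[OF IH(2,1)] IH(3,4) borel_measurable_add[OF IH(2,1)])
next
  case (seq U)
  then have [measurable]: "\<And>i. U i \<in> borel_measurable borel" by simp
  have sup: "(SUP i. U i) p * indicator R p = (SUP i. U i p * indicator R p)" for p
    by (simp add: SUP_mult_right_ennreal image_comp split: split_indicator)
  have inc: "incseq (\<lambda>i p. U i p * indicator R p)"
    using seq(3) by (auto simp: incseq_def le_fun_def intro!: mult_right_mono)
  have eqN: "(\<integral>\<^sup>+ p. (SUP i. U i) p * indicator R p \<partial>N \<omega>) = (SUP i. \<integral>\<^sup>+ p. U i p * indicator R p \<partial>N \<omega>)" if "\<omega> \<in> space M" for \<omega>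
    unfolding sup using inc
    by (intro nn_integral_monotone_convergence_SUP) (auto simp: measurable_cong_sets[OF sets_N[OF that] refl])
  have eqG: "(\<integral>\<^sup>+ p. (SUP i. U i) p * indicator R p \<partial>\<Gamma>) = (SUP i. \<integral>\<^sup>+ p. U i p * indicator R p \<partial>\<Gamma>)"
    unfolding sup using inc
    by (intro nn_integral_monotone_convergence_SUP) (auto simp: measurable_cong_sets[OF sets_\<Gamma> refl])
  have inc2: "incseq (\<lambda>i \<omega>. \<integral>\<^sup>+ p. U i p * indicator R p \<partial>N \<omega>)"
    using inc by (auto simp: incseq_def le_fun_def intro!: nn_integral_mono)
  have "(\<integral>\<^sup>+ \<omega>. (SUP i. \<integral>\<^sup>+ p. U i p * indicator R p \<partial>N \<omega>) \<partial>M) = (SUP i. \<integral>\<^sup>+ \<omega>. (\<integral>\<^sup>+ p. U i p * indicator R p \<partial>N \<omega>) \<partial>M)"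
    using seq by (intro nn_integral_monotone_convergence_SUP inc2) auto
  then have "(\<integral>\<^sup>+ \<omega>. (SUP i. \<integral>\<^sup>+ p. U i p * indicator R p \<partial>N \<omega>) \<partial>M) = (SUP i. \<integral>\<^sup>+ p. U i p * indicator R p \<partial>\<Gamma>)"
    using seq by simp
  moreover have "(\<lambda>\<omega>. SUP i. \<integral>\<^sup>+ p. U i p * indicator R p \<partial>N \<omega>) \<in> borel_measurable M"
    using seq by (intro borel_measurable_SUP) auto
  ultimately show ?case
    unfolding eqG by (intro nn_integral_congI[OF eqN])
qed

end

lemma simple_jump_function_diff:
  assumes "simple_jump_function e g" "simple_jump_function e h"
  shows "simple_jump_function e (\<lambda>x. g x - h x)"
proof -
  have "range (\<lambda>x. g x - h x) \<subseteq> (\<lambda>(a, b). a - b) ` (range g \<times> range h)" by auto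
  then have "finite (range (\<lambda>x. g x - h x))"
    by (rule finite_subset) (use assms in \<open>simp add: simple_jump_function_def\<close>)
  then show ?thesis using assms by (auto simp: simple_jump_function_def)
qed

text \<open>Since \<open>h\<close> vanishes at 0, the level set of 0, which may have infinite mass,
  can be left out of the sum.\<close>

lemma sum_over_values:
  fixes g h :: "real \<Rightarrow> real"
  assumes "finite (range g)" "h 0 = 0"
  shows "h (g x) = (\<Sum>c\<in>range g - {0}. h c * indicator (g -` {c}) x)"
proof -
  have "(\<Sum>c\<in>range g - {0}. h c * indicator (g -` {c}) x) = (\<Sum>c\<in>range g - {0}. if g x = c then h c else 0)"
    by (intro sum.cong) auto
  then show ?thesis using assms by (auto simp: sum.delta)
qed

context jump_noise
begin

text \<open>A version of \<open>jump_integral\<close> that is a finite sum of centred counts, hence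
  visibly measurable in \<open>\<omega>\<close> and accessible to moment formulas; the two agree
  wherever only finitely many large jumps occur.\<close>

definition jump_sum :: "(real \<Rightarrow> real) \<Rightarrow> real \<Rightarrow> real \<Rightarrow> 'a \<Rightarrow> real" where
  "jump_sum g s t \<omega> =
     (\<Sum>c\<in>range g - {0}. c * centred_count \<Gamma> N ({s<..t} \<times> g -` {c}) \<omega>)"

context
  fixes e :: real and g :: "real \<Rightarrow> real"
  assumes e: "0 < e" and g: "simple_jump_function e g"
begin

lemma simple_jump_measurable: "g \<in> borel_measurable borel"
  and simple_jump_finite: "finite (range g)"
  and simple_jump_support: "x \<notin> large_jumps e \<Longrightarrow> g x = 0"
  using g by (auto simp: simple_jump_function_def)

lemma level_set_borel: "g -` {c} \<in> sets borel"
  using measurable_sets[OF simple_jump_measurable, of "{c}"] by simp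

lemma jump_sum_measurable: "jump_sum g s t \<in> borel_measurable M"
  unfolding jump_sum_def[abs_def]
  by (intro borel_measurable_sum borel_measurable_times borel_measurable_const
      centred_count_measurable rect_borel level_set_borel)

lemma level_set_finite:
  assumes "c \<in> range g - {0}"
  shows "emeasure \<nu> (g -` {c}) < \<infinity>"
proof -
  have "g -` {c} \<subseteq> large_jumps e" using simple_jump_support assms by fastforce
  then have "emeasure \<nu> (g -` {c}) \<le> emeasure \<nu> (large_jumps e)" by (intro emeasure_mono) auto
  then show ?thesis using emeasure_large_jumps[OF e] by (rule order_le_less_trans)
qed

lemma level_rect:
  assumes "c \<in> range g - {0}" "0 \<le> s" "s \<le> t"
  shows "emeasure \<Gamma> ({s<..t} \<times> g -` {c}) < \<infinity>"
    "measure \<Gamma> ({s<..t} \<times> g -` {c}) = (t - s) * measure \<nu> (g -` {c})"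
proof -
  have e: "emeasure \<Gamma> ({s<..t} \<times> g -` {c}) = ennreal (t - s) * emeasure \<nu> (g -` {c})"
    using assms by (intro emeasure_\<Gamma>_rect level_set_borel) auto
  show "emeasure \<Gamma> ({s<..t} \<times> g -` {c}) < \<infinity>"
    unfolding e using level_set_finite[OF assms(1)] by (simp add: ennreal_mult_less_top)
  show "measure \<Gamma> ({s<..t} \<times> g -` {c}) = (t - s) * measure \<nu> (g -` {c})"
    using assms unfolding measure_def e by (simp add: enn2real_mult)
qed

lemma integral_simple_jump:
  assumes "h 0 = 0"
  shows "integrable \<nu> (\<lambda>x. h (g x))"
    "(LINT x|\<nu>. h (g x)) = (\<Sum>c\<in>range g - {0}. h c * measure \<nu> (g -` {c}))"
proof -
  have i: "integrable \<nu> (\<lambda>x. h c * indicator (g -` {c}) x :: real)" if "c \<in> range g - {0}" for c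
    using level_set_finite[OF that] level_set_borel by (intro integrable_mult_right integrable_real_indicator) auto
  have eq: "(\<lambda>x. h (g x)) = (\<lambda>x. \<Sum>c\<in>range g - {0}. h c * indicator (g -` {c}) x)"
    using sum_over_values[of g h] simple_jump_finite assms by auto
  show "integrable \<nu> (\<lambda>x. h (g x))"
    unfolding eq using i by (intro Bochner_Integration.integrable_sum) auto
  show "(LINT x|\<nu>. h (g x)) = (\<Sum>c\<in>range g - {0}. h c * measure \<nu> (g -` {c}))"
    unfolding eq using i by (subst Bochner_Integration.integral_sum) auto
qed

text \<open>With a finite count in the strip every level rectangle has finite mass under
  \<open>N \<omega>\<close>, so the integrand is integrable and the integral is a true finite sum,
  not the default value 0.\<close>

lemma jump_sum_eq_integral:
  assumes st: "0 \<le> s" "s \<le> t" and \<omega>: "\<omega> \<in> space M"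
    and fin: "emeasure (N \<omega>) ({s<..t} \<times> large_jumps e) < \<infinity>"
  shows "integrable (N \<omega>) (\<lambda>p. indicator {s<..t} (fst p) * g (snd p))"
    and "jump_integral \<nu> N g s t \<omega> = jump_sum g s t \<omega>"
proof -
  let ?R = "\<lambda>c. {s<..t} \<times> g -` {c}"
  have sets: "?R c \<in> sets (N \<omega>)" for c using sets_N[OF \<omega>] level_set_borel by simp
  have finR: "emeasure (N \<omega>) (?R c) < \<infinity>" if "c \<in> range g - {0}" for c
  proof -
    have "g -` {c} \<subseteq> large_jumps e" using simple_jump_support that by fastforce
    then have "emeasure (N \<omega>) (?R c) \<le> emeasure (N \<omega>) ({s<..t} \<times> large_jumps e)"
      using sets_N[OF \<omega>] by (intro emeasure_mono) auto
    then show ?thesis using fin by (rule order_le_less_trans)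
  qed
  have eq: "(\<lambda>p. indicator {s<..t} (fst p) * g (snd p)) = (\<lambda>p. \<Sum>c\<in>range g - {0}. c * indicator (?R c) p)"
  proof
    fix p :: "real \<times> real"
    have "g (snd p) = (\<Sum>c\<in>range g - {0}. c * indicator (g -` {c}) (snd p))"
      using simple_jump_finite by (rule sum_over_values) simp
    then have "indicator {s<..t} (fst p) * g (snd p)
        = indicator {s<..t} (fst p) * (\<Sum>c\<in>range g - {0}. c * indicator (g -` {c}) (snd p))"
      by (rule arg_cong)
    also have "\<dots> = (\<Sum>c\<in>range g - {0}. c * indicator (?R c) p)"
      unfolding sum_distrib_left by (cases p) (auto intro!: sum.cong simp: indicator_times)
    finally show "indicator {s<..t} (fst p) * g (snd p) = (\<Sum>c\<in>range g - {0}. c * indicator (?R c) p)" .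
  qed
  have i: "integrable (N \<omega>) (\<lambda>p. c * indicator (?R c) p :: real)" if "c \<in> range g - {0}" for c
    using finR[OF that] sets by (intro integrable_mult_right integrable_real_indicator) auto
  show int: "integrable (N \<omega>) (\<lambda>p. indicator {s<..t} (fst p) * g (snd p))"
    unfolding eq using i by (intro Bochner_Integration.integrable_sum) auto
  have "(LINT p|N \<omega>. indicator {s<..t} (fst p) * g (snd p)) = (\<Sum>c\<in>range g - {0}. c * measure (N \<omega>) (?R c))"
    unfolding eq using i sets by (subst Bochner_Integration.integral_sum) auto
  moreover have "(t - s) * (LINT x|\<nu>. g x) = (\<Sum>c\<in>range g - {0}. c * measure \<Gamma> (?R c))"
    using integral_simple_jump(2)[of "\<lambda>x. x"] st
    by (auto simp: level_rect(2)[OF _ st] sum_distrib_left intro!: sum.cong)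
  ultimately show "jump_integral \<nu> N g s t \<omega> = jump_sum g s t \<omega>"
    unfolding jump_integral_def jump_sum_def centred_count_def
    by (simp add: measure_def right_diff_distrib sum_subtractf)
qed

end

lemma large_rect_finite:
  assumes "0 < e" "0 \<le> s" "s \<le> t"
  shows "emeasure \<Gamma> ({s<..t} \<times> large_jumps e) < \<infinity>"
    and "AE \<omega> in M. emeasure (N \<omega>) ({s<..t} \<times> large_jumps e) < \<infinity>"
proof -
  show fin: "emeasure \<Gamma> ({s<..t} \<times> large_jumps e) < \<infinity>"
    using emeasure_\<Gamma>_rect[OF assms(2,3), of "large_jumps e"] emeasure_large_jumps[OF assms(1)]
    by (simp add: ennreal_mult_less_top)
  show "AE \<omega> in M. emeasure (N \<omega>) ({s<..t} \<times> large_jumps e) < \<infinity>"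
    by (rule centred_count_moments(5)[OF _ fin]) simp
qed

text \<open>The level sets of a difference are not those of its terms, so linearity is invisible in
  the defining sum; it is inherited from the integral, off the null set where the count of large
  jumps is infinite.\<close>

lemma jump_sum_diff_AE:
  assumes e: "0 < e" and g: "simple_jump_function e g" and h: "simple_jump_function e h"
    and st: "0 \<le> s" "s \<le> t"
  shows "AE \<omega> in M. jump_sum (\<lambda>x. g x - h x) s t \<omega> = jump_sum g s t \<omega> - jump_sum h s t \<omega>"
  using large_rect_finite(2)[OF e st] AE_space
proof eventually_elim
  case (elim \<omega>)
  note E = jump_sum_eq_integral[OF e _ st elim(2,1)]
  have i: "integrable \<nu> g" "integrable \<nu> h"
    using integral_simple_jump(1)[OF e g, of "\<lambda>x. x"] integral_simple_jump(1)[OF e h, of "\<lambda>x. x"] by auto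
  show ?case
    unfolding E(2)[OF simple_jump_function_diff[OF g h], symmetric] E(2)[OF g, symmetric] E(2)[OF h, symmetric]
      jump_integral_def right_diff_distrib
    using E(1)[OF g] E(1)[OF h] i by (simp add: algebra_simps)
qed

lemma jump_sum_increment_AE:
  assumes e: "0 < e" and g: "simple_jump_function e g" and st: "0 \<le> s" "s \<le> t"
  shows "AE \<omega> in M. jump_sum g 0 t \<omega> - jump_sum g 0 s \<omega> = jump_sum g s t \<omega>"
  using large_rect_finite(2)[OF e order_refl order_trans[OF st]] large_rect_finite(2)[OF e order_refl st(1)]
    large_rect_finite(2)[OF e st] AE_space
proof eventually_elim
  case (elim \<omega>)
  note E1 = jump_sum_eq_integral[OF e g order_refl order_trans[OF st] elim(4,1)]
  note E2 = jump_sum_eq_integral[OF e g order_refl st(1) elim(4,2)]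
  note E3 = jump_sum_eq_integral[OF e g st elim(4,3)]
  have "indicator {0<..t} x = (indicator {0<..s} x + indicator {s<..t} x :: real)" for x
    using st by (auto simp: indicator_def)
  then have "(LINT p|N \<omega>. indicator {0<..t} (fst p) * g (snd p))
    = (LINT p|N \<omega>. indicator {0<..s} (fst p) * g (snd p)) + (LINT p|N \<omega>. indicator {s<..t} (fst p) * g (snd p))"
    using E2(1) E3(1) by (simp add: distrib_right)
  then show ?case
    unfolding E1(2)[symmetric] E2(2)[symmetric] E3(2)[symmetric] jump_integral_def
    by (simp add: algebra_simps)
qed

text \<open>Distinct levels give disjoint rectangles, hence independent centred counts, and a
  Poisson variable has variance equal to its mean.\<close>

lemma jump_sum_isometry:
  assumes e: "0 < e" and g: "simple_jump_function e g" and st: "0 \<le> s" "s \<le> t"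
  shows "(\<integral>\<^sup>+ \<omega>. ennreal ((jump_sum g s t \<omega>)\<^sup>2) \<partial>M) = ennreal ((t - s) * (LINT x|\<nu>. (g x)\<^sup>2))"
proof -
  let ?R = "\<lambda>c. {s<..t} \<times> g -` {c}" and ?C = "range g - {0}"
  have R: "?R c \<in> sets borel" for c using level_set_borel[OF e g] by simp
  have disj: "disjoint_family_on ?R ?C" by (auto simp: disjoint_family_on_def)
  have fin: "finite ?C" using simple_jump_finite[OF e g] by simp
  note m = centred_count_moments[OF R level_rect(1)[OF e g _ st]]
  note lin = indep_linear_form[OF fin centred_counts_indep[OF fin disj R],
      of "\<lambda>c. measure \<Gamma> (?R c)" "\<lambda>c. c"]
  have si: "square_integrable M (jump_sum g s t)"
    and ex: "expectation (\<lambda>\<omega>. (jump_sum g s t \<omega>)\<^sup>2) = (\<Sum>c\<in>?C. c\<^sup>2 * measure \<Gamma> (?R c))"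
    using lin m(2,3) centred_count_square_integrable[OF R level_rect(1)[OF e g _ st]]
    unfolding jump_sum_def[abs_def] by blast+
  have "(\<Sum>c\<in>?C. c\<^sup>2 * measure \<Gamma> (?R c)) = (t - s) * (LINT x|\<nu>. (g x)\<^sup>2)"
    using integral_simple_jump(2)[OF e g, of "\<lambda>x. x\<^sup>2"] st
    by (auto simp: level_rect(2)[OF e g _ st] sum_distrib_left intro!: sum.cong)
  then show ?thesis
    using nn_integral_eq_integral[OF square_integrableD(2)[OF si]] ex by simp
qed

text \<open>On jumps larger than \<open>e\<close> the modulus is at most the square divided by
  \<open>e\<close>, and the square has integral 1 per unit of time.\<close>

lemma nn_integral_large_jumps_finite:
  assumes e: "0 < e" and t: "0 \<le> t"
  shows "(\<integral>\<^sup>+ p. ennreal \<bar>snd p\<bar> * indicator ({0<..t} \<times> large_jumps e) p \<partial>\<Gamma>) < \<infinity>"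
proof -
  have "(\<integral>\<^sup>+ p. ennreal \<bar>snd p\<bar> * indicator ({0<..t} \<times> large_jumps e) p \<partial>\<Gamma>)
      \<le> (\<integral>\<^sup>+ p. ennreal (1 / e) * ennreal ((snd p)\<^sup>2) * indicator {0<..t} (fst p) \<partial>\<Gamma>)"
  proof (rule nn_integral_mono)
    fix p :: "real \<times> real"
    show "ennreal \<bar>snd p\<bar> * indicator ({0<..t} \<times> large_jumps e) p
        \<le> ennreal (1 / e) * ennreal ((snd p)\<^sup>2) * indicator {0<..t} (fst p)"
    proof (cases "snd p \<in> large_jumps e")
      case True
      then have "e * \<bar>snd p\<bar> \<le> \<bar>snd p\<bar> * \<bar>snd p\<bar>"
        by (intro mult_right_mono) (auto simp: large_jumps_def)
      then have "\<bar>snd p\<bar> \<le> 1 / e * (snd p)\<^sup>2"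
        using e by (simp add: field_simps power2_eq_square)
      then have "ennreal \<bar>snd p\<bar> \<le> ennreal (1 / e) * ennreal ((snd p)\<^sup>2)"
        using e by (simp add: ennreal_mult[symmetric] ennreal_leI)
      then show ?thesis
        by (cases p) (auto simp: indicator_times split: split_indicator)
    qed (cases p, simp add: indicator_times)
  qed
  also have "\<dots> = (\<integral>\<^sup>+ s. (\<integral>\<^sup>+ x. ennreal (1 / e) * ennreal (x\<^sup>2) * indicator {0<..t} s \<partial>\<nu>)
      \<partial>density lborel (indicator {0..}))"
    unfolding jump_intensity_def by (subst \<nu>.nn_integral_fst[symmetric]) auto
  also have "\<dots> = (\<integral>\<^sup>+ s. ennreal (1 / e) * indicator {0<..t} s \<partial>density lborel (indicator {0..}))"
  proof (intro nn_integral_cong)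
    fix s :: real
    have "(\<integral>\<^sup>+ x. ennreal (1 / e) * ennreal (x\<^sup>2) * indicator {0<..t} s \<partial>\<nu>)
        = (\<integral>\<^sup>+ x. ennreal (1 / e) * ennreal (x\<^sup>2) \<partial>\<nu>) * indicator {0<..t} s"
      by (intro nn_integral_multc) measurable
    also have "(\<integral>\<^sup>+ x. ennreal (1 / e) * ennreal (x\<^sup>2) \<partial>\<nu>) = ennreal (1 / e)"
      by (subst nn_integral_cmult) (auto simp: nn_square_\<nu>)
    finally show "(\<integral>\<^sup>+ x. ennreal (1 / e) * ennreal (x\<^sup>2) * indicator {0<..t} s \<partial>\<nu>)
        = ennreal (1 / e) * indicator {0<..t} s" .
  qed
  also have "\<dots> = ennreal (1 / e) * ennreal t"
  proof -
    have "(\<integral>\<^sup>+ s. ennreal (1 / e) * indicator {0<..t} s \<partial>density lborel (indicator {0..}))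
       = (\<integral>\<^sup>+ s. ennreal (1 / e) * indicator {0<..t} s \<partial>lborel)"
      by (subst nn_integral_density) (auto intro!: nn_integral_cong split: split_indicator)
    then show ?thesis using t by (simp add: nn_integral_cmult_indicator)
  qed
  finally show ?thesis
    by (simp add: ennreal_mult_less_top order_le_less_trans)
qed

text \<open>At a fixed cut-off, simple functions approximate the truncated identity. The compensated
  sum of large jumps is an integral against a random measure and comes without a measurability
  statement in \<open>\<omega>\<close>; \<open>U\<close> is a measurable version of it, equal almost
  everywhere, against which the mean square error is measured.\<close>

lemma large_jumps_approximation:
  assumes e: "0 < e"
  obtains s where "\<And>l. simple_jump_function e (s l)" "\<And>l x. \<bar>s l x\<bar> \<le> 2 * \<bar>x\<bar>"
    "(\<lambda>l. LINT x|\<nu>. (indicator (large_jumps e) x * x - s l x)\<^sup>2) \<longlonglongrightarrow> 0"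
    "(\<lambda>l. LINT x|\<nu>. (s l x)\<^sup>2) \<longlonglongrightarrow> (LINT x|\<nu>. indicator (large_jumps e) x * x\<^sup>2)"
    "\<And>t. 0 \<le> t \<Longrightarrow> \<exists>U. U \<in> borel_measurable M \<and>
        (AE \<omega> in M. compensated_large_jumps \<nu> N e t \<omega> = U \<omega>) \<and>
        (\<forall>l. (\<integral>\<^sup>+ \<omega>. ennreal ((U \<omega> - jump_sum (s l) 0 t \<omega>)\<^sup>2) \<partial>M)
           \<le> ennreal (t * (LINT x|\<nu>. (indicator (large_jumps e) x * x - s l x)\<^sup>2)))"
proof -
  define f where "f x = indicator (large_jumps e) x * x" for x :: real
  have [measurable]: "f \<in> borel_measurable borel" unfolding f_def by measurable
  have "\<exists>F. (\<forall>i. simple_function borel (F i)) \<and> (\<forall>x\<in>space borel. (\<lambda>i. F i x) \<longlonglongrightarrow> f x) \<and>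
    (\<forall>i. \<forall>x\<in>space borel. dist (F i x) 0 \<le> 2 * dist (f x) 0)"
    by (rule borel_measurable_implies_sequence_metric) measurable
  then obtain s where s: "\<And>l. simple_function borel (s l)" "\<And>x. (\<lambda>l. s l x) \<longlonglongrightarrow> f x"
      "\<And>l x. \<bar>s l x\<bar> \<le> 2 * \<bar>f x\<bar>"
    by auto
  have [measurable]: "s l \<in> borel_measurable borel" for l
    using s(1) by (rule borel_measurable_simple_function)
  have fx: "\<bar>f x\<bar> \<le> \<bar>x\<bar>" for x by (auto simp: f_def split: split_indicator)
  have sx: "\<bar>s l x\<bar> \<le> 2 * \<bar>x\<bar>" for l x using s(3)[of l x] fx[of x] by linarith
  have sj: "simple_jump_function e (s l)" for l
  proof -
    have "s l x = 0" if "x \<notin> large_jumps e" for x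
      using s(3)[of l x] that by (simp add: f_def)
    then show ?thesis
      using simple_functionD(1)[OF s(1)[of l]] by (simp add: simple_jump_function_def)
  qed
  \<comment> \<open>From the bounds \<open>2 * \<bar>x\<bar>\<close> on the approximants and
    \<open>\<bar>x\<bar>\<close> on \<open>f\<close>: the constants are the squares of 1 + 2, 2 + 2
    and 2.\<close>
  have sq: "(f x - s l x)\<^sup>2 \<le> 9 * x\<^sup>2" "(s k x - s l x)\<^sup>2 \<le> 16 * x\<^sup>2" "(s l x)\<^sup>2 \<le> 4 * x\<^sup>2" for k l x
  proof -
    have "\<bar>f x - s l x\<bar> \<le> \<bar>3 * x\<bar>" "\<bar>s k x - s l x\<bar> \<le> \<bar>4 * x\<bar>" "\<bar>s l x\<bar> \<le> \<bar>2 * x\<bar>"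
      using sx[of l x] sx[of k x] fx[of x] by linarith+
    then show "(f x - s l x)\<^sup>2 \<le> 9 * x\<^sup>2" "(s k x - s l x)\<^sup>2 \<le> 16 * x\<^sup>2" "(s l x)\<^sup>2 \<le> 4 * x\<^sup>2"
      by (simp_all add: abs_le_square_iff power_mult_distrib)
  qed
  have i: "integrable \<nu> (\<lambda>x. a * x\<^sup>2)" for a using integrable_square_\<nu>(1) by simp
  have c1: "(\<lambda>l. LINT x|\<nu>. (f x - s l x)\<^sup>2) \<longlonglongrightarrow> (LINT x|\<nu>. 0)"
    using sq(1) i[of 9]
    by (intro integral_dominated_convergence[where w="\<lambda>x. 9 * x\<^sup>2"])
       (auto intro!: tendsto_eq_intros s(2) AE_I2)
  have c2: "(\<lambda>l. LINT x|\<nu>. (s l x)\<^sup>2) \<longlonglongrightarrow> (LINT x|\<nu>. (f x)\<^sup>2)"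
    using sq(3) i[of 4]
    by (intro integral_dominated_convergence[where w="\<lambda>x. 4 * x\<^sup>2"])
       (auto intro!: tendsto_intros s(2) AE_I2)
  have c3: "(\<lambda>k. LINT x|\<nu>. (s k x - s l x)\<^sup>2) \<longlonglongrightarrow> (LINT x|\<nu>. (f x - s l x)\<^sup>2)" for l
    using sq(2) i[of 16]
    by (intro integral_dominated_convergence[where w="\<lambda>x. 16 * x\<^sup>2"])
       (auto intro!: tendsto_intros s(2) AE_I2)
  have main: "\<exists>U. U \<in> borel_measurable M \<and>
        (AE \<omega> in M. compensated_large_jumps \<nu> N e t \<omega> = U \<omega>) \<and>
        (\<forall>l. (\<integral>\<^sup>+ \<omega>. ennreal ((U \<omega> - jump_sum (s l) 0 t \<omega>)\<^sup>2) \<partial>M)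
           \<le> ennreal (t * (LINT x|\<nu>. (f x - s l x)\<^sup>2)))" if t: "0 \<le> t" for t
  proof -
    let ?R = "{0<..t} \<times> large_jumps e"
    have R: "?R \<in> sets borel" by simp
    note js = jump_sum_measurable[OF e sj, measurable]
    have "(\<lambda>p. ennreal \<bar>snd p\<bar>) \<in> borel_measurable (borel :: (real \<times> real) measure)"
      by (simp add: borel_prod[symmetric])
    note C = campbell[OF R large_rect_finite(1)[OF e order_refl t] this]
    have "(\<integral>\<^sup>+ \<omega>. (\<integral>\<^sup>+ p. ennreal \<bar>snd p\<bar> * indicator ?R p \<partial>N \<omega>) \<partial>M) \<noteq> \<infinity>"
      using C nn_integral_large_jumps_finite[OF e t] by simp
    \<comment> \<open>A finite mean makes the sum of the absolute large jumps finite on almost every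
      path; this is the majorant for dominated convergence under \<open>N \<omega>\<close>.\<close>
    then have "AE \<omega> in M. (\<integral>\<^sup>+ p. ennreal \<bar>snd p\<bar> * indicator ?R p \<partial>N \<omega>) \<noteq> \<infinity>"
      using C by (intro nn_integral_PInf_AE) auto
    then have conv: "AE \<omega> in M. (\<lambda>l. jump_sum (s l) 0 t \<omega>) \<longlonglongrightarrow> compensated_large_jumps \<nu> N e t \<omega>"
      using large_rect_finite(2)[OF e order_refl t] AE_space
    proof eventually_elim
      case (elim \<omega>)
      have mc: "borel_measurable (N \<omega>) = (borel_measurable borel :: (real \<times> real \<Rightarrow> real) set)"
        by (rule measurable_cong_sets[OF sets_N[OF elim(3)] refl])
      have mcb: "(borel_measurable borel :: (real \<times> real \<Rightarrow> real) set) = borel_measurable (borel \<Otimes>\<^sub>M borel)"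
        by (simp add: borel_prod)
      have w: "integrable (N \<omega>) (\<lambda>p. \<bar>snd p\<bar> * indicator ?R p)"
      proof (rule integrableI_nonneg)
        show "(\<lambda>p. \<bar>snd p\<bar> * indicator ?R p) \<in> borel_measurable (N \<omega>)"
          unfolding mc mcb by measurable
        show "(\<integral>\<^sup>+ p. ennreal (\<bar>snd p\<bar> * indicator ?R p) \<partial>N \<omega>) < \<infinity>"
          using elim(1) by (simp add: ennreal_mult ennreal_indicator less_top)
      qed simp
      have "(\<lambda>l. LINT p|N \<omega>. indicator {0<..t} (fst p) * s l (snd p))
         \<longlonglongrightarrow> (LINT p|N \<omega>. indicator {0<..t} (fst p) * f (snd p))"
      proof (rule integral_dominated_convergence[where w="\<lambda>p. 2 * (\<bar>snd p\<bar> * indicator ?R p)"])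
        show "integrable (N \<omega>) (\<lambda>p. 2 * (\<bar>snd p\<bar> * indicator ?R p))" using w by simp
        show "AE p in N \<omega>. (\<lambda>l. indicator {0<..t} (fst p) * s l (snd p)) \<longlonglongrightarrow> indicator {0<..t} (fst p) * f (snd p)"
          by (intro AE_I2 tendsto_intros s(2))
        show "AE p in N \<omega>. norm (indicator {0<..t} (fst p) * s l (snd p)) \<le> 2 * (\<bar>snd p\<bar> * indicator ?R p)" for l
        proof (rule AE_I2)
          fix p
          show "norm (indicator {0<..t} (fst p) * s l (snd p)) \<le> 2 * (\<bar>snd p\<bar> * indicator ?R p)"
            using s(3)[of l "snd p"] by (cases p) (auto simp: f_def split: split_indicator)
        qed
      qed (unfold mc mcb, measurable)
      moreover have "(\<lambda>l. LINT x|\<nu>. s l x) \<longlonglongrightarrow> (LINT x|\<nu>. f x)"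
      proof (rule integral_dominated_convergence[where w="\<lambda>x. 2 / e * x\<^sup>2"])
        show "integrable \<nu> (\<lambda>x. 2 / e * x\<^sup>2)" by (rule i)
        show "AE x in \<nu>. norm (s l x) \<le> 2 / e * x\<^sup>2" for l
        proof (rule AE_I2)
          fix x
          have "\<bar>f x\<bar> \<le> x\<^sup>2 / e"
          proof (cases "x \<in> large_jumps e")
            case True
            then have "e * \<bar>x\<bar> \<le> \<bar>x\<bar> * \<bar>x\<bar>"
              by (intro mult_right_mono) (auto simp: large_jumps_def)
            then show ?thesis using e True by (simp add: f_def field_simps power2_eq_square)
          qed (use e in \<open>simp add: f_def\<close>)
          then show "norm (s l x) \<le> 2 / e * x\<^sup>2" using s(3)[of l x] by simp
        qed
      qed (auto intro: s(2))
      ultimately have "(\<lambda>l. jump_integral \<nu> N (s l) 0 t \<omega>) \<longlonglongrightarrow>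
          (LINT p|N \<omega>. indicator {0<..t} (fst p) * f (snd p)) - (t - 0) * (LINT x|\<nu>. f x)"
        unfolding jump_integral_def by (intro tendsto_intros)
      moreover have "compensated_large_jumps \<nu> N e t \<omega> =
          (LINT p|N \<omega>. indicator {0<..t} (fst p) * f (snd p)) - (t - 0) * (LINT x|\<nu>. f x)"
      proof -
        have 1: "(\<lambda>p. indicator ({0<..t} \<times> {x. e < \<bar>x\<bar>}) p *\<^sub>R snd p)
            = (\<lambda>p :: real \<times> real. indicator {0<..t} (fst p) * f (snd p))"
          by (auto simp: f_def indicator_times large_jumps_def fun_eq_iff)
        have 2: "(\<lambda>x. indicator {x. e < \<bar>x\<bar>} x *\<^sub>R x) = f"
          by (simp add: f_def large_jumps_def fun_eq_iff)
        show ?thesis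
          unfolding compensated_large_jumps_def set_lebesgue_integral_def 1 2 by simp
      qed
      ultimately show ?case
        using jump_sum_eq_integral(2)[OF e sj order_refl t elim(3,2)] by simp
    qed
    \<comment> \<open>The pointwise \<open>lim\<close> of measurable functions is measurable whether
      or not it converges; on almost every path it is the compensated sum.\<close>
    define U where "U \<omega> = lim (\<lambda>l. jump_sum (s l) 0 t \<omega>)" for \<omega>
    have [measurable]: "U \<in> borel_measurable M"
      unfolding U_def by (intro borel_measurable_lim_metric js)
    have UA: "AE \<omega> in M. compensated_large_jumps \<nu> N e t \<omega> = U \<omega>"
      using conv by eventually_elim (simp add: U_def limI)
    \<comment> \<open>Fatou in the second index \<open>k\<close> at fixed \<open>l\<close>: the
      isometry is applied to the simple function \<open>s k - s l\<close>, and \<open>k\<close> is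
      sent to infinity.\<close>
    have "(\<integral>\<^sup>+ \<omega>. ennreal ((U \<omega> - jump_sum (s l) 0 t \<omega>)\<^sup>2) \<partial>M)
           \<le> ennreal (t * (LINT x|\<nu>. (f x - s l x)\<^sup>2))" for l
    proof (rule nn_integral_le_limit)
      show "AE \<omega> in M. (\<lambda>k. (jump_sum (s k) 0 t \<omega> - jump_sum (s l) 0 t \<omega>)\<^sup>2) \<longlonglongrightarrow> (U \<omega> - jump_sum (s l) 0 t \<omega>)\<^sup>2"
        using conv UA by eventually_elim (auto intro!: tendsto_intros)
      show "(\<integral>\<^sup>+ \<omega>. ennreal ((jump_sum (s k) 0 t \<omega> - jump_sum (s l) 0 t \<omega>)\<^sup>2) \<partial>M)
         \<le> ennreal (t * (LINT x|\<nu>. (s k x - s l x)\<^sup>2))" for k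
      proof -
        have "(\<integral>\<^sup>+ \<omega>. ennreal ((jump_sum (s k) 0 t \<omega> - jump_sum (s l) 0 t \<omega>)\<^sup>2) \<partial>M)
          = (\<integral>\<^sup>+ \<omega>. ennreal ((jump_sum (\<lambda>x. s k x - s l x) 0 t \<omega>)\<^sup>2) \<partial>M)"
        proof (rule nn_integral_cong_AE)
          show "AE \<omega> in M. ennreal ((jump_sum (s k) 0 t \<omega> - jump_sum (s l) 0 t \<omega>)\<^sup>2)
            = ennreal ((jump_sum (\<lambda>x. s k x - s l x) 0 t \<omega>)\<^sup>2)"
            using jump_sum_diff_AE[OF e sj[of k] sj[of l] order_refl t] by eventually_elim simp
        qed
        then show ?thesis
          using jump_sum_isometry[OF e simple_jump_function_diff[OF sj[of k] sj[of l]] order_refl t] by simp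
      qed
      show "(\<lambda>k. t * (LINT x|\<nu>. (s k x - s l x)\<^sup>2)) \<longlonglongrightarrow> t * (LINT x|\<nu>. (f x - s l x)\<^sup>2)"
        by (intro tendsto_intros c3)
      show "(\<lambda>\<omega>. (jump_sum (s k) 0 t \<omega> - jump_sum (s l) 0 t \<omega>)\<^sup>2) \<in> borel_measurable M" for k
        by measurable
    qed
    with UA show ?thesis by (intro exI[of _ U]) auto
  qed
  show thesis
  proof (rule that)
    show "(\<lambda>l. LINT x|\<nu>. (indicator (large_jumps e) x * x - s l x)\<^sup>2) \<longlonglongrightarrow> 0"
      using c1 by (simp add: f_def)
    have "(f x)\<^sup>2 = indicator (large_jumps e) x * x\<^sup>2" for x
      by (auto simp: f_def split: split_indicator)
    then show "(\<lambda>l. LINT x|\<nu>. (s l x)\<^sup>2) \<longlonglongrightarrow> (LINT x|\<nu>. indicator (large_jumps e) x * x\<^sup>2)"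
      using c2 by simp
  qed (use sj sx main in \<open>auto simp: f_def\<close>)
qed

end

section \<open>The noise as a linear form in jointly independent elementary variables\<close>

section \<open>Elementary approximations of the noise\<close>

locale levy_noise = jump_noise M \<nu> N
  for M :: "'a measure" and \<nu> N +
  fixes w z :: "real \<Rightarrow> 'a \<Rightarrow> real"
  assumes bm: "brownian_motion M w"
    and sources: "indep_noise_sources M (jump_intensity \<nu>) w N"
    and cjp: "compensated_jump_process M \<nu> N z"
begin

lemma w_measurable [measurable]: "0 \<le> t \<Longrightarrow> w t \<in> borel_measurable M"
  using bm by (simp add: brownian_motion_def)

lemma z_measurable [measurable]: "0 \<le> t \<Longrightarrow> z t \<in> borel_measurable M"
  using cjp by (simp add: compensated_jump_process_def)

text \<open>Two limits in succession: the cut-off tends to 0, which is how \<open>z\<close> is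
  defined, and then a simple function tends to the truncated identity. The bound on \<open>g\<close>
  by \<open>2 * \<bar>x\<bar>\<close> is kept for the fourth moment, and the second moment close to
  1 for the variance.\<close>

lemma jump_process_approximation:
  assumes T: "finite T" "\<And>t. t \<in> T \<Longrightarrow> 0 \<le> t" and \<epsilon>: "0 < \<epsilon>"
  obtains e g where "0 < e" "simple_jump_function e g" "\<And>x. \<bar>g x\<bar> \<le> 2 * \<bar>x\<bar>"
    "\<bar>(LINT x|\<nu>. (g x)\<^sup>2) - 1\<bar> \<le> \<epsilon>"
    "\<And>t. t \<in> T \<Longrightarrow> (\<integral>\<^sup>+ \<omega>. ennreal ((z t \<omega> - jump_sum g 0 t \<omega>)\<^sup>2) \<partial>M) \<le> ennreal \<epsilon>"
proof -
  define E where "E e t = (\<integral>\<^sup>+ \<omega>. ennreal ((compensated_large_jumps \<nu> N e t \<omega> - z t \<omega>)\<^sup>2) \<partial>M)" for e t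
  have lim: "((\<lambda>e. E e t) \<longlongrightarrow> 0) (at_right 0)" if "t \<in> T" for t
    using cjp T(2)[OF that] by (simp add: compensated_jump_process_def E_def)
  define en where "en n = 1 / real (Suc n)" for n
  have en0: "en n > 0" for n by (simp add: en_def)
  have "en \<longlonglongrightarrow> 0" unfolding en_def by (rule LIMSEQ_Suc[OF lim_1_over_n])
  then have en_lim: "filterlim en (at_right 0) sequentially"
    using en0 less_imp_neq[OF en0] by (auto simp: filterlim_at intro!: always_eventually)
  \<comment> \<open>The level \<open>\<epsilon> / 4\<close>, here and for the second limit, is
    chosen because the two errors are joined by (x + y)^2 \<le> 2 x^2 + 2 y^2.\<close>
  have ev1: "\<forall>\<^sub>F n in sequentially. \<forall>t\<in>T. E (en n) t < ennreal (\<epsilon> / 4)"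
  proof (rule eventually_ball_finite[OF T(1)], rule ballI)
    fix t assume "t \<in> T"
    from filterlim_compose[OF lim[OF this] en_lim] \<epsilon>
    show "\<forall>\<^sub>F n in sequentially. E (en n) t < ennreal (\<epsilon> / 4)"
      by (intro order_tendstoD(2)) auto
  qed
  have "(\<lambda>n. LINT x|\<nu>. indicator (large_jumps (en n)) x * x\<^sup>2) \<longlonglongrightarrow> (LINT x|\<nu>. x\<^sup>2)"
  proof (rule integral_dominated_convergence[where w="\<lambda>x. x\<^sup>2"])
    show "AE x in \<nu>. (\<lambda>n. indicator (large_jumps (en n)) x * x\<^sup>2) \<longlonglongrightarrow> x\<^sup>2"
    proof (rule AE_I2)
      fix x :: real
      show "(\<lambda>n. indicator (large_jumps (en n)) x * x\<^sup>2) \<longlonglongrightarrow> x\<^sup>2"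
      proof (cases "x = 0")
        case False
        then have "\<forall>\<^sub>F n in sequentially. en n < \<bar>x\<bar>"
          using \<open>en \<longlonglongrightarrow> 0\<close> by (intro order_tendstoD(2)) auto
        then have "\<forall>\<^sub>F n in sequentially. indicator (large_jumps (en n)) x * x\<^sup>2 = x\<^sup>2"
          by eventually_elim (simp add: large_jumps_def)
        then show ?thesis by (rule tendsto_eventually)
      qed simp
    qed
  qed (auto simp: integrable_square_\<nu> split: split_indicator)
  then have ev2: "\<forall>\<^sub>F n in sequentially. dist (LINT x|\<nu>. indicator (large_jumps (en n)) x * x\<^sup>2) 1 < \<epsilon> / 2"
    using \<epsilon> unfolding integrable_square_\<nu>(2) by (intro tendstoD) auto
  obtain n where n: "\<And>t. t \<in> T \<Longrightarrow> E (en n) t < ennreal (\<epsilon> / 4)"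
      "dist (LINT x|\<nu>. indicator (large_jumps (en n)) x * x\<^sup>2) 1 < \<epsilon> / 2"
    using eventually_happens[OF eventually_conj[OF ev1 ev2]] by auto
  define e where "e = en n"
  have e: "0 < e" using en0 by (simp add: e_def)
  obtain s where s: "\<And>l. simple_jump_function e (s l)" "\<And>l x. \<bar>s l x\<bar> \<le> 2 * \<bar>x\<bar>"
    "(\<lambda>l. LINT x|\<nu>. (indicator (large_jumps e) x * x - s l x)\<^sup>2) \<longlonglongrightarrow> 0"
    "(\<lambda>l. LINT x|\<nu>. (s l x)\<^sup>2) \<longlonglongrightarrow> (LINT x|\<nu>. indicator (large_jumps e) x * x\<^sup>2)"
    "\<And>t. 0 \<le> t \<Longrightarrow> \<exists>U. U \<in> borel_measurable M \<and>
        (AE \<omega> in M. compensated_large_jumps \<nu> N e t \<omega> = U \<omega>) \<and>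
        (\<forall>l. (\<integral>\<^sup>+ \<omega>. ennreal ((U \<omega> - jump_sum (s l) 0 t \<omega>)\<^sup>2) \<partial>M)
           \<le> ennreal (t * (LINT x|\<nu>. (indicator (large_jumps e) x * x - s l x)\<^sup>2)))"
    using large_jumps_approximation[OF e] by blast
  have ev3: "\<forall>\<^sub>F l in sequentially. \<forall>t\<in>T.
      t * (LINT x|\<nu>. (indicator (large_jumps e) x * x - s l x)\<^sup>2) < \<epsilon> / 4"
  proof (rule eventually_ball_finite[OF T(1)], rule ballI)
    fix t assume "t \<in> T"
    have "(\<lambda>l. t * (LINT x|\<nu>. (indicator (large_jumps e) x * x - s l x)\<^sup>2)) \<longlonglongrightarrow> t * 0"
      by (intro tendsto_intros s(3))
    then show "\<forall>\<^sub>F l in sequentially. t * (LINT x|\<nu>. (indicator (large_jumps e) x * x - s l x)\<^sup>2) < \<epsilon> / 4"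
      using \<epsilon> by (intro order_tendstoD(2)) auto
  qed
  have ev4: "\<forall>\<^sub>F l in sequentially. dist (LINT x|\<nu>. (s l x)\<^sup>2) (LINT x|\<nu>. indicator (large_jumps e) x * x\<^sup>2) < \<epsilon> / 2"
    using \<epsilon> s(4) by (intro tendstoD) auto
  obtain l where l: "\<And>t. t \<in> T \<Longrightarrow> t * (LINT x|\<nu>. (indicator (large_jumps e) x * x - s l x)\<^sup>2) < \<epsilon> / 4"
      "dist (LINT x|\<nu>. (s l x)\<^sup>2) (LINT x|\<nu>. indicator (large_jumps e) x * x\<^sup>2) < \<epsilon> / 2"
    using eventually_happens[OF eventually_conj[OF ev3 ev4]] by auto
  have "(\<integral>\<^sup>+ \<omega>. ennreal ((z t \<omega> - jump_sum (s l) 0 t \<omega>)\<^sup>2) \<partial>M) \<le> ennreal \<epsilon>" if t: "t \<in> T" for t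
  proof -
    have [measurable]: "z t \<in> borel_measurable M" using T(2)[OF t] by measurable
    note [measurable] = jump_sum_measurable[OF e s(1)]
    obtain U where U [measurable]: "U \<in> borel_measurable M"
       and UA: "AE \<omega> in M. compensated_large_jumps \<nu> N e t \<omega> = U \<omega>"
       and Ul: "(\<integral>\<^sup>+ \<omega>. ennreal ((U \<omega> - jump_sum (s l) 0 t \<omega>)\<^sup>2) \<partial>M)
           \<le> ennreal (t * (LINT x|\<nu>. (indicator (large_jumps e) x * x - s l x)\<^sup>2))"
      using s(5)[OF T(2)[OF t]] by blast
    have "(\<integral>\<^sup>+ \<omega>. ennreal ((z t \<omega> - U \<omega>)\<^sup>2) \<partial>M) = E e t"
      unfolding E_def
    proof (rule nn_integral_cong_AE)
      show "AE \<omega> in M. ennreal ((z t \<omega> - U \<omega>)\<^sup>2) = ennreal ((compensated_large_jumps \<nu> N e t \<omega> - z t \<omega>)\<^sup>2)"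
        using UA by eventually_elim (simp add: power2_commute)
    qed
    then have 1: "(\<integral>\<^sup>+ \<omega>. ennreal ((z t \<omega> - U \<omega>)\<^sup>2) \<partial>M) \<le> ennreal (\<epsilon> / 4)"
      using n(1)[OF t] by (simp add: e_def)
    have 2: "(\<integral>\<^sup>+ \<omega>. ennreal ((U \<omega> - jump_sum (s l) 0 t \<omega>)\<^sup>2) \<partial>M) \<le> ennreal (\<epsilon> / 4)"
      using Ul l(1)[OF t] by (meson ennreal_leI less_imp_le order_trans)
    have "(\<integral>\<^sup>+ \<omega>. ennreal ((z t \<omega> - jump_sum (s l) 0 t \<omega>)\<^sup>2) \<partial>M)
      = (\<integral>\<^sup>+ \<omega>. ennreal (((z t \<omega> - U \<omega>) + (U \<omega> - jump_sum (s l) 0 t \<omega>))\<^sup>2) \<partial>M)" by simp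
    also have "\<dots> \<le> 2 * (\<integral>\<^sup>+ \<omega>. ennreal ((z t \<omega> - U \<omega>)\<^sup>2) \<partial>M)
        + 2 * (\<integral>\<^sup>+ \<omega>. ennreal ((U \<omega> - jump_sum (s l) 0 t \<omega>)\<^sup>2) \<partial>M)"
      by (rule nn_integral_square_sum_le) measurable
    also have "\<dots> \<le> 2 * ennreal (\<epsilon> / 4) + 2 * ennreal (\<epsilon> / 4)"
      by (intro add_mono mult_left_mono 1 2) auto
    also have "\<dots> = ennreal \<epsilon>"
    proof -
      have "2 * ennreal (\<epsilon> / 4) = ennreal (2 * (\<epsilon> / 4))"
        using \<epsilon> by (subst ennreal_mult) auto
      then show ?thesis using \<epsilon> by (simp flip: ennreal_plus)
    qed
    finally show ?thesis .
  qed
  moreover have "\<bar>(LINT x|\<nu>. (s l x)\<^sup>2) - 1\<bar> \<le> \<epsilon>"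
    using n(2) l(2) unfolding e_def[symmetric] dist_real_def by linarith
  ultimately show thesis
    using that[OF e s(1)[of l] s(2)] by blast
qed

context
  fixes v :: "nat \<Rightarrow> real" and K :: nat and e :: real and g :: "real \<Rightarrow> real" and \<sigma>1 \<sigma>2 :: real
  assumes v: "0 \<le> v 0" "\<And>i. i < K \<Longrightarrow> v i < v (Suc i)"
    and e: "0 < e" and g: "simple_jump_function e g"
begin

text \<open>A left tag stands for the Brownian increment over one cell of the partition, a right tag
  \<open>(l, c)\<close> for the centred number of jumps in cell \<open>l\<close> on which
  \<open>g\<close> takes the value \<open>c\<close>. The Gaussian and the Poisson part thus form one
  family.\<close>

definition elem_index :: "(nat + nat \<times> real) set" where
  "elem_index = {..<K} <+> ({..<K} \<times> (range g - {0}))"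

definition elem_var :: "nat + nat \<times> real \<Rightarrow> 'a \<Rightarrow> real" where
  "elem_var = case_sum (\<lambda>l \<omega>. w (v (Suc l)) \<omega> - w (v l) \<omega>)
     (\<lambda>(l, c). centred_count \<Gamma> N ({v l<..v (Suc l)} \<times> g -` {c}))"

definition elem_second :: "nat + nat \<times> real \<Rightarrow> real" where
  "elem_second = case_sum (\<lambda>l. v (Suc l) - v l) (\<lambda>(l, c). (v (Suc l) - v l) * measure \<nu> (g -` {c}))"

text \<open>Fourth cumulants: 0 for a Gaussian variable, the mean for a Poisson variable.\<close>

definition elem_excess :: "nat + nat \<times> real \<Rightarrow> real" where
  "elem_excess = case_sum (\<lambda>l. 0) (\<lambda>(l, c). (v (Suc l) - v l) * measure \<nu> (g -` {c}))"

definition elem_coeff :: "(nat \<Rightarrow> real) \<Rightarrow> nat + nat \<times> real \<Rightarrow> real" where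
  "elem_coeff a = case_sum (\<lambda>l. \<sigma>1 * a l) (\<lambda>(l, c). \<sigma>2 * a l * c)"

definition elem_sum :: "(nat \<Rightarrow> real) \<Rightarrow> 'a \<Rightarrow> real" where
  "elem_sum a \<omega> = (\<Sum>l<K. a l * (\<sigma>1 * (w (v (Suc l)) \<omega> - w (v l) \<omega>) + \<sigma>2 * jump_sum g (v l) (v (Suc l)) \<omega>))"

definition elem_sigma :: real where
  "elem_sigma = \<sigma>1\<^sup>2 + \<sigma>2\<^sup>2 * (LINT x|\<nu>. (g x)\<^sup>2)"

lemma v_nonneg: "i \<le> K \<Longrightarrow> 0 \<le> v i"
proof (induction i)
  case (Suc i)
  then show ?case using v(2)[of i] by simp
qed (rule v(1))

lemma v_mono: "i \<le> j \<Longrightarrow> j \<le> K \<Longrightarrow> v i \<le> v j"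
proof (induction j)
  case (Suc j)
  then show ?case using v(2)[of j] by (cases "i = Suc j") auto
qed simp

lemma elem_index_finite: "finite elem_index"
  using simple_jump_finite[OF e g] by (simp add: elem_index_def)

text \<open>Increments over disjoint cells are independent, and so are counts on disjoint
  rectangles. The two sources are independent as generated \<sigma>-algebras, so it remains to see
  that each variable is measurable with respect to its own source.\<close>

lemma elem_indep: "indep_vars (\<lambda>_. borel) elem_var elem_index"
proof -
  have W: "indep_vars (\<lambda>_. borel) (\<lambda>l \<omega>. w (v (Suc l)) \<omega> - w (v l) \<omega>) {..<K}"
    using bm v unfolding brownian_motion_def by blast
  let ?R = "\<lambda>(l, c). {v l<..v (Suc l)} \<times> g -` {c}" and ?J = "{..<K} \<times> (range g - {0})"
  have R: "?R j \<in> sets borel" for j using level_set_borel[OF e g] by (cases j) simp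
  have disj: "disjoint_family_on ?R ?J"
    unfolding disjoint_family_on_def
  proof (intro ballI impI)
    fix p q assume pq: "p \<in> ?J" "q \<in> ?J" "p \<noteq> q"
    obtain l c l' c' where [simp]: "p = (l, c)" "q = (l', c')" by (cases p, cases q)
    show "?R p \<inter> ?R q = {}"
    proof (cases "c = c'")
      case True
      then have "l \<noteq> l'" using pq by simp
      then consider "Suc l \<le> l'" | "Suc l' \<le> l" by linarith
      then show ?thesis
      proof cases
        case 1
        then have "v (Suc l) \<le> v l'" using pq by (intro v_mono) auto
        then show ?thesis by auto
      next
        case 2
        then have "v (Suc l') \<le> v l" using pq by (intro v_mono) auto
        then show ?thesis by auto
      qed
    qed auto
  qed
  have C: "indep_vars (\<lambda>_. borel) (\<lambda>j. centred_count \<Gamma> N (?R j)) ?J"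
    using simple_jump_finite[OF e g] R by (intro centred_counts_indep disj) auto
  let ?W = "vimage_algebra (space M) (\<lambda>\<omega>. \<lambda>t\<in>{0..}. w t \<omega>) (PiM {0..} (\<lambda>_. borel :: real measure))"
  let ?N = "vimage_algebra (space M) (\<lambda>\<omega>. \<lambda>A\<in>sets \<Gamma>. emeasure (N \<omega>) A) (PiM (sets \<Gamma>) (\<lambda>_. borel :: ennreal measure))"
  have sp: "space ?W = space M" "space ?N = space M" by simp_all
  have "indep_vars (\<lambda>_. borel) (case_sum (\<lambda>l \<omega>. w (v (Suc l)) \<omega> - w (v l) \<omega>) (\<lambda>j. centred_count \<Gamma> N (?R j))) ({..<K} <+> ?J)"
  proof (rule indep_vars_Plus[OF W C])
    show "indep_set (sets ?W) (sets ?N)"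
      using sources by (simp add: indep_noise_sources_def)
    show "sigma_algebra (space M) (sets ?W)" "sigma_algebra (space M) (sets ?N)"
      using sets.sigma_algebra_axioms[of ?W] sets.sigma_algebra_axioms[of ?N] sp by simp_all
    have mw: "w t \<in> borel_measurable ?W" if "0 \<le> t" for t
    proof -
      have "(\<lambda>\<omega>. (\<lambda>t\<in>{0..}. w t \<omega>) t) \<in> borel_measurable ?W"
        using that
        by (intro measurable_compose[OF measurable_vimage_algebra1 measurable_component_singleton])
           (simp_all only: space_PiM Pi_iff restrict_PiE_iff space_borel UNIV_I atLeast_iff simp_thms ball_simps, auto)
      then show ?thesis using that by simp
    qed
    have mN: "(\<lambda>\<omega>. emeasure (N \<omega>) A) \<in> borel_measurable ?N" if "A \<in> sets borel" for A
    proof -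
      have "(\<lambda>\<omega>. (\<lambda>A\<in>sets \<Gamma>. emeasure (N \<omega>) A) A) \<in> borel_measurable ?N"
        using that
        by (intro measurable_compose[OF measurable_vimage_algebra1 measurable_component_singleton])
           (simp_all only: space_PiM Pi_iff restrict_PiE_iff space_borel UNIV_I sets_\<Gamma> simp_thms ball_simps, auto)
      then show ?thesis using that by simp
    qed
    show "(\<lambda>\<omega>. w (v (Suc l)) \<omega> - w (v l) \<omega>) -` A \<inter> space M \<in> sets ?W" if "l \<in> {..<K}" "A \<in> sets borel" for l A
    proof -
      have "0 \<le> v (Suc l)" "0 \<le> v l" using that v_nonneg by auto
      from measurable_sets[OF borel_measurable_diff[OF this[THEN mw]] that(2)]
      show ?thesis by (simp only: sp)
    qed
    show "centred_count \<Gamma> N (?R j) -` A \<inter> space M \<in> sets ?N" if "j \<in> ?J" "A \<in> sets borel" for j A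
    proof -
      have "centred_count \<Gamma> N (?R j) \<in> borel_measurable ?N"
        unfolding centred_count_def[abs_def]
        by (intro borel_measurable_diff borel_measurable_const borel_measurable_enn2real mN R)
      from measurable_sets[OF this that(2)] show ?thesis by (simp only: sp)
    qed
  qed
  moreover have "case_sum (\<lambda>l \<omega>. w (v (Suc l)) \<omega> - w (v l) \<omega>) (\<lambda>j. centred_count \<Gamma> N (?R j)) = elem_var"
    unfolding elem_var_def by (intro arg_cong2[where f=case_sum] refl) (simp add: fun_eq_iff)
  ultimately show ?thesis by (simp only: elem_index_def)
qed

lemma elem_moments:
  assumes i: "i \<in> elem_index"
  shows "integrable M (\<lambda>\<omega>. (elem_var i \<omega>)^4)" "expectation (elem_var i) = 0"
    "expectation (\<lambda>\<omega>. (elem_var i \<omega>)\<^sup>2) = elem_second i"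
    "expectation (\<lambda>\<omega>. (elem_var i \<omega>)^4) \<le> 3 * (elem_second i)\<^sup>2 + elem_excess i"
    "square_integrable M (elem_var i)"
proof -
  have *: "integrable M (\<lambda>\<omega>. (elem_var i \<omega>)^4) \<and> expectation (elem_var i) = 0 \<and>
    expectation (\<lambda>\<omega>. (elem_var i \<omega>)\<^sup>2) = elem_second i \<and>
    expectation (\<lambda>\<omega>. (elem_var i \<omega>)^4) \<le> 3 * (elem_second i)\<^sup>2 + elem_excess i"
  proof (cases i)
    case (Inl l)
    then have l: "l < K" using i by (auto simp: elem_index_def)
    have "distributed M lborel (\<lambda>\<omega>. w (v (Suc l)) \<omega> - w (v l) \<omega>)
        (\<lambda>x. ennreal (normal_density 0 (sqrt (v (Suc l) - v l)) x))"
      using bm v(2)[OF l] v_nonneg[OF less_imp_le[OF l]] unfolding brownian_motion_def by blast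
    note m = normal_central_moments[OF _ this]
    show ?thesis
      unfolding Inl elem_var_def elem_second_def elem_excess_def sum.case
      using m v(2)[OF l] by simp
  next
    case (Inr p)
    obtain l c where p: "p = (l, c)" by (cases p)
    have l: "l < K" "c \<in> range g - {0}" using i Inr p by (auto simp: elem_index_def)
    note r = level_rect[OF e g l(2) v_nonneg[OF less_imp_le[OF l(1)]] less_imp_le[OF v(2)[OF l(1)]]]
    have "{v l<..v (Suc l)} \<times> g -` {c} \<in> sets borel"
      using level_set_borel[OF e g] by simp
    note m = centred_count_moments(1-4)[OF this r(1), unfolded r(2)]
    show ?thesis
      unfolding Inr p elem_var_def elem_second_def elem_excess_def sum.case prod.case
      using m by (simp only: simp_thms order_refl)
  qed
  then show "integrable M (\<lambda>\<omega>. (elem_var i \<omega>)^4)" "expectation (elem_var i) = 0"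
    "expectation (\<lambda>\<omega>. (elem_var i \<omega>)\<^sup>2) = elem_second i"
    "expectation (\<lambda>\<omega>. (elem_var i \<omega>)^4) \<le> 3 * (elem_second i)\<^sup>2 + elem_excess i"
    by blast+
  have rv: "random_variable borel (elem_var i)"
    using elem_indep i unfolding indep_vars_def by blast
  have "integrable M (\<lambda>\<omega>. ((elem_var i \<omega>)\<^sup>2)\<^sup>2)"
    using conjunct1[OF *] by (simp flip: power_mult)
  then have "square_integrable M (\<lambda>\<omega>. (elem_var i \<omega>)\<^sup>2)"
    unfolding square_integrable_def using borel_measurable_power[OF rv] by blast
  from square_integrable_integrable[OF this] rv
  show "square_integrable M (elem_var i)"
    unfolding square_integrable_def by blast
qed

lemma sum_elem_index:
  "(\<Sum>i\<in>elem_index. f i) = (\<Sum>l<K. f (Inl l) + (\<Sum>c\<in>range g - {0}. f (Inr (l, c))))"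
proof -
  have "(\<Sum>i\<in>elem_index. f i) = (\<Sum>l<K. f (Inl l)) + (\<Sum>p\<in>{..<K} \<times> (range g - {0}). f (Inr p))"
    unfolding elem_index_def using simple_jump_finite[OF e g] by (subst sum.Plus) auto
  also have "(\<Sum>p\<in>{..<K} \<times> (range g - {0}). f (Inr p)) = (\<Sum>l<K. \<Sum>c\<in>range g - {0}. f (Inr (l, c)))"
    unfolding sum.cartesian_product by (intro sum.cong) auto
  finally show ?thesis by (simp only: sum.distrib)
qed

lemma elem_sum_eq: "elem_sum a \<omega> = (\<Sum>i\<in>elem_index. elem_coeff a i * elem_var i \<omega>)"
  unfolding elem_sum_def sum_elem_index
proof (intro sum.cong refl)
  fix l
  have "a l * (\<sigma>2 * jump_sum g (v l) (v (Suc l)) \<omega>)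
      = (\<Sum>c\<in>range g - {0}. elem_coeff a (Inr (l, c)) * elem_var (Inr (l, c)) \<omega>)"
    unfolding jump_sum_def sum_distrib_left elem_coeff_def elem_var_def sum.case prod.case
    by (intro sum.cong refl) (simp only: mult_ac)
  moreover have "a l * (\<sigma>1 * (w (v (Suc l)) \<omega> - w (v l) \<omega>)) = elem_coeff a (Inl l) * elem_var (Inl l) \<omega>"
    unfolding elem_coeff_def elem_var_def sum.case by (simp only: mult_ac)
  ultimately show "a l * (\<sigma>1 * (w (v (Suc l)) \<omega> - w (v l) \<omega>) + \<sigma>2 * jump_sum g (v l) (v (Suc l)) \<omega>)
     = elem_coeff a (Inl l) * elem_var (Inl l) \<omega>
       + (\<Sum>c\<in>range g - {0}. elem_coeff a (Inr (l, c)) * elem_var (Inr (l, c)) \<omega>)"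
    by (simp only: distrib_left)
qed

text \<open>Gaussian terms contribute \<open>\<sigma>1\<^sup>2\<close> and jump terms
  \<open>\<sigma>2\<^sup>2\<close> times the second moment of \<open>g\<close>, both with the same
  time integral; covariances therefore depend on the two parts only through
  \<open>elem_sigma\<close>.\<close>

lemma elem_covariance:
  "(\<Sum>i\<in>elem_index. elem_coeff a i * elem_coeff b i * elem_second i)
    = elem_sigma * (\<Sum>l<K. a l * b l * (v (Suc l) - v l))"
proof -
  have G: "(LINT x|\<nu>. (g x)\<^sup>2) = (\<Sum>c\<in>range g - {0}. c\<^sup>2 * measure \<nu> (g -` {c}))"
    using integral_simple_jump(2)[OF e g, of "\<lambda>x. x\<^sup>2"] by simp
  show ?thesis
    unfolding sum_elem_index elem_sigma_def G sum_distrib_left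
    by (intro sum.cong refl)
       (simp add: elem_coeff_def elem_second_def algebra_simps power2_eq_square sum_distrib_left)
qed

lemma elem_sum_second_moment:
  "square_integrable M (elem_sum a)"
  "expectation (\<lambda>\<omega>. (elem_sum a \<omega>)\<^sup>2) = elem_sigma * (\<Sum>l<K. (a l)\<^sup>2 * (v (Suc l) - v l))"
proof -
  have f: "elem_sum a = (\<lambda>\<omega>. \<Sum>i\<in>elem_index. elem_coeff a i * elem_var i \<omega>)"
    by (rule ext) (rule elem_sum_eq)
  have c: "elem_sigma * (\<Sum>l<K. (a l)\<^sup>2 * (v (Suc l) - v l)) = (\<Sum>i\<in>elem_index. (elem_coeff a i)\<^sup>2 * elem_second i)"
    unfolding power2_eq_square by (rule elem_covariance[symmetric])
  show "square_integrable M (elem_sum a)"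
    "expectation (\<lambda>\<omega>. (elem_sum a \<omega>)\<^sup>2) = elem_sigma * (\<Sum>l<K. (a l)\<^sup>2 * (v (Suc l) - v l))"
    using indep_linear_form[OF elem_index_finite elem_indep elem_moments(5,2,3), of "elem_coeff a"]
    unfolding f c by blast+
qed

text \<open>A weighted sum of squares of linear forms is the quadratic form with matrix
  \<open>A\<close>, a weighted sum of rank one matrices. Its weighted Hilbert-Schmidt norm collapses
  to the squared covariances \<open>C j k\<close>. On the diagonal only Poisson variables carry a
  fourth cumulant, which produces the term with the fourth moment of \<open>g\<close>.\<close>

lemma elem_quadratic_moment:
  fixes x :: "'j \<Rightarrow> real" and b :: "'j \<Rightarrow> nat \<Rightarrow> real"
  assumes J: "finite J"
  defines "C \<equiv> \<lambda>j k. elem_sigma * (\<Sum>l<K. b j l * b k l * (v (Suc l) - v l))"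
  shows "square_integrable M (\<lambda>\<omega>. \<Sum>j\<in>J. x j * ((elem_sum (b j) \<omega>)\<^sup>2 - C j j))"
    "expectation (\<lambda>\<omega>. (\<Sum>j\<in>J. x j * ((elem_sum (b j) \<omega>)\<^sup>2 - C j j))\<^sup>2)
      \<le> 2 * (\<Sum>j\<in>J. \<Sum>k\<in>J. x j * x k * (C j k)\<^sup>2)
        + \<sigma>2^4 * (LINT x|\<nu>. (g x)^4) * (\<Sum>l<K. (\<Sum>j\<in>J. x j * (b j l)\<^sup>2)\<^sup>2 * (v (Suc l) - v l))"
proof -
  define A where "A i k = (\<Sum>j\<in>J. x j * elem_coeff (b j) i * elem_coeff (b j) k)" for i k
  have sym: "A i k = A k i" for i k by (simp add: A_def mult_ac)
  note q = indep_quadratic_form[OF elem_index_finite elem_indep elem_moments(1-4), of A, OF _ _ _ _ sym]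
  have C: "(\<Sum>i\<in>elem_index. elem_coeff (b j) i * elem_coeff (b k) i * elem_second i) = C j k" for j k
    unfolding C_def by (rule elem_covariance)
  have 1: "(\<Sum>i\<in>elem_index. \<Sum>k\<in>elem_index. A i k * elem_var i \<omega> * elem_var k \<omega>) = (\<Sum>j\<in>J. x j * (elem_sum (b j) \<omega>)\<^sup>2)" for \<omega>
  proof -
    have "(\<Sum>i\<in>elem_index. \<Sum>k\<in>elem_index. A i k * elem_var i \<omega> * elem_var k \<omega>)
      = (\<Sum>i\<in>elem_index. \<Sum>k\<in>elem_index. \<Sum>j\<in>J. x j * ((elem_coeff (b j) i * elem_var i \<omega>) * (elem_coeff (b j) k * elem_var k \<omega>)))"
      unfolding A_def sum_distrib_right by (intro sum.cong refl) (simp add: mult_ac)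
    also have "\<dots> = (\<Sum>i\<in>elem_index. \<Sum>j\<in>J. \<Sum>k\<in>elem_index. x j * ((elem_coeff (b j) i * elem_var i \<omega>) * (elem_coeff (b j) k * elem_var k \<omega>)))"
      by (intro sum.cong refl, rule sum.swap)
    also have "\<dots> = (\<Sum>j\<in>J. \<Sum>i\<in>elem_index. \<Sum>k\<in>elem_index. x j * ((elem_coeff (b j) i * elem_var i \<omega>) * (elem_coeff (b j) k * elem_var k \<omega>)))"
      by (rule sum.swap)
    also have "\<dots> = (\<Sum>j\<in>J. x j * (elem_sum (b j) \<omega>)\<^sup>2)"
      by (simp only: elem_sum_eq power2_eq_square sum_product) (simp only: sum_distrib_left)
    finally show ?thesis .
  qed
  have 2: "(\<Sum>i\<in>elem_index. A i i * elem_second i) = (\<Sum>j\<in>J. x j * C j j)"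
  proof -
    have "(\<Sum>i\<in>elem_index. A i i * elem_second i)
        = (\<Sum>i\<in>elem_index. \<Sum>j\<in>J. x j * (elem_coeff (b j) i * elem_coeff (b j) i * elem_second i))"
      unfolding A_def sum_distrib_right by (intro sum.cong refl) (simp add: mult_ac)
    also have "\<dots> = (\<Sum>j\<in>J. \<Sum>i\<in>elem_index. x j * (elem_coeff (b j) i * elem_coeff (b j) i * elem_second i))"
      by (rule sum.swap)
    also have "\<dots> = (\<Sum>j\<in>J. x j * C j j)"
      by (simp only: C[symmetric] sum_distrib_left)
    finally show ?thesis .
  qed
  have 3: "(\<Sum>i\<in>elem_index. \<Sum>k\<in>elem_index. (A i k)\<^sup>2 * elem_second i * elem_second k)
      = (\<Sum>j\<in>J. \<Sum>k\<in>J. x j * x k * (C j k)\<^sup>2)"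
  proof -
    let ?t = "\<lambda>j k p. elem_coeff (b j) p * elem_coeff (b k) p * elem_second p"
    have "(\<Sum>i\<in>elem_index. \<Sum>k\<in>elem_index. (A i k)\<^sup>2 * elem_second i * elem_second k)
      = (\<Sum>i\<in>elem_index. \<Sum>k\<in>elem_index. \<Sum>j\<in>J. \<Sum>j'\<in>J. x j * x j' * (?t j j' i * ?t j j' k))"
      unfolding A_def power2_eq_square sum_product sum_distrib_right
      by (intro sum.cong refl) (simp add: sum_distrib_left mult_ac)
    also have "\<dots> = (\<Sum>i\<in>elem_index. \<Sum>j\<in>J. \<Sum>k\<in>elem_index. \<Sum>j'\<in>J. x j * x j' * (?t j j' i * ?t j j' k))"
      by (intro sum.cong refl, rule sum.swap)
    also have "\<dots> = (\<Sum>j\<in>J. \<Sum>i\<in>elem_index. \<Sum>k\<in>elem_index. \<Sum>j'\<in>J. x j * x j' * (?t j j' i * ?t j j' k))"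
      by (rule sum.swap)
    also have "\<dots> = (\<Sum>j\<in>J. \<Sum>i\<in>elem_index. \<Sum>j'\<in>J. \<Sum>k\<in>elem_index. x j * x j' * (?t j j' i * ?t j j' k))"
      by (intro sum.cong refl, rule sum.swap)
    also have "\<dots> = (\<Sum>j\<in>J. \<Sum>j'\<in>J. \<Sum>i\<in>elem_index. \<Sum>k\<in>elem_index. x j * x j' * (?t j j' i * ?t j j' k))"
      by (intro sum.cong refl, rule sum.swap)
    also have "\<dots> = (\<Sum>j\<in>J. \<Sum>k\<in>J. x j * x k * (C j k)\<^sup>2)"
      by (simp only: C[symmetric] power2_eq_square sum_product) (simp only: sum_distrib_left)
    finally show ?thesis .
  qed
  have 4: "(\<Sum>i\<in>elem_index. (A i i)\<^sup>2 * elem_excess i)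
      = \<sigma>2^4 * (LINT x|\<nu>. (g x)^4) * (\<Sum>l<K. (\<Sum>j\<in>J. x j * (b j l)\<^sup>2)\<^sup>2 * (v (Suc l) - v l))"
  proof -
    have G: "(LINT x|\<nu>. (g x)^4) = (\<Sum>c\<in>range g - {0}. c^4 * measure \<nu> (g -` {c}))"
      using integral_simple_jump(2)[OF e g, of "\<lambda>x. x^4"] by simp
    have a: "A (Inr (l, c)) (Inr (l, c)) = \<sigma>2\<^sup>2 * c\<^sup>2 * (\<Sum>j\<in>J. x j * (b j l)\<^sup>2)" for l c
      by (simp add: A_def elem_coeff_def sum_distrib_left power2_eq_square mult_ac)
    have p4: "(y :: real)^4 = y\<^sup>2 * y\<^sup>2" for y by (simp flip: power_add)
    have "(\<Sum>i\<in>elem_index. (A i i)\<^sup>2 * elem_excess i)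
      = (\<Sum>l<K. \<Sum>c\<in>range g - {0}. (\<sigma>2\<^sup>2 * c\<^sup>2 * (\<Sum>j\<in>J. x j * (b j l)\<^sup>2))\<^sup>2 * ((v (Suc l) - v l) * measure \<nu> (g -` {c})))"
      unfolding sum_elem_index by (simp add: elem_excess_def a)
    also have "\<dots> = (\<Sum>l<K. \<Sum>c\<in>range g - {0}. (c^4 * measure \<nu> (g -` {c})) * (\<sigma>2^4 * ((\<Sum>j\<in>J. x j * (b j l)\<^sup>2)\<^sup>2 * (v (Suc l) - v l))))"
      by (intro sum.cong refl) (simp add: power_mult_distrib p4 power2_eq_square mult_ac)
    also have "\<dots> = (\<Sum>l<K. (LINT x|\<nu>. (g x)^4) * (\<sigma>2^4 * ((\<Sum>j\<in>J. x j * (b j l)\<^sup>2)\<^sup>2 * (v (Suc l) - v l))))"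
      unfolding G by (simp only: sum_distrib_right)
    also have "\<dots> = \<sigma>2^4 * (LINT x|\<nu>. (g x)^4) * (\<Sum>l<K. (\<Sum>j\<in>J. x j * (b j l)\<^sup>2)\<^sup>2 * (v (Suc l) - v l))"
      unfolding sum_distrib_left by (intro sum.cong refl) (simp only: mult_ac)
    finally show ?thesis .
  qed
  have 5: "(\<Sum>j\<in>J. x j * ((elem_sum (b j) \<omega>)\<^sup>2 - C j j))
    = (\<Sum>i\<in>elem_index. \<Sum>k\<in>elem_index. A i k * elem_var i \<omega> * elem_var k \<omega>) - (\<Sum>i\<in>elem_index. A i i * elem_second i)" for \<omega>
    unfolding 1 2 by (simp add: right_diff_distrib sum_subtractf)
  show "square_integrable M (\<lambda>\<omega>. \<Sum>j\<in>J. x j * ((elem_sum (b j) \<omega>)\<^sup>2 - C j j))"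
    "expectation (\<lambda>\<omega>. (\<Sum>j\<in>J. x j * ((elem_sum (b j) \<omega>)\<^sup>2 - C j j))\<^sup>2)
      \<le> 2 * (\<Sum>j\<in>J. \<Sum>k\<in>J. x j * x k * (C j k)\<^sup>2)
        + \<sigma>2^4 * (LINT x|\<nu>. (g x)^4) * (\<Sum>l<K. (\<Sum>j\<in>J. x j * (b j l)\<^sup>2)\<^sup>2 * (v (Suc l) - v l))"
    using q unfolding 5 3 4 by blast+
qed

end

end

section \<open>Stochastic integrals of deterministic functions as limits of elementary sums\<close>

section \<open>Step functions\<close>

text \<open>Brownian increments are specified over strictly increasing times, whereas the
  breakpoints of the approximating step functions may repeat.\<close>

definition strict_partition :: "nat \<Rightarrow> (nat \<Rightarrow> real) \<Rightarrow> real \<Rightarrow> bool" where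
  "strict_partition K v T \<longleftrightarrow> v 0 = 0 \<and> v K = T \<and> (\<forall>i<K. v i < v (Suc i))"

lemma strict_partition_less:
  assumes "strict_partition K v T" "i < j" "j \<le> K"
  shows "v i < v j"
  using assms(2,3)
proof (induction j)
  case (Suc j)
  then have "v j < v (Suc j)" using assms(1) by (simp add: strict_partition_def)
  with Suc show ?case by (cases "i = j") auto
qed simp

lemma strict_partition_less_iff:
  assumes "strict_partition K v T" "i \<le> K" "j \<le> K"
  shows "v i < v j \<longleftrightarrow> i < j"
  using strict_partition_less[OF assms(1), of i j] strict_partition_less[OF assms(1), of j i] assms(2,3)
  by (cases i j rule: linorder_cases) auto

lemma strict_partition_bounds:
  assumes "strict_partition K v T" "i \<le> K"
  shows "0 \<le> v i" "v i \<le> T"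
proof -
  show "0 \<le> v i"
    using strict_partition_less[OF assms(1), of 0 i] assms by (cases "i = 0") (auto simp: strict_partition_def)
  show "v i \<le> T"
    using strict_partition_less[OF assms(1), of i K] assms by (cases "i = K") (auto simp: strict_partition_def)
qed

lemma ex_strict_partition:
  assumes F: "finite F" "F \<subseteq> {0..T}" "0 \<in> F" "T \<in> F"
  obtains K v where "strict_partition K v T" "F = v ` {..K}"
proof -
  define xs where "xs = sorted_list_of_set F"
  have xs: "set xs = F" "sorted_wrt (<) xs"
    using F(1) by (simp_all add: xs_def)
  have ne: "xs \<noteq> []" using xs(1) F(3) by auto
  define K where "K = length xs - 1"
  have len: "length xs = Suc K" using ne by (simp add: K_def)
  have img: "F = (\<lambda>i. xs ! i) ` {..K}"
    using xs(1) len by (auto simp: set_conv_nth less_Suc_eq_le)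
  have mono: "xs ! i < xs ! j" if "i < j" "j \<le> K" for i j
    using xs(2) that len by (simp add: sorted_wrt_nth_less)
  obtain i where i: "i \<le> K" "xs ! i = 0" using F(3) unfolding img by auto
  have "xs ! 0 \<in> F" unfolding img by auto
  then have "xs ! 0 \<ge> 0" using F(2) by auto
  then have 0: "xs ! 0 = 0" using mono[of 0 i] i by (cases "i = 0") auto
  obtain j where j: "j \<le> K" "xs ! j = T" using F(4) unfolding img by auto
  have "xs ! K \<in> F" unfolding img by auto
  then have "xs ! K \<le> T" using F(2) by auto
  then have K: "xs ! K = T" using mono[of j K] j by (cases "j = K") auto
  show thesis
    using 0 K mono img by (intro that[of K "\<lambda>i. xs ! i"]) (auto simp: strict_partition_def)
qed

lemma strict_partition_locate:
  assumes p: "strict_partition K v T" and s: "0 < s" "s \<le> T"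
  obtains l where "l < K" "v l < s" "s \<le> v (Suc l)"
proof -
  define l where "l = (LEAST i. s \<le> v (Suc i))"
  have K: "K \<noteq> 0" using p s by (auto simp: strict_partition_def intro: ccontr)
  then have ex: "s \<le> v (Suc (K - 1))" using p s by (simp add: strict_partition_def)
  have l1: "s \<le> v (Suc l)" unfolding l_def by (rule LeastI[of "\<lambda>i. s \<le> v (Suc i)", OF ex])
  have l2: "l \<le> K - 1" unfolding l_def by (rule Least_le[of "\<lambda>i. s \<le> v (Suc i)", OF ex])
  have "v l < s"
  proof (cases l)
    case 0
    then show ?thesis using p s by (simp add: strict_partition_def)
  next
    case (Suc i)
    then have "\<not> s \<le> v (Suc i)" using not_less_Least[of i "\<lambda>i. s \<le> v (Suc i)"] by (simp add: l_def)
    then show ?thesis using Suc by simp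
  qed
  then show thesis using that[of l] l1 l2 K by auto
qed

lemma step_fun_eq:
  assumes p: "strict_partition K v T" and l: "l < K" "v l < s" "s \<le> v (Suc l)"
  shows "step_fun K v b s = b l"
proof -
  have "indicator {v i<..v (Suc i)} s = (if i = l then 1 else 0 :: real)" if "i < K" for i
  proof (cases i l rule: linorder_cases)
    case less
    then have "v (Suc i) \<le> v l"
      using strict_partition_less[OF p, of "Suc i" l] l by (cases "Suc i = l") auto
    then show ?thesis using l less by auto
  next
    case greater
    then have "v (Suc l) \<le> v i"
      using strict_partition_less[OF p, of "Suc l" i] that by (cases "Suc l = i") auto
    then show ?thesis using l greater by auto
  qed (use l in auto)
  then have "step_fun K v b s = (\<Sum>i<K. if i = l then b i else 0)"
    unfolding step_fun_def by (intro sum.cong) auto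
  also have "\<dots> = b l" using l by (simp add: sum.delta)
  finally show ?thesis .
qed

lemma step_fun_measurable [measurable]: "step_fun K v b \<in> borel_measurable borel"
  unfolding step_fun_def by measurable

lemma step_fun_integral:
  assumes p: "strict_partition K v T"
  shows "integrable lborel (step_fun K v b)"
    "(LINT s|lborel. step_fun K v b s) = (\<Sum>l<K. b l * (v (Suc l) - v l))"
proof -
  have i: "integrable lborel (\<lambda>s. b l * indicator {v l<..v (Suc l)} s :: real)" if "l < K" for l
    using p that by (intro integrable_mult_right integrable_real_indicator)
      (auto simp: strict_partition_def less_imp_le)
  show "integrable lborel (step_fun K v b)"
    unfolding step_fun_def using i by (intro Bochner_Integration.integrable_sum) auto
  have "(LINT s|lborel. step_fun K v b s) = (\<Sum>l<K. LINT s|lborel. b l * indicator {v l<..v (Suc l)} s)"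
    unfolding step_fun_def using i by (intro Bochner_Integration.integral_sum) auto
  also have "\<dots> = (\<Sum>l<K. b l * (v (Suc l) - v l))"
  proof (intro sum.cong refl)
    fix l assume "l \<in> {..<K}"
    then have "v l \<le> v (Suc l)" using p by (auto simp: strict_partition_def less_imp_le)
    then show "(LINT s|lborel. b l * indicator {v l<..v (Suc l)} s) = b l * (v (Suc l) - v l)" by simp
  qed
  finally show "(LINT s|lborel. step_fun K v b s) = (\<Sum>l<K. b l * (v (Suc l) - v l))" .
qed

lemma step_fun_outside:
  assumes p: "strict_partition K v T" and s: "s \<notin> {0<..T}"
  shows "step_fun K v b s = 0"
  unfolding step_fun_def
proof (rule sum.neutral, rule ballI)
  fix i assume "i \<in> {..<K}"
  then have "0 \<le> v i" "v (Suc i) \<le> T" using strict_partition_bounds[OF p] by auto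
  then show "b i * indicator {v i<..v (Suc i)} s = 0" using s by auto
qed

text \<open>No breakpoint lies strictly inside a cell, so every comparison in the indicators keeps
  its truth value there. Cells are open on the left and closed on the right, so the right endpoint
  represents the cell.\<close>

lemma step_fun_refine:
  assumes p: "strict_partition K v T" and u: "\<And>i. i \<le> k \<Longrightarrow> u i \<in> v ` {..K}"
    and l: "l < K" "v l < s" "s \<le> v (Suc l)"
  shows "step_fun k u c s = step_fun k u c (v (Suc l))"
  unfolding step_fun_def
proof (intro sum.cong refl)
  fix i assume i: "i \<in> {..<k}"
  obtain a b where ab: "u i = v a" "a \<le> K" "u (Suc i) = v b" "b \<le> K"
    using u[of i] u[of "Suc i"] i by auto
  have "v a < s \<longleftrightarrow> v a < v (Suc l)"
  proof
    assume "v a < v (Suc l)"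
    then have "a \<le> l" using strict_partition_less_iff[OF p, of a "Suc l"] ab l by auto
    then have "v a \<le> v l" using strict_partition_less[OF p, of a l] l by (cases "a = l") auto
    then show "v a < s" using l by simp
  qed (use l in simp)
  moreover have "s \<le> v b \<longleftrightarrow> v (Suc l) \<le> v b"
  proof
    assume "s \<le> v b"
    then have "v l < v b" using l by simp
    then have "Suc l \<le> b" using strict_partition_less_iff[OF p, of l b] ab l by auto
    then show "v (Suc l) \<le> v b" using strict_partition_less[OF p, of "Suc l" b] ab by (cases "Suc l = b") auto
  qed (use l in simp)
  ultimately show "c i * indicator {u i<..u (Suc i)} s = c i * indicator {u i<..u (Suc i)} (v (Suc l))"
    using ab by (auto simp: indicator_def)
qed

lemma step_integral_refine:
  assumes p: "strict_partition K v T" and u: "\<And>i. i \<le> k \<Longrightarrow> u i \<in> v ` {..K}"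
    and mono: "\<And>i. i < k \<Longrightarrow> u i \<le> u (Suc i)"
  shows "step_integral k u c y = (\<Sum>l<K. step_fun k u c (v (Suc l)) * (y (v (Suc l)) - y (v l)))"
proof -
  have "y (u (Suc i)) - y (u i) = (\<Sum>l<K. indicator {u i<..u (Suc i)} (v (Suc l)) * (y (v (Suc l)) - y (v l)))"
    if i: "i < k" for i
  proof -
    obtain a b where ab: "u i = v a" "a \<le> K" "u (Suc i) = v b" "b \<le> K"
      using u[of i] u[of "Suc i"] i by auto
    have "a \<le> b" using mono[OF i] strict_partition_less_iff[OF p, of b a] ab by (simp add: not_less[symmetric])
    have "(\<Sum>l<K. indicator {u i<..u (Suc i)} (v (Suc l)) * (y (v (Suc l)) - y (v l)))
        = (\<Sum>l<K. if l \<in> {a..<b} then y (v (Suc l)) - y (v l) else 0)"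
    proof (intro sum.cong refl)
      fix l assume "l \<in> {..<K}"
      then have "v a < v (Suc l) \<longleftrightarrow> a \<le> l" "v b < v (Suc l) \<longleftrightarrow> b \<le> l"
        using strict_partition_less_iff[OF p, of a "Suc l"] strict_partition_less_iff[OF p, of b "Suc l"] ab
        by auto
      then show "indicator {u i<..u (Suc i)} (v (Suc l)) * (y (v (Suc l)) - y (v l))
          = (if l \<in> {a..<b} then y (v (Suc l)) - y (v l) else 0)"
        using ab by (auto simp: indicator_def not_less[symmetric])
    qed
    also have "\<dots> = (\<Sum>l\<in>{..<K} \<inter> {a..<b}. y (v (Suc l)) - y (v l))"
      by (subst sum.inter_restrict) auto
    also have "{..<K} \<inter> {a..<b} = {a..<b}" using ab by auto
    also have "(\<Sum>l\<in>{a..<b}. y (v (Suc l)) - y (v l)) = y (v b) - y (v a)"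
      using sum_Suc_diff'[OF \<open>a \<le> b\<close>, of "\<lambda>l. y (v l)"] by simp
    finally show ?thesis using ab by simp
  qed
  then have "step_integral k u c y
      = (\<Sum>i<k. \<Sum>l<K. c i * indicator {u i<..u (Suc i)} (v (Suc l)) * (y (v (Suc l)) - y (v l)))"
    unfolding step_integral_def by (intro sum.cong refl) (simp only: lessThan_iff sum_distrib_left mult.assoc)
  also have "\<dots> = (\<Sum>l<K. \<Sum>i<k. c i * indicator {u i<..u (Suc i)} (v (Suc l)) * (y (v (Suc l)) - y (v l)))"
    by (rule sum.swap)
  also have "\<dots> = (\<Sum>l<K. step_fun k u c (v (Suc l)) * (y (v (Suc l)) - y (v l)))"
    unfolding step_fun_def sum_distrib_right ..
  finally show ?thesis .
qed

text \<open>Step functions that approximate a bounded \<open>f\<close> in mean square may still take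
  large values, while the fourth cumulant term needs a uniform bound on the coefficients. Clipping
  supplies it without moving away from \<open>f\<close>.\<close>

definition clip :: "real \<Rightarrow> real \<Rightarrow> real" where
  "clip B x = max (- B) (min B x)"

lemma clip_bound: "0 \<le> B \<Longrightarrow> \<bar>clip B x\<bar> \<le> B"
  by (auto simp: clip_def)

lemma clip_closer:
  assumes "\<bar>y\<bar> \<le> B"
  shows "\<bar>clip B x - y\<bar> \<le> \<bar>x - y\<bar>" "\<bar>x - clip B x\<bar> \<le> \<bar>x - y\<bar>"
  using assms by (auto simp: clip_def min_def max_def)

lemma clip_measurable [measurable]: "clip B \<in> borel_measurable borel"
  unfolding clip_def by measurable

section \<open>Second moments of stochastic integrals and of their squares\<close>

text \<open>The sum of all squared errors has finite mean, hence is almost surely finite, and the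
  terms of a convergent series tend to 0.\<close>

lemma AE_tendsto_of_summable_squares:
  fixes X :: "nat \<Rightarrow> 'a \<Rightarrow> real"
  assumes [measurable]: "\<And>m. X m \<in> borel_measurable M" "Y \<in> borel_measurable M"
    and le: "\<And>m. (\<integral>\<^sup>+ \<omega>. ennreal ((Y \<omega> - X m \<omega>)\<^sup>2) \<partial>M) \<le> ennreal (b m)"
    and b: "summable b" "\<And>m. 0 \<le> b m"
  shows "AE \<omega> in M. (\<lambda>m. X m \<omega>) \<longlonglongrightarrow> Y \<omega>"
proof -
  have "(\<integral>\<^sup>+ \<omega>. (\<Sum>m. ennreal ((Y \<omega> - X m \<omega>)\<^sup>2)) \<partial>M) = (\<Sum>m. \<integral>\<^sup>+ \<omega>. ennreal ((Y \<omega> - X m \<omega>)\<^sup>2) \<partial>M)"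
    by (intro nn_integral_suminf) measurable
  also have "\<dots> \<le> (\<Sum>m. ennreal (b m))"
    by (intro suminf_le le) auto
  also have "\<dots> < \<infinity>"
    using ennreal_suminf_neq_top[OF b] by (simp add: less_top)
  finally have "(\<integral>\<^sup>+ \<omega>. (\<Sum>m. ennreal ((Y \<omega> - X m \<omega>)\<^sup>2)) \<partial>M) \<noteq> \<infinity>"
    by simp
  then have "AE \<omega> in M. (\<Sum>m. ennreal ((Y \<omega> - X m \<omega>)\<^sup>2)) \<noteq> \<infinity>"
    by (intro nn_integral_PInf_AE) measurable
  then show ?thesis
  proof eventually_elim
    case (elim \<omega>)
    then have "summable (\<lambda>m. (Y \<omega> - X m \<omega>)\<^sup>2)"
      by (intro summable_suminf_not_top) auto
    from summable_LIMSEQ_zero[OF this] have "(\<lambda>m. sqrt ((Y \<omega> - X m \<omega>)\<^sup>2)) \<longlonglongrightarrow> sqrt 0"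
      by (intro tendsto_real_sqrt)
    then have "(\<lambda>m. \<bar>X m \<omega> - Y \<omega>\<bar>) \<longlonglongrightarrow> 0" by (simp add: abs_minus_commute)
    then show ?case by (simp add: tendsto_rabs_zero_iff LIM_zero_iff)
  qed
qed

lemma nn_integral_square_sum_bound:
  fixes Y :: "nat \<Rightarrow> 'a \<Rightarrow> real"
  assumes [measurable]: "\<And>l. l < K \<Longrightarrow> Y l \<in> borel_measurable M"
  shows "(\<integral>\<^sup>+ \<omega>. ennreal ((\<Sum>l<K. Y l \<omega>)\<^sup>2) \<partial>M) \<le> of_nat K * (\<Sum>l<K. \<integral>\<^sup>+ \<omega>. ennreal ((Y l \<omega>)\<^sup>2) \<partial>M)"
proof -
  have "(\<integral>\<^sup>+ \<omega>. ennreal ((\<Sum>l<K. Y l \<omega>)\<^sup>2) \<partial>M) \<le> (\<integral>\<^sup>+ \<omega>. of_nat K * (\<Sum>l<K. ennreal ((Y l \<omega>)\<^sup>2)) \<partial>M)"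
  proof (rule nn_integral_mono)
    fix \<omega>
    have "(\<Sum>l<K. Y l \<omega>)\<^sup>2 \<le> real K * (\<Sum>l<K. (Y l \<omega>)\<^sup>2)"
      using Cauchy_Schwarz_ineq_sum[of "\<lambda>_. 1" "\<lambda>l. Y l \<omega>" "{..<K}"] by simp
    then have "ennreal ((\<Sum>l<K. Y l \<omega>)\<^sup>2) \<le> ennreal (real K * (\<Sum>l<K. (Y l \<omega>)\<^sup>2))"
      by (rule ennreal_leI)
    also have "\<dots> = of_nat K * (\<Sum>l<K. ennreal ((Y l \<omega>)\<^sup>2))"
      by (subst ennreal_mult) (auto simp: sum_nonneg ennreal_of_nat_eq_real_of_nat sum_ennreal)
    finally show "ennreal ((\<Sum>l<K. Y l \<omega>)\<^sup>2) \<le> of_nat K * (\<Sum>l<K. ennreal ((Y l \<omega>)\<^sup>2))" .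
  qed
  also have "\<dots> = of_nat K * (\<Sum>l<K. \<integral>\<^sup>+ \<omega>. ennreal ((Y l \<omega>)\<^sup>2) \<partial>M)"
    by (subst nn_integral_cmult, measurable) (subst nn_integral_sum, measurable)
  finally show ?thesis .
qed

lemma chain_bounds:
  fixes u :: "nat \<Rightarrow> real"
  assumes "\<And>i. i < k \<Longrightarrow> u i \<le> u (Suc i)" "i \<le> k"
  shows "u 0 \<le> u i" "u i \<le> u k"
proof -
  show "u 0 \<le> u i"
    using assms by (induction i) (auto intro: order_trans)
  show "u i \<le> u k"
    using assms(2,1)
  proof (induction rule: dec_induct)
    case (step m)
    then show ?case by (meson less_imp_le order_trans Suc_lessI less_SucI lessI)
  qed simp
qed

context levy_noise
begin

text \<open>The Brownian increments are already elementary, so only the jump part is replaced; the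
  error is a combination of increments of \<open>z\<close> minus \<open>jump_sum\<close>.\<close>

lemma noise_sum_approximation:
  assumes v: "strict_partition K v T" and \<epsilon>: "0 < \<epsilon>" and J: "finite (J :: 'j set)"
  obtains e g where "0 < e" "simple_jump_function e g" "\<And>x. \<bar>g x\<bar> \<le> 2 * \<bar>x\<bar>"
    "\<bar>(LINT x|\<nu>. (g x)\<^sup>2) - 1\<bar> \<le> \<epsilon>"
    "\<And>j. j \<in> J \<Longrightarrow> (\<integral>\<^sup>+ \<omega>. ennreal (((\<Sum>l<K. a j l * ((\<sigma>1 * w (v (Suc l)) \<omega> + \<sigma>2 * z (v (Suc l)) \<omega>)
        - (\<sigma>1 * w (v l) \<omega> + \<sigma>2 * z (v l) \<omega>))) - elem_sum v K g \<sigma>1 \<sigma>2 (a j) \<omega>)\<^sup>2) \<partial>M) \<le> ennreal \<epsilon>"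
proof -
  have v0: "0 \<le> v i" if "i \<le> K" for i using strict_partition_bounds[OF v that] by simp
  have vs: "v l \<le> v (Suc l)" if "l < K" for l using v that by (simp add: strict_partition_def less_imp_le)
  define A where "A = (\<Sum>j\<in>J. \<Sum>l<K. (\<sigma>2 * a j l)\<^sup>2)"
  have A0: "0 \<le> A" by (simp add: A_def sum_nonneg)
  \<comment> \<open>Each increment of the error has second moment at most \<open>4 * \<eta>\<close>,
    and Cauchy-Schwarz over the \<open>K\<close> cells multiplies by \<open>K\<close>;
    \<open>A\<close> dominates the squared coefficients for all \<open>j\<close> at once.\<close>
  define \<eta> where "\<eta> = min \<epsilon> (\<epsilon> / (1 + real K * (4 * A)))"
  have den: "0 < 1 + real K * (4 * A)" using A0 by (simp add: add_pos_nonneg)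
  have \<eta>: "0 < \<eta>" "\<eta> \<le> \<epsilon>" using \<epsilon> den by (auto simp: \<eta>_def)
  have \<eta>2: "real K * (4 * A) * \<eta> \<le> \<epsilon>"
  proof -
    have "real K * (4 * A) * \<eta> \<le> (1 + real K * (4 * A)) * (\<epsilon> / (1 + real K * (4 * A)))"
      using A0 \<epsilon> \<eta> by (intro mult_mono) (auto simp: \<eta>_def)
    then show ?thesis using den by simp
  qed
  obtain e g where eg: "0 < e" "simple_jump_function e g" "\<And>x. \<bar>g x\<bar> \<le> 2 * \<bar>x\<bar>"
    "\<bar>(LINT x|\<nu>. (g x)\<^sup>2) - 1\<bar> \<le> \<eta>"
    "\<And>t. t \<in> v ` {..K} \<Longrightarrow> (\<integral>\<^sup>+ \<omega>. ennreal ((z t \<omega> - jump_sum g 0 t \<omega>)\<^sup>2) \<partial>M) \<le> ennreal \<eta>"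
    using jump_process_approximation[of "v ` {..K}" \<eta>] v0 \<eta> by blast
  have js [measurable]: "jump_sum g s t \<in> borel_measurable M" for s t
    by (rule jump_sum_measurable[OF eg(1,2)])
  have vl: "v i < v (Suc i)" if "i < K" for i using v that by (simp add: strict_partition_def)
  have sum_def: "elem_sum v K g \<sigma>1 \<sigma>2 x \<omega> = (\<Sum>l<K. x l *
      (\<sigma>1 * (w (v (Suc l)) \<omega> - w (v l) \<omega>) + \<sigma>2 * jump_sum g (v l) (v (Suc l)) \<omega>))" for x \<omega>
    by (rule elem_sum_def[OF v0[OF le0] vl eg(1,2)])
  define D where "D i \<omega> = z (v i) \<omega> - jump_sum g 0 (v i) \<omega>" for i \<omega>
  have Dm: "D i \<in> borel_measurable M" if "i \<le> K" for i
    unfolding D_def[abs_def] using z_measurable[OF v0[OF that]] by measurable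
  have DE: "(\<integral>\<^sup>+ \<omega>. ennreal ((D i \<omega>)\<^sup>2) \<partial>M) \<le> ennreal \<eta>" if "i \<le> K" for i
    unfolding D_def using eg(5)[of "v i"] that by blast
  have main: "(\<integral>\<^sup>+ \<omega>. ennreal (((\<Sum>l<K. a j l * ((\<sigma>1 * w (v (Suc l)) \<omega> + \<sigma>2 * z (v (Suc l)) \<omega>)
        - (\<sigma>1 * w (v l) \<omega> + \<sigma>2 * z (v l) \<omega>))) - elem_sum v K g \<sigma>1 \<sigma>2 (a j) \<omega>)\<^sup>2) \<partial>M) \<le> ennreal \<epsilon>"
    if j: "j \<in> J" for j
  proof -
    have inc: "AE \<omega> in M. \<forall>l<K. jump_sum g (v l) (v (Suc l)) \<omega> = jump_sum g 0 (v (Suc l)) \<omega> - jump_sum g 0 (v l) \<omega>"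
    proof -
      have "AE \<omega> in M. \<forall>l\<in>{..<K}. jump_sum g (v l) (v (Suc l)) \<omega> = jump_sum g 0 (v (Suc l)) \<omega> - jump_sum g 0 (v l) \<omega>"
      proof (intro AE_finite_allI)
        fix l assume "l \<in> {..<K}"
        then have "0 \<le> v l" "v l \<le> v (Suc l)" using v0 vs by auto
        from jump_sum_increment_AE[OF eg(1,2) this]
        show "AE \<omega> in M. jump_sum g (v l) (v (Suc l)) \<omega> = jump_sum g 0 (v (Suc l)) \<omega> - jump_sum g 0 (v l) \<omega>"
          by eventually_elim simp
      qed simp
      then show ?thesis unfolding Ball_def lessThan_iff .
    qed
    have "(\<integral>\<^sup>+ \<omega>. ennreal (((\<Sum>l<K. a j l * ((\<sigma>1 * w (v (Suc l)) \<omega> + \<sigma>2 * z (v (Suc l)) \<omega>)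
        - (\<sigma>1 * w (v l) \<omega> + \<sigma>2 * z (v l) \<omega>))) - elem_sum v K g \<sigma>1 \<sigma>2 (a j) \<omega>)\<^sup>2) \<partial>M)
      = (\<integral>\<^sup>+ \<omega>. ennreal ((\<Sum>l<K. \<sigma>2 * a j l * (D (Suc l) \<omega> - D l \<omega>))\<^sup>2) \<partial>M)"
    proof (rule nn_integral_cong_AE)
      show "AE \<omega> in M. ennreal (((\<Sum>l<K. a j l * ((\<sigma>1 * w (v (Suc l)) \<omega> + \<sigma>2 * z (v (Suc l)) \<omega>)
        - (\<sigma>1 * w (v l) \<omega> + \<sigma>2 * z (v l) \<omega>))) - elem_sum v K g \<sigma>1 \<sigma>2 (a j) \<omega>)\<^sup>2)
        = ennreal ((\<Sum>l<K. \<sigma>2 * a j l * (D (Suc l) \<omega> - D l \<omega>))\<^sup>2)"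
        using inc
      proof eventually_elim
        case (elim \<omega>)
        have "(\<Sum>l<K. a j l * ((\<sigma>1 * w (v (Suc l)) \<omega> + \<sigma>2 * z (v (Suc l)) \<omega>)
            - (\<sigma>1 * w (v l) \<omega> + \<sigma>2 * z (v l) \<omega>))) - elem_sum v K g \<sigma>1 \<sigma>2 (a j) \<omega>
          = (\<Sum>l<K. \<sigma>2 * a j l * (D (Suc l) \<omega> - D l \<omega>))"
          unfolding sum_def sum_subtractf[symmetric]
        proof (intro sum.cong refl)
          fix l assume "l \<in> {..<K}"
          with elim have jeq: "jump_sum g (v l) (v (Suc l)) \<omega> = jump_sum g 0 (v (Suc l)) \<omega> - jump_sum g 0 (v l) \<omega>"
            by blast
          show "a j l * ((\<sigma>1 * w (v (Suc l)) \<omega> + \<sigma>2 * z (v (Suc l)) \<omega>)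
            - (\<sigma>1 * w (v l) \<omega> + \<sigma>2 * z (v l) \<omega>))
            - a j l * (\<sigma>1 * (w (v (Suc l)) \<omega> - w (v l) \<omega>) + \<sigma>2 * jump_sum g (v l) (v (Suc l)) \<omega>)
            = \<sigma>2 * a j l * (D (Suc l) \<omega> - D l \<omega>)"
            unfolding D_def jeq by (simp add: algebra_simps)
        qed
        then show ?case by (rule arg_cong)
      qed
    qed
    also have "\<dots> \<le> of_nat K * (\<Sum>l<K. \<integral>\<^sup>+ \<omega>. ennreal ((\<sigma>2 * a j l * (D (Suc l) \<omega> - D l \<omega>))\<^sup>2) \<partial>M)"
      using Dm by (intro nn_integral_square_sum_bound) auto
    also have "\<dots> \<le> of_nat K * (\<Sum>l<K. ennreal ((\<sigma>2 * a j l)\<^sup>2 * (4 * \<eta>)))"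
    proof (intro mult_left_mono sum_mono)
      fix l assume "l \<in> {..<K}"
      then have l: "l \<le> K" "Suc l \<le> K" by auto
      note [measurable] = Dm[OF l(1)] Dm[OF l(2)]
      have neg: "(\<lambda>\<omega>. - D l \<omega>) \<in> borel_measurable M" by measurable
      have "(\<integral>\<^sup>+ \<omega>. ennreal ((\<sigma>2 * a j l * (D (Suc l) \<omega> - D l \<omega>))\<^sup>2) \<partial>M)
        = (\<integral>\<^sup>+ \<omega>. ennreal ((\<sigma>2 * a j l)\<^sup>2) * ennreal ((D (Suc l) \<omega> + - D l \<omega>)\<^sup>2) \<partial>M)"
        by (intro nn_integral_cong) (simp add: power_mult_distrib ennreal_mult)
      also have "\<dots> = ennreal ((\<sigma>2 * a j l)\<^sup>2) * (\<integral>\<^sup>+ \<omega>. ennreal ((D (Suc l) \<omega> + - D l \<omega>)\<^sup>2) \<partial>M)"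
        by (intro nn_integral_cmult) measurable
      also have "\<dots> \<le> ennreal ((\<sigma>2 * a j l)\<^sup>2) * (2 * ennreal \<eta> + 2 * ennreal \<eta>)"
      proof (rule mult_left_mono)
        have "(\<integral>\<^sup>+ \<omega>. ennreal ((D (Suc l) \<omega> + - D l \<omega>)\<^sup>2) \<partial>M)
          \<le> 2 * (\<integral>\<^sup>+ \<omega>. ennreal ((D (Suc l) \<omega>)\<^sup>2) \<partial>M) + 2 * (\<integral>\<^sup>+ \<omega>. ennreal ((- D l \<omega>)\<^sup>2) \<partial>M)"
          by (rule nn_integral_square_sum_le[OF Dm[OF l(2)] neg])
        also have "\<dots> \<le> 2 * ennreal \<eta> + 2 * ennreal \<eta>"
          using DE[OF l(1)] DE[OF l(2)] by (intro add_mono mult_left_mono) simp_all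
        finally show "(\<integral>\<^sup>+ \<omega>. ennreal ((D (Suc l) \<omega> + - D l \<omega>)\<^sup>2) \<partial>M) \<le> 2 * ennreal \<eta> + 2 * ennreal \<eta>" .
      qed simp
      also have "2 * ennreal \<eta> + 2 * ennreal \<eta> = ennreal (4 * \<eta>)"
        using \<eta> by (simp add: ennreal_mult flip: distrib_right)
      also have "ennreal ((\<sigma>2 * a j l)\<^sup>2) * ennreal (4 * \<eta>) = ennreal ((\<sigma>2 * a j l)\<^sup>2 * (4 * \<eta>))"
        using \<eta> by (intro ennreal_mult[symmetric]) auto
      finally show "(\<integral>\<^sup>+ \<omega>. ennreal ((\<sigma>2 * a j l * (D (Suc l) \<omega> - D l \<omega>))\<^sup>2) \<partial>M)
        \<le> ennreal ((\<sigma>2 * a j l)\<^sup>2 * (4 * \<eta>))" .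
    qed simp
    also have "\<dots> = ennreal (real K * ((\<Sum>l<K. (\<sigma>2 * a j l)\<^sup>2) * (4 * \<eta>)))"
      using \<eta> by (subst ennreal_mult) (auto simp: sum_ennreal sum_nonneg sum_distrib_right ennreal_of_nat_eq_real_of_nat)
    also have "\<dots> \<le> ennreal \<epsilon>"
    proof (rule ennreal_leI)
      have "(\<Sum>l<K. (\<sigma>2 * a j l)\<^sup>2) \<le> A"
        unfolding A_def using J j by (intro member_le_sum[of j J "\<lambda>j. \<Sum>l<K. (\<sigma>2 * a j l)\<^sup>2"]) (auto simp: sum_nonneg)
      then have "real K * ((\<Sum>l<K. (\<sigma>2 * a j l)\<^sup>2) * (4 * \<eta>)) \<le> real K * (A * (4 * \<eta>))"
        using \<eta> by (intro mult_left_mono mult_right_mono) auto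
      with \<eta>2 show "real K * ((\<Sum>l<K. (\<sigma>2 * a j l)\<^sup>2) * (4 * \<eta>)) \<le> \<epsilon>"
        by (simp add: mult_ac)
    qed
    finally show ?thesis .
  qed
  show thesis
    using that[OF eg(1,2,3)] eg(4) \<eta>(2) main by force
qed

text \<open>Three errors are joined: the stochastic integral against its step version, true jumps
  against simple jumps, and unclipped against clipped coefficients.\<close>

lemma stoch_integral_approximation:
  fixes f :: "'j \<Rightarrow> real \<Rightarrow> real" and \<zeta> :: "'j \<Rightarrow> 'a \<Rightarrow> real"
  assumes T: "0 < T" and J: "finite J" and B: "0 \<le> B" and \<epsilon>: "0 < \<epsilon>"
    and fm: "\<And>j. j \<in> J \<Longrightarrow> f j \<in> borel_measurable borel"
    and fb: "\<And>j s. j \<in> J \<Longrightarrow> s \<in> {0..T} \<Longrightarrow> \<bar>f j s\<bar> \<le> B"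
    and \<zeta>m: "\<And>j. j \<in> J \<Longrightarrow> \<zeta> j \<in> borel_measurable M"
    and ap: "\<And>j. j \<in> J \<Longrightarrow> \<exists>k u c.
        (\<forall>m::nat. u m (0::nat) = 0 \<and> u m (k m) = T \<and> (\<forall>i<k m. u m i \<le> u m (Suc i))) \<and>
        (\<lambda>m. \<integral>\<^sup>+ s\<in>{0..T}. ennreal ((step_fun (k m) (u m) (c m) s - f j s)\<^sup>2) \<partial>lborel) \<longlonglongrightarrow> 0 \<and>
        (\<lambda>m. \<integral>\<^sup>+ \<omega>. ennreal ((step_integral (k m) (u m) (c m) (\<lambda>t. \<sigma>1 * w t \<omega> + \<sigma>2 * z t \<omega>) - \<zeta> j \<omega>)\<^sup>2) \<partial>M) \<longlonglongrightarrow> 0"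
  obtains K v e g b where "strict_partition K v T" "0 < e" "simple_jump_function e g"
    "\<And>x. \<bar>g x\<bar> \<le> 2 * \<bar>x\<bar>" "\<bar>(LINT x|\<nu>. (g x)\<^sup>2) - 1\<bar> \<le> \<epsilon>"
    "\<And>j l. j \<in> J \<Longrightarrow> \<bar>b j l\<bar> \<le> B"
    "\<And>j. j \<in> J \<Longrightarrow> (\<integral>\<^sup>+ s\<in>{0..T}. ennreal ((step_fun K v (b j) s - f j s)\<^sup>2) \<partial>lborel) \<le> ennreal \<epsilon>"
    "\<And>j. j \<in> J \<Longrightarrow> (\<integral>\<^sup>+ \<omega>. ennreal ((\<zeta> j \<omega> - elem_sum v K g \<sigma>1 \<sigma>2 (b j) \<omega>)\<^sup>2) \<partial>M) \<le> ennreal \<epsilon>"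
proof -
  \<comment> \<open>The three errors combine to \<open>2 * \<eta> + 2 * (2 * \<eta> + 2 *
    (\<sigma>1\<^sup>2 + \<sigma>2\<^sup>2 * 2) * \<eta>)\<close>; the inner factor 2 bounds the
    second moment of \<open>g\<close>, which is at most \<open>1 + \<eta>\<close>.\<close>
  define c0 where "c0 = 6 + 4 * (\<sigma>1\<^sup>2 + \<sigma>2\<^sup>2 * 2)"
  have c0: "0 < c0" by (simp add: c0_def add_pos_nonneg)
  define \<eta> where "\<eta> = min 1 (min \<epsilon> (\<epsilon> / c0))"
  have \<eta>: "0 < \<eta>" "\<eta> \<le> 1" "\<eta> \<le> \<epsilon>" "c0 * \<eta> \<le> \<epsilon>"
    using \<epsilon> c0 by (auto simp: \<eta>_def min_def field_simps)
  have "\<forall>j\<in>J. \<exists>k u c. u (0::nat) = 0 \<and> u k = T \<and> (\<forall>i<k. u i \<le> u (Suc i)) \<and>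
        (\<integral>\<^sup>+ s\<in>{0..T}. ennreal ((step_fun k u c s - f j s)\<^sup>2) \<partial>lborel) < ennreal \<eta> \<and>
        (\<integral>\<^sup>+ \<omega>. ennreal ((step_integral k u c (\<lambda>t. \<sigma>1 * w t \<omega> + \<sigma>2 * z t \<omega>) - \<zeta> j \<omega>)\<^sup>2) \<partial>M) < ennreal \<eta>"
  proof
    fix j assume "j \<in> J"
    obtain k u c where p: "\<forall>m::nat. u m (0::nat) = 0 \<and> u m (k m) = T \<and> (\<forall>i<k m. u m i \<le> u m (Suc i))"
      and l1: "(\<lambda>m. \<integral>\<^sup>+ s\<in>{0..T}. ennreal ((step_fun (k m) (u m) (c m) s - f j s)\<^sup>2) \<partial>lborel) \<longlonglongrightarrow> 0"
      and l2: "(\<lambda>m. \<integral>\<^sup>+ \<omega>. ennreal ((step_integral (k m) (u m) (c m) (\<lambda>t. \<sigma>1 * w t \<omega> + \<sigma>2 * z t \<omega>) - \<zeta> j \<omega>)\<^sup>2) \<partial>M) \<longlonglongrightarrow> 0"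
      using ap[OF \<open>j \<in> J\<close>] by blast
    have "0 < ennreal \<eta>" using \<eta> by simp
    from eventually_conj[OF order_tendstoD(2)[OF l1 this] order_tendstoD(2)[OF l2 this]]
    obtain m where "(\<integral>\<^sup>+ s\<in>{0..T}. ennreal ((step_fun (k m) (u m) (c m) s - f j s)\<^sup>2) \<partial>lborel) < ennreal \<eta>"
      "(\<integral>\<^sup>+ \<omega>. ennreal ((step_integral (k m) (u m) (c m) (\<lambda>t. \<sigma>1 * w t \<omega> + \<sigma>2 * z t \<omega>) - \<zeta> j \<omega>)\<^sup>2) \<partial>M) < ennreal \<eta>"
      by (auto simp: eventually_sequentially)
    with p show "\<exists>k u c. u (0::nat) = 0 \<and> u k = T \<and> (\<forall>i<k. u i \<le> u (Suc i)) \<and>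
        (\<integral>\<^sup>+ s\<in>{0..T}. ennreal ((step_fun k u c s - f j s)\<^sup>2) \<partial>lborel) < ennreal \<eta> \<and>
        (\<integral>\<^sup>+ \<omega>. ennreal ((step_integral k u c (\<lambda>t. \<sigma>1 * w t \<omega> + \<sigma>2 * z t \<omega>) - \<zeta> j \<omega>)\<^sup>2) \<partial>M) < ennreal \<eta>"
      by blast
  qed
  then obtain k u c where kuc: "\<And>j. j \<in> J \<Longrightarrow> u j (0::nat) = 0"
      "\<And>j. j \<in> J \<Longrightarrow> u j (k j) = T" "\<And>j i. j \<in> J \<Longrightarrow> i < k j \<Longrightarrow> u j i \<le> u j (Suc i)"
      and l1: "\<And>j. j \<in> J \<Longrightarrow> (\<integral>\<^sup>+ s\<in>{0..T}. ennreal ((step_fun (k j) (u j) (c j) s - f j s)\<^sup>2) \<partial>lborel) < ennreal \<eta>"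
      and l2: "\<And>j. j \<in> J \<Longrightarrow> (\<integral>\<^sup>+ \<omega>. ennreal ((step_integral (k j) (u j) (c j) (\<lambda>t. \<sigma>1 * w t \<omega> + \<sigma>2 * z t \<omega>) - \<zeta> j \<omega>)\<^sup>2) \<partial>M) < ennreal \<eta>"
    unfolding bchoice_iff by blast
  have ub: "0 \<le> u j i \<and> u j i \<le> T" if "j \<in> J" "i \<le> k j" for j i
    using chain_bounds[of "k j" "u j" i] kuc that by auto
  \<comment> \<open>Breakpoints of all integrands are pooled: on one common partition all sums are
    linear forms in the same elementary variables, as the joint quadratic form requires.\<close>
  define F where "F = insert 0 (insert T (\<Union>j\<in>J. u j ` {..k j}))"
  have "finite F" "F \<subseteq> {0..T}" "0 \<in> F" "T \<in> F"
    using J T ub by (auto simp: F_def)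
  then obtain K v where v: "strict_partition K v T" and Fv: "F = v ` {..K}"
    by (rule ex_strict_partition)
  have uv: "u j i \<in> v ` {..K}" if "j \<in> J" "i \<le> k j" for j i
    using that unfolding Fv[symmetric] F_def by auto
  have v0: "0 \<le> v i" if "i \<le> K" for i using strict_partition_bounds[OF v that] by simp
  define a where "a j l = step_fun (k j) (u j) (c j) (v (Suc l))" for j l
  define b where "b j l = clip B (a j l)" for j l
  obtain e g where eg: "0 < e" "simple_jump_function e g" "\<And>x. \<bar>g x\<bar> \<le> 2 * \<bar>x\<bar>"
    "\<bar>(LINT x|\<nu>. (g x)\<^sup>2) - 1\<bar> \<le> \<eta>"
    and el: "\<And>j. j \<in> J \<Longrightarrow> (\<integral>\<^sup>+ \<omega>. ennreal (((\<Sum>l<K. a j l * ((\<sigma>1 * w (v (Suc l)) \<omega> + \<sigma>2 * z (v (Suc l)) \<omega>)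
        - (\<sigma>1 * w (v l) \<omega> + \<sigma>2 * z (v l) \<omega>))) - elem_sum v K g \<sigma>1 \<sigma>2 (a j) \<omega>)\<^sup>2) \<partial>M) \<le> ennreal \<eta>"
    using noise_sum_approximation[OF v \<eta>(1) J] by blast
  have vs: "v i < v (Suc i)" if "i < K" for i using v that by (simp add: strict_partition_def)
  have es: "square_integrable M (elem_sum v K g \<sigma>1 \<sigma>2 x)"
    "expectation (\<lambda>\<omega>. (elem_sum v K g \<sigma>1 \<sigma>2 x \<omega>)\<^sup>2)
      = elem_sigma g \<sigma>1 \<sigma>2 * (\<Sum>l<K. (x l)\<^sup>2 * (v (Suc l) - v l))" for x
    by (rule elem_sum_second_moment[OF v0[OF le0] vs eg(1,2)]; assumption)+
  have sum_def: "elem_sum v K g \<sigma>1 \<sigma>2 x \<omega> = (\<Sum>l<K. x l *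
      (\<sigma>1 * (w (v (Suc l)) \<omega> - w (v l) \<omega>) + \<sigma>2 * jump_sum g (v l) (v (Suc l)) \<omega>))" for x \<omega>
    by (rule elem_sum_def[OF v0[OF le0] vs eg(1,2)])
  have sigma_def: "elem_sigma g \<sigma>1 \<sigma>2 = \<sigma>1\<^sup>2 + \<sigma>2\<^sup>2 * (LINT x|\<nu>. (g x)\<^sup>2)"
    by (rule elem_sigma_def[OF v0[OF le0] vs eg(1,2)])
  have em [measurable]: "elem_sum v K g \<sigma>1 \<sigma>2 x \<in> borel_measurable M" for x
    using es(1) by (rule square_integrableD(1))
  have stepeq: "step_fun (k j) (u j) (c j) s = a j l"
    if "j \<in> J" "l < K" "v l < s" "s \<le> v (Suc l)" for j l s
    unfolding a_def using that uv by (intro step_fun_refine[OF v]) auto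
  have sb: "(\<integral>\<^sup>+ s\<in>{0..T}. ennreal ((step_fun K v (b j) s - f j s)\<^sup>2) \<partial>lborel) \<le> ennreal \<eta>" if j: "j \<in> J" for j
  proof -
    have "(\<integral>\<^sup>+ s\<in>{0..T}. ennreal ((step_fun K v (b j) s - f j s)\<^sup>2) \<partial>lborel)
      \<le> (\<integral>\<^sup>+ s\<in>{0..T}. ennreal ((step_fun (k j) (u j) (c j) s - f j s)\<^sup>2) \<partial>lborel)"
    proof (rule nn_integral_mono_AE)
      show "AE s in lborel. ennreal ((step_fun K v (b j) s - f j s)\<^sup>2) * indicator {0..T} s
        \<le> ennreal ((step_fun (k j) (u j) (c j) s - f j s)\<^sup>2) * indicator {0..T} s"
        using AE_lborel_singleton[of 0]
      proof eventually_elim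
        case (elim s)
        show ?case
        proof (cases "s \<in> {0..T}")
          case True
          with elim have s: "0 < s" "s \<le> T" by auto
          obtain l where l: "l < K" "v l < s" "s \<le> v (Suc l)"
            by (rule strict_partition_locate[OF v s])
          have "\<bar>step_fun K v (b j) s - f j s\<bar> \<le> \<bar>step_fun (k j) (u j) (c j) s - f j s\<bar>"
            unfolding stepeq[OF j l] step_fun_eq[OF v l] b_def
            by (rule clip_closer(1)[OF fb[OF j True]])
          then have "(step_fun K v (b j) s - f j s)\<^sup>2 \<le> (step_fun (k j) (u j) (c j) s - f j s)\<^sup>2"
            by (simp add: abs_le_square_iff)
          then show ?thesis by (intro mult_right_mono ennreal_leI) auto
        qed simp
      qed
    qed
    then show ?thesis using l1[OF j] by simp
  qed
  \<comment> \<open>The part removed by clipping is nowhere larger than the distance to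
    \<open>f\<close>; the isometry then turns its size into a bound on the change of the
    noise.\<close>
  have db: "(\<Sum>l<K. (a j l - b j l)\<^sup>2 * (v (Suc l) - v l)) \<le> \<eta>" if j: "j \<in> J" for j
  proof -
    let ?q = "step_fun K v (\<lambda>l. (a j l - b j l)\<^sup>2)"
    have nn: "0 \<le> ?q s" for s
      unfolding step_fun_def by (intro sum_nonneg) auto
    have "ennreal (\<Sum>l<K. (a j l - b j l)\<^sup>2 * (v (Suc l) - v l)) = (\<integral>\<^sup>+ s. ennreal (?q s) \<partial>lborel)"
      using nn_integral_eq_integral[OF step_fun_integral(1)[OF v], of "\<lambda>l. (a j l - b j l)\<^sup>2"]
        step_fun_integral(2)[OF v] nn by simp
    also have "\<dots> \<le> (\<integral>\<^sup>+ s\<in>{0..T}. ennreal ((step_fun (k j) (u j) (c j) s - f j s)\<^sup>2) \<partial>lborel)"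
    proof (rule nn_integral_mono)
      fix s
      show "ennreal (?q s) \<le> ennreal ((step_fun (k j) (u j) (c j) s - f j s)\<^sup>2) * indicator {0..T} s"
      proof (cases "s \<in> {0<..T}")
        case True
        then have s: "0 < s" "s \<le> T" "s \<in> {0..T}" by auto
        obtain l where l: "l < K" "v l < s" "s \<le> v (Suc l)"
          by (rule strict_partition_locate[OF v s(1,2)])
        have "\<bar>a j l - b j l\<bar> \<le> \<bar>a j l - f j s\<bar>"
          unfolding b_def by (rule clip_closer(2)[OF fb[OF j s(3)]])
        then have "?q s \<le> (step_fun (k j) (u j) (c j) s - f j s)\<^sup>2"
          unfolding stepeq[OF j l] step_fun_eq[OF v l] by (simp add: abs_le_square_iff)
        then show ?thesis using s by (simp add: ennreal_leI)
      next
        case False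
        from step_fun_outside[OF v False] show ?thesis by simp
      qed
    qed
    also have "\<dots> \<le> ennreal \<eta>" using l1[OF j] by simp
    finally show ?thesis using \<eta> by simp
  qed
  have main: "(\<integral>\<^sup>+ \<omega>. ennreal ((\<zeta> j \<omega> - elem_sum v K g \<sigma>1 \<sigma>2 (b j) \<omega>)\<^sup>2) \<partial>M) \<le> ennreal \<epsilon>" if j: "j \<in> J" for j
  proof -
    note [measurable] = \<zeta>m[OF j]
    define I where "I \<omega> = (\<Sum>l<K. a j l * ((\<sigma>1 * w (v (Suc l)) \<omega> + \<sigma>2 * z (v (Suc l)) \<omega>)
        - (\<sigma>1 * w (v l) \<omega> + \<sigma>2 * z (v l) \<omega>)))" for \<omega>
    have [measurable]: "I \<in> borel_measurable M"
      unfolding I_def[abs_def]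
    proof (intro borel_measurable_sum)
      fix l assume "l \<in> {..<K}"
      then have "0 \<le> v l" "0 \<le> v (Suc l)" using v0 by auto
      note [measurable] = this[THEN w_measurable] this[THEN z_measurable]
      show "(\<lambda>\<omega>. a j l * ((\<sigma>1 * w (v (Suc l)) \<omega> + \<sigma>2 * z (v (Suc l)) \<omega>)
        - (\<sigma>1 * w (v l) \<omega> + \<sigma>2 * z (v l) \<omega>))) \<in> borel_measurable M"
        by measurable
    qed
    have SI: "step_integral (k j) (u j) (c j) (\<lambda>t. \<sigma>1 * w t \<omega> + \<sigma>2 * z t \<omega>) = I \<omega>" for \<omega>
      unfolding I_def a_def using uv[OF j] kuc(3)[OF j] by (intro step_integral_refine[OF v]) auto
    have 1: "(\<integral>\<^sup>+ \<omega>. ennreal ((\<zeta> j \<omega> - I \<omega>)\<^sup>2) \<partial>M) \<le> ennreal \<eta>"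
      using l2[OF j] unfolding SI by (simp add: power2_commute)
    have 2: "(\<integral>\<^sup>+ \<omega>. ennreal ((I \<omega> - elem_sum v K g \<sigma>1 \<sigma>2 (a j) \<omega>)\<^sup>2) \<partial>M) \<le> ennreal \<eta>"
      unfolding I_def by (rule el[OF j])
    have diff: "elem_sum v K g \<sigma>1 \<sigma>2 (a j) \<omega> - elem_sum v K g \<sigma>1 \<sigma>2 (b j) \<omega>
        = elem_sum v K g \<sigma>1 \<sigma>2 (\<lambda>l. a j l - b j l) \<omega>" for \<omega>
      unfolding sum_def sum_subtractf[symmetric] by (simp only: left_diff_distrib)
    have 3: "(\<integral>\<^sup>+ \<omega>. ennreal ((elem_sum v K g \<sigma>1 \<sigma>2 (a j) \<omega> - elem_sum v K g \<sigma>1 \<sigma>2 (b j) \<omega>)\<^sup>2) \<partial>M)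
        \<le> ennreal ((\<sigma>1\<^sup>2 + \<sigma>2\<^sup>2 * 2) * \<eta>)"
    proof -
      have "(\<integral>\<^sup>+ \<omega>. ennreal ((elem_sum v K g \<sigma>1 \<sigma>2 (\<lambda>l. a j l - b j l) \<omega>)\<^sup>2) \<partial>M)
        = ennreal (elem_sigma g \<sigma>1 \<sigma>2 * (\<Sum>l<K. (a j l - b j l)\<^sup>2 * (v (Suc l) - v l)))"
        unfolding es(2)[symmetric] using square_integrableD(2)[OF es(1)]
        by (intro nn_integral_eq_integral) auto
      also have "\<dots> \<le> ennreal ((\<sigma>1\<^sup>2 + \<sigma>2\<^sup>2 * 2) * \<eta>)"
      proof (intro ennreal_leI mult_mono db[OF j])
        show "elem_sigma g \<sigma>1 \<sigma>2 \<le> \<sigma>1\<^sup>2 + \<sigma>2\<^sup>2 * 2"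
          unfolding sigma_def using eg(4) \<eta>(2) by (intro add_left_mono mult_left_mono) auto
        show "0 \<le> (\<Sum>l<K. (a j l - b j l)\<^sup>2 * (v (Suc l) - v l))"
          using vs by (intro sum_nonneg mult_nonneg_nonneg) (auto simp: less_imp_le)
      qed simp
      finally show ?thesis unfolding diff .
    qed
    have 4: "(\<integral>\<^sup>+ \<omega>. ennreal ((I \<omega> - elem_sum v K g \<sigma>1 \<sigma>2 (b j) \<omega>)\<^sup>2) \<partial>M)
        \<le> 2 * ennreal \<eta> + 2 * ennreal ((\<sigma>1\<^sup>2 + \<sigma>2\<^sup>2 * 2) * \<eta>)"
    proof -
      have "(\<integral>\<^sup>+ \<omega>. ennreal (((I \<omega> - elem_sum v K g \<sigma>1 \<sigma>2 (a j) \<omega>)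
            + (elem_sum v K g \<sigma>1 \<sigma>2 (a j) \<omega> - elem_sum v K g \<sigma>1 \<sigma>2 (b j) \<omega>))\<^sup>2) \<partial>M)
        \<le> 2 * (\<integral>\<^sup>+ \<omega>. ennreal ((I \<omega> - elem_sum v K g \<sigma>1 \<sigma>2 (a j) \<omega>)\<^sup>2) \<partial>M)
          + 2 * (\<integral>\<^sup>+ \<omega>. ennreal ((elem_sum v K g \<sigma>1 \<sigma>2 (a j) \<omega> - elem_sum v K g \<sigma>1 \<sigma>2 (b j) \<omega>)\<^sup>2) \<partial>M)"
        by (rule nn_integral_square_sum_le) measurable
      also have "\<dots> \<le> 2 * ennreal \<eta> + 2 * ennreal ((\<sigma>1\<^sup>2 + \<sigma>2\<^sup>2 * 2) * \<eta>)"
        by (intro add_mono mult_left_mono 2 3) simp_all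
      finally show ?thesis by simp
    qed
    have "(\<integral>\<^sup>+ \<omega>. ennreal (((\<zeta> j \<omega> - I \<omega>) + (I \<omega> - elem_sum v K g \<sigma>1 \<sigma>2 (b j) \<omega>))\<^sup>2) \<partial>M)
        \<le> 2 * (\<integral>\<^sup>+ \<omega>. ennreal ((\<zeta> j \<omega> - I \<omega>)\<^sup>2) \<partial>M)
          + 2 * (\<integral>\<^sup>+ \<omega>. ennreal ((I \<omega> - elem_sum v K g \<sigma>1 \<sigma>2 (b j) \<omega>)\<^sup>2) \<partial>M)"
      by (rule nn_integral_square_sum_le) measurable
    also have "\<dots> \<le> 2 * ennreal \<eta> + 2 * (2 * ennreal \<eta> + 2 * ennreal ((\<sigma>1\<^sup>2 + \<sigma>2\<^sup>2 * 2) * \<eta>))"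
      by (intro add_mono mult_left_mono 1 4) simp_all
    also have "\<dots> = ennreal (c0 * \<eta>)"
    proof -
      have two: "2 * ennreal x = ennreal (2 * x)" if "0 \<le> x" for x using that by (simp add: ennreal_mult)
      have p: "0 \<le> \<eta>" "0 \<le> (\<sigma>1\<^sup>2 + \<sigma>2\<^sup>2 * 2) * \<eta>" using \<eta> by auto
      have q: "0 \<le> 2 * \<eta> + 2 * ((\<sigma>1\<^sup>2 + \<sigma>2\<^sup>2 * 2) * \<eta>)" using p by linarith
      have r: "c0 * \<eta> = 2 * \<eta> + 2 * (2 * \<eta> + 2 * ((\<sigma>1\<^sup>2 + \<sigma>2\<^sup>2 * 2) * \<eta>))"
        by (simp add: c0_def algebra_simps)
      show ?thesis
        unfolding r two[OF p(1)] two[OF p(2)]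
        using p q by (simp add: ennreal_plus[symmetric] two del: ennreal_plus)
    qed
    also have "\<dots> \<le> ennreal \<epsilon>" using \<eta>(4) by (rule ennreal_leI)
    finally show ?thesis by simp
  qed
  have sb': "(\<integral>\<^sup>+ s\<in>{0..T}. ennreal ((step_fun K v (b j) s - f j s)\<^sup>2) \<partial>lborel) \<le> ennreal \<epsilon>" if "j \<in> J" for j
    using sb[OF that] ennreal_leI[OF \<eta>(3)] by (rule order_trans)
  have gb: "\<bar>(LINT x|\<nu>. (g x)\<^sup>2) - 1\<bar> \<le> \<epsilon>" using eg(4) \<eta>(3) by linarith
  show thesis
    by (rule that[OF v eg(1,2,3) gb _ sb' main]) (auto simp: b_def intro: clip_bound[OF B])
qed

end

text \<open>Boundedness by \<open>B\<close> reduces the difference of products to the two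
  differences in mean, and these are controlled by their squares. The hypotheses use
  \<open>\<eta>\<^sup>2\<close> so that the bound is linear in \<open>\<eta>\<close>.\<close>

lemma step_inner_product_bound:
  assumes T: "0 < T" and v: "strict_partition K v T" and B: "0 \<le> B" and \<eta>: "0 < \<eta>"
    and m [measurable]: "f \<in> borel_measurable borel" "g \<in> borel_measurable borel"
    and fb: "\<And>s. s \<in> {0..T} \<Longrightarrow> \<bar>f s\<bar> \<le> B" "\<And>s. s \<in> {0..T} \<Longrightarrow> \<bar>g s\<bar> \<le> B"
    and bb: "\<And>l. \<bar>b l\<bar> \<le> B" "\<And>l. \<bar>c l\<bar> \<le> B"
    and le: "(\<integral>\<^sup>+ s\<in>{0..T}. ennreal ((step_fun K v b s - f s)\<^sup>2) \<partial>lborel) \<le> ennreal (\<eta>\<^sup>2)"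
      "(\<integral>\<^sup>+ s\<in>{0..T}. ennreal ((step_fun K v c s - g s)\<^sup>2) \<partial>lborel) \<le> ennreal (\<eta>\<^sup>2)"
  shows "\<bar>(\<Sum>l<K. b l * c l * (v (Suc l) - v l)) - (LINT s:{0..T}|lborel. f s * g s)\<bar> \<le> B * (2 * T + 2) * \<eta>"
proof -
  define R where "R = restrict_space lborel {0..T}"
  have spR: "space R = {0..T}" by (simp add: R_def space_restrict_space)
  have eR: "emeasure R (space R) = ennreal T"
    using T by (simp add: R_def space_restrict_space emeasure_restrict_space)
  interpret R: finite_measure R by (rule finite_measureI) (simp add: eR)
  have mR: "h \<in> borel_measurable R" if "h \<in> borel_measurable borel" for h :: "real \<Rightarrow> real"
    unfolding R_def using that by (intro measurable_restrict_space1) simp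
  have iR: "integrable R h" if "h \<in> borel_measurable borel" "\<And>s. s \<in> {0..T} \<Longrightarrow> \<bar>h s\<bar> \<le> C" for h and C :: real
    using that by (intro R.integrable_const_bound[of _ C] mR AE_I2) (auto simp: spR)
  have LR: "(LINT s:{0..T}|lborel. h s) = (LINT s|R. h s)" for h :: "real \<Rightarrow> real"
    unfolding R_def set_lebesgue_integral_def by (subst integral_restrict_space) auto
  have NR: "(\<integral>\<^sup>+ s. h s \<partial>R) = (\<integral>\<^sup>+ s\<in>{0..T}. h s \<partial>lborel)" for h
    unfolding R_def by (rule nn_integral_restrict_space) simp
  define p where "p = step_fun K v b"
  define q where "q = step_fun K v c"
  have [measurable]: "p \<in> borel_measurable borel" "q \<in> borel_measurable borel"
    by (simp_all add: p_def q_def)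
  have prod: "step_fun K v (\<lambda>l. b l * c l) s = indicator {0..T} s *\<^sub>R (p s * q s)"
    and pb: "\<bar>p s\<bar> \<le> B" and qb: "\<bar>q s\<bar> \<le> B" for s
  proof -
    have "step_fun K v (\<lambda>l. b l * c l) s = indicator {0..T} s *\<^sub>R (p s * q s) \<and> \<bar>p s\<bar> \<le> B \<and> \<bar>q s\<bar> \<le> B"
    proof (cases "s \<in> {0<..T}")
      case True
      then obtain l where l: "l < K" "v l < s" "s \<le> v (Suc l)"
        using strict_partition_locate[OF v, of s] by auto
      show ?thesis
        unfolding p_def q_def step_fun_eq[OF v l] using bb True by auto
    next
      case False
      show ?thesis
        unfolding p_def q_def step_fun_outside[OF v False] using B by simp
    qed
    then show "step_fun K v (\<lambda>l. b l * c l) s = indicator {0..T} s *\<^sub>R (p s * q s)"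
      "\<bar>p s\<bar> \<le> B" "\<bar>q s\<bar> \<le> B" by blast+
  qed
  have bd: "\<bar>x * y\<bar> \<le> B * B" "\<bar>x - y\<bar> \<le> 2 * B" "(x - y)\<^sup>2 \<le> (2 * B)\<^sup>2"
    if "\<bar>x\<bar> \<le> B" "\<bar>y\<bar> \<le> B" for x y
  proof -
    show "\<bar>x * y\<bar> \<le> B * B" unfolding abs_mult using that B by (intro mult_mono) auto
    show *: "\<bar>x - y\<bar> \<le> 2 * B" using that by linarith
    have "\<bar>x - y\<bar> \<le> \<bar>2 * B\<bar>" using * B by simp
    then show "(x - y)\<^sup>2 \<le> (2 * B)\<^sup>2" by (simp only: abs_le_square_iff)
  qed
  have i1: "integrable R (\<lambda>s. p s * q s)"
    using bd(1) pb qb by (intro iR[of _ "B * B"]) auto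
  have i2: "integrable R (\<lambda>s. f s * g s)"
    using bd(1) fb by (intro iR[of _ "B * B"]) auto
  have i3: "integrable R (\<lambda>s. (p s - f s)\<^sup>2)"
    using bd(3) pb fb by (intro iR[of _ "(2 * B)\<^sup>2"]) auto
  have i4: "integrable R (\<lambda>s. (q s - g s)\<^sup>2)"
    using bd(3) qb fb by (intro iR[of _ "(2 * B)\<^sup>2"]) auto
  have d1: "(LINT s|R. (p s - f s)\<^sup>2) \<le> \<eta>\<^sup>2"
    using le(1) nn_integral_eq_integral[OF i3] by (simp add: NR p_def)
  have d2: "(LINT s|R. (q s - g s)\<^sup>2) \<le> \<eta>\<^sup>2"
    using le(2) nn_integral_eq_integral[OF i4] by (simp add: NR q_def)
  have sumeq: "(\<Sum>l<K. b l * c l * (v (Suc l) - v l)) = (LINT s|R. p s * q s)"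
    unfolding LR[symmetric] set_lebesgue_integral_def prod[symmetric] step_fun_integral(2)[OF v] ..
  have pt: "\<bar>p s * q s - f s * g s\<bar> \<le> B * (2 * \<eta> + (1 / \<eta>) * ((p s - f s)\<^sup>2 + (q s - g s)\<^sup>2))"
    if s: "s \<in> {0..T}" for s
  proof -
    \<comment> \<open>Passes from mean square to mean: values below \<open>\<eta>\<close> cost at
      most \<open>\<eta>\<close>, larger ones at most their square over
      \<open>\<eta>\<close>.\<close>
    have am: "\<bar>x\<bar> \<le> \<eta> + (1 / \<eta>) * x\<^sup>2" for x
    proof (cases "\<bar>x\<bar> \<le> \<eta>")
      case True
      have "0 \<le> (1 / \<eta>) * x\<^sup>2" using \<eta> by simp
      then show ?thesis using True by linarith
    next
      case False
      then have "\<eta> * \<bar>x\<bar> \<le> \<bar>x\<bar> * \<bar>x\<bar>" by (intro mult_right_mono) auto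
      then have "\<bar>x\<bar> \<le> (1 / \<eta>) * x\<^sup>2" using \<eta> by (simp add: field_simps power2_eq_square)
      then show ?thesis using \<eta> by linarith
    qed
    have "p s * q s - f s * g s = (p s - f s) * q s + f s * (q s - g s)"
      by (simp add: algebra_simps)
    then have "\<bar>p s * q s - f s * g s\<bar> \<le> \<bar>p s - f s\<bar> * \<bar>q s\<bar> + \<bar>f s\<bar> * \<bar>q s - g s\<bar>"
      using abs_triangle_ineq[of "(p s - f s) * q s" "f s * (q s - g s)"] by (simp add: abs_mult)
    also have "\<dots> \<le> \<bar>p s - f s\<bar> * B + B * \<bar>q s - g s\<bar>"
      using qb fb(1)[OF s] by (intro add_mono mult_left_mono mult_right_mono) auto
    also have "\<dots> = B * (\<bar>p s - f s\<bar> + \<bar>q s - g s\<bar>)" by (simp add: algebra_simps)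
    also have "\<dots> \<le> B * ((\<eta> + (1 / \<eta>) * (p s - f s)\<^sup>2) + (\<eta> + (1 / \<eta>) * (q s - g s)\<^sup>2))"
      using B by (intro mult_left_mono add_mono am)
    finally show ?thesis by (simp add: algebra_simps)
  qed
  have "\<bar>(\<Sum>l<K. b l * c l * (v (Suc l) - v l)) - (LINT s:{0..T}|lborel. f s * g s)\<bar>
      = \<bar>LINT s|R. p s * q s - f s * g s\<bar>"
    unfolding sumeq LR using i1 i2 by simp
  also have "\<dots> \<le> (LINT s|R. \<bar>p s * q s - f s * g s\<bar>)"
    by (rule integral_abs_bound)
  also have "\<dots> \<le> (LINT s|R. B * (2 * \<eta> + (1 / \<eta>) * ((p s - f s)\<^sup>2 + (q s - g s)\<^sup>2)))"
  proof (rule integral_mono)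
    show "integrable R (\<lambda>s. \<bar>p s * q s - f s * g s\<bar>)" using i1 i2 by simp
    show "integrable R (\<lambda>s. B * (2 * \<eta> + (1 / \<eta>) * ((p s - f s)\<^sup>2 + (q s - g s)\<^sup>2)))"
      using i3 i4 by simp
  qed (use pt spR in auto)
  also have "\<dots> = B * (2 * \<eta> * T + (1 / \<eta>) * ((LINT s|R. (p s - f s)\<^sup>2) + (LINT s|R. (q s - g s)\<^sup>2)))"
  proof -
    have "measure R (space R) = T" using eR T by (simp add: measure_def)
    then show ?thesis using i3 i4 by simp
  qed
  also have "\<dots> \<le> B * (2 * \<eta> * T + (1 / \<eta>) * (\<eta>\<^sup>2 + \<eta>\<^sup>2))"
    using B \<eta> d1 d2 by (intro mult_left_mono add_left_mono add_mono) auto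
  also have "\<dots> = B * (2 * T + 2) * \<eta>"
    using \<eta> by (simp add: field_simps power2_eq_square)
  finally show ?thesis .
qed

context levy_noise
begin

text \<open>By orthogonality the elementary covariances tend to \<open>\<sigma> * T\<close> on the
  diagonal and to 0 off it. Almost sure convergence and Fatou turn the exact elementary formulas
  into upper bounds, also for the squares, so no convergence of fourth moments has to be
  proved.\<close>

lemma stoch_integral_moments:
  fixes f :: "'j \<Rightarrow> real \<Rightarrow> real" and \<zeta> :: "'j \<Rightarrow> 'a \<Rightarrow> real"
  assumes T: "0 < T" and J: "finite J" and B: "0 \<le> B"
    and fm: "\<And>j. j \<in> J \<Longrightarrow> f j \<in> borel_measurable borel"
    and fb: "\<And>j s. j \<in> J \<Longrightarrow> s \<in> {0..T} \<Longrightarrow> \<bar>f j s\<bar> \<le> B"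
    and \<zeta>m: "\<And>j. j \<in> J \<Longrightarrow> \<zeta> j \<in> borel_measurable M"
    and ap: "\<And>j. j \<in> J \<Longrightarrow> \<exists>k u c.
        (\<forall>m::nat. u m (0::nat) = 0 \<and> u m (k m) = T \<and> (\<forall>i<k m. u m i \<le> u m (Suc i))) \<and>
        (\<lambda>m. \<integral>\<^sup>+ s\<in>{0..T}. ennreal ((step_fun (k m) (u m) (c m) s - f j s)\<^sup>2) \<partial>lborel) \<longlonglongrightarrow> 0 \<and>
        (\<lambda>m. \<integral>\<^sup>+ \<omega>. ennreal ((step_integral (k m) (u m) (c m) (\<lambda>t. \<sigma>1 * w t \<omega> + \<sigma>2 * z t \<omega>) - \<zeta> j \<omega>)\<^sup>2) \<partial>M) \<longlonglongrightarrow> 0"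
    and orth: "\<And>i j. i \<in> J \<Longrightarrow> j \<in> J \<Longrightarrow> (LINT s:{0..T}|lborel. f i s * f j s) = (if i = j then T else 0)"
  defines "\<sigma> \<equiv> \<sigma>1\<^sup>2 + \<sigma>2\<^sup>2"
  shows "(\<integral>\<^sup>+ \<omega>. ennreal ((\<Sum>j\<in>J. x j * \<zeta> j \<omega>)\<^sup>2) \<partial>M) \<le> ennreal (\<sigma> * T * (\<Sum>j\<in>J. (x j)\<^sup>2))"
    and "(\<integral>\<^sup>+ \<omega>. ennreal ((\<Sum>j\<in>J. x j * ((\<zeta> j \<omega>)\<^sup>2 - \<sigma> * T))\<^sup>2) \<partial>M)
      \<le> ennreal (2 * (\<sigma> * T)\<^sup>2 * (\<Sum>j\<in>J. (x j)\<^sup>2)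
          + \<sigma>2^4 * (16 * (LINT x|\<nu>. x^4)) * (B^4 * (\<Sum>j\<in>J. \<bar>x j\<bar>)\<^sup>2 * T))"
proof -
  \<comment> \<open>Equal to 4^(-m): summable, which gives almost sure convergence, and a square, as
    \<open>step_inner_product_bound\<close> expects.\<close>
  define \<epsilon> where "\<epsilon> m = ((1/2 :: real) ^ m)\<^sup>2" for m :: nat
  have \<epsilon>0: "0 < \<epsilon> m" for m by (simp add: \<epsilon>_def)
  have \<epsilon>s: "summable \<epsilon>"
  proof -
    have "\<epsilon> = (\<lambda>m. (1/4) ^ m)"
      by (auto simp: \<epsilon>_def power_mult[symmetric] power_mult_distrib fun_eq_iff mult.commute[of _ 2] power_mult power_divide)
    then show ?thesis by (simp add: summable_geometric)
  qed
  define P where "P m K v e g b \<longleftrightarrow> strict_partition K v T \<and> 0 < e \<and> simple_jump_function e g \<and>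
    (\<forall>x. \<bar>g x\<bar> \<le> 2 * \<bar>x\<bar>) \<and> \<bar>(LINT x|\<nu>. (g x)\<^sup>2) - 1\<bar> \<le> \<epsilon> m \<and>
    (\<forall>j\<in>J. \<forall>l. \<bar>b j l\<bar> \<le> B) \<and>
    (\<forall>j\<in>J. (\<integral>\<^sup>+ s\<in>{0..T}. ennreal ((step_fun K v (b j) s - f j s)\<^sup>2) \<partial>lborel) \<le> ennreal (\<epsilon> m)) \<and>
    (\<forall>j\<in>J. (\<integral>\<^sup>+ \<omega>. ennreal ((\<zeta> j \<omega> - elem_sum v K g \<sigma>1 \<sigma>2 (b j) \<omega>)\<^sup>2) \<partial>M) \<le> ennreal (\<epsilon> m))"
    for m :: nat and K :: nat and v :: "nat \<Rightarrow> real" and e :: real and g :: "real \<Rightarrow> real" and b :: "'j \<Rightarrow> nat \<Rightarrow> real"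
  have "\<forall>m. \<exists>K v e g b. P m K v e g b"
  proof
    fix m
    show "\<exists>K v e g b. P m K v e g b"
    proof (rule stoch_integral_approximation[OF T J B \<epsilon>0[of m] fm fb \<zeta>m ap])
      fix K v e g and b :: "'j \<Rightarrow> nat \<Rightarrow> real"
      assume "strict_partition K v T" "0 < e" "simple_jump_function e g"
        "\<And>x. \<bar>g x\<bar> \<le> 2 * \<bar>x\<bar>" "\<bar>(LINT x|\<nu>. (g x)\<^sup>2) - 1\<bar> \<le> \<epsilon> m"
        "\<And>j l. j \<in> J \<Longrightarrow> \<bar>b j l\<bar> \<le> B"
        "\<And>j. j \<in> J \<Longrightarrow> (\<integral>\<^sup>+ s\<in>{0..T}. ennreal ((step_fun K v (b j) s - f j s)\<^sup>2) \<partial>lborel) \<le> ennreal (\<epsilon> m)"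
        "\<And>j. j \<in> J \<Longrightarrow> (\<integral>\<^sup>+ \<omega>. ennreal ((\<zeta> j \<omega> - elem_sum v K g \<sigma>1 \<sigma>2 (b j) \<omega>)\<^sup>2) \<partial>M) \<le> ennreal (\<epsilon> m)"
      then have "P m K v e g b" unfolding P_def by blast
      then show ?thesis by blast
    qed
  qed
  then obtain K v e g b where P: "\<And>m. P m (K m) (v m) (e m) (g m) (b m)"
    unfolding choice_iff by blast
  have v: "strict_partition (K m) (v m) T" and e: "0 < e m" and g: "simple_jump_function (e m) (g m)"
    and gb: "\<bar>g m x\<bar> \<le> 2 * \<bar>x\<bar>" and g2: "\<bar>(LINT x|\<nu>. (g m x)\<^sup>2) - 1\<bar> \<le> \<epsilon> m" for m x
    using P[of m] unfolding P_def by blast+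
  have bb: "\<bar>b m j l\<bar> \<le> B"
    and bs: "(\<integral>\<^sup>+ s\<in>{0..T}. ennreal ((step_fun (K m) (v m) (b m j) s - f j s)\<^sup>2) \<partial>lborel) \<le> ennreal (\<epsilon> m)"
    and b\<zeta>: "(\<integral>\<^sup>+ \<omega>. ennreal ((\<zeta> j \<omega> - elem_sum (v m) (K m) (g m) \<sigma>1 \<sigma>2 (b m j) \<omega>)\<^sup>2) \<partial>M) \<le> ennreal (\<epsilon> m)"
    if "j \<in> J" for m j l
    using P[of m] that unfolding P_def by blast+
  define \<eta> where "\<eta> m j = elem_sum (v m) (K m) (g m) \<sigma>1 \<sigma>2 (b m j)" for m j
  define h where "h m l = v m (Suc l) - v m l" for m l
  define s where "s m = elem_sigma (g m) \<sigma>1 \<sigma>2" for m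
  define D where "D m i j = (\<Sum>l<K m. b m i l * b m j l * h m l)" for m i j
  have v0: "0 \<le> v m 0" for m using v[of m] by (simp add: strict_partition_def)
  have vs: "v m i < v m (Suc i)" if "i < K m" for m i using v[of m] that by (simp add: strict_partition_def)
  have h0: "0 \<le> h m l" if "l < K m" for m l using vs[OF that] by (simp add: h_def)
  have hsum: "(\<Sum>l<K m. h m l) = T" for m
    using sum_lessThan_telescope[of "v m" "K m"] v[of m] by (simp add: h_def strict_partition_def)
  have es: "square_integrable M (elem_sum (v m) (K m) (g m) \<sigma>1 \<sigma>2 a)"
    "expectation (\<lambda>\<omega>. (elem_sum (v m) (K m) (g m) \<sigma>1 \<sigma>2 a \<omega>)\<^sup>2) = s m * (\<Sum>l<K m. (a l)\<^sup>2 * h m l)" for m a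
    unfolding s_def h_def by (rule elem_sum_second_moment[OF v0 vs e g]; assumption)+
  have sum_def: "elem_sum (v m) (K m) (g m) \<sigma>1 \<sigma>2 a \<omega> = (\<Sum>l<K m. a l *
      (\<sigma>1 * (w (v m (Suc l)) \<omega> - w (v m l) \<omega>) + \<sigma>2 * jump_sum (g m) (v m l) (v m (Suc l)) \<omega>))" for m a \<omega>
    by (rule elem_sum_def[OF v0 vs e g])
  have sigma_def: "s m = \<sigma>1\<^sup>2 + \<sigma>2\<^sup>2 * (LINT x|\<nu>. (g m x)\<^sup>2)" for m
    unfolding s_def by (rule elem_sigma_def[OF v0 vs e g])
  have \<eta>m: "\<eta> m j \<in> borel_measurable M" for m j
    unfolding \<eta>_def by (rule square_integrableD(1)[OF es(1)])
  have half: "(\<lambda>m. (1/2) ^ m :: real) \<longlonglongrightarrow> 0" by (rule LIMSEQ_realpow_zero) auto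
  have \<epsilon>lim: "\<epsilon> \<longlonglongrightarrow> 0" using summable_LIMSEQ_zero[OF \<epsilon>s] .
  have "(\<lambda>m. (LINT x|\<nu>. (g m x)\<^sup>2) - 1) \<longlonglongrightarrow> 0"
    by (rule Lim_null_comparison[OF _ \<epsilon>lim]) (use g2 in auto)
  then have "(\<lambda>m. LINT x|\<nu>. (g m x)\<^sup>2) \<longlonglongrightarrow> 1" by (simp add: LIM_zero_iff)
  then have slim: "s \<longlonglongrightarrow> \<sigma>"
    unfolding sigma_def[abs_def] \<sigma>_def by (auto intro!: tendsto_eq_intros)
  have Dlim: "(\<lambda>m. D m i j) \<longlonglongrightarrow> (if i = j then T else 0)" if ij: "i \<in> J" "j \<in> J" for i j
  proof -
    have "\<bar>D m i j - (if i = j then T else 0)\<bar> \<le> B * (2 * T + 2) * (1/2) ^ m" for m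
      unfolding D_def h_def orth[OF ij, symmetric]
      using fm ij fb bb bs
      by (intro step_inner_product_bound[OF T v B]) (auto simp: \<epsilon>_def)
    then have "(\<lambda>m. D m i j - (if i = j then T else 0)) \<longlonglongrightarrow> 0"
      by (intro Lim_null_comparison[OF _ tendsto_mult_right_zero[OF half, of "B * (2 * T + 2)"]]) auto
    then show ?thesis by (simp only: LIM_zero_iff)
  qed
  have conv: "AE \<omega> in M. \<forall>j\<in>J. (\<lambda>m. \<eta> m j \<omega>) \<longlonglongrightarrow> \<zeta> j \<omega>"
  proof (intro AE_finite_allI J)
    fix j assume j: "j \<in> J"
    show "AE \<omega> in M. (\<lambda>m. \<eta> m j \<omega>) \<longlonglongrightarrow> \<zeta> j \<omega>"
      using b\<zeta>[OF j] \<epsilon>s \<epsilon>0 unfolding \<eta>_def[symmetric]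
      by (intro AE_tendsto_of_summable_squares[OF \<eta>m \<zeta>m[OF j]]) (auto simp: less_imp_le)
  qed
  show "(\<integral>\<^sup>+ \<omega>. ennreal ((\<Sum>j\<in>J. x j * \<zeta> j \<omega>)\<^sup>2) \<partial>M) \<le> ennreal (\<sigma> * T * (\<Sum>j\<in>J. (x j)\<^sup>2))"
  proof (rule nn_integral_le_limit)
    show "(\<lambda>\<omega>. (\<Sum>j\<in>J. x j * \<eta> m j \<omega>)\<^sup>2) \<in> borel_measurable M" for m
      using \<eta>m by (intro borel_measurable_power borel_measurable_sum borel_measurable_times) auto
    show "AE \<omega> in M. (\<lambda>m. (\<Sum>j\<in>J. x j * \<eta> m j \<omega>)\<^sup>2) \<longlonglongrightarrow> (\<Sum>j\<in>J. x j * \<zeta> j \<omega>)\<^sup>2"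
      using conv by eventually_elim (intro tendsto_intros, blast)
    show "(\<integral>\<^sup>+ \<omega>. ennreal ((\<Sum>j\<in>J. x j * \<eta> m j \<omega>)\<^sup>2) \<partial>M)
        \<le> ennreal (s m * (\<Sum>i\<in>J. \<Sum>j\<in>J. x i * x j * D m i j))" for m
    proof -
      have lin: "(\<Sum>j\<in>J. x j * \<eta> m j \<omega>) = elem_sum (v m) (K m) (g m) \<sigma>1 \<sigma>2 (\<lambda>l. \<Sum>j\<in>J. x j * b m j l) \<omega>" for \<omega>
        unfolding \<eta>_def sum_def sum_distrib_left sum_distrib_right
        by (subst sum.swap) (simp only: mult.assoc)
      have "(\<Sum>l<K m. (\<Sum>j\<in>J. x j * b m j l)\<^sup>2 * h m l)
          = (\<Sum>l<K m. \<Sum>i\<in>J. \<Sum>j\<in>J. x i * x j * (b m i l * b m j l * h m l))"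
        unfolding power2_eq_square sum_product sum_distrib_right
        by (intro sum.cong refl) (simp add: sum_distrib_left mult_ac)
      also have "\<dots> = (\<Sum>i\<in>J. \<Sum>l<K m. \<Sum>j\<in>J. x i * x j * (b m i l * b m j l * h m l))"
        by (rule sum.swap)
      also have "\<dots> = (\<Sum>i\<in>J. \<Sum>j\<in>J. \<Sum>l<K m. x i * x j * (b m i l * b m j l * h m l))"
        by (intro sum.cong refl sum.swap)
      also have "\<dots> = (\<Sum>i\<in>J. \<Sum>j\<in>J. x i * x j * D m i j)"
        unfolding D_def sum_distrib_left ..
      finally have "s m * (\<Sum>i\<in>J. \<Sum>j\<in>J. x i * x j * D m i j)
          = expectation (\<lambda>\<omega>. (elem_sum (v m) (K m) (g m) \<sigma>1 \<sigma>2 (\<lambda>l. \<Sum>j\<in>J. x j * b m j l) \<omega>)\<^sup>2)"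
        unfolding es(2) by simp
      then show ?thesis
        unfolding lin by (simp only: nn_integral_eq_integral[OF square_integrableD(2)[OF es(1)]] AE_I2 zero_le_power2 order_refl simp_thms)
    qed
    have "(\<lambda>m. s m * (\<Sum>i\<in>J. \<Sum>j\<in>J. x i * x j * D m i j))
        \<longlonglongrightarrow> \<sigma> * (\<Sum>i\<in>J. \<Sum>j\<in>J. x i * x j * (if i = j then T else 0))"
      by (intro tendsto_intros slim Dlim)
    also have "(\<Sum>i\<in>J. \<Sum>j\<in>J. x i * x j * (if i = j then T else 0)) = (\<Sum>i\<in>J. (x i)\<^sup>2 * T)"
    proof (intro sum.cong refl)
      fix i assume "i \<in> J"
      have "(\<Sum>j\<in>J. x i * x j * (if i = j then T else 0)) = (\<Sum>j\<in>J. if i = j then x i * x j * T else 0)"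
        by (intro sum.cong) auto
      also have "\<dots> = (x i)\<^sup>2 * T" using \<open>i \<in> J\<close> J by (simp add: power2_eq_square)
      finally show "(\<Sum>j\<in>J. x i * x j * (if i = j then T else 0)) = (x i)\<^sup>2 * T" .
    qed
    also have "\<sigma> * (\<Sum>i\<in>J. (x i)\<^sup>2 * T) = \<sigma> * T * (\<Sum>j\<in>J. (x j)\<^sup>2)"
      by (simp add: sum_distrib_right[symmetric])
    finally show "(\<lambda>m. s m * (\<Sum>i\<in>J. \<Sum>j\<in>J. x i * x j * D m i j)) \<longlonglongrightarrow> \<sigma> * T * (\<Sum>j\<in>J. (x j)\<^sup>2)" .
  qed
  \<comment> \<open>Bounds the cumulant term uniformly in \<open>m\<close>: 16 is the fourth power
    of the 2 in \<open>2 * \<bar>x\<bar>\<close>, and the coefficients are at most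
    \<open>B\<close>.\<close>
  define Q where "Q = \<sigma>2^4 * (16 * (LINT x|\<nu>. x^4)) * (B^4 * (\<Sum>j\<in>J. \<bar>x j\<bar>)\<^sup>2 * T)"
  show "(\<integral>\<^sup>+ \<omega>. ennreal ((\<Sum>j\<in>J. x j * ((\<zeta> j \<omega>)\<^sup>2 - \<sigma> * T))\<^sup>2) \<partial>M)
      \<le> ennreal (2 * (\<sigma> * T)\<^sup>2 * (\<Sum>j\<in>J. (x j)\<^sup>2) + \<sigma>2^4 * (16 * (LINT x|\<nu>. x^4)) * (B^4 * (\<Sum>j\<in>J. \<bar>x j\<bar>)\<^sup>2 * T))"
    unfolding Q_def[symmetric]
  proof (rule nn_integral_le_limit)
    show "(\<lambda>\<omega>. (\<Sum>j\<in>J. x j * ((\<eta> m j \<omega>)\<^sup>2 - s m * D m j j))\<^sup>2) \<in> borel_measurable M" for m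
      using \<eta>m by (intro borel_measurable_power borel_measurable_sum borel_measurable_times borel_measurable_diff) auto
    show "AE \<omega> in M. (\<lambda>m. (\<Sum>j\<in>J. x j * ((\<eta> m j \<omega>)\<^sup>2 - s m * D m j j))\<^sup>2)
        \<longlonglongrightarrow> (\<Sum>j\<in>J. x j * ((\<zeta> j \<omega>)\<^sup>2 - \<sigma> * T))\<^sup>2"
      using conv
    proof eventually_elim
      case (elim \<omega>)
      have "(\<lambda>m. D m j j) \<longlonglongrightarrow> T" if "j \<in> J" for j using Dlim[OF that that] by simp
      with elim show ?case by (intro tendsto_intros slim) auto
    qed
    show "(\<integral>\<^sup>+ \<omega>. ennreal ((\<Sum>j\<in>J. x j * ((\<eta> m j \<omega>)\<^sup>2 - s m * D m j j))\<^sup>2) \<partial>M)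
        \<le> ennreal (2 * (\<Sum>i\<in>J. \<Sum>j\<in>J. x i * x j * (s m * D m i j)\<^sup>2) + Q)" for m
    proof -
      have qm: "square_integrable M (\<lambda>\<omega>. \<Sum>j\<in>J. x j * ((\<eta> m j \<omega>)\<^sup>2 - s m * D m j j))"
        "expectation (\<lambda>\<omega>. (\<Sum>j\<in>J. x j * ((\<eta> m j \<omega>)\<^sup>2 - s m * D m j j))\<^sup>2)
          \<le> 2 * (\<Sum>i\<in>J. \<Sum>j\<in>J. x i * x j * (s m * D m i j)\<^sup>2)
            + \<sigma>2^4 * (LINT x|\<nu>. (g m x)^4) * (\<Sum>l<K m. (\<Sum>j\<in>J. x j * (b m j l)\<^sup>2)\<^sup>2 * h m l)"
        unfolding \<eta>_def s_def D_def h_def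
        by (rule elem_quadratic_moment[OF v0 vs e g J]; assumption)+
      have G4: "(LINT x|\<nu>. (g m x)^4) \<le> 16 * (LINT x|\<nu>. x^4)"
      proof -
        have "(LINT x|\<nu>. (g m x)^4) \<le> (LINT x|\<nu>. 16 * x^4)"
        proof (rule integral_mono)
          show "integrable \<nu> (\<lambda>x. (g m x)^4)"
            using integral_simple_jump(1)[OF e g, of "\<lambda>x. x^4"] by simp
          show "integrable \<nu> (\<lambda>x. 16 * x^4)" using integrable_fourth_\<nu> by simp
          fix x
          have "\<bar>g m x\<bar>^4 \<le> (2 * \<bar>x\<bar>)^4" by (intro power_mono gb) simp
          then show "(g m x)^4 \<le> 16 * x^4" by (simp add: power_mult_distrib)
        qed
        then show ?thesis by simp
      qed
      have G0: "0 \<le> (LINT x|\<nu>. (g m x)^4)" by simp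
      have R: "(\<Sum>l<K m. (\<Sum>j\<in>J. x j * (b m j l)\<^sup>2)\<^sup>2 * h m l) \<le> B^4 * (\<Sum>j\<in>J. \<bar>x j\<bar>)\<^sup>2 * T"
      proof -
        have "(\<Sum>j\<in>J. x j * (b m j l)\<^sup>2)\<^sup>2 \<le> B^4 * (\<Sum>j\<in>J. \<bar>x j\<bar>)\<^sup>2" for l
        proof -
          have "\<bar>\<Sum>j\<in>J. x j * (b m j l)\<^sup>2\<bar> \<le> (\<Sum>j\<in>J. \<bar>x j\<bar> * B\<^sup>2)"
          proof (rule order_trans[OF sum_abs sum_mono])
            fix j assume "j \<in> J"
            from bb[OF this] have "(b m j l)\<^sup>2 \<le> B\<^sup>2" using B by (simp add: abs_le_square_iff[symmetric])
            then show "\<bar>x j * (b m j l)\<^sup>2\<bar> \<le> \<bar>x j\<bar> * B\<^sup>2"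
              by (simp add: abs_mult mult_left_mono)
          qed
          also have "\<dots> = \<bar>B\<^sup>2 * (\<Sum>j\<in>J. \<bar>x j\<bar>)\<bar>"
            by (simp add: sum_distrib_right[symmetric] sum_nonneg abs_mult mult.commute)
          finally have "(\<Sum>j\<in>J. x j * (b m j l)\<^sup>2)\<^sup>2 \<le> (B\<^sup>2 * (\<Sum>j\<in>J. \<bar>x j\<bar>))\<^sup>2"
            by (simp only: abs_le_square_iff)
          then show ?thesis by (simp add: power_mult_distrib flip: power_mult)
        qed
        then have "(\<Sum>l<K m. (\<Sum>j\<in>J. x j * (b m j l)\<^sup>2)\<^sup>2 * h m l) \<le> (\<Sum>l<K m. (B^4 * (\<Sum>j\<in>J. \<bar>x j\<bar>)\<^sup>2) * h m l)"
          using h0 by (intro sum_mono mult_right_mono) auto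
        also have "\<dots> = B^4 * (\<Sum>j\<in>J. \<bar>x j\<bar>)\<^sup>2 * T"
          unfolding sum_distrib_left[symmetric] hsum ..
        finally show ?thesis .
      qed
      have "\<sigma>2^4 * (LINT x|\<nu>. (g m x)^4) * (\<Sum>l<K m. (\<Sum>j\<in>J. x j * (b m j l)\<^sup>2)\<^sup>2 * h m l) \<le> Q"
        unfolding Q_def
        using G4 G0 R h0 by (intro mult_mono mult_left_mono sum_nonneg mult_nonneg_nonneg) auto
      with qm(2) have "expectation (\<lambda>\<omega>. (\<Sum>j\<in>J. x j * ((\<eta> m j \<omega>)\<^sup>2 - s m * D m j j))\<^sup>2)
          \<le> 2 * (\<Sum>i\<in>J. \<Sum>j\<in>J. x i * x j * (s m * D m i j)\<^sup>2) + Q" by linarith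
      moreover have "(\<integral>\<^sup>+ \<omega>. ennreal ((\<Sum>j\<in>J. x j * ((\<eta> m j \<omega>)\<^sup>2 - s m * D m j j))\<^sup>2) \<partial>M)
          = ennreal (expectation (\<lambda>\<omega>. (\<Sum>j\<in>J. x j * ((\<eta> m j \<omega>)\<^sup>2 - s m * D m j j))\<^sup>2))"
        using square_integrableD(2)[OF qm(1)] by (intro nn_integral_eq_integral) auto
      ultimately show ?thesis by (simp add: ennreal_leI)
    qed
    have "(\<lambda>m. 2 * (\<Sum>i\<in>J. \<Sum>j\<in>J. x i * x j * (s m * D m i j)\<^sup>2) + Q)
        \<longlonglongrightarrow> 2 * (\<Sum>i\<in>J. \<Sum>j\<in>J. x i * x j * (\<sigma> * (if i = j then T else 0))\<^sup>2) + Q"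
      by (intro tendsto_intros slim Dlim)
    also have "(\<Sum>i\<in>J. \<Sum>j\<in>J. x i * x j * (\<sigma> * (if i = j then T else 0))\<^sup>2) = (\<Sum>i\<in>J. (x i)\<^sup>2 * (\<sigma> * T)\<^sup>2)"
    proof (intro sum.cong refl)
      fix i assume "i \<in> J"
      have "(\<Sum>j\<in>J. x i * x j * (\<sigma> * (if i = j then T else 0))\<^sup>2) = (\<Sum>j\<in>J. if i = j then x i * x j * (\<sigma> * T)\<^sup>2 else 0)"
        by (intro sum.cong) auto
      also have "\<dots> = (x i)\<^sup>2 * (\<sigma> * T)\<^sup>2" using \<open>i \<in> J\<close> J by (simp add: power2_eq_square)
      finally show "(\<Sum>j\<in>J. x i * x j * (\<sigma> * (if i = j then T else 0))\<^sup>2) = (x i)\<^sup>2 * (\<sigma> * T)\<^sup>2" .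
    qed
    also have "2 * (\<Sum>i\<in>J. (x i)\<^sup>2 * (\<sigma> * T)\<^sup>2) + Q = 2 * (\<sigma> * T)\<^sup>2 * (\<Sum>j\<in>J. (x j)\<^sup>2) + Q"
      by (simp add: sum_distrib_right[symmetric])
    finally show "(\<lambda>m. 2 * (\<Sum>i\<in>J. \<Sum>j\<in>J. x i * x j * (s m * D m i j)\<^sup>2) + Q)
      \<longlonglongrightarrow> 2 * (\<sigma> * T)\<^sup>2 * (\<Sum>j\<in>J. (x j)\<^sup>2) + Q" .
  qed
qed

end

section \<open>Deterministic comparison of the selected weights with fixed competing weights\<close>

section \<open>The oracle inequality\<close>

text \<open>Completing the square, divided by \<open>a * v\<close>. If \<open>v\<close> vanishes
  then so does \<open>u\<close>, and division by zero gives the correct value 0.\<close>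

lemma two_mult_le_weighted:
  fixes u v a :: real
  assumes "0 \<le> v" "v = 0 \<Longrightarrow> u = 0" "0 < a"
  shows "2 * \<bar>u\<bar> \<le> a * v + (1 / a) * (u\<^sup>2 / v)"
proof (cases "v = 0")
  case False
  then have v: "0 < v" using assms by simp
  have "0 \<le> (a * v - \<bar>u\<bar>)\<^sup>2 / (a * v)" using v assms by simp
  also have "\<dots> = a * v + (1 / a) * (u\<^sup>2 / v) - 2 * \<bar>u\<bar>"
    using v assms by (simp add: power2_diff field_simps power2_eq_square)
  finally show ?thesis by simp
qed (use assms in simp)

context
  fixes I :: "nat set" and th e :: "nat \<Rightarrow> real" and \<tau> :: real
  assumes I: "finite I" and \<tau>: "0 < \<tau>"
begin

text \<open>\<open>th j + e j\<close> is the estimated coefficient and \<open>g j\<close> the amount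
  removed by shrinkage, so the bracket is the shrunken coefficient.\<close>

definition loss :: "(nat \<Rightarrow> real) \<Rightarrow> (nat \<Rightarrow> real) \<Rightarrow> real" where
  "loss l g = (\<Sum>j\<in>I. (l j * (th j + e j - g j) - th j)\<^sup>2)"

text \<open>\<open>h\<close> stands for the estimated noise level per coordinate, an approximation
  of \<open>\<tau>\<close>.\<close>

definition penalised_cost :: "real \<Rightarrow> real \<Rightarrow> (nat \<Rightarrow> real) \<Rightarrow> (nat \<Rightarrow> real) \<Rightarrow> real" where
  "penalised_cost \<delta> h l g = (\<Sum>j\<in>I. (l j)\<^sup>2 * (th j + e j - g j)\<^sup>2)
     - 2 * (\<Sum>j\<in>I. l j * ((th j + e j - g j) * (th j + e j) - h)) + \<delta> * (h * (\<Sum>j\<in>I. (l j)\<^sup>2))"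

definition chaos :: "(nat \<Rightarrow> real) \<Rightarrow> real" where
  "chaos x = (\<Sum>j\<in>I. x j * ((e j)\<^sup>2 - \<tau>))"

definition signal_noise :: "(nat \<Rightarrow> real) \<Rightarrow> real" where
  "signal_noise x = (\<Sum>j\<in>I. x j * th j * e j)"

definition signal_energy :: "(nat \<Rightarrow> real) \<Rightarrow> real" where
  "signal_energy x = (\<Sum>j\<in>I. (x j * th j)\<^sup>2)"

definition penalty :: "(nat \<Rightarrow> real) \<Rightarrow> real" where
  "penalty l = \<tau> * (\<Sum>j\<in>I. (l j)\<^sup>2)"

text \<open>\<open>D\<close> is the set of coordinates on which the shrinkage \<open>g\<close> acts; the weights are 1 there.\<close>

definition shrink_weights :: "(nat \<Rightarrow> real) \<Rightarrow> nat set \<Rightarrow> (nat \<Rightarrow> real) \<Rightarrow> real \<Rightarrow> bool" where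
  "shrink_weights l D g c \<longleftrightarrow> D \<subseteq> I \<and> D \<noteq> {} \<and> (\<forall>j\<in>I. 0 \<le> l j \<and> l j \<le> 1) \<and> (\<forall>j\<in>D. l j = 1) \<and>
     (\<forall>j\<in>I - D. g j = 0) \<and> (\<Sum>j\<in>I. (g j)\<^sup>2) \<le> c\<^sup>2"

text \<open>The cost replaces the unknown product of estimated and true coefficient by an observable
  product minus \<open>h\<close>; the difference is pure noise plus the error
  \<open>\<tau> - h\<close>. The energy of \<open>th\<close> does not depend on the weights and
  cancels in comparisons. Weight 1 on the shrunken coordinates removes \<open>l\<close> from the
  shrinkage term.\<close>

lemma loss_eq_cost:
  assumes "\<And>j. j \<in> I \<Longrightarrow> l j * g j = g j"
  shows "loss l g = penalised_cost \<delta> h l g + (\<Sum>j\<in>I. (th j)\<^sup>2)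
     + 2 * (signal_noise l + chaos l + (\<tau> - h) * (\<Sum>j\<in>I. l j) - (\<Sum>j\<in>I. g j * e j))
     - \<delta> * (h * (\<Sum>j\<in>I. (l j)\<^sup>2))"
proof -
  have "(\<Sum>j\<in>I. (l j * (th j + e j - g j) - th j)\<^sup>2)
    = (\<Sum>j\<in>I. ((l j)\<^sup>2 * (th j + e j - g j)\<^sup>2 - 2 * (l j * ((th j + e j - g j) * (th j + e j) - h))) + (th j)\<^sup>2
       + 2 * (l j * th j * e j + l j * ((e j)\<^sup>2 - \<tau>) + (\<tau> - h) * l j - g j * e j))"
  proof (intro sum.cong refl)
    fix j assume "j \<in> I"
    from assms[OF this] have g: "g j * e j = l j * g j * e j" by simp
    show "(l j * (th j + e j - g j) - th j)\<^sup>2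
      = ((l j)\<^sup>2 * (th j + e j - g j)\<^sup>2 - 2 * (l j * ((th j + e j - g j) * (th j + e j) - h))) + (th j)\<^sup>2
       + 2 * (l j * th j * e j + l j * ((e j)\<^sup>2 - \<tau>) + (\<tau> - h) * l j - g j * e j)"
      unfolding g by (simp add: power2_eq_square algebra_simps)
  qed
  then show ?thesis
    unfolding loss_def penalised_cost_def signal_noise_def chaos_def
    by (simp add: sum.distrib sum_subtractf sum_distrib_left)
qed

context
  fixes l g :: "nat \<Rightarrow> real" and D :: "nat set" and c :: real
  assumes w: "shrink_weights l D g c"
begin

lemma weights: "j \<in> I \<Longrightarrow> 0 \<le> l j" "j \<in> I \<Longrightarrow> l j \<le> 1" "j \<in> D \<Longrightarrow> l j = 1" "j \<in> I - D \<Longrightarrow> g j = 0"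
    "(\<Sum>j\<in>I. (g j)\<^sup>2) \<le> c\<^sup>2" "D \<subseteq> I" "D \<noteq> {}"
  using w unfolding shrink_weights_def by blast+

lemma weight_shrink: "j \<in> I \<Longrightarrow> l j * g j = g j"
  using weights(3,4) by (cases "j \<in> D") auto

lemma finite_D: "finite D" "0 < real (card D)"
  using weights(6,7) I finite_subset by (auto simp: card_gt_0_iff)

lemma card_le_sum_squares: "real (card D) \<le> (\<Sum>j\<in>I. (l j)\<^sup>2)"
proof -
  have "real (card D) = (\<Sum>j\<in>D. (l j)\<^sup>2)" using weights(3) by simp
  also have "\<dots> \<le> (\<Sum>j\<in>I. (l j)\<^sup>2)" using I weights(6) by (intro sum_mono2) auto
  finally show ?thesis .
qed

lemma penalty_pos: "0 < penalty l"
  unfolding penalty_def using \<tau> card_le_sum_squares finite_D by (intro mult_pos_pos) auto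

lemma sum_squares_le: "(\<Sum>j\<in>I. (l j)\<^sup>2) \<le> (\<Sum>j\<in>I. l j)"
  using weights by (intro sum_mono) (auto simp: power2_eq_square mult_left_le)

text \<open>Cauchy-Schwarz bounds the square by \<open>c\<^sup>2\<close> times the noise energy on
  \<open>D\<close>. That energy is its mean \<open>\<tau> * card D\<close> plus a chaos term, and
  the mean is at most the penalty because the weights are 1 on \<open>D\<close>. Splitting with
  weight \<open>\<delta>/8\<close> and bounding the energy by twice the penalty plus the normalised
  square gives \<open>\<delta>/4\<close>.\<close>

lemma shrink_noise_bound:
  assumes \<delta>: "0 < \<delta>"
  shows "2 * \<bar>\<Sum>j\<in>I. g j * e j\<bar>
    \<le> \<delta>/4 * penalty l + \<delta>/8 * ((chaos (indicator D))\<^sup>2 / (\<tau> * card D)) + 8/\<delta> * c\<^sup>2"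
proof -
  define s where "s = (\<Sum>j\<in>D. (e j)\<^sup>2)"
  have s0: "0 \<le> s" by (simp add: s_def sum_nonneg)
  have "(\<Sum>j\<in>I. g j * e j) = (\<Sum>j\<in>D. g j * e j)"
    using weights(4,6) I by (intro sum.mono_neutral_right) auto
  also have "\<bar>\<dots>\<bar>\<^sup>2 \<le> (\<Sum>j\<in>D. (g j)\<^sup>2) * s"
    unfolding s_def using Cauchy_Schwarz_ineq_sum[of g e D] by simp
  also have "(\<Sum>j\<in>D. (g j)\<^sup>2) \<le> c\<^sup>2"
    using weights(5,6) I by (intro order_trans[OF sum_mono2 weights(5)]) auto
  finally have cs: "(\<Sum>j\<in>I. g j * e j)\<^sup>2 \<le> c\<^sup>2 * s"
    using s0 by (simp add: mult_right_mono)
  have z: "(\<Sum>j\<in>I. g j * e j) = 0" if "s = 0" using cs that by simp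
  have "2 * \<bar>\<Sum>j\<in>I. g j * e j\<bar> \<le> \<delta>/8 * s + 8/\<delta> * ((\<Sum>j\<in>I. g j * e j)\<^sup>2 / s)"
    using two_mult_le_weighted[OF s0 z, of "\<delta>/8"] \<delta> by simp
  moreover have "8/\<delta> * ((\<Sum>j\<in>I. g j * e j)\<^sup>2 / s) \<le> 8/\<delta> * c\<^sup>2"
    using cs s0 \<delta> by (intro mult_left_mono) (cases "s = 0", auto simp: field_simps)
  ultimately have 1: "2 * \<bar>\<Sum>j\<in>I. g j * e j\<bar> \<le> \<delta>/8 * s + 8/\<delta> * c\<^sup>2"
    by linarith
  define t where "t = \<tau> * card D"
  have t0: "0 < t" using \<tau> finite_D by (simp add: t_def)
  have ch: "chaos (indicator D) = s - t"
  proof -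
    have "chaos (indicator D) = (\<Sum>j\<in>I. if j \<in> D then (e j)\<^sup>2 - \<tau> else 0)"
      unfolding chaos_def by (intro sum.cong) auto
    also have "\<dots> = (\<Sum>j\<in>I \<inter> D. (e j)\<^sup>2 - \<tau>)" using I by (subst sum.inter_restrict) auto
    also have "I \<inter> D = D" using weights(6) by auto
    finally show ?thesis by (simp add: s_def t_def sum_subtractf mult.commute)
  qed
  define q where "q = (chaos (indicator D))\<^sup>2 / t"
  define y where "y = \<bar>s - t\<bar>"
  have "2 * y \<le> t + q"
    using two_mult_le_weighted[of t "chaos (indicator D)" 1] t0 by (simp add: q_def ch y_def)
  moreover have "0 \<le> q" using t0 by (simp add: q_def)
  moreover have "s - t \<le> y" by (simp add: y_def)
  ultimately have "s \<le> 2 * t + q" using t0 by linarith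
  also have "t \<le> penalty l"
    unfolding t_def penalty_def using \<tau> card_le_sum_squares by simp
  finally have "s \<le> 2 * penalty l + q" by simp
  then have "\<delta>/8 * s \<le> \<delta>/8 * (2 * penalty l + q)"
    using \<delta> by (intro mult_left_mono) auto
  with 1 have "2 * \<bar>\<Sum>j\<in>I. g j * e j\<bar> \<le> \<delta>/4 * penalty l + \<delta>/8 * q + 8/\<delta> * c\<^sup>2"
    by (simp add: algebra_simps)
  then show ?thesis by (simp add: q_def t_def)
qed

text \<open>The penalty is the mean of the variance part of the loss without shrinkage. Undoing the
  shrinkage costs \<open>c\<^sup>2\<close>; what remains is the bias energy \<open>V\<close>, a
  cross term \<open>U\<close> and the fluctuation \<open>W\<close> of the variance part.\<close>

lemma penalty_le_loss:
  "penalty l \<le> 5/3 * loss l g + 7 * c\<^sup>2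
     + 4/3 * ((signal_noise (\<lambda>j. l j * (1 - l j)))\<^sup>2 / signal_energy (\<lambda>j. 1 - l j)
        + (chaos (\<lambda>j. (l j)\<^sup>2))\<^sup>2 / penalty l)"
proof -
  define E0 where "E0 = (\<Sum>j\<in>I. (l j * (th j + e j) - th j)\<^sup>2)"
  define U where "U = signal_noise (\<lambda>j. l j * (1 - l j))"
  define V where "V = signal_energy (\<lambda>j. 1 - l j)"
  define W where "W = chaos (\<lambda>j. (l j)\<^sup>2)"
  have V0: "0 \<le> V" by (simp add: V_def signal_energy_def sum_nonneg)
  have VU: "U = 0" if "V = 0"
  proof -
    have "\<forall>j\<in>I. ((1 - l j) * th j)\<^sup>2 = 0"
      using that I unfolding V_def signal_energy_def by (subst (asm) sum_nonneg_eq_0_iff) auto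
    then have "\<forall>j\<in>I. l j * (1 - l j) * th j * e j = 0" by auto
    then show ?thesis unfolding U_def signal_noise_def by (intro sum.neutral) auto
  qed
  have E0: "(\<Sum>j\<in>I. (l j)\<^sup>2 * (e j)\<^sup>2) = E0 - V + 2 * U"
    unfolding E0_def V_def U_def signal_energy_def signal_noise_def sum_distrib_left
      sum_subtractf[symmetric] sum.distrib[symmetric]
    by (intro sum.cong refl) (simp add: power2_eq_square algebra_simps)
  have P: "penalty l = (\<Sum>j\<in>I. (l j)\<^sup>2 * (e j)\<^sup>2) - W"
    unfolding penalty_def W_def chaos_def sum_distrib_left sum_subtractf[symmetric]
    by (intro sum.cong refl) (simp add: algebra_simps)
  define q where "q = W\<^sup>2 / penalty l"
  define u where "u = U\<^sup>2 / V"
  \<comment> \<open>Weight 1 is chosen so that the bias energy cancels exactly against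
    \<open>- V\<close> in the expansion of \<open>E0\<close>.\<close>
  have U2: "2 * U \<le> V + u"
    using two_mult_le_weighted[OF V0 VU, of 1] by (simp add: u_def)
  have W2: "2 * \<bar>W\<bar> \<le> 1/2 * penalty l + 2 * q"
    using penalty_pos two_mult_le_weighted[of "penalty l" W "1/2"] by (simp add: q_def)
  have E1: "E0 \<le> 5/4 * loss l g + 5 * (\<Sum>j\<in>I. (g j)\<^sup>2)"
    unfolding E0_def loss_def sum_distrib_left sum.distrib[symmetric]
  proof (intro sum_mono)
    fix j assume j: "j \<in> I"
    have eq: "l j * (th j + e j) - th j = (l j * (th j + e j - g j) - th j) + g j"
      using weight_shrink[OF j] by (simp add: algebra_simps)
    have sq: "(a + b)\<^sup>2 \<le> 5/4 * a\<^sup>2 + 5 * b\<^sup>2" for a b :: real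
    proof -
      have "0 \<le> (a/2 - 2 * b)\<^sup>2" by simp
      then show ?thesis by (simp add: power2_diff power2_sum power_divide power_mult_distrib)
    qed
    show "(l j * (th j + e j) - th j)\<^sup>2 \<le> 5/4 * (l j * (th j + e j - g j) - th j)\<^sup>2 + 5 * (g j)\<^sup>2"
      by (subst eq) (rule sq)
  qed
  have "penalty l \<le> E0 + u + \<bar>W\<bar>"
    using P E0 U2 by linarith
  then have "3/4 * penalty l \<le> E0 + u + q" using W2 by linarith
  moreover have "0 \<le> c\<^sup>2" by simp
  \<comment> \<open>Dividing by 3/4: 4/3 * 5/4 = 5/3, and 4/3 * 5 = 20/3, rounded up to 7.\<close>
  moreover have "p \<le> 5/3 * y + 7 * k + 4/3 * (u + q)"
    if "3/4 * p \<le> E0 + u + q" "0 \<le> k" "E0 \<le> 5/4 * y + 5 * x" "x \<le> k" for p y k x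
    using that unfolding distrib_left by linarith
  ultimately have "penalty l \<le> 5/3 * loss l g + 7 * c\<^sup>2 + 4/3 * (u + q)"
    using E1 weights(5) by blast
  then show ?thesis by (simp add: q_def u_def U_def V_def W_def)
qed

end

text \<open>The two estimators differ by \<open>(m j - l j) * (th j + e j)\<close> up to shrinkage,
  so the energy of this difference is bounded by the two losses. Passing from observed to true
  coefficients leaves a cross term \<open>M2\<close>, half of whose bound is absorbed in the left
  side; this doubles the constants.\<close>

lemma signal_energy_le:
  assumes l: "shrink_weights l D g c" and m: "shrink_weights m D' g' c"
  shows "signal_energy (\<lambda>j. m j - l j) \<le> 8 * (loss m g' + loss l g) + 16 * c\<^sup>2
    + 4 * ((signal_noise (\<lambda>j. (m j - l j)\<^sup>2))\<^sup>2 / signal_energy (\<lambda>j. m j - l j))"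
proof -
  define x where "x j = m j - l j" for j
  define M2 where "M2 = signal_noise (\<lambda>j. (x j)\<^sup>2)"
  define X where "X = signal_energy x"
  have X0: "0 \<le> X" by (simp add: X_def signal_energy_def sum_nonneg)
  have XM: "M2 = 0" if "X = 0"
  proof -
    have "\<forall>j\<in>I. (x j * th j)\<^sup>2 = 0"
      using that I unfolding X_def signal_energy_def by (subst (asm) sum_nonneg_eq_0_iff) auto
    then have "\<forall>j\<in>I. (x j)\<^sup>2 * th j * e j = 0" by auto
    then show ?thesis unfolding M2_def signal_noise_def by (intro sum.neutral) auto
  qed
  \<comment> \<open>The nonnegative pure noise part is dropped, so only a cross term linear in the
    noise has to be controlled.\<close>
  have 1: "X \<le> (\<Sum>j\<in>I. (x j * (th j + e j))\<^sup>2) - 2 * M2"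
  proof -
    have "X + 2 * M2 \<le> (\<Sum>j\<in>I. (x j * (th j + e j))\<^sup>2)"
      unfolding X_def M2_def signal_energy_def signal_noise_def sum_distrib_left sum.distrib[symmetric]
    proof (intro sum_mono)
      fix j
      have "0 \<le> (x j * e j)\<^sup>2" by simp
      then show "(x j * th j)\<^sup>2 + 2 * ((x j)\<^sup>2 * th j * e j) \<le> (x j * (th j + e j))\<^sup>2"
        by (simp add: power2_eq_square algebra_simps)
    qed
    then show ?thesis by simp
  qed
  have 2: "2 * \<bar>M2\<bar> \<le> (1/2) * X + (1/(1/2)) * (M2\<^sup>2 / X)"
    using X0 XM by (intro two_mult_le_weighted) auto
  have 3: "(\<Sum>j\<in>I. (x j * (th j + e j))\<^sup>2) \<le> 4 * loss m g' + 4 * loss l g + 4 * (\<Sum>j\<in>I. (g' j)\<^sup>2) + 4 * (\<Sum>j\<in>I. (g j)\<^sup>2)"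
    unfolding loss_def sum_distrib_left sum.distrib[symmetric]
  proof (intro sum_mono)
    fix j assume j: "j \<in> I"
    have el: "l j * (th j + e j - g j) = l j * (th j + e j) - g j"
      by (simp only: right_diff_distrib weight_shrink[OF l j])
    have em: "m j * (th j + e j - g' j) = m j * (th j + e j) - g' j"
      by (simp only: right_diff_distrib weight_shrink[OF m j])
    have eq: "x j * (th j + e j) = (m j * (th j + e j - g' j) - th j) - (l j * (th j + e j - g j) - th j) + g' j - g j"
      unfolding el em x_def by (simp add: algebra_simps)
    have sq: "(a - b + c - d)\<^sup>2 \<le> 4 * a\<^sup>2 + 4 * b\<^sup>2 + 4 * c\<^sup>2 + 4 * d\<^sup>2" for a b c d :: real
    proof -
      have "0 \<le> (a + b)\<^sup>2 + (a - c)\<^sup>2 + (a + d)\<^sup>2 + (b + c)\<^sup>2 + (b - d)\<^sup>2 + (c + d)\<^sup>2" by simp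
      then show ?thesis by (simp add: power2_eq_square algebra_simps)
    qed
    show "(x j * (th j + e j))\<^sup>2 \<le> 4 * (m j * (th j + e j - g' j) - th j)\<^sup>2
       + 4 * (l j * (th j + e j - g j) - th j)\<^sup>2 + 4 * (g' j)\<^sup>2 + 4 * (g j)\<^sup>2"
      unfolding eq by (rule sq)
  qed
  have "X \<le> 8 * (loss m g' + loss l g) + 16 * c\<^sup>2 + 4 * (M2\<^sup>2 / X)"
    using 1 2 3 weights(5)[OF l] weights(5)[OF m] by simp
  then show ?thesis unfolding X_def M2_def x_def[abs_def] .
qed

text \<open>In the quotients below a vanishing denominator forces the numerator to vanish, so \<open>0/0 = 0\<close> is
  the right value.\<close>

definition single_noise :: "(nat \<Rightarrow> real) \<Rightarrow> nat set \<Rightarrow> real" where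
  "single_noise l D = 4 * ((chaos l)\<^sup>2 / penalty l) + (chaos (indicator D))\<^sup>2 / (\<tau> * card D)
     + (signal_noise (\<lambda>j. l j * (1 - l j)))\<^sup>2 / signal_energy (\<lambda>j. 1 - l j)
     + (chaos (\<lambda>j. (l j)\<^sup>2))\<^sup>2 / penalty l"

definition pair_noise :: "(nat \<Rightarrow> real) \<Rightarrow> (nat \<Rightarrow> real) \<Rightarrow> real" where
  "pair_noise l m = 32 * ((signal_noise (\<lambda>j. m j - l j))\<^sup>2 / signal_energy (\<lambda>j. m j - l j))
     + (signal_noise (\<lambda>j. (m j - l j)\<^sup>2))\<^sup>2 / signal_energy (\<lambda>j. m j - l j)"

text \<open>At the selected weights \<open>m\<close> the chaos and shrinkage noise cost
  \<open>\<delta>/2\<close> times the penalty, which is covered by the \<open>-\<delta>\<close>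
  coming from the cost. At \<open>l\<close> these terms add to \<open>\<delta>\<close>, and
  \<open>penalty_le_loss\<close> returns 3/2 * 5/3 = 5/2 of \<open>\<delta>\<close> times the loss.
  The cross term contributes \<open>\<delta>/4\<close> to each loss, whence 11/4 on the right and
  1/4 on the left.\<close>

theorem pathwise_oracle_inequality:
  assumes l: "shrink_weights l D g c" and m: "shrink_weights m D' g' c"
    and \<delta>: "0 < \<delta>" "\<delta> < 1/2"
    and A: "(\<Sum>j\<in>I. l j) \<le> A" "(\<Sum>j\<in>I. m j) \<le> A"
    and min: "penalised_cost \<delta> h m g' \<le> penalised_cost \<delta> h l g"
  shows "(1 - \<delta>/4) * loss m g' \<le> (1 + 11/4 * \<delta>) * loss l g
    + (1 / \<delta>) * (single_noise l D + single_noise m D' + pair_noise l m + 24 * c\<^sup>2 + 3 * (\<bar>h - \<tau>\<bar> * A))"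
proof -
  define a where "a = \<bar>h - \<tau>\<bar> * A"
  have cost: "loss m g' \<le> loss l g
      + 2 * (signal_noise m + chaos m + (\<tau> - h) * (\<Sum>j\<in>I. m j) - (\<Sum>j\<in>I. g' j * e j))
      - 2 * (signal_noise l + chaos l + (\<tau> - h) * (\<Sum>j\<in>I. l j) - (\<Sum>j\<in>I. g j * e j))
      - \<delta> * (h * (\<Sum>j\<in>I. (m j)\<^sup>2)) + \<delta> * (h * (\<Sum>j\<in>I. (l j)\<^sup>2))"
  proof -
    have "loss l g = penalised_cost \<delta> h l g + (\<Sum>j\<in>I. (th j)\<^sup>2)
     + 2 * (signal_noise l + chaos l + (\<tau> - h) * (\<Sum>j\<in>I. l j) - (\<Sum>j\<in>I. g j * e j))
     - \<delta> * (h * (\<Sum>j\<in>I. (l j)\<^sup>2))"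
      by (rule loss_eq_cost) (rule weight_shrink[OF l])
    moreover have "loss m g' = penalised_cost \<delta> h m g' + (\<Sum>j\<in>I. (th j)\<^sup>2)
     + 2 * (signal_noise m + chaos m + (\<tau> - h) * (\<Sum>j\<in>I. m j) - (\<Sum>j\<in>I. g' j * e j))
     - \<delta> * (h * (\<Sum>j\<in>I. (m j)\<^sup>2))"
      by (rule loss_eq_cost) (rule weight_shrink[OF m])
    ultimately show ?thesis using min by linarith
  qed
  have M: "signal_noise m - signal_noise l = signal_noise (\<lambda>j. m j - l j)"
    unfolding signal_noise_def sum_subtractf[symmetric] by (intro sum.cong refl) (simp add: algebra_simps)
  have sm: "\<bar>(\<tau> - h) * y\<bar> \<le> a" if "0 \<le> y" "y \<le> A" for y
    unfolding abs_mult a_def using that by (intro mult_mono) auto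
  have pos: "0 \<le> (\<Sum>j\<in>I. l j)" "0 \<le> (\<Sum>j\<in>I. m j)" "0 \<le> (\<Sum>j\<in>I. (l j)\<^sup>2)" "0 \<le> (\<Sum>j\<in>I. (m j)\<^sup>2)"
    using weights(1)[OF l] weights(1)[OF m] by (auto intro: sum_nonneg)
  note s1 = sm[OF pos(1) A(1)] and s2 = sm[OF pos(2) A(2)]
    and s3 = sm[OF pos(3) order_trans[OF sum_squares_le[OF l] A(1)]]
    and s4 = sm[OF pos(4) order_trans[OF sum_squares_le[OF m] A(2)]]
  have h: "h * y = \<tau> * y - (\<tau> - h) * y" for y by (simp add: algebra_simps)
  have s3': "\<delta> * (h * (\<Sum>j\<in>I. (l j)\<^sup>2)) \<le> \<delta> * penalty l + \<delta> * a"
    unfolding penalty_def distrib_left[symmetric] using s3 \<delta> by (intro mult_left_mono) (auto simp: h)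
  have s4': "- (\<delta> * (h * (\<Sum>j\<in>I. (m j)\<^sup>2))) \<le> - (\<delta> * penalty m) + \<delta> * a"
  proof -
    have "\<delta> * (- (h * (\<Sum>j\<in>I. (m j)\<^sup>2))) \<le> \<delta> * (- penalty m + a)"
      unfolding penalty_def using s4 \<delta> by (intro mult_left_mono) (auto simp: h)
    then show ?thesis by (simp add: algebra_simps)
  qed
  define X where "X = signal_energy (\<lambda>j. m j - l j)"
  define Y where "Y = signal_noise (\<lambda>j. m j - l j)"
  have X0: "0 \<le> X" by (simp add: X_def signal_energy_def sum_nonneg)
  have XY: "Y = 0" if "X = 0"
  proof -
    have "\<forall>j\<in>I. ((m j - l j) * th j)\<^sup>2 = 0"
      using that I unfolding X_def signal_energy_def by (subst (asm) sum_nonneg_eq_0_iff) auto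
    then have "\<forall>j\<in>I. (m j - l j) * th j * e j = 0" by auto
    then show ?thesis unfolding Y_def signal_noise_def by (intro sum.neutral) auto
  qed
  define n1 where "n1 = (chaos l)\<^sup>2 / penalty l"
  define n1' where "n1' = (chaos m)\<^sup>2 / penalty m"
  define n3 where "n3 = (chaos (indicator D))\<^sup>2 / (\<tau> * card D)"
  define n3' where "n3' = (chaos (indicator D'))\<^sup>2 / (\<tau> * card D')"
  define n4 where "n4 = (signal_noise (\<lambda>j. l j * (1 - l j)))\<^sup>2 / signal_energy (\<lambda>j. 1 - l j)"
  define n4' where "n4' = (signal_noise (\<lambda>j. m j * (1 - m j)))\<^sup>2 / signal_energy (\<lambda>j. 1 - m j)"
  define n2 where "n2 = (chaos (\<lambda>j. (l j)\<^sup>2))\<^sup>2 / penalty l"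
  define n2' where "n2' = (chaos (\<lambda>j. (m j)\<^sup>2))\<^sup>2 / penalty m"
  define n5 where "n5 = Y\<^sup>2 / X"
  define n6 where "n6 = (signal_noise (\<lambda>j. (m j - l j)\<^sup>2))\<^sup>2 / X"
  define P where "P = penalty l"
  define P' where "P' = penalty m"
  define E where "E = loss l g"
  define E' where "E' = loss m g'"
  have P0: "0 < P" "0 < P'" using penalty_pos[OF l] penalty_pos[OF m] by (simp_all add: P_def P'_def)
  have nn: "0 \<le> n1" "0 \<le> n1'" "0 \<le> n2" "0 \<le> n2'" "0 \<le> n3" "0 \<le> n3'" "0 \<le> n4" "0 \<le> n4'" "0 \<le> n5" "0 \<le> n6"
    using P0 X0 \<tau>
    by (simp_all add: n1_def n1'_def n2_def n2'_def n3_def n3'_def n4_def n4'_def n5_def n6_def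
        P_def[symmetric] P'_def[symmetric] signal_energy_def sum_nonneg)
  have E0: "0 \<le> E" "0 \<le> E'" by (simp_all add: E_def E'_def loss_def sum_nonneg)
  have a0: "0 \<le> a" using s1 by linarith
  have c0: "0 \<le> c\<^sup>2" by simp
  \<comment> \<open>The energy \<open>X\<close> is at most 8 times the two losses plus noise, so the
    weight \<open>\<delta>/32\<close> leaves exactly \<open>\<delta>/4\<close> on each loss.\<close>
  have b1: "2 * \<bar>Y\<bar> \<le> (\<delta>/32) * X + (1/(\<delta>/32)) * n5"
    unfolding n5_def using X0 XY \<delta> by (intro two_mult_le_weighted) auto
  have b2: "X \<le> 8 * (E' + E) + 16 * c\<^sup>2 + 4 * n6"
    using signal_energy_le[OF l m] by (simp add: X_def n6_def E_def E'_def)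
  have b3: "2 * \<bar>chaos l\<bar> \<le> (\<delta>/4) * P + (1/(\<delta>/4)) * n1"
    unfolding n1_def P_def[symmetric] using P0 \<delta> by (intro two_mult_le_weighted) auto
  have b4: "2 * \<bar>chaos m\<bar> \<le> (\<delta>/4) * P' + (1/(\<delta>/4)) * n1'"
    unfolding n1'_def P'_def[symmetric] using P0 \<delta> by (intro two_mult_le_weighted) auto
  have b5: "2 * \<bar>\<Sum>j\<in>I. g j * e j\<bar> \<le> \<delta>/4 * P + \<delta>/8 * n3 + 8/\<delta> * c\<^sup>2"
    using shrink_noise_bound[OF l \<delta>(1)] by (simp add: P_def n3_def)
  have b6: "2 * \<bar>\<Sum>j\<in>I. g' j * e j\<bar> \<le> \<delta>/4 * P' + \<delta>/8 * n3' + 8/\<delta> * c\<^sup>2"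
    using shrink_noise_bound[OF m \<delta>(1)] by (simp add: P'_def n3'_def)
  have b7: "P \<le> 5/3 * E + 7 * c\<^sup>2 + 4/3 * (n4 + n2)"
    using penalty_le_loss[OF l] by (simp add: P_def E_def n4_def n2_def)
  have "E' \<le> E + 2 * \<bar>Y\<bar> + 2 * \<bar>chaos l\<bar> + 2 * \<bar>chaos m\<bar> + 2 * \<bar>\<Sum>j\<in>I. g j * e j\<bar> + 2 * \<bar>\<Sum>j\<in>I. g' j * e j\<bar>
      + 4 * a + (\<delta> * P + \<delta> * a) + (- (\<delta> * P') + \<delta> * a)"
  proof -
    note ab = abs_ge_self[of Y] abs_ge_minus_self[of "chaos l"] abs_ge_self[of "chaos m"]
      abs_ge_self[of "\<Sum>j\<in>I. g j * e j"] abs_ge_minus_self[of "\<Sum>j\<in>I. g' j * e j"]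
      abs_le_D2[OF s1] abs_le_D1[OF s2]
    have "E' \<le> E + 2 * (signal_noise m - signal_noise l) + 2 * chaos m - 2 * chaos l
        + 2 * ((\<tau> - h) * (\<Sum>j\<in>I. m j)) - 2 * ((\<tau> - h) * (\<Sum>j\<in>I. l j))
        - 2 * (\<Sum>j\<in>I. g' j * e j) + 2 * (\<Sum>j\<in>I. g j * e j)
        - \<delta> * (h * (\<Sum>j\<in>I. (m j)\<^sup>2)) + \<delta> * (h * (\<Sum>j\<in>I. (l j)\<^sup>2))"
      using cost unfolding E_def E'_def by (simp only: algebra_simps)
    then show ?thesis
      using ab s3' s4' unfolding M Y_def[symmetric] P_def[symmetric] P'_def[symmetric]
      by linarith
  qed
  also have "\<dots> \<le> E + ((\<delta>/32) * X + 32/\<delta> * n5) + ((\<delta>/4) * P + 4/\<delta> * n1) + ((\<delta>/4) * P' + 4/\<delta> * n1')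
      + (\<delta>/4 * P + \<delta>/8 * n3 + 8/\<delta> * c\<^sup>2) + (\<delta>/4 * P' + \<delta>/8 * n3' + 8/\<delta> * c\<^sup>2)
      + 4 * a + (\<delta> * P + \<delta> * a) + (- (\<delta> * P') + \<delta> * a)"
    using b1 b3 b4 b5 b6 by (intro add_mono order_refl) simp_all
  finally have m1: "\<delta> * E' \<le> \<delta> * (E + ((\<delta>/32) * X + 32/\<delta> * n5) + ((\<delta>/4) * P + 4/\<delta> * n1) + ((\<delta>/4) * P' + 4/\<delta> * n1')
      + (\<delta>/4 * P + \<delta>/8 * n3 + 8/\<delta> * c\<^sup>2) + (\<delta>/4 * P' + \<delta>/8 * n3' + 8/\<delta> * c\<^sup>2)
      + 4 * a + (\<delta> * P + \<delta> * a) + (- (\<delta> * P') + \<delta> * a))"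
    using \<delta> by (intro mult_left_mono) auto
  \<comment> \<open>The inequality has been multiplied by \<open>\<delta>\<close> to clear all
    quotients; with \<open>dd\<close> at most 1/4 the mixed coefficients are then rounded to
    numbers.\<close>
  define dd where "dd = \<delta> * \<delta>"
  have dd: "0 < dd" "dd \<le> 1/4"
    using \<delta> mult_mono[of \<delta> "1/2" \<delta> "1/2"] by (simp_all add: dd_def)
  have "\<delta> * E' \<le> \<delta> * E + dd/32 * X + 32 * n5 + dd * 3/2 * P + 4 * n1 - dd/2 * P' + 4 * n1'
      + dd/8 * n3 + dd/8 * n3' + 16 * c\<^sup>2 + (4 * \<delta> + 2 * dd) * a"
  proof -
    have d: "\<delta> * (k/\<delta> * y) = k * y" for k y using \<delta> by simp
    show ?thesis
      using m1 unfolding distrib_left d dd_def by (simp add: algebra_simps)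
  qed
  also have "\<dots> \<le> \<delta> * E + dd/32 * (8 * (E' + E) + 16 * c\<^sup>2 + 4 * n6) + 32 * n5
      + dd * 3/2 * (5/3 * E + 7 * c\<^sup>2 + 4/3 * (n4 + n2)) + 4 * n1 + 4 * n1'
      + n3 + n3' + 16 * c\<^sup>2 + 3 * a"
  proof -
    have "dd/32 * X \<le> dd/32 * (8 * (E' + E) + 16 * c\<^sup>2 + 4 * n6)"
      using b2 dd by (intro mult_left_mono) auto
    moreover have "dd * 3/2 * P \<le> dd * 3/2 * (5/3 * E + 7 * c\<^sup>2 + 4/3 * (n4 + n2))"
      using b7 dd by (intro mult_left_mono) auto
    \<comment> \<open>The penalty of the selected weights ends up with coefficient 1/4 + 1/4 - 1 =
      -1/2 and can be discarded.\<close>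
    moreover have "0 \<le> dd/2 * P'" using dd P0 by simp
    moreover have "dd/8 * n3 \<le> 1 * n3" "dd/8 * n3' \<le> 1 * n3'"
      using dd nn by (intro mult_right_mono; simp)+
    moreover have "(4 * \<delta> + 2 * dd) * a \<le> 3 * a"
      using dd a0 \<delta> by (intro mult_right_mono) auto
    ultimately show ?thesis by linarith
  qed
  also have "\<dots> = \<delta> * E + dd/4 * E' + dd * (11/4) * E + (dd * 11 + 16) * c\<^sup>2 + dd/8 * n6 + 32 * n5
      + dd * 2 * n4 + dd * 2 * n2 + 4 * n1 + 4 * n1' + n3 + n3' + 3 * a"
    by (simp add: algebra_simps)
  also have "\<dots> \<le> \<delta> * E + dd/4 * E' + dd * (11/4) * E + 24 * c\<^sup>2 + n6 + 32 * n5
      + n4 + n2 + 4 * n1 + 4 * n1' + n3 + n3' + 3 * a + n4' + n2'"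
  proof -
    have "(dd * 11 + 16) * c\<^sup>2 \<le> 24 * c\<^sup>2" using dd by (intro mult_right_mono) auto
    moreover have "dd/8 * n6 \<le> 1 * n6" "dd * 2 * n4 \<le> 1 * n4" "dd * 2 * n2 \<le> 1 * n2"
      using dd nn by (intro mult_right_mono; simp)+
    ultimately show ?thesis using nn by linarith
  qed
  finally have "\<delta> * ((1 - \<delta>/4) * E') \<le> \<delta> * ((1 + 11/4 * \<delta>) * E)
      + (single_noise l D + single_noise m D' + pair_noise l m + 24 * c\<^sup>2 + 3 * a)"
    unfolding single_noise_def pair_noise_def dd_def n1_def n1'_def n2_def n2'_def n3_def n3'_def
      n4_def n4'_def n5_def n6_def X_def Y_def
    by (simp add: algebra_simps)
  then have "(1 - \<delta>/4) * E' \<le> (1 + 11/4 * \<delta>) * E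
      + (1/\<delta>) * (single_noise l D + single_noise m D' + pair_noise l m + 24 * c\<^sup>2 + 3 * a)"
    using \<delta>(1) by (simp add: field_simps)
  then show ?thesis by (simp add: E_def E'_def a_def)
qed

end

section \<open>Parseval identities, periodicity and decay of trigonometric coefficients\<close>

section \<open>Integrals over the unit interval\<close>

definition segment_measure :: "real \<Rightarrow> real measure" where
  "segment_measure T = restrict_space lborel {0..T}"

lemma space_segment_measure [simp]: "space (segment_measure T) = {0..T}"
  by (simp add: segment_measure_def space_restrict_space)

lemma measurable_segment_measure:
  "h \<in> borel_measurable borel \<Longrightarrow> h \<in> borel_measurable (segment_measure T)"
  unfolding segment_measure_def by (intro measurable_restrict_space1) simp

lemma emeasure_segment_measure: "0 \<le> T \<Longrightarrow> emeasure (segment_measure T) {0..T} = ennreal T"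
  by (simp add: segment_measure_def emeasure_restrict_space)

lemma measure_segment_measure: "0 \<le> T \<Longrightarrow> measure (segment_measure T) {0..T} = T"
  by (simp add: measure_def emeasure_segment_measure)

lemma finite_segment_measure: "0 \<le> T \<Longrightarrow> finite_measure (segment_measure T)"
  by (rule finite_measureI) (simp add: emeasure_segment_measure)

lemma integrable_interval_bounded:
  fixes h :: "real \<Rightarrow> real"
  assumes "0 \<le> T" "h \<in> borel_measurable borel" "\<And>s. s \<in> {0..T} \<Longrightarrow> \<bar>h s\<bar> \<le> C"
  shows "integrable (segment_measure T) h"
proof -
  interpret finite_measure "segment_measure T" by (rule finite_segment_measure) fact
  show ?thesis
    using assms by (intro integrable_const_bound[of _ C] measurable_segment_measure AE_I2) auto
qed

lemma set_integral_interval: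
  fixes h :: "real \<Rightarrow> real"
  shows "(LINT s:{0..T}|lborel. h s) = (LINT s|segment_measure T. h s)"
  unfolding segment_measure_def set_lebesgue_integral_def by (subst integral_restrict_space) auto

lemma nn_integral_interval:
  "(\<integral>\<^sup>+ s\<in>{0..T}. h s \<partial>lborel) = (\<integral>\<^sup>+ s. h s \<partial>segment_measure T)"
  unfolding segment_measure_def by (rule nn_integral_restrict_space[symmetric]) simp

text \<open>Nonnegativity of a variance: \<open>m\<close> is the mean of \<open>h\<close> over the
  interval.\<close>

lemma square_integral_interval_le:
  fixes h :: "real \<Rightarrow> real"
  assumes "0 < T" "h \<in> borel_measurable borel" "\<And>s. s \<in> {0..T} \<Longrightarrow> \<bar>h s\<bar> \<le> C"
  shows "(LINT s|segment_measure T. h s)\<^sup>2 \<le> T * (LINT s|segment_measure T. (h s)\<^sup>2)"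
proof -
  let ?R = "segment_measure T"
  have i1: "integrable ?R h" using assms by (intro integrable_interval_bounded) auto
  have i2: "integrable ?R (\<lambda>s. (h s)\<^sup>2)"
  proof (rule integrable_interval_bounded[where C="C\<^sup>2"])
    fix s assume "s \<in> {0..T}"
    then have "\<bar>h s\<bar> \<le> \<bar>C\<bar>" using assms(3)[of s] by linarith
    then show "\<bar>(h s)\<^sup>2\<bar> \<le> C\<^sup>2" by (simp add: abs_le_square_iff)
  qed (use assms in auto)
  define m where "m = (LINT s|?R. h s) / T"
  interpret finite_measure ?R by (rule finite_segment_measure) (use assms in simp)
  have "0 \<le> (LINT s|?R. (h s - m)\<^sup>2)" by simp
  also have "\<dots> = (LINT s|?R. (h s)\<^sup>2 - 2 * m * h s + m\<^sup>2)"
    by (simp add: power2_diff algebra_simps)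
  also have "\<dots> = (LINT s|?R. (h s)\<^sup>2) - 2 * m * (LINT s|?R. h s) + m\<^sup>2 * T"
    using i1 i2 assms(1) by (simp add: measure_segment_measure)
  finally show ?thesis using assms(1) by (simp add: m_def field_simps power2_eq_square)
qed

text \<open>A finite, bounded part of a basis, general enough for both the basis of the estimators
  and the trigonometric one; boundedness makes all products integrable.\<close>

definition orthonormal_system :: "'i set \<Rightarrow> ('i \<Rightarrow> real \<Rightarrow> real) \<Rightarrow> bool" where
  "orthonormal_system F \<psi> \<longleftrightarrow> finite F \<and> (\<forall>j\<in>F. \<psi> j \<in> borel_measurable borel) \<and>
     (\<exists>C. \<forall>j\<in>F. \<forall>s\<in>{0..1}. \<bar>\<psi> j s\<bar> \<le> C) \<and>
     (\<forall>i\<in>F. \<forall>j\<in>F. (LINT s:{0..1}|lborel. \<psi> i s * \<psi> j s) = (if i = j then 1 else 0))"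

text \<open>Pythagoras: the second bracket is the energy of \<open>h\<close> outside the span and
  does not depend on the coefficients \<open>a\<close>, so it is common to all estimators. Choosing
  \<open>a = c\<close> gives Bessel's inequality.\<close>

lemma orthonormal_expansion:
  fixes h :: "real \<Rightarrow> real"
  assumes on: "orthonormal_system F \<psi>"
    and h: "h \<in> borel_measurable borel" "\<And>s. s \<in> {0..1} \<Longrightarrow> \<bar>h s\<bar> \<le> H"
  defines "c \<equiv> \<lambda>j. LINT s:{0..1}|lborel. h s * \<psi> j s"
  shows "(\<integral>\<^sup>+ s\<in>{0..1}. ennreal (((\<Sum>j\<in>F. a j * \<psi> j s) - h s)\<^sup>2) \<partial>lborel)
      = ennreal ((\<Sum>j\<in>F. (a j - c j)\<^sup>2) + ((LINT s:{0..1}|lborel. (h s)\<^sup>2) - (\<Sum>j\<in>F. (c j)\<^sup>2)))"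
    and "(\<Sum>j\<in>F. (c j)\<^sup>2) \<le> (LINT s:{0..1}|lborel. (h s)\<^sup>2)"
proof -
  let ?R = "segment_measure 1"
  have F: "finite F" and \<psi>: "\<And>j. j \<in> F \<Longrightarrow> \<psi> j \<in> borel_measurable borel"
    using on by (auto simp: orthonormal_system_def)
  obtain C0 where C0: "\<And>j s. j \<in> F \<Longrightarrow> s \<in> {0..1} \<Longrightarrow> \<bar>\<psi> j s\<bar> \<le> C0"
    using on unfolding orthonormal_system_def by blast
  define C where "C = max 0 C0"
  have C: "0 \<le> C" "\<And>j s. j \<in> F \<Longrightarrow> s \<in> {0..1} \<Longrightarrow> \<bar>\<psi> j s\<bar> \<le> C"
    using C0 by (auto simp: C_def max.coboundedI2)
  have H: "0 \<le> H" using h(2)[of 0] by simp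
  have i1: "integrable ?R (\<lambda>s. \<psi> i s * \<psi> j s)" if "i \<in> F" "j \<in> F" for i j
  proof (rule integrable_interval_bounded[where C="C * C"])
    show "\<bar>\<psi> i s * \<psi> j s\<bar> \<le> C * C" if "s \<in> {0..1}" for s
      unfolding abs_mult using C(1) C(2)[OF \<open>i \<in> F\<close> that] C(2)[OF \<open>j \<in> F\<close> that] by (intro mult_mono) auto
  qed (use \<psi> that in auto)
  have i2: "integrable ?R (\<lambda>s. h s * \<psi> j s)" if "j \<in> F" for j
  proof (rule integrable_interval_bounded[where C="H * C"])
    show "\<bar>h s * \<psi> j s\<bar> \<le> H * C" if "s \<in> {0..1}" for s
      unfolding abs_mult using H h(2)[OF that] C(2)[OF \<open>j \<in> F\<close> that] by (intro mult_mono) auto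
  qed (use \<psi> h that in auto)
  have i3: "integrable ?R (\<lambda>s. (h s)\<^sup>2)"
  proof (rule integrable_interval_bounded[where C="H\<^sup>2"])
    fix s :: real assume "s \<in> {0..1}"
    then have "\<bar>h s\<bar> \<le> \<bar>H\<bar>" using h(2)[of s] by linarith
    then show "\<bar>(h s)\<^sup>2\<bar> \<le> H\<^sup>2" by (simp add: abs_le_square_iff)
  qed (use h in auto)
  have orth: "(LINT s|?R. \<psi> i s * \<psi> j s) = (if i = j then 1 else 0)" if "i \<in> F" "j \<in> F" for i j
    using on that unfolding orthonormal_system_def set_integral_interval by blast
  have c: "(LINT s|?R. h s * \<psi> j s) = c j" for j
    unfolding c_def set_integral_interval ..
  have ex: "integrable ?R (\<lambda>s. ((\<Sum>j\<in>F. a j * \<psi> j s) - h s)\<^sup>2) \<and>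
     (LINT s|?R. ((\<Sum>j\<in>F. a j * \<psi> j s) - h s)\<^sup>2)
      = (\<Sum>j\<in>F. (a j - c j)\<^sup>2) + ((LINT s|?R. (h s)\<^sup>2) - (\<Sum>j\<in>F. (c j)\<^sup>2))" for a
  proof -
    have eq: "((\<Sum>j\<in>F. a j * \<psi> j s) - h s)\<^sup>2 = (\<Sum>i\<in>F. \<Sum>j\<in>F. (a i * a j) * (\<psi> i s * \<psi> j s))
        - (\<Sum>j\<in>F. (2 * a j) * (h s * \<psi> j s)) + (h s)\<^sup>2" for s
    proof -
      have "(\<Sum>j\<in>F. a j * \<psi> j s)\<^sup>2 = (\<Sum>i\<in>F. \<Sum>j\<in>F. (a i * a j) * (\<psi> i s * \<psi> j s))"
        unfolding power2_eq_square sum_product by (intro sum.cong refl) (simp add: mult_ac)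
      moreover have "2 * (\<Sum>j\<in>F. a j * \<psi> j s) * h s = (\<Sum>j\<in>F. (2 * a j) * (h s * \<psi> j s))"
        unfolding sum_distrib_left sum_distrib_right by (intro sum.cong refl) (simp add: mult_ac)
      ultimately show ?thesis by (simp add: power2_diff)
    qed
    have I1: "integrable ?R (\<lambda>s. \<Sum>i\<in>F. \<Sum>j\<in>F. (a i * a j) * (\<psi> i s * \<psi> j s))"
      using i1 by (intro Bochner_Integration.integrable_sum integrable_mult_right) auto
    have I2: "integrable ?R (\<lambda>s. \<Sum>j\<in>F. (2 * a j) * (h s * \<psi> j s))"
      using i2 by (intro Bochner_Integration.integrable_sum integrable_mult_right) auto
    have E1: "(LINT s|?R. (\<Sum>i\<in>F. \<Sum>j\<in>F. (a i * a j) * (\<psi> i s * \<psi> j s))) = (\<Sum>j\<in>F. (a j)\<^sup>2)"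
    proof -
      have "(LINT s|?R. (\<Sum>i\<in>F. \<Sum>j\<in>F. (a i * a j) * (\<psi> i s * \<psi> j s)))
        = (\<Sum>i\<in>F. LINT s|?R. (\<Sum>j\<in>F. (a i * a j) * (\<psi> i s * \<psi> j s)))"
        using i1 by (intro Bochner_Integration.integral_sum Bochner_Integration.integrable_sum integrable_mult_right) auto
      also have "\<dots> = (\<Sum>i\<in>F. \<Sum>j\<in>F. LINT s|?R. (a i * a j) * (\<psi> i s * \<psi> j s))"
        using i1 by (intro sum.cong refl Bochner_Integration.integral_sum integrable_mult_right) auto
      also have "\<dots> = (\<Sum>i\<in>F. \<Sum>j\<in>F. if i = j then a i * a j else 0)"
        by (intro sum.cong refl) (simp add: orth)
      also have "\<dots> = (\<Sum>j\<in>F. (a j)\<^sup>2)"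
        using F by (intro sum.cong refl) (simp add: power2_eq_square)
      finally show ?thesis .
    qed
    have E2: "(LINT s|?R. (\<Sum>j\<in>F. (2 * a j) * (h s * \<psi> j s))) = (\<Sum>j\<in>F. 2 * a j * c j)"
    proof -
      have "(LINT s|?R. (\<Sum>j\<in>F. (2 * a j) * (h s * \<psi> j s))) = (\<Sum>j\<in>F. LINT s|?R. (2 * a j) * (h s * \<psi> j s))"
        using i2 by (intro Bochner_Integration.integral_sum integrable_mult_right) auto
      then show ?thesis by (simp add: c)
    qed
    have "(\<Sum>j\<in>F. (a j)\<^sup>2) - (\<Sum>j\<in>F. 2 * a j * c j) = (\<Sum>j\<in>F. (a j - c j)\<^sup>2) - (\<Sum>j\<in>F. (c j)\<^sup>2)"
      unfolding sum_subtractf[symmetric] by (intro sum.cong refl) (simp add: power2_diff)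
    then show ?thesis
      unfolding eq using I1 I2 i3 E1 E2 by simp
  qed
  show "(\<integral>\<^sup>+ s\<in>{0..1}. ennreal (((\<Sum>j\<in>F. a j * \<psi> j s) - h s)\<^sup>2) \<partial>lborel)
      = ennreal ((\<Sum>j\<in>F. (a j - c j)\<^sup>2) + ((LINT s:{0..1}|lborel. (h s)\<^sup>2) - (\<Sum>j\<in>F. (c j)\<^sup>2)))"
    unfolding nn_integral_interval set_integral_interval using ex[of a]
    by (subst nn_integral_eq_integral) auto
  have "0 \<le> (LINT s|?R. ((\<Sum>j\<in>F. c j * \<psi> j s) - h s)\<^sup>2)" by simp
  then show "(\<Sum>j\<in>F. (c j)\<^sup>2) \<le> (LINT s:{0..1}|lborel. (h s)\<^sup>2)"
    unfolding set_integral_interval using ex[of c] by simp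
qed

lemma periodic_add_nat:
  assumes "\<And>x. f (x + 1) = (f x :: real)"
  shows "f (x + real n) = f x"
proof (induction n)
  case (Suc n)
  then show ?case using assms[of "x + real n"] by (simp add: add_ac)
qed simp

lemma periodic_bounded:
  fixes f :: "real \<Rightarrow> real"
  assumes "\<And>x. f (x + 1) = f x" "\<And>x. x \<in> {0..1} \<Longrightarrow> \<bar>f x\<bar> \<le> C" "0 \<le> x"
  shows "\<bar>f x\<bar> \<le> C"
proof -
  define n where "n = nat \<lfloor>x\<rfloor>"
  have n: "real n = of_int \<lfloor>x\<rfloor>" using assms(3) by (simp add: n_def)
  then have "0 \<le> x - real n" "x - real n \<le> 1" by linarith+
  then have "x - real n \<in> {0..1}" by simp
  then have "\<bar>f (x - real n)\<bar> \<le> C" by (rule assms(2))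
  moreover have "f (x - real n + real n) = f (x - real n)" by (rule periodic_add_nat[where f=f]) (rule assms(1))
  ultimately show ?thesis by simp
qed

lemma set_integral_Ioc_Icc:
  fixes f :: "real \<Rightarrow> real"
  assumes [measurable]: "f \<in> borel_measurable borel"
  shows "(LINT s:{0..T}|lborel. f s) = (LINT s|lborel. indicator {0<..T} s * f s)"
  unfolding set_lebesgue_integral_def
proof (rule integral_cong_AE)
  show "AE s in lborel. indicator {0..T} s *\<^sub>R f s = indicator {0<..T} s * f s"
    using AE_lborel_singleton[of 0] by eventually_elim (auto split: split_indicator)
qed measurable

text \<open>Half-open unit cells tile the interval, and each is a translate of the first.\<close>

lemma periodic_integral:
  fixes f :: "real \<Rightarrow> real"
  assumes f [measurable]: "f \<in> borel_measurable borel" and per: "\<And>x. f (x + 1) = f x"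
    and b: "\<And>x. x \<in> {0..1} \<Longrightarrow> \<bar>f x\<bar> \<le> C"
  shows "(LINT s:{0..real n}|lborel. f s) = real n * (LINT s:{0..1}|lborel. f s)"
proof -
  define I where "I m = (LINT s|lborel. indicator {0<..real m} s * f s)" for m
  have pb: "\<bar>f x\<bar> \<le> C" if "0 \<le> x" for x
    by (rule periodic_bounded[where f=f]) (use per b that in auto)
  have C: "0 \<le> C" using b[of 0] by simp
  have i: "integrable lborel (\<lambda>s. indicator {x<..y} s * f s)" if "0 \<le> x" "x \<le> y" for x y :: real
  proof (rule Bochner_Integration.integrable_bound)
    show "integrable lborel (\<lambda>s. C * indicator {x<..y} s :: real)"
      using that by (intro integrable_mult_right integrable_real_indicator) auto
    show "AE s in lborel. norm (indicator {x<..y} s * f s) \<le> norm (C * indicator {x<..y} s)"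
      using pb C that by (intro AE_I2) (auto split: split_indicator)
  qed measurable
  have I: "I m = real m * I 1" for m
  proof (induction m)
    case 0
    then show ?case by (simp add: I_def)
  next
    case (Suc m)
    have "I (Suc m) = (LINT s|lborel. indicator {0<..real m} s * f s + indicator {real m<..real m + 1} s * f s)"
      unfolding I_def by (intro Bochner_Integration.integral_cong refl) (auto split: split_indicator)
    also have "\<dots> = I m + (LINT s|lborel. indicator {real m<..real m + 1} s * f s)"
      unfolding I_def by (intro Bochner_Integration.integral_add i) auto
    also have "(LINT s|lborel. indicator {real m<..real m + 1} s * f s)
        = (LINT s|lborel. indicator {real m<..real m + 1} (real m + 1 * s) * f (real m + 1 * s))"
      by (subst lborel_integral_real_affine[where c=1 and t="real m"]) auto
    also have "\<dots> = I 1"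
      unfolding I_def
    proof (intro Bochner_Integration.integral_cong refl)
      fix s
      have "f (real m + 1 * s) = f s" using periodic_add_nat[of f s m, OF per] by (simp add: add.commute)
      then show "indicator {real m<..real m + 1} (real m + 1 * s) * f (real m + 1 * s) = indicator {0<..real 1} s * f s"
        by (auto split: split_indicator)
    qed
    finally show ?case using Suc by (simp add: algebra_simps)
  qed
  show ?thesis
    unfolding set_integral_Ioc_Icc[OF f] using I[of n] by (simp add: I_def)
qed

section \<open>The trigonometric basis\<close>

lemma integral_unit_FTC:
  fixes F f :: "real \<Rightarrow> real"
  assumes "\<And>x. (F has_real_derivative f x) (at x)" "continuous_on UNIV f"
  shows "(LINT s:{0..1}|lborel. f s) = F 1 - F 0"
  unfolding set_lebesgue_integral_def
  using assms
  by (intro integral_FTC_atLeastAtMost)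
     (auto simp: has_real_derivative_iff_has_vector_derivative[symmetric]
       intro: has_field_derivative_at_within continuous_on_subset)

lemma integral_cos_sin_int:
  shows "(LINT s:{0..1}|lborel. cos (2 * pi * of_int k * s)) = (if k = 0 then 1 else 0)"
    and "(LINT s:{0..1}|lborel. sin (2 * pi * of_int k * s)) = 0"
proof -
  show "(LINT s:{0..1}|lborel. cos (2 * pi * of_int k * s)) = (if k = 0 then 1 else 0)"
  proof (cases "k = 0")
    case True
    then show ?thesis by (simp add: set_lebesgue_integral_def)
  next
    case False
    have "(LINT s:{0..1}|lborel. cos (2 * pi * of_int k * s))
        = sin (2 * pi * of_int k * 1) / (2 * pi * of_int k) - sin (2 * pi * of_int k * 0) / (2 * pi * of_int k)"
      using False by (intro integral_unit_FTC) (auto intro!: derivative_eq_intros continuous_intros)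
    then show ?thesis using False by (simp add: sin_int_2pin)
  qed
  show "(LINT s:{0..1}|lborel. sin (2 * pi * of_int k * s)) = 0"
  proof (cases "k = 0")
    case True
    then show ?thesis by (simp add: set_lebesgue_integral_def)
  next
    case False
    have "(LINT s:{0..1}|lborel. sin (2 * pi * of_int k * s))
        = - cos (2 * pi * of_int k * 1) / (2 * pi * of_int k) - (- cos (2 * pi * of_int k * 0) / (2 * pi * of_int k))"
      using False by (intro integral_unit_FTC) (auto intro!: derivative_eq_intros continuous_intros)
    then show ?thesis using False by (simp add: cos_int_2pin)
  qed
qed

lemma set_integrable_unit_continuous:
  fixes f :: "real \<Rightarrow> real"
  assumes "continuous_on UNIV f"
  shows "set_integrable lborel {0..1} f"
  using assms by (intro borel_integrable_atLeastAtMost') (auto intro: continuous_on_subset)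

text \<open>Integer frequencies keep both \<open>a - b\<close> and \<open>a + b\<close> within one
  formula; the case \<open>a + b = 0\<close> takes care of frequency 0.\<close>

lemma integral_products_int:
  fixes a b :: int
  shows "(LINT s:{0..1}|lborel. cos (2 * pi * of_int a * s) * cos (2 * pi * of_int b * s))
      = ((if a = b then 1 else 0) + (if a + b = 0 then 1 else 0)) / 2"
    and "(LINT s:{0..1}|lborel. sin (2 * pi * of_int a * s) * sin (2 * pi * of_int b * s))
      = ((if a = b then 1 else 0) - (if a + b = 0 then 1 else 0)) / 2"
    and "(LINT s:{0..1}|lborel. sin (2 * pi * of_int a * s) * cos (2 * pi * of_int b * s)) = 0"
proof -
  let ?c = "\<lambda>(k::int) s. cos (2 * pi * of_int k * s)" and ?s = "\<lambda>(k::int) s. sin (2 * pi * of_int k * s)"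
  have ic: "set_integrable lborel {0..1} (?c k)" and ii: "set_integrable lborel {0..1} (?s k)" for k
    by (auto intro!: set_integrable_unit_continuous continuous_intros)
  have cc: "?c a s * ?c b s = (?c (a - b) s + ?c (a + b) s) / 2" for s
    by (simp only: cos_times_cos of_int_add of_int_diff distrib_left distrib_right left_diff_distrib right_diff_distrib)
  have ss: "?s a s * ?s b s = (?c (a - b) s - ?c (a + b) s) / 2" for s
    by (simp only: sin_times_sin of_int_add of_int_diff distrib_left distrib_right left_diff_distrib right_diff_distrib)
  have sc: "?s a s * ?c b s = (?s (a + b) s + ?s (a - b) s) / 2" for s
    by (simp only: sin_times_cos of_int_add of_int_diff distrib_left distrib_right left_diff_distrib right_diff_distrib)
  show "(LINT s:{0..1}|lborel. ?c a s * ?c b s) = ((if a = b then 1 else 0) + (if a + b = 0 then 1 else 0)) / 2"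
    unfolding cc using ic[of "a - b"] ic[of "a + b"]
    by (simp only: set_integral_divide_zero set_integral_add integral_cos_sin_int) simp
  show "(LINT s:{0..1}|lborel. ?s a s * ?s b s) = ((if a = b then 1 else 0) - (if a + b = 0 then 1 else 0)) / 2"
    unfolding ss using ic[of "a - b"] ic[of "a + b"]
    by (simp only: set_integral_divide_zero set_integral_diff integral_cos_sin_int) simp
  show "(LINT s:{0..1}|lborel. ?s a s * ?c b s) = 0"
    unfolding sc using ii[of "a - b"] ii[of "a + b"]
    by (simp only: set_integral_divide_zero set_integral_add integral_cos_sin_int) simp
qed

text \<open>The constant function is written as a cosine of frequency 0 with factor 1, so that a
  single table of integrals of products covers all pairs of basis functions.\<close>

lemma trig_basis_cases:
  assumes "1 \<le> j"
  obtains "j = 1" "trig_basis j = (\<lambda>x. 1 * cos (2 * pi * of_int 0 * x))"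
  | k where "j = 2 * k" "1 \<le> k" "trig_basis j = (\<lambda>x. sqrt 2 * cos (2 * pi * of_int (int k) * x))"
  | k where "j = 2 * k + 1" "1 \<le> k" "trig_basis j = (\<lambda>x. sqrt 2 * sin (2 * pi * of_int (int k) * x))"
proof -
  consider "j = 1" | k where "j = 2 * k" "1 \<le> k" | k where "j = 2 * k + 1" "1 \<le> k"
  proof -
    show thesis
    proof (cases "even j")
      case True
      then obtain k where "j = 2 * k" by blast
      then show thesis using assms that(2)[of k] by simp
    next
      case False
      then obtain k where "j = 2 * k + 1" by (blast elim: oddE)
      then show thesis using that(1) that(3)[of k] by (cases "k = 0") auto
    qed
  qed
  then show thesis
  proof cases
    case 1
    then show thesis using that(1) by (simp add: trig_basis_def fun_eq_iff)
  next
    case (2 k)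
    then show thesis using that(2)[of k] by (simp add: trig_basis_def fun_eq_iff)
  next
    case (3 k)
    then show thesis using that(3)[of k] by (simp add: trig_basis_def fun_eq_iff)
  qed
qed

lemma trig_basis_bound: "\<bar>trig_basis j x\<bar> \<le> sqrt 2"
proof -
  have "sqrt 2 * \<bar>y\<bar> \<le> sqrt 2" if "\<bar>y\<bar> \<le> 1" for y
    using mult_left_mono[OF that, of "sqrt 2"] by simp
  then show ?thesis by (auto simp: trig_basis_def abs_mult)
qed

lemma trig_basis_continuous: "continuous_on UNIV (trig_basis j)"
proof (cases "j = 1")
  case True
  then show ?thesis by (simp add: trig_basis_def[abs_def])
next
  case False
  then show ?thesis by (cases "even j") (simp_all add: trig_basis_def[abs_def] continuous_intros)
qed

lemma trig_basis_measurable [measurable]: "trig_basis j \<in> borel_measurable borel"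
  by (rule borel_measurable_continuous_onI[OF trig_basis_continuous])

lemma trig_basis_periodic: "trig_basis j (x + 1) = trig_basis j x"
proof -
  have e: "2 * pi * real k * (x + 1) = 2 * pi * real k * x + real_of_int (int k) * (2 * pi)" for k
    by (simp add: algebra_simps)
  have "cos (2 * pi * real k * (x + 1)) = cos (2 * pi * real k * x)" for k
    unfolding e cos_add using cos_int_2pin[of "int k"] sin_int_2pin[of "int k"] by (simp add: mult.commute)
  moreover have "sin (2 * pi * real k * (x + 1)) = sin (2 * pi * real k * x)" for k
    unfolding e sin_add using cos_int_2pin[of "int k"] sin_int_2pin[of "int k"] by (simp add: mult.commute)
  ultimately show ?thesis by (simp add: trig_basis_def)
qed

lemma trig_basis_orthonormal:
  assumes "1 \<le> i" "1 \<le> j"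
  shows "(LINT s:{0..1}|lborel. trig_basis i s * trig_basis j s) = (if i = j then 1 else 0)"
proof -
  have r: "(LINT s:{0..1}|lborel. (a * f s) * (b * g s)) = (a * b) * (LINT s:{0..1}|lborel. f s * g s)"
    for a b :: real and f g
  proof -
    have "(\<lambda>s. (a * f s) * (b * g s)) = (\<lambda>s. (a * b) * (f s * g s))" by (simp add: fun_eq_iff)
    then show ?thesis by simp
  qed
  have cs: "(LINT s:{0..1}|lborel. cos (2 * pi * of_int a * s) * sin (2 * pi * of_int b * s)) = 0" for a b :: int
    using integral_products_int(3)[of b a] by (simp add: mult.commute)
  note eqs = r cs integral_products_int
  show ?thesis
  proof (rule trig_basis_cases[OF assms(1)])
    assume i: "i = 1" "trig_basis i = (\<lambda>x. 1 * cos (2 * pi * of_int 0 * x))"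
    show ?thesis
      by (rule trig_basis_cases[OF assms(2)]) (simp_all only: i(2) eqs, use i in simp_all)
  next
    fix k assume i: "i = 2 * k" "1 \<le> k" "trig_basis i = (\<lambda>x. sqrt 2 * cos (2 * pi * of_int (int k) * x))"
    show ?thesis
      by (rule trig_basis_cases[OF assms(2)]) (simp_all only: i(3) eqs, use i in \<open>simp_all, presburger?\<close>)
  next
    fix k assume i: "i = 2 * k + 1" "1 \<le> k" "trig_basis i = (\<lambda>x. sqrt 2 * sin (2 * pi * of_int (int k) * x))"
    show ?thesis
      by (rule trig_basis_cases[OF assms(2)]) (simp_all only: i(3) eqs, use i in \<open>simp_all, presburger?\<close>)
  qed
qed

lemma trig_orthonormal_system:
  assumes "finite F" "0 \<notin> F"
  shows "orthonormal_system F trig_basis"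
proof -
  have "1 \<le> j" if "j \<in> F" for j using assms(2) that by (cases j) auto
  then show ?thesis
    unfolding orthonormal_system_def
    using assms(1) trig_basis_bound trig_basis_orthonormal trig_basis_measurable by blast
qed

text \<open>Integration by parts over a full period has no boundary term and exchanges sine and
  cosine of the same frequency \<open>k\<close>, that is the indices \<open>2 * k\<close> and
  \<open>2 * k + 1\<close>. It produces the factor \<open>m\<close>, equal to 2 \<pi> k, which is at
  least \<open>3 * k\<close> and hence at least \<open>j\<close>.\<close>

lemma trig_coefficient_derivative:
  assumes S: "\<And>x. (S has_real_derivative S' x) (at x)" "continuous_on UNIV S'" "\<And>x. S (x + 1) = S x"
    and j: "2 \<le> j"
  shows "((LINT s:{0..1}|lborel. S s * trig_basis j s) * real j)\<^sup>2
    \<le> (LINT s:{0..1}|lborel. S' s * trig_basis (if even j then j + 1 else j - 1) s)\<^sup>2"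
proof -
  have cS: "continuous_on UNIV S"
    using S(1) by (auto intro!: DERIV_isCont continuous_at_imp_continuous_on)
  have S1: "S 1 = S 0" using S(3)[of 0] by simp
  define k where "k = j div 2"
  have "j \<le> 3 * k" "1 \<le> k" using j unfolding k_def by presburger+
  then have k: "1 \<le> k" "real j \<le> 3 * real k" by linarith+
  define m where "m = 2 * pi * real k"
  have m: "0 < m" "real j \<le> m"
  proof -
    have le: "3 * real k \<le> 2 * pi * real k" using pi_gt3 by (intro mult_right_mono) auto
    show "real j \<le> m" unfolding m_def using k(2) le by (rule order_trans)
    show "0 < m" unfolding m_def using k(1) by simp
  qed
  have s1: "sin (m * 1) = 0" "cos (m * 1) = 1"
    unfolding m_def using sin_int_2pin[of "int k"] cos_int_2pin[of "int k"] by simp_all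
  note ci = continuous_on_mult[OF S(2)] continuous_on_mult[OF cS]
  have intg: "set_integrable lborel {0..1} (\<lambda>s. S' s * (sqrt 2 * sin (m * s)))"
    "set_integrable lborel {0..1} (\<lambda>s. S' s * (sqrt 2 * cos (m * s)))"
    "set_integrable lborel {0..1} (\<lambda>s. S s * (sqrt 2 * sin (m * s)))"
    "set_integrable lborel {0..1} (\<lambda>s. S s * (sqrt 2 * cos (m * s)))"
    by (intro set_integrable_unit_continuous ci continuous_intros)+
  have e1: "(LINT s:{0..1}|lborel. S' s * (sqrt 2 * sin (m * s)) + m * (S s * (sqrt 2 * cos (m * s))))
      = S 1 * (sqrt 2 * sin (m * 1)) - S 0 * (sqrt 2 * sin (m * 0))"
    using S(1) S(2) cS
    by (intro integral_unit_FTC) (auto intro!: derivative_eq_intros continuous_intros simp: algebra_simps)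
  have e2: "(LINT s:{0..1}|lborel. S' s * (sqrt 2 * cos (m * s)) - m * (S s * (sqrt 2 * sin (m * s))))
      = S 1 * (sqrt 2 * cos (m * 1)) - S 0 * (sqrt 2 * cos (m * 0))"
    using S(1) S(2) cS
    by (intro integral_unit_FTC) (auto intro!: derivative_eq_intros continuous_intros simp: algebra_simps)
  have e1': "(LINT s:{0..1}|lborel. S' s * (sqrt 2 * sin (m * s))) + m * (LINT s:{0..1}|lborel. S s * (sqrt 2 * cos (m * s))) = 0"
    using e1 s1 intg by (simp add: set_integral_add)
  have e2': "(LINT s:{0..1}|lborel. S' s * (sqrt 2 * cos (m * s))) - m * (LINT s:{0..1}|lborel. S s * (sqrt 2 * sin (m * s))) = 0"
    using e2 s1 S1 intg by (simp add: set_integral_diff)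
  have eq: "((LINT s:{0..1}|lborel. S s * trig_basis j s) * m)\<^sup>2
      = (LINT s:{0..1}|lborel. S' s * trig_basis (if even j then j + 1 else j - 1) s)\<^sup>2"
  proof (cases "even j")
    case True
    have "trig_basis j = (\<lambda>s. sqrt 2 * cos (m * s))"
      using True j by (auto simp: trig_basis_def m_def k_def)
    moreover have "trig_basis (j + 1) = (\<lambda>s. sqrt 2 * sin (m * s))"
      using True j by (auto simp: trig_basis_def m_def k_def)
    moreover have "m * (LINT s:{0..1}|lborel. S s * (sqrt 2 * cos (m * s))) = - (LINT s:{0..1}|lborel. S' s * (sqrt 2 * sin (m * s)))"
      using e1' by linarith
    ultimately show ?thesis
      using True by (simp only: if_True mult.commute[of _ m] power2_minus)
  next
    case False
    then have "even (j - 1)" "j - 1 \<noteq> 1" "(j - 1) div 2 = k" using j by (auto simp: k_def elim!: oddE)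
    then have "trig_basis (j - 1) = (\<lambda>s. sqrt 2 * cos (m * s))"
      by (auto simp: trig_basis_def m_def)
    moreover have "trig_basis j = (\<lambda>s. sqrt 2 * sin (m * s))"
      using False j by (auto simp: trig_basis_def m_def k_def)
    moreover have "m * (LINT s:{0..1}|lborel. S s * (sqrt 2 * sin (m * s))) = (LINT s:{0..1}|lborel. S' s * (sqrt 2 * cos (m * s)))"
      using e2' by linarith
    ultimately show ?thesis
      using False by (simp only: if_False mult.commute[of _ m])
  qed
  have "((LINT s:{0..1}|lborel. S s * trig_basis j s) * real j)\<^sup>2 \<le> ((LINT s:{0..1}|lborel. S s * trig_basis j s) * m)\<^sup>2"
    unfolding power_mult_distrib using m by (intro mult_left_mono power_mono) auto
  with eq show ?thesis by simp
qed

text \<open>The exchange of sine and cosine is injective on indices, so the coefficients of the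
  derivative that arise are distinct and Bessel's inequality bounds their sum.\<close>

lemma trig_tail_energy:
  assumes S: "\<And>x. (S has_real_derivative S' x) (at x)" "continuous_on UNIV S'" "\<And>x. S (x + 1) = S x"
    and J: "finite J" "\<And>j. j \<in> J \<Longrightarrow> 2 \<le> j \<and> y \<le> (real j)\<^sup>2" and y: "0 < y"
  shows "(\<Sum>j\<in>J. (LINT s:{0..1}|lborel. S s * trig_basis j s)\<^sup>2)
    \<le> (LINT s:{0..1}|lborel. (S' s)\<^sup>2) / y"
proof -
  define p where "p j = (if even j then j + 1 else j - 1)" for j :: nat
  have inj: "inj_on p J"
  proof (rule inj_onI)
    fix i j assume "i \<in> J" "j \<in> J" "p i = p j"
    then show "i = j"
      using J(2)[of i] J(2)[of j] unfolding p_def by (auto split: if_splits elim!: evenE oddE) presburger+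
  qed
  obtain H where H: "\<And>s. s \<in> {0..1} \<Longrightarrow> \<bar>S' s\<bar> \<le> H"
  proof -
    have "compact (S' ` {0..1})"
      using S(2) by (intro compact_continuous_image) (auto intro: continuous_on_subset)
    then have "bounded (S' ` {0..1})" by (rule compact_imp_bounded)
    then obtain a where "\<forall>x\<in>S' ` {0..1}. norm x \<le> a" by (auto simp: bounded_iff)
    then show thesis using that[of a] by auto
  qed
  have "1 \<le> p j" if "j \<in> J" for j using J(2)[OF that] by (auto simp: p_def)
  then have "0 \<notin> p ` J" by fastforce
  then have on: "orthonormal_system (p ` J) trig_basis"
    using J(1) by (intro trig_orthonormal_system) auto
  have mS': "S' \<in> borel_measurable borel" by (rule borel_measurable_continuous_onI[OF S(2)])
  have "y * (LINT s:{0..1}|lborel. S s * trig_basis j s)\<^sup>2 \<le> (LINT s:{0..1}|lborel. S' s * trig_basis (p j) s)\<^sup>2"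
    if j: "j \<in> J" for j
  proof -
    have "y * (LINT s:{0..1}|lborel. S s * trig_basis j s)\<^sup>2 \<le> (real j)\<^sup>2 * (LINT s:{0..1}|lborel. S s * trig_basis j s)\<^sup>2"
      using J(2)[OF j] by (intro mult_right_mono) auto
    also have "\<dots> = ((LINT s:{0..1}|lborel. S s * trig_basis j s) * real j)\<^sup>2"
      by (simp add: power_mult_distrib)
    also have "\<dots> \<le> (LINT s:{0..1}|lborel. S' s * trig_basis (p j) s)\<^sup>2"
      unfolding p_def using J(2)[OF j] by (intro trig_coefficient_derivative S) auto
    finally show ?thesis .
  qed
  then have "y * (\<Sum>j\<in>J. (LINT s:{0..1}|lborel. S s * trig_basis j s)\<^sup>2)
      \<le> (\<Sum>j\<in>J. (LINT s:{0..1}|lborel. S' s * trig_basis (p j) s)\<^sup>2)"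
    unfolding sum_distrib_left by (intro sum_mono)
  also have "\<dots> = (\<Sum>j\<in>p ` J. (LINT s:{0..1}|lborel. S' s * trig_basis j s)\<^sup>2)"
    using inj by (simp add: sum.reindex)
  also have "\<dots> \<le> (LINT s:{0..1}|lborel. (S' s)\<^sup>2)"
    by (rule orthonormal_expansion(2)[OF on mS' H])
  finally show ?thesis using y by (simp add: field_simps)
qed

section \<open>Sequences of subpolynomial growth\<close>

definition subpolynomial :: "(nat \<Rightarrow> real) \<Rightarrow> bool" where
  "subpolynomial f \<longleftrightarrow> (\<forall>\<epsilon>>0. (\<lambda>n. f n / real n powr \<epsilon>) \<longlonglongrightarrow> 0)"

lemma subpolynomial_const: "subpolynomial (\<lambda>_. c)"
  unfolding subpolynomial_def
proof (intro allI impI)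
  fix \<epsilon> :: real assume "0 < \<epsilon>"
  then have "(\<lambda>n. real n powr (- \<epsilon>)) \<longlonglongrightarrow> 0"
    by (intro tendsto_neg_powr filterlim_real_sequentially) auto
  from tendsto_mult_right_zero[OF this, of c]
  show "(\<lambda>n. c / real n powr \<epsilon>) \<longlonglongrightarrow> 0" by (simp add: powr_minus_divide)
qed

lemma subpolynomial_add: "subpolynomial f \<Longrightarrow> subpolynomial g \<Longrightarrow> subpolynomial (\<lambda>n. f n + g n)"
  unfolding subpolynomial_def add_divide_distrib by (auto intro!: tendsto_add_zero)

text \<open>The exponent is shared equally between the two factors, which is possible because every
  positive exponent is allowed.\<close>

lemma subpolynomial_mult:
  assumes "subpolynomial f" "subpolynomial g"
  shows "subpolynomial (\<lambda>n. f n * g n)"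
  unfolding subpolynomial_def
proof (intro allI impI)
  fix \<epsilon> :: real assume "0 < \<epsilon>"
  then have "(\<lambda>n. f n / real n powr (\<epsilon>/2)) \<longlonglongrightarrow> 0" "(\<lambda>n. g n / real n powr (\<epsilon>/2)) \<longlonglongrightarrow> 0"
    using assms by (auto simp: subpolynomial_def)
  from tendsto_mult_zero[OF this]
  show "(\<lambda>n. f n * g n / real n powr \<epsilon>) \<longlonglongrightarrow> 0" by (simp flip: powr_add)
qed

lemma subpolynomial_power: "subpolynomial f \<Longrightarrow> subpolynomial (\<lambda>n. f n ^ k)"
  by (induction k) (auto intro: subpolynomial_const subpolynomial_mult)

section \<open>The observed path as drift plus noise on the underlying probability space\<close>

section \<open>The law of the observations\<close>

lemma cadlag_on_add_continuous:
  assumes T: "0 < T" and g: "continuous_on {0..T} g" and y: "cadlag_on T y"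
  shows "cadlag_on T (\<lambda>t\<in>{0..T}. g t + y t)"
  unfolding cadlag_on_def
proof (intro conjI ballI)
  fix t assume t: "t \<in> {0..<T}"
  have "continuous_on {t..T} g" using g t by (auto intro: continuous_on_subset)
  then have "(g \<longlongrightarrow> g t) (at_right t)"
    using t by (intro continuous_on_Icc_at_rightD) auto
  moreover have "(y \<longlongrightarrow> y t) (at_right t)" using y t by (simp add: cadlag_on_def)
  ultimately have l: "((\<lambda>s. g s + y s) \<longlongrightarrow> g t + y t) (at_right t)" by (rule tendsto_add)
  have "\<forall>\<^sub>F s in at_right t. s \<in> {t<..<T}" using t by (intro eventually_at_right_real) auto
  then have "\<forall>\<^sub>F s in at_right t. g s + y s = (\<lambda>t\<in>{0..T}. g t + y t) s"
    by eventually_elim (use t in auto)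
  then show "((\<lambda>t\<in>{0..T}. g t + y t) \<longlongrightarrow> (\<lambda>t\<in>{0..T}. g t + y t) t) (at_right t)"
    using l t by (subst tendsto_cong[symmetric]) auto
next
  fix t assume t: "t \<in> {0<..T}"
  have "continuous_on {0..t} g" using g t by (auto intro: continuous_on_subset)
  then have "(g \<longlongrightarrow> g t) (at_left t)"
    using t by (intro continuous_on_Icc_at_leftD) auto
  moreover from y t obtain l where "(y \<longlongrightarrow> l) (at_left t)" unfolding cadlag_on_def by blast
  ultimately have l: "((\<lambda>s. g s + y s) \<longlongrightarrow> g t + l) (at_left t)" by (rule tendsto_add)
  have "\<forall>\<^sub>F s in at_left t. s \<in> {0<..<t}" using t by (intro eventually_at_left_real) auto
  then have "\<forall>\<^sub>F s in at_left t. g s + y s = (\<lambda>t\<in>{0..T}. g t + y t) s"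
    by eventually_elim (use t in auto)
  then have "((\<lambda>t\<in>{0..T}. g t + y t) \<longlongrightarrow> g t + l) (at_left t)"
    using l by (subst tendsto_cong[symmetric]) auto
  then show "\<exists>l. ((\<lambda>t\<in>{0..T}. g t + y t) \<longlongrightarrow> l) (at_left t)" by blast
qed

lemma cadlag_on_cmult: "cadlag_on T y \<Longrightarrow> cadlag_on T (\<lambda>t. c * y t)"
  unfolding cadlag_on_def by (blast intro: tendsto_mult_left)

lemma measurable_skorokhod:
  assumes "\<And>t. t \<in> {0..real n} \<Longrightarrow> (\<lambda>\<omega>. X \<omega> t) \<in> borel_measurable M"
    and "\<And>\<omega>. \<omega> \<in> space M \<Longrightarrow> cadlag_on (real n) (\<lambda>t\<in>{0..real n}. X \<omega> t)"
  shows "(\<lambda>\<omega>. \<lambda>t\<in>{0..real n}. X \<omega> t) \<in> measurable M (skorokhod_space n)"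
  unfolding skorokhod_space_def
  using assms by (intro measurable_restrict_space2 measurable_restrict) auto

lemma skorokhod_coordinate:
  "t \<in> {0..real n} \<Longrightarrow> (\<lambda>y. y t) \<in> borel_measurable (skorokhod_space n)"
  unfolding skorokhod_space_def
  by (intro measurable_restrict_space1 measurable_component_singleton)

lemma primitive_continuous:
  fixes S :: "real \<Rightarrow> real"
  assumes "continuous_on UNIV S"
  shows "continuous_on {0..T} (\<lambda>t. LINT s:{0..t}|lborel. S s)"
proof -
  have "(LINT s:{0..t}|lborel. S s) = integral {0..t} S" for t :: real
    using assms by (intro set_borel_integral_eq_integral(2) borel_integrable_atLeastAtMost')
      (auto intro: continuous_on_subset)
  moreover have "continuous_on {0..T} (\<lambda>t. integral {0..t} S)"
    using assms by (intro indefinite_integral_continuous_1 integrable_continuous_real)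
      (auto intro: continuous_on_subset)
  ultimately show ?thesis by simp
qed

lemma continuous_periodic_bounded:
  fixes S :: "real \<Rightarrow> real"
  assumes "continuous_on UNIV S" "\<And>x. S (x + 1) = S x"
  obtains H where "\<And>x. 0 \<le> x \<Longrightarrow> \<bar>S x\<bar> \<le> H"
proof -
  have "compact (S ` {0..1})"
    using assms(1) by (intro compact_continuous_image) (auto intro: continuous_on_subset)
  then have "bounded (S ` {0..1})" by (rule compact_imp_bounded)
  then obtain a where "\<forall>y\<in>S ` {0..1}. norm y \<le> a" by (auto simp: bounded_iff)
  then have a: "\<And>x. x \<in> {0..1} \<Longrightarrow> \<bar>S x\<bar> \<le> a" by simp
  show thesis
    by (rule that[of a], rule periodic_bounded[where f=S]) (use assms(2) a in auto)
qed

lemma step_integral_primitive: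
  fixes S :: "real \<Rightarrow> real"
  assumes S: "S \<in> borel_measurable borel" "\<And>x. x \<in> {0..T} \<Longrightarrow> \<bar>S x\<bar> \<le> H"
    and u: "u 0 = 0" "u k = T" "\<And>i. i < k \<Longrightarrow> u i \<le> u (Suc i)"
  shows "step_integral k u c (\<lambda>t. LINT s:{0..t}|lborel. S s) = (LINT s:{0..T}|lborel. step_fun k u c s * S s)"
proof -
  note [measurable] = S(1)
  have ub: "0 \<le> u i" "u i \<le> T" if "i \<le> k" for i
    using chain_bounds[of k u i, OF u(3) that] u by auto
  have T: "0 \<le> T" using ub[of k] u by simp
  have H: "0 \<le> H" using S(2)[of 0] T by simp
  have i: "integrable lborel (\<lambda>s. indicator {x<..y} s * S s)" if "0 \<le> x" "x \<le> y" "y \<le> T" for x y :: real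
  proof (rule Bochner_Integration.integrable_bound)
    show "integrable lborel (\<lambda>s. H * indicator {x<..y} s :: real)"
      using that by (intro integrable_mult_right integrable_real_indicator) auto
    show "AE s in lborel. norm (indicator {x<..y} s * S s) \<le> norm (H * indicator {x<..y} s)"
      using S(2) H that by (intro AE_I2) (auto split: split_indicator)
  qed measurable
  have inc: "(LINT s:{0..y}|lborel. S s) - (LINT s:{0..x}|lborel. S s) = (LINT s|lborel. indicator {x<..y} s * S s)"
    if "0 \<le> x" "x \<le> y" "y \<le> T" for x y :: real
  proof -
    have "(LINT s|lborel. indicator {0<..y} s * S s) = (LINT s|lborel. indicator {0<..x} s * S s + indicator {x<..y} s * S s)"
      using that by (intro Bochner_Integration.integral_cong refl) (auto split: split_indicator)
    also have "\<dots> = (LINT s|lborel. indicator {0<..x} s * S s) + (LINT s|lborel. indicator {x<..y} s * S s)"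
      using that by (intro Bochner_Integration.integral_add i) auto
    finally show ?thesis unfolding set_integral_Ioc_Icc[OF S(1)] by simp
  qed
  have "step_integral k u c (\<lambda>t. LINT s:{0..t}|lborel. S s)
      = (\<Sum>i<k. LINT s|lborel. c i * (indicator {u i<..u (Suc i)} s * S s))"
    unfolding step_integral_def
  proof (intro sum.cong refl)
    fix j assume "j \<in> {..<k}"
    then have "0 \<le> u j" "u j \<le> u (Suc j)" "u (Suc j) \<le> T" using ub u(3) by auto
    from inc[OF this]
    show "c j * ((LINT s:{0..u (Suc j)}|lborel. S s) - (LINT s:{0..u j}|lborel. S s))
        = (LINT s|lborel. c j * (indicator {u j<..u (Suc j)} s * S s))" by simp
  qed
  also have "\<dots> = (LINT s|lborel. (\<Sum>i<k. c i * (indicator {u i<..u (Suc i)} s * S s)))"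
    using ub u(3) by (intro Bochner_Integration.integral_sum[symmetric] integrable_mult_right i) auto
  also have "\<dots> = (LINT s:{0..T}|lborel. step_fun k u c s * S s)"
    unfolding set_lebesgue_integral_def
  proof (intro Bochner_Integration.integral_cong refl)
    fix s
    have "(\<Sum>i<k. c i * (indicator {u i<..u (Suc i)} s * S s)) = step_fun k u c s * S s"
      unfolding step_fun_def sum_distrib_right by (simp only: mult.assoc)
    moreover have "step_fun k u c s = 0" if "s \<notin> {0..T}"
      unfolding step_fun_def
    proof (intro sum.neutral ballI)
      fix j assume "j \<in> {..<k}"
      then have "0 \<le> u j" "u (Suc j) \<le> T" using ub by auto
      then show "c j * indicator {u j<..u (Suc j)} s = 0" using that by auto
    qed
    ultimately show "(\<Sum>i<k. c i * (indicator {u i<..u (Suc i)} s * S s)) = indicator {0..T} s *\<^sub>R (step_fun k u c s * S s)"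
      by (cases "s \<in> {0..T}") simp_all
  qed
  finally show ?thesis .
qed

lemma step_fun_bounded: "\<bar>step_fun k u c s\<bar> \<le> (\<Sum>i<k. \<bar>c i\<bar>)"
  unfolding step_fun_def
proof (rule order_trans[OF sum_abs], rule sum_mono)
  fix i
  show "\<bar>c i * indicator {u i<..u (Suc i)} s\<bar> \<le> \<bar>c i\<bar>" by (simp split: split_indicator)
qed

context levy_noise
begin

text \<open>Realises the observation on the space that carries \<open>w\<close> and
  \<open>z\<close>, so that expectations under the observation law become expectations over
  \<open>M\<close>.\<close>

definition obs_path :: "nat \<Rightarrow> (real \<Rightarrow> real) \<Rightarrow> real \<Rightarrow> real \<Rightarrow> 'a \<Rightarrow> real \<Rightarrow> real" where
  "obs_path n S \<sigma>1 \<sigma>2 \<omega> = (\<lambda>t\<in>{0..real n}. (LINT s:{0..t}|lborel. S s) + (\<sigma>1 * w t \<omega> + \<sigma>2 * z t \<omega>))"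

lemma noise_cadlag:
  assumes n: "1 \<le> n" and \<omega>: "\<omega> \<in> space M"
  shows "cadlag_on (real n) (\<lambda>t\<in>{0..real n}. \<sigma>1 * w t \<omega> + \<sigma>2 * z t \<omega>)"
proof (rule cadlag_on_add_continuous)
  have "continuous_on {0..} (\<lambda>t. w t \<omega>)" using bm \<omega> unfolding brownian_motion_def by blast
  then show "continuous_on {0..real n} (\<lambda>t. \<sigma>1 * w t \<omega>)"
    by (intro continuous_on_mult_left) (auto intro: continuous_on_subset)
  have "cadlag_on (real n) (\<lambda>t. z t \<omega>)"
    using cjp \<omega> n unfolding compensated_jump_process_def by simp
  then show "cadlag_on (real n) (\<lambda>t. \<sigma>2 * z t \<omega>)" by (rule cadlag_on_cmult)
qed (use n in simp)

lemma observation_law_eq: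
  assumes n: "1 \<le> n" and S: "continuous_on UNIV S"
  shows "obs_path n S \<sigma>1 \<sigma>2 \<in> measurable M (skorokhod_space n)"
    and "observation_law n (noise_law M w z n \<sigma>1 \<sigma>2) S = distr M (skorokhod_space n) (obs_path n S \<sigma>1 \<sigma>2)"
proof -
  let ?X = "\<lambda>\<omega>. \<lambda>t\<in>{0..real n}. \<sigma>1 * w t \<omega> + \<sigma>2 * z t \<omega>"
  let ?F = "\<lambda>x. \<lambda>t\<in>{0..real n}. (LINT s:{0..t}|lborel. S s) + x t"
  have X: "?X \<in> measurable M (skorokhod_space n)"
  proof (rule measurable_skorokhod[OF _ noise_cadlag[OF n]])
    fix t assume "t \<in> {0..real n}"
    then have "0 \<le> t" by simp
    note [measurable] = w_measurable[OF this] z_measurable[OF this]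
    show "(\<lambda>\<omega>. \<sigma>1 * w t \<omega> + \<sigma>2 * z t \<omega>) \<in> borel_measurable M" by measurable
  qed
  have F: "?F \<in> measurable (skorokhod_space n) (skorokhod_space n)"
  proof (rule measurable_skorokhod)
    fix t assume t: "t \<in> {0..real n}"
    show "(\<lambda>x. (LINT s:{0..t}|lborel. S s) + x t) \<in> borel_measurable (skorokhod_space n)"
      by (intro borel_measurable_add borel_measurable_const skorokhod_coordinate[OF t])
  next
    fix x assume "x \<in> space (skorokhod_space n)"
    then have "cadlag_on (real n) x" by (simp add: skorokhod_space_def space_restrict_space)
    then show "cadlag_on (real n) (?F x)"
      using n by (intro cadlag_on_add_continuous primitive_continuous S) auto
  qed
  have comp: "?F \<circ> ?X = obs_path n S \<sigma>1 \<sigma>2"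
    by (auto simp: obs_path_def fun_eq_iff)
  show "obs_path n S \<sigma>1 \<sigma>2 \<in> measurable M (skorokhod_space n)"
    unfolding comp[symmetric] by (rule measurable_comp[OF X F])
  show "observation_law n (noise_law M w z n \<sigma>1 \<sigma>2) S = distr M (skorokhod_space n) (obs_path n S \<sigma>1 \<sigma>2)"
    unfolding observation_law_def noise_law_def comp[symmetric] by (rule distr_distr[OF F X])
qed

lemma nn_integral_observation_law:
  assumes "1 \<le> n" "continuous_on UNIV S" "f \<in> borel_measurable (skorokhod_space n)"
  shows "(\<integral>\<^sup>+ y. f y \<partial>observation_law n (noise_law M w z n \<sigma>1 \<sigma>2) S) = (\<integral>\<^sup>+ \<omega>. f (obs_path n S \<sigma>1 \<sigma>2 \<omega>) \<partial>M)"
  unfolding observation_law_eq(2)[OF assms(1,2)]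
  using assms(3) by (intro nn_integral_distr observation_law_eq(1)[OF assms(1,2)]) simp

text \<open>Step integrals of the observed path split into those of the drift and those of the
  noise. The drift part converges to the integral of \<open>f * S\<close>, so the very same step
  functions exhibit \<open>\<zeta>\<close> as a limit of noise integrals.\<close>

lemma centred_stoch_integral:
  assumes n: "1 \<le> n" and S: "continuous_on UNIV S" "\<And>x. S (x + 1) = S x"
    and f: "f \<in> borel_measurable borel" "\<And>s. s \<in> {0..real n} \<Longrightarrow> \<bar>f s\<bar> \<le> B"
    and I: "is_stoch_integral n (observation_law n (noise_law M w z n \<sigma>1 \<sigma>2) S) f I"
  defines "\<zeta> \<equiv> \<lambda>\<omega>. I (obs_path n S \<sigma>1 \<sigma>2 \<omega>) - (LINT s:{0..real n}|lborel. f s * S s)"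
  shows "\<zeta> \<in> borel_measurable M"
    and "\<exists>k u c.
        (\<forall>m::nat. u m (0::nat) = 0 \<and> u m (k m) = real n \<and> (\<forall>i<k m. u m i \<le> u m (Suc i))) \<and>
        (\<lambda>m. \<integral>\<^sup>+ s\<in>{0..real n}. ennreal ((step_fun (k m) (u m) (c m) s - f s)\<^sup>2) \<partial>lborel) \<longlonglongrightarrow> 0 \<and>
        (\<lambda>m. \<integral>\<^sup>+ \<omega>. ennreal ((step_integral (k m) (u m) (c m) (\<lambda>t. \<sigma>1 * w t \<omega> + \<sigma>2 * z t \<omega>) - \<zeta> \<omega>)\<^sup>2) \<partial>M) \<longlonglongrightarrow> 0"
proof -
  let ?T = "real n" and ?Y = "obs_path n S \<sigma>1 \<sigma>2" and ?R = "segment_measure (real n)"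
  have T: "0 < ?T" using n by simp
  have Im: "I \<in> borel_measurable (skorokhod_space n)" using I unfolding is_stoch_integral_def by blast
  have IYm [measurable]: "(\<lambda>\<omega>. I (?Y \<omega>)) \<in> borel_measurable M"
    by (rule measurable_compose[OF observation_law_eq(1)[OF n S(1)] Im])
  then show "\<zeta> \<in> borel_measurable M" unfolding \<zeta>_def by measurable
  obtain H where H: "\<And>x. 0 \<le> x \<Longrightarrow> \<bar>S x\<bar> \<le> H"
    using continuous_periodic_bounded[OF S] by blast
  have H0: "0 \<le> H" using H[of 0] by simp
  have Sm [measurable]: "S \<in> borel_measurable borel" by (rule borel_measurable_continuous_onI[OF S(1)])
  note [measurable] = f(1)
  obtain k u c where p: "\<And>m::nat. u m (0::nat) = 0" "\<And>m. u m (k m) = ?T"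
      "\<And>m i. i < k m \<Longrightarrow> u m i \<le> u m (Suc i)"
    and l1: "(\<lambda>m. \<integral>\<^sup>+ s\<in>{0..?T}. ennreal ((step_fun (k m) (u m) (c m) s - f s)\<^sup>2) \<partial>lborel) \<longlonglongrightarrow> 0"
    and l2: "(\<lambda>m. \<integral>\<^sup>+ y. ennreal ((step_integral (k m) (u m) (c m) y - I y)\<^sup>2)
        \<partial>observation_law n (noise_law M w z n \<sigma>1 \<sigma>2) S) \<longlonglongrightarrow> 0"
    using I unfolding is_stoch_integral_def by blast
  have ub: "u m i \<in> {0..?T}" if "i \<le> k m" for m i
    using chain_bounds[of "k m" "u m" i, OF p(3) that] p by auto
  define q where "q m s = step_fun (k m) (u m) (c m) s - f s" for m s
  have qm [measurable]: "q m \<in> borel_measurable borel" for m unfolding q_def by measurable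
  define b where "b m = (\<Sum>i<k m. \<bar>c m i\<bar>) + B" for m
  have qb: "\<bar>q m s\<bar> \<le> b m" if "s \<in> {0..?T}" for m s
    unfolding q_def b_def using step_fun_bounded[of "k m" "u m" "c m" s] f(2)[OF that] by linarith
  have b0: "0 \<le> b m" for m using qb[of 0 m] T by simp
  define d where "d m = (LINT s|?R. q m s * S s)" for m
  have iq2: "integrable ?R (\<lambda>s. (q m s)\<^sup>2)" for m
  proof (rule integrable_interval_bounded[where C="(b m)\<^sup>2"])
    fix s assume "s \<in> {0..?T}"
    then have "\<bar>q m s\<bar> \<le> \<bar>b m\<bar>" using qb[of s m] b0[of m] by simp
    then show "\<bar>(q m s)\<^sup>2\<bar> \<le> (b m)\<^sup>2" by (simp add: abs_le_square_iff)
  qed (use T in auto)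
  have qS: "\<bar>q m s * S s\<bar> \<le> b m * H" if "s \<in> {0..?T}" for m s
    unfolding abs_mult using qb[OF that] H[of s] that H0 b0 by (intro mult_mono) auto
  \<comment> \<open>Cauchy-Schwarz with the signal bounded by \<open>H\<close>: the drift error is
    controlled by the mean square distance of the step functions from \<open>f\<close>, which tends
    to 0.\<close>
  have d2: "(d m)\<^sup>2 \<le> ?T * H\<^sup>2 * (LINT s|?R. (q m s)\<^sup>2)" for m
  proof -
    have "(d m)\<^sup>2 \<le> ?T * (LINT s|?R. (q m s * S s)\<^sup>2)"
      unfolding d_def using qS T by (intro square_integral_interval_le) auto
    also have "(LINT s|?R. (q m s * S s)\<^sup>2) \<le> (LINT s|?R. H\<^sup>2 * (q m s)\<^sup>2)"
    proof (rule integral_mono_AE)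
      show "integrable ?R (\<lambda>s. H\<^sup>2 * (q m s)\<^sup>2)" using iq2 by simp
      have pt: "(q m s * S s)\<^sup>2 \<le> H\<^sup>2 * (q m s)\<^sup>2" if "s \<in> {0..?T}" for s
      proof -
        have "\<bar>S s\<bar> \<le> \<bar>H\<bar>" using H[of s] H0 that by simp
        then have "(S s)\<^sup>2 \<le> H\<^sup>2" by (simp add: abs_le_square_iff)
        then have "(q m s)\<^sup>2 * (S s)\<^sup>2 \<le> (q m s)\<^sup>2 * H\<^sup>2" by (rule mult_left_mono) simp
        then show ?thesis by (simp only: power_mult_distrib mult.commute)
      qed
      then show "AE s in ?R. (q m s * S s)\<^sup>2 \<le> H\<^sup>2 * (q m s)\<^sup>2" by (intro AE_I2) simp
      show "integrable ?R (\<lambda>s. (q m s * S s)\<^sup>2)"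
      proof (rule integrable_interval_bounded[where C="H\<^sup>2 * (b m)\<^sup>2"])
        fix s assume s: "s \<in> {0..?T}"
        then have "\<bar>q m s\<bar> \<le> \<bar>b m\<bar>" using qb[of s m] b0[of m] by simp
        then have "(q m s)\<^sup>2 \<le> (b m)\<^sup>2" by (simp add: abs_le_square_iff)
        then have "H\<^sup>2 * (q m s)\<^sup>2 \<le> H\<^sup>2 * (b m)\<^sup>2" by (intro mult_left_mono) auto
        with pt[OF s] show "\<bar>(q m s * S s)\<^sup>2\<bar> \<le> H\<^sup>2 * (b m)\<^sup>2" by simp
      qed (use T in auto)
    qed
    finally show ?thesis using T by (simp add: mult.assoc)
  qed
  have "(\<lambda>m. ennreal (LINT s|?R. (q m s)\<^sup>2)) \<longlonglongrightarrow> ennreal 0"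
    using l1 unfolding nn_integral_interval q_def[symmetric]
    by (subst (asm) nn_integral_eq_integral[OF iq2]) auto
  then have "(\<lambda>m. LINT s|?R. (q m s)\<^sup>2) \<longlonglongrightarrow> 0"
    by (subst (asm) tendsto_ennreal_iff) auto
  then have "(\<lambda>m. ?T * H\<^sup>2 * (LINT s|?R. (q m s)\<^sup>2)) \<longlonglongrightarrow> 0" by (rule tendsto_mult_right_zero)
  then have dlim: "(\<lambda>m. (d m)\<^sup>2) \<longlonglongrightarrow> 0"
    by (rule Lim_null_comparison[rotated]) (use d2 in auto)
  have stepm: "step_integral (k m) (u m) (c m) \<in> borel_measurable (skorokhod_space n)" for m
    unfolding step_integral_def[abs_def]
    by (intro borel_measurable_sum borel_measurable_times borel_measurable_const borel_measurable_diff
        skorokhod_coordinate ub) auto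
  have path: "step_integral (k m) (u m) (c m) (?Y \<omega>)
      = step_integral (k m) (u m) (c m) (\<lambda>t. LINT s:{0..t}|lborel. S s)
        + step_integral (k m) (u m) (c m) (\<lambda>t. \<sigma>1 * w t \<omega> + \<sigma>2 * z t \<omega>)" for m \<omega>
    unfolding step_integral_def sum.distrib[symmetric]
  proof (intro sum.cong refl)
    fix i assume "i \<in> {..<k m}"
    then have "u m i \<in> {0..?T}" "u m (Suc i) \<in> {0..?T}" using ub by auto
    then show "c m i * (?Y \<omega> (u m (Suc i)) - ?Y \<omega> (u m i))
      = c m i * ((LINT s:{0..u m (Suc i)}|lborel. S s) - (LINT s:{0..u m i}|lborel. S s))
        + c m i * ((\<sigma>1 * w (u m (Suc i)) \<omega> + \<sigma>2 * z (u m (Suc i)) \<omega>) - (\<sigma>1 * w (u m i) \<omega> + \<sigma>2 * z (u m i) \<omega>))"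
      unfolding obs_path_def by (simp add: algebra_simps)
  qed
  have prim: "step_integral (k m) (u m) (c m) (\<lambda>t. LINT s:{0..t}|lborel. S s)
      = d m + (LINT s:{0..?T}|lborel. f s * S s)" for m
  proof -
    have i1: "integrable ?R (\<lambda>s. q m s * S s)"
      using qS T by (intro integrable_interval_bounded[where C="b m * H"]) auto
    have i2: "integrable ?R (\<lambda>s. f s * S s)"
    proof (rule integrable_interval_bounded[where C="B * H"])
      fix s assume s: "s \<in> {0..?T}"
      then have "0 \<le> B" using f(2)[OF s] by linarith
      then show "\<bar>f s * S s\<bar> \<le> B * H"
        unfolding abs_mult using f(2)[OF s] H[of s] s H0 by (intro mult_mono) auto
    qed (use T in auto)
    have "step_integral (k m) (u m) (c m) (\<lambda>t. LINT s:{0..t}|lborel. S s)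
        = (LINT s|?R. step_fun (k m) (u m) (c m) s * S s)"
      unfolding set_integral_interval[symmetric] using H
      by (intro step_integral_primitive[OF Sm _ p]) auto
    also have "\<dots> = (LINT s|?R. q m s * S s + f s * S s)"
      by (simp add: q_def left_diff_distrib)
    also have "\<dots> = d m + (LINT s:{0..?T}|lborel. f s * S s)"
      unfolding d_def set_integral_interval using i1 i2 by simp
    finally show ?thesis .
  qed
  have main: "(\<lambda>m. \<integral>\<^sup>+ \<omega>. ennreal ((step_integral (k m) (u m) (c m) (\<lambda>t. \<sigma>1 * w t \<omega> + \<sigma>2 * z t \<omega>) - \<zeta> \<omega>)\<^sup>2) \<partial>M) \<longlonglongrightarrow> 0"
  proof (rule tendsto_sandwich[OF _ _ tendsto_const])
    let ?E = "\<lambda>m. \<integral>\<^sup>+ \<omega>. ennreal ((step_integral (k m) (u m) (c m) (?Y \<omega>) - I (?Y \<omega>))\<^sup>2) \<partial>M"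
    show "\<forall>\<^sub>F m in sequentially. (\<integral>\<^sup>+ \<omega>. ennreal ((step_integral (k m) (u m) (c m) (\<lambda>t. \<sigma>1 * w t \<omega> + \<sigma>2 * z t \<omega>) - \<zeta> \<omega>)\<^sup>2) \<partial>M)
        \<le> 2 * ?E m + 2 * ennreal ((d m)\<^sup>2)"
    proof (intro always_eventually allI)
      fix m
      have eq: "step_integral (k m) (u m) (c m) (\<lambda>t. \<sigma>1 * w t \<omega> + \<sigma>2 * z t \<omega>) - \<zeta> \<omega>
          = (step_integral (k m) (u m) (c m) (?Y \<omega>) - I (?Y \<omega>)) + - d m" for \<omega>
        unfolding path prim \<zeta>_def by simp
      have [measurable]: "(\<lambda>\<omega>. step_integral (k m) (u m) (c m) (?Y \<omega>)) \<in> borel_measurable M"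
        by (rule measurable_compose[OF observation_law_eq(1)[OF n S(1)] stepm])
      have "(\<integral>\<^sup>+ \<omega>. ennreal (((step_integral (k m) (u m) (c m) (?Y \<omega>) - I (?Y \<omega>)) + - d m)\<^sup>2) \<partial>M)
        \<le> 2 * ?E m + 2 * (\<integral>\<^sup>+ \<omega>. ennreal ((- d m)\<^sup>2) \<partial>M)"
        by (rule nn_integral_square_sum_le) measurable
      then show "(\<integral>\<^sup>+ \<omega>. ennreal ((step_integral (k m) (u m) (c m) (\<lambda>t. \<sigma>1 * w t \<omega> + \<sigma>2 * z t \<omega>) - \<zeta> \<omega>)\<^sup>2) \<partial>M)
        \<le> 2 * ?E m + 2 * ennreal ((d m)\<^sup>2)"
        unfolding eq by (simp add: emeasure_space_1)
    qed
    have "?E \<longlonglongrightarrow> 0"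
    proof -
      have "(\<lambda>y. ennreal ((step_integral (k m) (u m) (c m) y - I y)\<^sup>2)) \<in> borel_measurable (skorokhod_space n)" for m
        using stepm Im by measurable
      from nn_integral_observation_law[OF n S(1) this] l2 show ?thesis by simp
    qed
    then have "(\<lambda>m. 2 * ?E m + 2 * ennreal ((d m)\<^sup>2)) \<longlonglongrightarrow> 2 * 0 + 2 * ennreal 0"
      by (intro tendsto_add ennreal_tendsto_cmult tendsto_ennrealI dlim) auto
    then show "(\<lambda>m. 2 * ?E m + 2 * ennreal ((d m)\<^sup>2)) \<longlonglongrightarrow> 0" by simp
  qed simp
  show "\<exists>k u c.
        (\<forall>m::nat. u m (0::nat) = 0 \<and> u m (k m) = real n \<and> (\<forall>i<k m. u m i \<le> u m (Suc i))) \<and>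
        (\<lambda>m. \<integral>\<^sup>+ s\<in>{0..real n}. ennreal ((step_fun (k m) (u m) (c m) s - f s)\<^sup>2) \<partial>lborel) \<longlonglongrightarrow> 0 \<and>
        (\<lambda>m. \<integral>\<^sup>+ \<omega>. ennreal ((step_integral (k m) (u m) (c m) (\<lambda>t. \<sigma>1 * w t \<omega> + \<sigma>2 * z t \<omega>) - \<zeta> \<omega>)\<^sup>2) \<partial>M) \<longlonglongrightarrow> 0"
    using p l1 main by (intro exI[of _ k] exI[of _ u] exI[of _ c]) auto
qed

end

section \<open>Mean size of the normalised noise terms and of the variance estimation error\<close>

section \<open>Expectations of the noise terms\<close>

text \<open>The interface between probability and the oracle inequality. It is instantiated twice,
  for the basis of the estimators on all coordinates and for the trigonometric basis on the
  coordinates of the variance estimator, with the same \<open>\<tau>\<close> but different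
  \<open>C\<close>.\<close>

definition noise_moments :: "'p measure \<Rightarrow> nat set \<Rightarrow> ('p \<Rightarrow> nat \<Rightarrow> real) \<Rightarrow> real \<Rightarrow> real \<Rightarrow> bool" where
  "noise_moments P I e \<tau> C \<longleftrightarrow> finite I \<and> 0 < \<tau> \<and> 0 \<le> C \<and> (\<forall>j\<in>I. (\<lambda>y. e y j) \<in> borel_measurable P) \<and>
     (\<forall>x. (\<integral>\<^sup>+ y. ennreal ((\<Sum>j\<in>I. x j * e y j)\<^sup>2) \<partial>P) \<le> ennreal (\<tau> * (\<Sum>j\<in>I. (x j)\<^sup>2))) \<and>
     (\<forall>x. (\<integral>\<^sup>+ y. ennreal ((\<Sum>j\<in>I. x j * ((e y j)\<^sup>2 - \<tau>))\<^sup>2) \<partial>P) \<le> ennreal (\<tau>\<^sup>2 * C * (\<Sum>j\<in>I. (x j)\<^sup>2)))"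

lemma noise_moments_bounds:
  assumes "noise_moments P I e \<tau> C"
  shows "(\<integral>\<^sup>+ y. ennreal ((\<Sum>j\<in>I. x j * e y j)\<^sup>2) \<partial>P) \<le> ennreal (\<tau> * (\<Sum>j\<in>I. (x j)\<^sup>2))"
    and "(\<integral>\<^sup>+ y. ennreal ((\<Sum>j\<in>I. x j * ((e y j)\<^sup>2 - \<tau>))\<^sup>2) \<partial>P) \<le> ennreal (\<tau>\<^sup>2 * C * (\<Sum>j\<in>I. (x j)\<^sup>2))"
  using assms by (simp_all add: noise_moments_def)

text \<open>Covers a vanishing normalisation as well, since then every quotient is 0.\<close>

lemma nn_integral_quotient_le:
  assumes [measurable]: "f \<in> borel_measurable P"
    and f: "\<And>y. 0 \<le> f y" and le: "(\<integral>\<^sup>+ y. ennreal (f y) \<partial>P) \<le> ennreal (K * p)" and K: "0 \<le> K" and p: "0 \<le> p"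
  shows "(\<integral>\<^sup>+ y. ennreal (f y / p) \<partial>P) \<le> ennreal K"
proof (cases "p = 0")
  case False
  then have p: "0 < p" using p by simp
  have "(\<integral>\<^sup>+ y. ennreal (f y / p) \<partial>P) = (\<integral>\<^sup>+ y. ennreal (1 / p) * ennreal (f y) \<partial>P)"
    using p f by (intro nn_integral_cong) (simp add: ennreal_mult'[symmetric])
  also have "\<dots> = ennreal (1 / p) * (\<integral>\<^sup>+ y. ennreal (f y) \<partial>P)" by (intro nn_integral_cmult) measurable
  also have "\<dots> \<le> ennreal (1 / p) * ennreal (K * p)" by (intro mult_left_mono le) simp
  also have "\<dots> = ennreal K" using p K by (simp add: ennreal_mult'[symmetric])
  finally show ?thesis .
qed simp

lemma nn_integral_add_le:
  assumes "f \<in> borel_measurable P" "g \<in> borel_measurable P" "\<And>y. 0 \<le> f y" "\<And>y. 0 \<le> g y"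
    and "(\<integral>\<^sup>+ y. ennreal (f y) \<partial>P) \<le> ennreal a" "(\<integral>\<^sup>+ y. ennreal (g y) \<partial>P) \<le> ennreal b" "0 \<le> a" "0 \<le> b"
  shows "(\<integral>\<^sup>+ y. ennreal (f y + g y) \<partial>P) \<le> ennreal (a + b)"
proof -
  have "(\<integral>\<^sup>+ y. ennreal (f y + g y) \<partial>P) = (\<integral>\<^sup>+ y. ennreal (f y) + ennreal (g y) \<partial>P)"
    using assms by (intro nn_integral_cong) simp
  also have "\<dots> = (\<integral>\<^sup>+ y. ennreal (f y) \<partial>P) + (\<integral>\<^sup>+ y. ennreal (g y) \<partial>P)"
    using assms by (intro nn_integral_add) auto
  also have "\<dots> \<le> ennreal a + ennreal b" by (intro add_mono assms)
  finally show ?thesis using assms by simp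
qed

lemma nn_integral_cmult_le:
  assumes "f \<in> borel_measurable P" "0 \<le> c" "\<And>y. 0 \<le> f y" "(\<integral>\<^sup>+ y. ennreal (f y) \<partial>P) \<le> ennreal a"
  shows "(\<integral>\<^sup>+ y. ennreal (c * f y) \<partial>P) \<le> ennreal (c * a)"
proof -
  have "(\<integral>\<^sup>+ y. ennreal (c * f y) \<partial>P) = ennreal c * (\<integral>\<^sup>+ y. ennreal (f y) \<partial>P)"
    using assms by (simp add: ennreal_mult' nn_integral_cmult)
  also have "\<dots> \<le> ennreal c * ennreal a" by (intro mult_left_mono assms) simp
  finally show ?thesis using assms by (simp add: ennreal_mult')
qed

lemma nn_integral_sum_le:
  assumes "finite J" "\<And>j. j \<in> J \<Longrightarrow> f j \<in> borel_measurable P" "\<And>j y. j \<in> J \<Longrightarrow> 0 \<le> f j y"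
    and "\<And>j. j \<in> J \<Longrightarrow> (\<integral>\<^sup>+ y. ennreal (f j y) \<partial>P) \<le> ennreal a" "0 \<le> a"
  shows "(\<integral>\<^sup>+ y. ennreal (\<Sum>j\<in>J. f j y) \<partial>P) \<le> ennreal (real (card J) * a)"
  using assms
proof (induction J rule: finite_induct)
  case (insert j J)
  have "(\<integral>\<^sup>+ y. ennreal (f j y + (\<Sum>j\<in>J. f j y)) \<partial>P) \<le> ennreal (a + real (card J) * a)"
    using insert by (intro nn_integral_add_le borel_measurable_sum sum_nonneg) auto
  then show ?case using insert.hyps by (simp add: algebra_simps)
qed simp

context
  fixes P :: "'p measure" and I :: "nat set" and th :: "nat \<Rightarrow> real" and e :: "'p \<Rightarrow> nat \<Rightarrow> real" and \<tau> C :: real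
  assumes nm: "noise_moments P I e \<tau> C"
begin

lemma noise_moments_I: "finite I" "0 < \<tau>" "0 \<le> C"
  using nm by (auto simp: noise_moments_def)

lemma
  shows chaos_measurable: "(\<lambda>y. chaos I (e y) \<tau> x) \<in> borel_measurable P"
    and signal_noise_measurable: "(\<lambda>y. signal_noise I th (e y) x) \<in> borel_measurable P"
proof -
  have [measurable]: "(\<lambda>y. e y j) \<in> borel_measurable P" if "j \<in> I" for j
    using nm that by (simp add: noise_moments_def)
  show "(\<lambda>y. chaos I (e y) \<tau> x) \<in> borel_measurable P"
    unfolding chaos_def[OF noise_moments_I(1,2)] by (intro borel_measurable_sum) simp
  show "(\<lambda>y. signal_noise I th (e y) x) \<in> borel_measurable P"
    unfolding signal_noise_def[OF noise_moments_I(1,2)] by (intro borel_measurable_sum) simp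
qed

lemma chaos_second_moment:
  assumes "(\<Sum>j\<in>I. (x j)\<^sup>2) \<le> q"
  shows "(\<integral>\<^sup>+ y. ennreal ((chaos I (e y) \<tau> x)\<^sup>2) \<partial>P) \<le> ennreal (\<tau>\<^sup>2 * C * q)"
proof -
  have "(\<integral>\<^sup>+ y. ennreal ((chaos I (e y) \<tau> x)\<^sup>2) \<partial>P) \<le> ennreal (\<tau>\<^sup>2 * C * (\<Sum>j\<in>I. (x j)\<^sup>2))"
    unfolding chaos_def[OF noise_moments_I(1,2)] using nm by (simp add: noise_moments_def)
  also have "\<dots> \<le> ennreal (\<tau>\<^sup>2 * C * q)"
    using assms noise_moments_I by (intro ennreal_leI mult_left_mono) auto
  finally show ?thesis .
qed

lemma signal_noise_second_moment:
  assumes "\<And>j. j \<in> I \<Longrightarrow> \<bar>x j\<bar> \<le> \<bar>x' j\<bar>"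
  shows "(\<integral>\<^sup>+ y. ennreal ((signal_noise I th (e y) x)\<^sup>2) \<partial>P) \<le> ennreal (\<tau> * signal_energy I th x')"
proof -
  have "(\<integral>\<^sup>+ y. ennreal ((\<Sum>j\<in>I. (x j * th j) * e y j)\<^sup>2) \<partial>P) \<le> ennreal (\<tau> * (\<Sum>j\<in>I. (x j * th j)\<^sup>2))"
    by (rule noise_moments_bounds(1)[OF nm])
  also have "\<dots> \<le> ennreal (\<tau> * (\<Sum>j\<in>I. (x' j * th j)\<^sup>2))"
    using assms noise_moments_I
    by (intro ennreal_leI mult_left_mono sum_mono)
       (auto simp: power_mult_distrib abs_le_square_iff intro!: mult_right_mono)
  finally show ?thesis
    unfolding signal_noise_def[OF noise_moments_I(1,2)] signal_energy_def[OF noise_moments_I(1,2)] by simp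
qed

lemma energies_nonneg: "0 \<le> penalty I \<tau> l" "0 \<le> signal_energy I th x"
  unfolding penalty_def[OF noise_moments_I(1,2)] signal_energy_def[OF noise_moments_I(1,2)]
  using noise_moments_I by (auto intro!: sum_nonneg mult_nonneg_nonneg)

lemma noise_terms_nonneg: "0 \<le> single_noise I th (e y) \<tau> l D" "0 \<le> pair_noise I th (e y) l m"
  unfolding single_noise_def[OF noise_moments_I(1,2)] pair_noise_def[OF noise_moments_I(1,2)]
  using energies_nonneg noise_moments_I by auto

lemma noise_terms_measurable:
  "(\<lambda>y. single_noise I th (e y) \<tau> l D) \<in> borel_measurable P"
  "(\<lambda>y. pair_noise I th (e y) l m) \<in> borel_measurable P"
  unfolding single_noise_def[OF noise_moments_I(1,2)] pair_noise_def[OF noise_moments_I(1,2)]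
  using chaos_measurable signal_noise_measurable by measurable

text \<open>Each chaos quotient divides a mean of at most \<open>\<tau>\<^sup>2 * C\<close> times a
  sum of squares by at least \<open>\<tau>\<close> times that sum, which leaves
  \<open>\<tau> * C\<close>; they have total coefficient 4 + 1 + 1. The signal quotient leaves
  \<open>\<tau>\<close>. Weights between 0 and 1 only decrease under squaring, which keeps
  numerators below denominators.\<close>

lemma single_noise_expectation:
  assumes l: "\<And>j. j \<in> I \<Longrightarrow> 0 \<le> l j \<and> l j \<le> 1" and D: "D \<subseteq> I"
  shows "(\<integral>\<^sup>+ y. ennreal (single_noise I th (e y) \<tau> l D) \<partial>P) \<le> ennreal (\<tau> * (6 * C + 1))"
proof -
  note [measurable] = chaos_measurable signal_noise_measurable
  note fin = noise_moments_I and nn = energies_nonneg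
  have C: "0 \<le> \<tau> * C" "0 \<le> \<tau>" using fin by auto
  have q: "(\<integral>\<^sup>+ y. ennreal ((chaos I (e y) \<tau> x)\<^sup>2 / p) \<partial>P) \<le> ennreal (\<tau> * C)"
    if "\<tau> * (\<Sum>j\<in>I. (x j)\<^sup>2) \<le> p" for x p
  proof (rule nn_integral_quotient_le)
    show "(\<integral>\<^sup>+ y. ennreal ((chaos I (e y) \<tau> x)\<^sup>2) \<partial>P) \<le> ennreal (\<tau> * C * p)"
      using chaos_second_moment[of x "p / \<tau>"] that fin by (simp add: pos_le_divide_eq mult.commute power2_eq_square mult.left_commute)
    have "0 \<le> \<tau> * (\<Sum>j\<in>I. (x j)\<^sup>2)" using fin by (intro mult_nonneg_nonneg sum_nonneg) auto
    then show "0 \<le> p" using that by simp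
  qed (use C in auto)
  have sq: "((l j)\<^sup>2)\<^sup>2 \<le> (l j)\<^sup>2" if "j \<in> I" for j
  proof -
    have "(l j)\<^sup>2 \<le> 1" using l[OF that] by (intro power_le_one) auto
    then have "(l j)\<^sup>2 * (l j)\<^sup>2 \<le> (l j)\<^sup>2" by (intro mult_left_le_one_le) auto
    then show ?thesis by (simp only: power2_eq_square[of "(l j)\<^sup>2"])
  qed
  have t1: "(\<integral>\<^sup>+ y. ennreal (4 * ((chaos I (e y) \<tau> l)\<^sup>2 / penalty I \<tau> l)) \<partial>P) \<le> ennreal (4 * (\<tau> * C))"
    using nn by (intro nn_integral_cmult_le q) (auto simp: penalty_def[OF fin(1,2)])
  have t2: "(\<integral>\<^sup>+ y. ennreal ((chaos I (e y) \<tau> (indicator D))\<^sup>2 / (\<tau> * card D)) \<partial>P) \<le> ennreal (\<tau> * C)"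
  proof (rule q)
    have "(\<Sum>j\<in>I. (indicator D j :: real)\<^sup>2) = real (card D)"
      using D fin(1) by (simp add: indicator_def power2_eq_square sum.If_cases Int_absorb1 if_distrib cong: if_cong)
    then show "\<tau> * (\<Sum>j\<in>I. (indicator D j :: real)\<^sup>2) \<le> \<tau> * card D" by simp
  qed
  have t3: "(\<integral>\<^sup>+ y. ennreal ((signal_noise I th (e y) (\<lambda>j. l j * (1 - l j)))\<^sup>2 / signal_energy I th (\<lambda>j. 1 - l j)) \<partial>P) \<le> ennreal \<tau>"
  proof (rule nn_integral_quotient_le)
    show "(\<integral>\<^sup>+ y. ennreal ((signal_noise I th (e y) (\<lambda>j. l j * (1 - l j)))\<^sup>2) \<partial>P) \<le> ennreal (\<tau> * signal_energy I th (\<lambda>j. 1 - l j))"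
      using l by (intro signal_noise_second_moment) (auto simp: abs_mult intro!: mult_left_le_one_le)
  qed (use nn fin in auto)
  have t4: "(\<integral>\<^sup>+ y. ennreal ((chaos I (e y) \<tau> (\<lambda>j. (l j)\<^sup>2))\<^sup>2 / penalty I \<tau> l) \<partial>P) \<le> ennreal (\<tau> * C)"
    unfolding penalty_def[OF fin(1,2)] using sq fin by (intro q mult_left_mono sum_mono) auto
  have "(\<integral>\<^sup>+ y. ennreal (single_noise I th (e y) \<tau> l D) \<partial>P) \<le> ennreal (4 * (\<tau> * C) + \<tau> * C + \<tau> + \<tau> * C)"
    unfolding single_noise_def[OF fin(1,2)]
    using nn fin C by (intro nn_integral_add_le t1 t2 t3 t4) auto
  also have "4 * (\<tau> * C) + \<tau> * C + \<tau> + \<tau> * C = \<tau> * (6 * C + 1)" by (simp add: algebra_simps)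
  finally show ?thesis .
qed

lemma pair_noise_expectation:
  assumes l: "\<And>j. j \<in> I \<Longrightarrow> 0 \<le> l j \<and> l j \<le> 1" and m: "\<And>j. j \<in> I \<Longrightarrow> 0 \<le> m j \<and> m j \<le> 1"
  shows "(\<integral>\<^sup>+ y. ennreal (pair_noise I th (e y) l m) \<partial>P) \<le> ennreal (\<tau> * 33)"
proof -
  note [measurable] = chaos_measurable signal_noise_measurable
  note fin = noise_moments_I and nn = energies_nonneg
  have sq: "\<bar>(m j - l j)\<^sup>2\<bar> \<le> \<bar>m j - l j\<bar>" if "j \<in> I" for j
  proof -
    have "\<bar>m j - l j\<bar> \<le> 1" using l[OF that] m[OF that] by auto
    then have "\<bar>m j - l j\<bar> * \<bar>m j - l j\<bar> \<le> \<bar>m j - l j\<bar>" by (intro mult_left_le_one_le) auto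
    then show ?thesis by (simp add: power2_eq_square abs_mult)
  qed
  have t1: "(\<integral>\<^sup>+ y. ennreal ((signal_noise I th (e y) (\<lambda>j. m j - l j))\<^sup>2 / signal_energy I th (\<lambda>j. m j - l j)) \<partial>P) \<le> ennreal \<tau>"
    by (rule nn_integral_quotient_le) (use nn fin signal_noise_second_moment[of "\<lambda>j. m j - l j"] in auto)
  have t2: "(\<integral>\<^sup>+ y. ennreal ((signal_noise I th (e y) (\<lambda>j. (m j - l j)\<^sup>2))\<^sup>2 / signal_energy I th (\<lambda>j. m j - l j)) \<partial>P) \<le> ennreal \<tau>"
    by (rule nn_integral_quotient_le) (use nn fin signal_noise_second_moment[of "\<lambda>j. (m j - l j)\<^sup>2" "\<lambda>j. m j - l j"] sq in auto)
  have "(\<integral>\<^sup>+ y. ennreal (pair_noise I th (e y) l m) \<partial>P) \<le> ennreal (32 * \<tau> + \<tau>)"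
    unfolding pair_noise_def[OF fin(1,2)]
    using nn fin by (intro nn_integral_add_le nn_integral_cmult_le t1 t2) auto
  then show ?thesis by (simp add: mult.commute)
qed

end

lemma two_abs_le: "0 < (a::real) \<Longrightarrow> 2 * \<bar>x\<bar> \<le> a * x\<^sup>2 + 1 / a"
proof -
  assume a: "0 < a"
  have "0 \<le> (a * \<bar>x\<bar> - 1)\<^sup>2 / a" using a by simp
  also have "\<dots> = a * x\<^sup>2 + 1 / a - 2 * \<bar>x\<bar>" using a by (simp add: power2_diff field_simps power2_eq_square)
  finally show ?thesis by simp
qed

text \<open>Four contributions, each of order n^(-3/2): the signal energy in the tail, the cross
  term \<open>Y\<close>, the chaos \<open>W\<close>, and the bias from at most sqrt n missing
  coordinates. The absolute values of \<open>Y\<close> and \<open>W\<close> are replaced by squares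
  with weight \<open>q\<close>, the root of \<open>n\<close>, which balances \<open>q\<close> times
  the second moment against \<open>1 / q\<close>.\<close>

lemma variance_estimator_deviation:
  assumes nm: "noise_moments P J e \<tau> C" and P: "prob_space P"
    and n: "1 \<le> n" and J: "J \<subseteq> {1..n}" "real n - sqrt (real n) \<le> real (card J)"
    and s: "(\<Sum>j\<in>J. (t j)\<^sup>2) \<le> s / real n" "0 \<le> s" and \<tau>: "\<tau> = \<sigma> / real n"
  shows "(\<integral>\<^sup>+ y. ennreal \<bar>(\<Sum>j\<in>J. (t j + e y j)\<^sup>2) / real n - \<tau>\<bar> \<partial>P)
    \<le> ennreal ((1 + s) * (2 + 2 * \<sigma> + \<sigma>\<^sup>2 * C) / (real n * sqrt (real n)))"
proof -
  interpret prob_space P by (rule P)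
  define q where "q = sqrt (real n)"
  have q: "1 \<le> q" "q * q = real n" using n by (auto simp: q_def)
  have q0: "0 < q" using q by simp
  note fin = noise_moments_I[OF nm]
  have em [measurable]: "(\<lambda>y. e y j) \<in> borel_measurable P" if "j \<in> J" for j
    using nm that by (simp add: noise_moments_def)
  define Y where "Y y = (\<Sum>j\<in>J. t j * e y j)" for y
  define W where "W y = (\<Sum>j\<in>J. 1 * ((e y j)\<^sup>2 - \<tau>))" for y
  have Ym [measurable]: "Y \<in> borel_measurable P" and Wm [measurable]: "W \<in> borel_measurable P"
    unfolding Y_def[abs_def] W_def[abs_def] by (auto intro!: borel_measurable_sum)
  have \<sigma>: "0 < \<sigma>" using fin(2) n by (simp add: \<tau> zero_less_divide_iff)
  have cJ: "real (card J) \<le> real n" using card_mono[OF _ J(1)] by simp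
  have EY: "(\<integral>\<^sup>+ y. ennreal ((Y y)\<^sup>2) \<partial>P) \<le> ennreal (\<tau> * (s / real n))"
  proof -
    have "(\<integral>\<^sup>+ y. ennreal ((Y y)\<^sup>2) \<partial>P) \<le> ennreal (\<tau> * (\<Sum>j\<in>J. (t j)\<^sup>2))"
      unfolding Y_def using nm by (simp add: noise_moments_def)
    also have "\<dots> \<le> ennreal (\<tau> * (s / real n))" using s fin by (intro ennreal_leI mult_left_mono) auto
    finally show ?thesis .
  qed
  have EW: "(\<integral>\<^sup>+ y. ennreal ((W y)\<^sup>2) \<partial>P) \<le> ennreal (\<tau>\<^sup>2 * C * real n)"
  proof -
    have "(\<integral>\<^sup>+ y. ennreal ((W y)\<^sup>2) \<partial>P) \<le> ennreal (\<tau>\<^sup>2 * C * (\<Sum>j\<in>J. 1\<^sup>2))"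
      unfolding W_def by (rule noise_moments_bounds(2)[OF nm])
    also have "\<dots> \<le> ennreal (\<tau>\<^sup>2 * C * real n)" using cJ fin by (intro ennreal_leI mult_left_mono) auto
    finally show ?thesis .
  qed
  define k where "k = (s / real n + 2 / q + \<sigma> / q) / real n"
  have k0: "0 \<le> k" using s \<sigma> q0 by (simp add: k_def)
  have pt: "\<bar>(\<Sum>j\<in>J. (t j + e y j)\<^sup>2) / real n - \<tau>\<bar> \<le> q / real n * (Y y)\<^sup>2 + (q / real n * (W y)\<^sup>2 + k)" for y
  proof -
    have "(\<Sum>j\<in>J. (t j + e y j)\<^sup>2) = (\<Sum>j\<in>J. ((t j)\<^sup>2 + 2 * (t j * e y j)) + (1 * ((e y j)\<^sup>2 - \<tau>) + \<tau>))"
      by (intro sum.cong refl) (simp add: power2_sum)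
    also have "\<dots> = ((\<Sum>j\<in>J. (t j)\<^sup>2) + 2 * Y y) + (W y + real (card J) * \<tau>)"
      unfolding sum.distrib sum_distrib_left[symmetric] Y_def W_def by simp
    finally have eq: "(\<Sum>j\<in>J. (t j + e y j)\<^sup>2) / real n - \<tau>
        = ((\<Sum>j\<in>J. (t j)\<^sup>2) + 2 * Y y + W y - (real n - real (card J)) * \<tau>) / real n"
      using n by (simp add: field_simps)
    have a1: "0 \<le> (real n - real (card J)) * \<tau>" using cJ fin by (intro mult_nonneg_nonneg) auto
    have "(real n - real (card J)) * \<tau> \<le> q * \<tau>" using J(2) fin unfolding q_def by (intro mult_right_mono) auto
    also have "q * \<tau> = \<sigma> / q" unfolding \<tau> q(2)[symmetric] using q0 by simp
    finally have a2: "(real n - real (card J)) * \<tau> \<le> \<sigma> / q" .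
    have a3: "0 \<le> (\<Sum>j\<in>J. (t j)\<^sup>2)" by (intro sum_nonneg) simp
    have y2: "2 * \<bar>Y y\<bar> \<le> q * (Y y)\<^sup>2 + 1 / q" and w2: "2 * \<bar>W y\<bar> \<le> q * (W y)\<^sup>2 + 1 / q"
      by (rule two_abs_le[OF q0])+
    have sq: "0 \<le> s / real n" "0 \<le> \<sigma> / q" "2 / q = 1 / q + 1 / q" using s \<sigma> q0 by (auto simp: field_simps)
    have "\<bar>(\<Sum>j\<in>J. (t j)\<^sup>2) + 2 * Y y + W y - (real n - real (card J)) * \<tau>\<bar>
        \<le> (s / real n + 2 / q + \<sigma> / q) + q * (Y y)\<^sup>2 + q * (W y)\<^sup>2"
      using a1 a2 a3 y2 w2 s(1) sq by (smt (verit))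
    then have "\<bar>(\<Sum>j\<in>J. (t j + e y j)\<^sup>2) / real n - \<tau>\<bar>
       \<le> ((s / real n + 2 / q + \<sigma> / q) + q * (Y y)\<^sup>2 + q * (W y)\<^sup>2) / real n"
      unfolding eq abs_divide using n by (simp add: divide_right_mono)
    then show ?thesis by (simp add: k_def add_divide_distrib)
  qed
  have "(\<integral>\<^sup>+ y. ennreal \<bar>(\<Sum>j\<in>J. (t j + e y j)\<^sup>2) / real n - \<tau>\<bar> \<partial>P)
     \<le> (\<integral>\<^sup>+ y. ennreal (q / real n * (Y y)\<^sup>2 + (q / real n * (W y)\<^sup>2 + k)) \<partial>P)"
    by (intro nn_integral_mono ennreal_leI pt)
  also have "\<dots> \<le> ennreal (q / real n * (\<tau> * (s / real n)) + (q / real n * (\<tau>\<^sup>2 * C * real n) + k))"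
    using q0 k0 fin s(2) by (intro nn_integral_add_le nn_integral_cmult_le EY EW) (auto simp: emeasure_space_1)
  also have "\<dots> \<le> ennreal ((1 + s) * (2 + 2 * \<sigma> + \<sigma>\<^sup>2 * C) / (real n * q))"
  proof (rule ennreal_leI)
    have "q / real n * (\<tau> * (s / real n)) + (q / real n * (\<tau>\<^sup>2 * C * real n) + k)
       = (\<sigma> * s / (q * q) + \<sigma>\<^sup>2 * C + (s / q + 2 + \<sigma>)) / (real n * q)"
      unfolding \<tau> k_def q(2)[symmetric] using q0 by (simp add: field_simps power2_eq_square)
    also have "\<dots> \<le> (\<sigma> * s + \<sigma>\<^sup>2 * C + (s + 2 + \<sigma>)) / (real n * q)"
    proof (intro divide_right_mono add_mono order_refl)
      have "1 \<le> q * q" using q(1) mult_mono[of 1 q 1 q] by simp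
      then have "\<sigma> * s / (q * q) \<le> \<sigma> * s / 1" using \<sigma> s by (intro divide_left_mono) auto
      then show "\<sigma> * s / (q * q) \<le> \<sigma> * s" by simp
      show "s / q \<le> s" using divide_left_mono[of 1 q s] s(2) q by simp
    qed (use q0 in auto)
    also have "\<dots> \<le> (1 + s) * (2 + 2 * \<sigma> + \<sigma>\<^sup>2 * C) / (real n * q)"
    proof (intro divide_right_mono)
      have "0 \<le> s * (\<sigma>\<^sup>2 * C)" "0 \<le> \<sigma> * s" using s fin \<sigma> by auto
      then show "\<sigma> * s + \<sigma>\<^sup>2 * C + (s + 2 + \<sigma>) \<le> (1 + s) * (2 + 2 * \<sigma> + \<sigma>\<^sup>2 * C)"
        using s(2) \<sigma> by (simp add: algebra_simps)
    qed (use q0 in auto)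
    finally show "q / real n * (\<tau> * (s / real n)) + (q / real n * (\<tau>\<^sup>2 * C * real n) + k)
      \<le> (1 + s) * (2 + 2 * \<sigma> + \<sigma>\<^sup>2 * C) / (real n * q)" .
  qed
  finally show ?thesis by (simp add: q_def)
qed

section \<open>From the pathwise comparison to robust risks\<close>

section \<open>The risk of the selected estimator\<close>

context levy_noise
begin

text \<open>The stochastic integral over [0, n] is \<open>n\<close> times the estimated coefficient,
  and by periodicity its drift is \<open>n\<close> times the true one; the moment bounds are
  rescaled accordingly. In the cumulant term the squared l1 norm of \<open>x\<close> is at most
  \<open>card J\<close>, hence \<open>n\<close>, times the sum of squares, and
  \<open>\<sigma>2^4\<close> is at most the square of the total variance. This gives the constant
  \<open>2 + 16 * (LINT x|\<nu>. x^4) * B^4\<close>.\<close>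

lemma coefficient_noise_moments:
  fixes \<psi> :: "nat \<Rightarrow> real \<Rightarrow> real"
  assumes n: "1 \<le> n" and S: "continuous_on UNIV S" "\<And>x. S (x + 1) = S x"
    and on: "orthonormal_system J \<psi>" and per: "\<And>j x. j \<in> J \<Longrightarrow> \<psi> j (x + 1) = \<psi> j x"
    and b: "\<And>j s. j \<in> J \<Longrightarrow> s \<in> {0..1} \<Longrightarrow> \<bar>\<psi> j s\<bar> \<le> B" and B: "0 \<le> B" and cJ: "card J \<le> n"
    and X: "\<And>j. j \<in> J \<Longrightarrow> is_stoch_integral n (observation_law n (noise_law M w z n \<sigma>1 \<sigma>2) S) (\<psi> j) (X j)"
    and \<sigma>: "0 < \<sigma>1\<^sup>2 + \<sigma>2\<^sup>2"
  shows "noise_moments (observation_law n (noise_law M w z n \<sigma>1 \<sigma>2) S) J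
    (\<lambda>y j. X j y / real n - (LINT s:{0..1}|lborel. S s * \<psi> j s))
    ((\<sigma>1\<^sup>2 + \<sigma>2\<^sup>2) / real n) (2 + 16 * (LINT x|\<nu>. x^4) * B^4)"
proof -
  let ?P = "observation_law n (noise_law M w z n \<sigma>1 \<sigma>2) S" and ?Y = "obs_path n S \<sigma>1 \<sigma>2"
  define \<sigma> where "\<sigma> = \<sigma>1\<^sup>2 + \<sigma>2\<^sup>2"
  define p4 where "p4 = (LINT x|\<nu>. x^4)"
  have \<sigma>0: "0 < \<sigma>" using \<sigma> by (simp add: \<sigma>_def)
  have n0: "0 < real n" using n by simp
  have p40: "0 \<le> p4" unfolding p4_def by (intro Bochner_Integration.integral_nonneg) auto
  have J: "finite J" and \<psi>m: "\<And>j. j \<in> J \<Longrightarrow> \<psi> j \<in> borel_measurable borel"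
    and orth: "\<And>i j. i \<in> J \<Longrightarrow> j \<in> J \<Longrightarrow> (LINT s:{0..1}|lborel. \<psi> i s * \<psi> j s) = (if i = j then 1 else 0)"
    using on by (auto simp: orthonormal_system_def)
  have \<psi>b: "\<bar>\<psi> j s\<bar> \<le> B" if "j \<in> J" "0 \<le> s" for j s
    by (rule periodic_bounded[where f="\<psi> j"]) (use that per b in auto)
  obtain H where H: "\<And>x. 0 \<le> x \<Longrightarrow> \<bar>S x\<bar> \<le> H" using continuous_periodic_bounded[OF S] by blast
  have H0: "0 \<le> H" using H[of 0] by simp
  have Sm [measurable]: "S \<in> borel_measurable borel" by (rule borel_measurable_continuous_onI[OF S(1)])
  have Xm: "X j \<in> borel_measurable (skorokhod_space n)" if "j \<in> J" for j
    using X[OF that] unfolding is_stoch_integral_def by blast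
  define e where "e y j = X j y / real n - (LINT s:{0..1}|lborel. S s * \<psi> j s)" for y j
  have em [measurable]: "(\<lambda>y. e y j) \<in> borel_measurable (skorokhod_space n)" if "j \<in> J" for j
    unfolding e_def using Xm[OF that] by measurable
  define \<zeta> where "\<zeta> j \<omega> = X j (?Y \<omega>) - (LINT s:{0..real n}|lborel. \<psi> j s * S s)" for j \<omega>
  have \<zeta>e: "\<zeta> j \<omega> = real n * e (?Y \<omega>) j" if j: "j \<in> J" for j \<omega>
  proof -
    have "(LINT s:{0..real n}|lborel. \<psi> j s * S s) = real n * (LINT s:{0..1}|lborel. \<psi> j s * S s)"
    proof (rule periodic_integral)
      show "(\<lambda>s. \<psi> j s * S s) \<in> borel_measurable borel" using \<psi>m[OF j] by measurable
      show "\<psi> j (x + 1) * S (x + 1) = \<psi> j x * S x" for x using per[OF j] S(2) by simp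
      show "\<bar>\<psi> j x * S x\<bar> \<le> B * H" if "x \<in> {0..1}" for x
        unfolding abs_mult using b[OF j that] H[of x] that B by (intro mult_mono) auto
    qed
    then show ?thesis unfolding \<zeta>_def e_def using n by (simp add: right_diff_distrib mult.commute)
  qed
  have mom: "(\<integral>\<^sup>+ \<omega>. ennreal ((\<Sum>j\<in>J. x j * \<zeta> j \<omega>)\<^sup>2) \<partial>M) \<le> ennreal (\<sigma> * real n * (\<Sum>j\<in>J. (x j)\<^sup>2))"
    "(\<integral>\<^sup>+ \<omega>. ennreal ((\<Sum>j\<in>J. x j * ((\<zeta> j \<omega>)\<^sup>2 - \<sigma> * real n))\<^sup>2) \<partial>M)
      \<le> ennreal (2 * (\<sigma> * real n)\<^sup>2 * (\<Sum>j\<in>J. (x j)\<^sup>2) + \<sigma>2^4 * (16 * p4) * (B^4 * (\<Sum>j\<in>J. \<bar>x j\<bar>)\<^sup>2 * real n))" for x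
  proof -
    have o: "(LINT s:{0..real n}|lborel. \<psi> i s * \<psi> j s) = (if i = j then real n else 0)" if ij: "i \<in> J" "j \<in> J" for i j
    proof -
      have "(LINT s:{0..real n}|lborel. \<psi> i s * \<psi> j s) = real n * (LINT s:{0..1}|lborel. \<psi> i s * \<psi> j s)"
      proof (rule periodic_integral)
        show "(\<lambda>s. \<psi> i s * \<psi> j s) \<in> borel_measurable borel" using \<psi>m ij by measurable
        show "\<psi> i (x + 1) * \<psi> j (x + 1) = \<psi> i x * \<psi> j x" for x using per ij by simp
        show "\<bar>\<psi> i x * \<psi> j x\<bar> \<le> B * B" if "x \<in> {0..1}" for x
          unfolding abs_mult using b[OF ij(1) that] b[OF ij(2) that] B by (intro mult_mono) auto
      qed
      then show ?thesis using orth[OF ij] by simp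
    qed
    have fb: "\<bar>\<psi> j s\<bar> \<le> B" if "j \<in> J" "s \<in> {0..real n}" for j s
      using \<psi>b that by simp
    note c = centred_stoch_integral[OF n S \<psi>m fb X, folded \<zeta>_def]
    show "(\<integral>\<^sup>+ \<omega>. ennreal ((\<Sum>j\<in>J. x j * \<zeta> j \<omega>)\<^sup>2) \<partial>M) \<le> ennreal (\<sigma> * real n * (\<Sum>j\<in>J. (x j)\<^sup>2))"
      unfolding \<sigma>_def
      by (rule stoch_integral_moments(1)[OF n0 J B \<psi>m fb c(1) c(2) o])
    show "(\<integral>\<^sup>+ \<omega>. ennreal ((\<Sum>j\<in>J. x j * ((\<zeta> j \<omega>)\<^sup>2 - \<sigma> * real n))\<^sup>2) \<partial>M)
      \<le> ennreal (2 * (\<sigma> * real n)\<^sup>2 * (\<Sum>j\<in>J. (x j)\<^sup>2) + \<sigma>2^4 * (16 * p4) * (B^4 * (\<Sum>j\<in>J. \<bar>x j\<bar>)\<^sup>2 * real n))"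
      unfolding \<sigma>_def p4_def
      by (rule stoch_integral_moments(2)[OF n0 J B \<psi>m fb c(1) c(2) o])
  qed
  have b1: "(\<integral>\<^sup>+ y. ennreal ((\<Sum>j\<in>J. x j * e y j)\<^sup>2) \<partial>?P) \<le> ennreal (\<sigma> / real n * (\<Sum>j\<in>J. (x j)\<^sup>2))" for x
  proof -
    have "(\<integral>\<^sup>+ y. ennreal ((\<Sum>j\<in>J. x j * e y j)\<^sup>2) \<partial>?P) = (\<integral>\<^sup>+ \<omega>. ennreal ((\<Sum>j\<in>J. x j * e (?Y \<omega>) j)\<^sup>2) \<partial>M)"
      by (rule nn_integral_observation_law[OF n S(1)]) (auto intro!: borel_measurable_sum measurable_compose[OF _ measurable_ennreal])
    also have "\<dots> = (\<integral>\<^sup>+ \<omega>. ennreal ((\<Sum>j\<in>J. (x j / real n) * \<zeta> j \<omega>)\<^sup>2) \<partial>M)"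
      using n by (simp add: \<zeta>e)
    also have "\<dots> \<le> ennreal (\<sigma> * real n * (\<Sum>j\<in>J. (x j / real n)\<^sup>2))" by (rule mom)
    also have "\<sigma> * real n * (\<Sum>j\<in>J. (x j / real n)\<^sup>2) = \<sigma> / real n * (\<Sum>j\<in>J. (x j)\<^sup>2)"
      using n by (simp add: power_divide sum_divide_distrib[symmetric] power2_eq_square)
    finally show ?thesis .
  qed
  have b2: "(\<integral>\<^sup>+ y. ennreal ((\<Sum>j\<in>J. x j * ((e y j)\<^sup>2 - \<sigma> / real n))\<^sup>2) \<partial>?P)
      \<le> ennreal ((\<sigma> / real n)\<^sup>2 * (2 + 16 * p4 * B^4) * (\<Sum>j\<in>J. (x j)\<^sup>2))" for x
  proof -
    have "(\<integral>\<^sup>+ y. ennreal ((\<Sum>j\<in>J. x j * ((e y j)\<^sup>2 - \<sigma> / real n))\<^sup>2) \<partial>?P)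
        = (\<integral>\<^sup>+ \<omega>. ennreal ((\<Sum>j\<in>J. x j * ((e (?Y \<omega>) j)\<^sup>2 - \<sigma> / real n))\<^sup>2) \<partial>M)"
      by (rule nn_integral_observation_law[OF n S(1)]) (auto intro!: borel_measurable_sum measurable_compose[OF _ measurable_ennreal])
    also have "\<dots> = (\<integral>\<^sup>+ \<omega>. ennreal ((\<Sum>j\<in>J. (x j / (real n)\<^sup>2) * ((\<zeta> j \<omega>)\<^sup>2 - \<sigma> * real n))\<^sup>2) \<partial>M)"
    proof -
      have "(x j / (real n)\<^sup>2) * ((\<zeta> j \<omega>)\<^sup>2 - \<sigma> * real n) = x j * ((e (?Y \<omega>) j)\<^sup>2 - \<sigma> / real n)" if "j \<in> J" for j \<omega>
        using n by (simp add: \<zeta>e[OF that] field_simps power2_eq_square)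
      then show ?thesis by simp
    qed
    also have "\<dots> \<le> ennreal (2 * (\<sigma> * real n)\<^sup>2 * (\<Sum>j\<in>J. (x j / (real n)\<^sup>2)\<^sup>2)
        + \<sigma>2^4 * (16 * p4) * (B^4 * (\<Sum>j\<in>J. \<bar>x j / (real n)\<^sup>2\<bar>)\<^sup>2 * real n))" by (rule mom)
    also have "\<dots> \<le> ennreal ((\<sigma> / real n)\<^sup>2 * (2 + 16 * p4 * B^4) * (\<Sum>j\<in>J. (x j)\<^sup>2))"
    proof (rule ennreal_leI)
      have e1: "2 * (\<sigma> * real n)\<^sup>2 * (\<Sum>j\<in>J. (x j / (real n)\<^sup>2)\<^sup>2) = (\<sigma> / real n)\<^sup>2 * (2 * (\<Sum>j\<in>J. (x j)\<^sup>2))"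
        using n by (simp add: power_divide sum_divide_distrib[symmetric] power2_eq_square field_simps)
      have "(\<Sum>j\<in>J. \<bar>x j / (real n)\<^sup>2\<bar>) = (\<Sum>j\<in>J. \<bar>x j\<bar>) / (real n)\<^sup>2"
        by (simp add: sum_divide_distrib)
      then have e2: "B^4 * (\<Sum>j\<in>J. \<bar>x j / (real n)\<^sup>2\<bar>)\<^sup>2 * real n = B^4 * (\<Sum>j\<in>J. \<bar>x j\<bar>)\<^sup>2 / real n / (real n)\<^sup>2"
        using n by (simp add: power_divide power2_eq_square)
      have "(\<Sum>j\<in>J. \<bar>x j\<bar>)\<^sup>2 \<le> real (card J) * (\<Sum>j\<in>J. \<bar>x j\<bar>\<^sup>2)"
        using sum_squared_le_sum_of_squares[of "\<lambda>j. \<bar>x j\<bar>" J] by (simp add: mult.commute)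
      also have "\<dots> \<le> real n * (\<Sum>j\<in>J. (x j)\<^sup>2)" using cJ by (intro mult_mono) (auto intro!: sum_nonneg)
      finally have "(\<Sum>j\<in>J. \<bar>x j\<bar>)\<^sup>2 / real n \<le> (\<Sum>j\<in>J. (x j)\<^sup>2)" using n by (simp add: field_simps)
      then have "B^4 * ((\<Sum>j\<in>J. \<bar>x j\<bar>)\<^sup>2 / real n) / (real n)\<^sup>2 \<le> B^4 * (\<Sum>j\<in>J. (x j)\<^sup>2) / (real n)\<^sup>2"
        using B by (intro divide_right_mono mult_left_mono) auto
      then have e3: "B^4 * (\<Sum>j\<in>J. \<bar>x j / (real n)\<^sup>2\<bar>)\<^sup>2 * real n \<le> B^4 * (\<Sum>j\<in>J. (x j)\<^sup>2) / (real n)\<^sup>2"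
        unfolding e2 by simp
      have "\<sigma>2\<^sup>2 \<le> \<sigma>" by (simp add: \<sigma>_def)
      then have "(\<sigma>2\<^sup>2)\<^sup>2 \<le> \<sigma>\<^sup>2" by (intro power_mono) auto
      then have "\<sigma>2^4 \<le> \<sigma>\<^sup>2" by (simp add: power_mult[symmetric])
      then have "\<sigma>2^4 * (16 * p4) * (B^4 * (\<Sum>j\<in>J. \<bar>x j / (real n)\<^sup>2\<bar>)\<^sup>2 * real n)
          \<le> \<sigma>\<^sup>2 * (16 * p4) * (B^4 * (\<Sum>j\<in>J. (x j)\<^sup>2) / (real n)\<^sup>2)"
        using e3 p40 B by (intro mult_mono) auto
      also have "\<dots> = (\<sigma> / real n)\<^sup>2 * (16 * p4 * B^4 * (\<Sum>j\<in>J. (x j)\<^sup>2))" by (simp add: power_divide)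
      finally show "2 * (\<sigma> * real n)\<^sup>2 * (\<Sum>j\<in>J. (x j / (real n)\<^sup>2)\<^sup>2)
        + \<sigma>2^4 * (16 * p4) * (B^4 * (\<Sum>j\<in>J. \<bar>x j / (real n)\<^sup>2\<bar>)\<^sup>2 * real n)
        \<le> (\<sigma> / real n)\<^sup>2 * (2 + 16 * p4 * B^4) * (\<Sum>j\<in>J. (x j)\<^sup>2)"
        unfolding e1 by (simp only: distrib_left distrib_right mult.assoc add_left_mono)
    qed
    finally show ?thesis .
  qed
  have "sets ?P = sets (skorokhod_space n)" by (simp add: observation_law_def)
  then have "(\<lambda>y. e y j) \<in> borel_measurable ?P" if "j \<in> J" for j
    using em[OF that] by (simp cong: measurable_cong_sets)
  then show ?thesis
    unfolding noise_moments_def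
    using J \<sigma>0 n0 p40 B b1 b2 unfolding \<sigma>_def p4_def e_def by simp
qed

end

text \<open>The amount subtracted from each estimated coefficient, isolated because the pathwise
  argument needs only its support and its Euclidean norm.\<close>

definition shrinkage ::
  "(nat \<Rightarrow> (real \<Rightarrow> real) \<Rightarrow> (real \<Rightarrow> real) \<Rightarrow> real) \<Rightarrow> (nat \<Rightarrow> real \<Rightarrow> real) \<Rightarrow> nat \<Rightarrow> real \<Rightarrow> nat \<Rightarrow>
   (real \<Rightarrow> real) \<Rightarrow> nat \<Rightarrow> real" where
  "shrinkage SI \<phi> n c d y j =
     (if 1 \<le> j \<and> j \<le> d then c / sqrt (\<Sum>i=1..d. (theta_hat SI \<phi> n i y)\<^sup>2) * theta_hat SI \<phi> n j y else 0)"

lemma theta_star_eq: "theta_star SI \<phi> n c d j y = theta_hat SI \<phi> n j y - shrinkage SI \<phi> n c d y j"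
  by (simp add: theta_star_def shrinkage_def left_diff_distrib)

text \<open>On its support it is \<open>c\<close> times a unit vector; if all estimated coefficients
  there vanish, division by zero makes it 0.\<close>

lemma shrinkage_norm:
  assumes "d \<le> n" "\<bar>c\<bar> \<le> c0"
  shows "(\<Sum>j\<in>{1..n}. (shrinkage SI \<phi> n c d y j)\<^sup>2) \<le> c0\<^sup>2"
proof -
  define q where "q = (\<Sum>i=1..d. (theta_hat SI \<phi> n i y)\<^sup>2)"
  have q: "0 \<le> q" unfolding q_def by (intro sum_nonneg) simp
  have "(\<Sum>j\<in>{1..n}. (shrinkage SI \<phi> n c d y j)\<^sup>2) = (\<Sum>j\<in>{1..d}. (shrinkage SI \<phi> n c d y j)\<^sup>2)"
    using assms by (intro sum.mono_neutral_right) (auto simp: shrinkage_def)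
  also have "\<dots> = (\<Sum>j\<in>{1..d}. (c / sqrt q)\<^sup>2 * (theta_hat SI \<phi> n j y)\<^sup>2)"
    by (intro sum.cong) (simp_all add: shrinkage_def q_def power_mult_distrib power_divide)
  also have "\<dots> = (c / sqrt q)\<^sup>2 * q" by (simp add: sum_distrib_left q_def)
  also have "\<dots> \<le> c\<^sup>2" using q by (cases "q = 0") (simp_all add: power_divide)
  also have "\<dots> \<le> c0\<^sup>2" using assms(2) by (simp add: abs_le_square_iff[symmetric])
  finally show ?thesis .
qed

lemma estimator_loss:
  assumes on: "orthonormal_system {1..n} \<phi>"
    and S: "S \<in> borel_measurable borel" "\<And>s. s \<in> {0..1} \<Longrightarrow> \<bar>S s\<bar> \<le> H" and \<tau>: "0 < (\<tau>::real)"
  defines "th \<equiv> \<lambda>j. LINT s:{0..1}|lborel. S s * \<phi> j s"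
  shows "(\<integral>\<^sup>+ t\<in>{0..1}. ennreal ((shrinkage_estimator SI \<phi> n c d l y t - S t)\<^sup>2) \<partial>lborel)
      = ennreal (loss {1..n} th (\<lambda>j. theta_hat SI \<phi> n j y - th j) l (shrinkage SI \<phi> n (c l) (d l) y)
          + ((LINT s:{0..1}|lborel. (S s)\<^sup>2) - (\<Sum>j\<in>{1..n}. (th j)\<^sup>2)))"
    and "cost_fun SI \<phi> n c d \<delta> y l = penalised_cost {1..n} th (\<lambda>j. theta_hat SI \<phi> n j y - th j) \<delta>
      (sigma_hat SI n y / real n) l (shrinkage SI \<phi> n (c l) (d l) y)"
proof -
  have "loss {1..n} th (\<lambda>j. theta_hat SI \<phi> n j y - th j) l (shrinkage SI \<phi> n (c l) (d l) y)
     = (\<Sum>j\<in>{1..n}. (l j * theta_star SI \<phi> n (c l) (d l) j y - th j)\<^sup>2)"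
    by (subst loss_def[OF _ \<tau>]) (simp_all add: theta_star_eq)
  moreover note orthonormal_expansion(1)[OF on S, of "\<lambda>j. l j * theta_star SI \<phi> n (c l) (d l) j y"]
  ultimately show "(\<integral>\<^sup>+ t\<in>{0..1}. ennreal ((shrinkage_estimator SI \<phi> n c d l y t - S t)\<^sup>2) \<partial>lborel)
      = ennreal (loss {1..n} th (\<lambda>j. theta_hat SI \<phi> n j y - th j) l (shrinkage SI \<phi> n (c l) (d l) y)
          + ((LINT s:{0..1}|lborel. (S s)\<^sup>2) - (\<Sum>j\<in>{1..n}. (th j)\<^sup>2)))"
    by (simp add: shrinkage_estimator_def th_def)
  show "cost_fun SI \<phi> n c d \<delta> y l = penalised_cost {1..n} th (\<lambda>j. theta_hat SI \<phi> n j y - th j) \<delta>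
      (sigma_hat SI n y / real n) l (shrinkage SI \<phi> n (c l) (d l) y)"
    by (subst penalised_cost_def[OF _ \<tau>]) (simp_all add: cost_fun_def theta_star_eq)
qed

text \<open>After cross-multiplication the two leading factors differ by
  \<open>3 * \<delta> + 3/2 * \<delta>\<^sup>2\<close>, which is positive. The factor 2 bounds
  \<open>1 / (1 - \<delta>/4)\<close>.\<close>

lemma oracle_constants:
  fixes a b N \<delta> :: real
  assumes \<delta>: "0 < \<delta>" "\<delta> < 1/2" and "0 \<le> b" "0 \<le> N"
    and le: "(1 - \<delta>/4) * a \<le> (1 + 11/4 * \<delta>) * b + (1 / \<delta>) * N"
  shows "a \<le> (1 + 5 * \<delta>) / (1 - \<delta>) * b + 2 / \<delta> * N"
proof -
  have p: "0 < 1 - \<delta>/4" "1/2 \<le> 1 - \<delta>/4" using \<delta> by auto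
  have "(1 + 5 * \<delta>) * (1 - \<delta>/4) = (1 + 11/4 * \<delta>) * (1 - \<delta>) + (3 * \<delta> + 3/2 * \<delta>\<^sup>2)"
    by (simp add: field_simps power2_eq_square)
  then have "(1 + 11/4 * \<delta>) * (1 - \<delta>) \<le> (1 + 5 * \<delta>) * (1 - \<delta>/4)" using \<delta> by simp
  then have "(1 + 11/4 * \<delta>) / (1 - \<delta>/4) \<le> (1 + 5 * \<delta>) / (1 - \<delta>)"
    using p \<delta> by (subst frac_le_eq) (auto simp: divide_le_0_iff)
  then have k: "(1 + 11/4 * \<delta>) / (1 - \<delta>/4) * b \<le> (1 + 5 * \<delta>) / (1 - \<delta>) * b"
    using assms by (intro mult_right_mono) auto
  have "1 / (1 - \<delta>/4) \<le> 2" using p by (simp add: divide_le_eq)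
  then have "1 / (1 - \<delta>/4) * (1 / \<delta> * N) \<le> 2 * (1 / \<delta> * N)" using assms by (intro mult_right_mono) auto
  moreover have "a \<le> ((1 + 11/4 * \<delta>) * b + (1 / \<delta>) * N) / (1 - \<delta>/4)"
    using le p by (simp add: pos_le_divide_eq mult.commute)
  moreover have "((1 + 11/4 * \<delta>) * b + (1 / \<delta>) * N) / (1 - \<delta>/4)
     = (1 + 11/4 * \<delta>) / (1 - \<delta>/4) * b + 1 / (1 - \<delta>/4) * (1 / \<delta> * N)"
  proof -
    have "(x * b + y) / p = x / p * b + 1 / p * y" for x y p :: real by (simp add: add_divide_distrib)
    then show ?thesis .
  qed
  ultimately show ?thesis using k by simp
qed

context levy_noise
begin

text \<open>Concerns one noise law and one competitor \<open>l\<close>. The random selection is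
  removed pathwise: \<open>N\<close> dominates the noise for every value that \<open>sel\<close> may
  take, so only means of noise at fixed weights occur.\<close>

lemma selected_risk_bound:
  fixes \<phi> :: "nat \<Rightarrow> real \<Rightarrow> real"
  defines "P \<equiv> \<lambda>n \<sigma>1 \<sigma>2 S. observation_law n (noise_law M w z n \<sigma>1 \<sigma>2) S"
  assumes n: "2 \<le> n" and \<sigma>0: "0 < \<sigma>1\<^sup>2 + \<sigma>2\<^sup>2" and S: "periodic_C1 S"
    and SI: "\<And>f. L2_on (real n) f \<Longrightarrow> is_stoch_integral n (P n \<sigma>1 \<sigma>2 S) f (SI n f)"
    and on: "orthonormal_system {1..n} \<phi>" and per: "\<And>j x. 1 \<le> j \<Longrightarrow> \<phi> j (x + 1) = \<phi> j x"
    and b: "\<And>j s. j \<in> {1..n} \<Longrightarrow> s \<in> {0..1} \<Longrightarrow> \<bar>\<phi> j s\<bar> \<le> b" "0 \<le> b"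
    and L: "finite L" "\<And>l j. l \<in> L \<Longrightarrow> j \<in> {1..n} \<Longrightarrow> 0 \<le> l j \<and> l j \<le> 1"
    and d: "\<And>l. l \<in> L \<Longrightarrow> 1 \<le> d l \<and> d l \<le> n \<and> (\<forall>j\<in>{1..d l}. l j = 1)"
    and A: "\<And>l. l \<in> L \<Longrightarrow> (\<Sum>j=1..n. l j) \<le> A" and c: "\<And>l. l \<in> L \<Longrightarrow> \<bar>c l\<bar> \<le> c0"
    and \<delta>: "0 < \<delta>" "\<delta> < 1/2"
    and sel: "\<And>y. y \<in> space (skorokhod_space n) \<Longrightarrow> is_arg_min (cost_fun SI \<phi> n c d \<delta> y) (\<lambda>l. l \<in> L) (sel y)"
    and l: "l \<in> L"
  shows "risk n (noise_law M w z n \<sigma>1 \<sigma>2) (\<lambda>y. shrinkage_estimator SI \<phi> n c d (sel y) y) S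
    \<le> ennreal ((1 + 5 * \<delta>) / (1 - \<delta>)) * risk n (noise_law M w z n \<sigma>1 \<sigma>2) (shrinkage_estimator SI \<phi> n c d l) S
      + ennreal (2 / \<delta> * (real (card L) * ((\<sigma>1\<^sup>2 + \<sigma>2\<^sup>2) / real n * (12 * (2 + 16 * (LINT x|\<nu>. x^4) * b^4) + 35))
          + (24 * c0\<^sup>2 + 3 * A * ((1 + (LINT t:{0..1}|lborel. (deriv S t)\<^sup>2))
              * (2 + 2 * (\<sigma>1\<^sup>2 + \<sigma>2\<^sup>2) + (\<sigma>1\<^sup>2 + \<sigma>2\<^sup>2)\<^sup>2 * (2 + 64 * (LINT x|\<nu>. x^4))) / (real n * sqrt (real n))))))"
proof -
  define \<sigma> where "\<sigma> = \<sigma>1\<^sup>2 + \<sigma>2\<^sup>2"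
  define p4 where "p4 = (LINT x|\<nu>. x^4)"
  define s where "s = (LINT t:{0..1}|lborel. (deriv S t)\<^sup>2)"
  define \<tau> where "\<tau> = \<sigma> / real n"
  let ?P = "P n \<sigma>1 \<sigma>2 S"
  let ?I = "{1..n}"
  have \<tau>: "0 < \<tau>" using \<sigma>0 n by (simp add: \<tau>_def \<sigma>_def)
  have n1: "1 \<le> n" using n by simp
  have Sd: "(S has_real_derivative deriv S x) (at x)" for x
    using S by (simp add: periodic_C1_def DERIV_deriv_iff_real_differentiable)
  have dS: "continuous_on UNIV (deriv S)" and Sper: "S (x + 1) = S x" for x
    using S by (auto simp: periodic_C1_def)
  have cS: "continuous_on UNIV S"
    using Sd by (auto intro!: DERIV_isCont continuous_at_imp_continuous_on)
  obtain H where H: "\<And>x. 0 \<le> x \<Longrightarrow> \<bar>S x\<bar> \<le> H" using continuous_periodic_bounded[OF cS Sper] by blast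
  have Sm [measurable]: "S \<in> borel_measurable borel" by (rule borel_measurable_continuous_onI[OF cS])
  have s0: "0 \<le> s" unfolding s_def set_lebesgue_integral_def by (intro Bochner_Integration.integral_nonneg) auto
  have L2: "L2_on (real n) f" if "f \<in> borel_measurable borel" "\<And>s. 0 \<le> s \<Longrightarrow> \<bar>f s\<bar> \<le> B" for f :: "real \<Rightarrow> real" and B
  proof -
    have "integrable (segment_measure (real n)) (\<lambda>t. (f t)\<^sup>2)"
    proof (rule integrable_interval_bounded[where C="B\<^sup>2"])
      fix s assume "s \<in> {0..real n}"
      then have "\<bar>f s\<bar> \<le> \<bar>B\<bar>" using that(2)[of s] by simp
      then show "\<bar>(f s)\<^sup>2\<bar> \<le> B\<^sup>2" by (simp add: abs_le_square_iff)
    qed (use that in auto)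
    then show ?thesis
      using that(1) by (simp add: L2_on_def segment_measure_def set_integrable_def integrable_restrict_space)
  qed
  define th where "th j = (LINT s:{0..1}|lborel. S s * \<phi> j s)" for j
  define e where "e y j = theta_hat SI \<phi> n j y - th j" for y j
  have \<phi>m: "\<phi> j \<in> borel_measurable borel" if "j \<in> ?I" for j
    using on that by (auto simp: orthonormal_system_def)
  have \<phi>S: "is_stoch_integral n ?P (\<phi> j) (SI n (\<phi> j))" if j: "j \<in> ?I" for j
  proof (rule SI[OF L2[OF \<phi>m[OF j]]])
    show "\<bar>\<phi> j s\<bar> \<le> b" if "0 \<le> s" for s
      by (rule periodic_bounded[where f="\<phi> j"]) (use that per b j in auto)
  qed
  define C where "C = 2 + 16 * p4 * b^4"
  have nm: "noise_moments ?P ?I e \<tau> C"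
    using coefficient_noise_moments[OF n1 cS Sper on _ b(1) b(2) _ \<phi>S[unfolded P_def] \<sigma>0] per
    by (simp add: P_def e_def[abs_def] th_def theta_hat_def \<tau>_def \<sigma>_def C_def p4_def)
  define J where "J = {nat \<lfloor>sqrt (real n)\<rfloor> + 1..n}"
  define t where "t j = (LINT s:{0..1}|lborel. S s * trig_basis j s)" for j
  define e' where "e' y j = theta_hat SI trig_basis n j y - t j" for y j
  \<comment> \<open>The general constant with the sup norm sqrt 2 of the trigonometric basis, whose
    fourth power is 4.\<close>
  define C2 where "C2 = 2 + 64 * p4"
  have nm': "noise_moments ?P J e' \<tau> C2"
  proof -
    have J: "card J \<le> n" "finite J" "0 \<notin> J" by (auto simp: J_def)
    have X: "is_stoch_integral n ?P (trig_basis j) (SI n (trig_basis j))" for j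
      by (rule SI[OF L2[OF trig_basis_measurable]]) (rule trig_basis_bound)
    have "(sqrt 2)^4 = ((sqrt 2)\<^sup>2)\<^sup>2" by (simp only: power_mult[symmetric]) simp
    then have q: "(sqrt 2)^4 = (4::real)" by simp
    show ?thesis
      using coefficient_noise_moments[OF n1 cS Sper trig_orthonormal_system[OF J(2,3)] trig_basis_periodic trig_basis_bound _ J(1)
          X[unfolded P_def] \<sigma>0]
      by (simp add: P_def e'_def[abs_def] t_def theta_hat_def \<tau>_def \<sigma>_def C2_def p4_def q)
  qed
  have PP: "prob_space ?P"
    unfolding P_def observation_law_eq(2)[OF n1 cS] by (rule prob_space_distr[OF observation_law_eq(1)[OF n1 cS]])
  have sp: "space ?P = space (skorokhod_space n)" by (simp add: P_def observation_law_def)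
  define D where "D y = \<bar>sigma_hat SI n y / real n - \<tau>\<bar>" for y
  have D_eq: "D y = \<bar>(\<Sum>j\<in>J. (t j + e' y j)\<^sup>2) / real n - \<tau>\<bar>" for y
    by (simp add: D_def sigma_hat_def J_def e'_def)
  have Dm: "D \<in> borel_measurable ?P"
  proof -
    have "(\<lambda>y. e' y j) \<in> borel_measurable ?P" if "j \<in> J" for j using nm' that by (simp add: noise_moments_def)
    then show ?thesis unfolding D_eq[abs_def] by measurable
  qed
  define K where "K = (1 + s) * (2 + 2 * \<sigma> + \<sigma>\<^sup>2 * C2) / (real n * sqrt (real n))"
  have ED: "(\<integral>\<^sup>+ y. ennreal (D y) \<partial>?P) \<le> ennreal K"
    unfolding D_eq K_def
  proof (rule variance_estimator_deviation[OF nm' PP n1 _ _ _ s0 \<tau>_def])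
    show "J \<subseteq> {1..n}" by (auto simp: J_def)
    have f: "real (nat \<lfloor>sqrt (real n)\<rfloor>) \<le> sqrt (real n)" by simp
    have "1 \<le> sqrt (real n)" using n by simp
    then have "sqrt (real n) * 1 \<le> sqrt (real n) * sqrt (real n)" by (rule mult_left_mono) simp
    then have "sqrt (real n) \<le> real n" by simp
    then have "nat \<lfloor>sqrt (real n)\<rfloor> \<le> n" using f by linarith
    then show "real n - sqrt (real n) \<le> real (card J)" using f by (simp add: J_def of_nat_diff)
    show "(\<Sum>j\<in>J. (t j)\<^sup>2) \<le> s / real n"
      unfolding t_def s_def
    proof (rule trig_tail_energy[OF Sd dS Sper])
      show "finite J" by (simp add: J_def)
      fix j assume "j \<in> J"
      then have "nat \<lfloor>sqrt (real n)\<rfloor> + 1 \<le> j" by (simp add: J_def)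
      then have "real (nat \<lfloor>sqrt (real n)\<rfloor> + 1) \<le> real j" by (simp only: of_nat_le_iff)
      then have j: "real (nat \<lfloor>sqrt (real n)\<rfloor>) + 1 \<le> real j" by (simp only: of_nat_add of_nat_1)
      have "sqrt (real n) < real (nat \<lfloor>sqrt (real n)\<rfloor>) + 1" by simp
      also note j
      \<comment> \<open>Indices beyond the integer part of sqrt n exceed sqrt n, so \<open>n\<close>
        bounds their squares from below and the tail energy is at most \<open>s / n\<close>.\<close>
      finally have k: "sqrt (real n) < real j" .
      have "1 \<le> sqrt (real n)" using n by simp
      then have "2 \<le> j" using k by linarith
      moreover have "(sqrt (real n))\<^sup>2 \<le> (real j)\<^sup>2" using k by (intro power_mono) auto
      ultimately show "2 \<le> j \<and> real n \<le> (real j)\<^sup>2" by simp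
    qed (use n in simp)
  qed
  note fin = noise_moments_I[OF nm]
  have A0: "0 \<le> A" using A[OF l] L(2)[OF l] sum_nonneg[of "{1..n}" l] by force
  \<comment> \<open>The single terms are taken twice, because those of \<open>l\<close> and those of
    the selected weights are each bounded by the full sum; the pair terms are summed over the second
    argument only, as \<open>l\<close> is fixed.\<close>
  define N where "N y = (\<Sum>m\<in>L. 2 * single_noise ?I th (e y) \<tau> m {1..d m} + pair_noise ?I th (e y) l m)
     + (24 * c0\<^sup>2 + 3 * A * D y)" for y
  have nn: "0 \<le> single_noise ?I th (e y) \<tau> m E" "0 \<le> pair_noise ?I th (e y) l m" for y m E
    by (rule noise_terms_nonneg[OF nm])+
  have nms: "(\<lambda>y. single_noise ?I th (e y) \<tau> m E) \<in> borel_measurable ?P"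
      "(\<lambda>y. pair_noise ?I th (e y) l m) \<in> borel_measurable ?P" for m E
    by (rule noise_terms_measurable[OF nm])+
  have D0: "0 \<le> D y" for y by (simp add: D_def)
  have K0: "0 \<le> K" using s0 \<sigma>0 noise_moments_I(3)[OF nm'] by (auto simp: K_def \<sigma>_def intro!: divide_nonneg_nonneg mult_nonneg_nonneg add_nonneg_nonneg)
  have N0: "0 \<le> N y" for y
    unfolding N_def using nn D0 A0 by (intro add_nonneg_nonneg sum_nonneg mult_nonneg_nonneg) auto
  have Nm: "N \<in> borel_measurable ?P"
    unfolding N_def[abs_def] using nms Dm by measurable
  define R where "R = real (card L) * (2 * (\<tau> * (6 * C + 1)) + \<tau> * 33) + (24 * c0\<^sup>2 + 3 * A * K)"
  have EN: "(\<integral>\<^sup>+ y. ennreal (N y) \<partial>?P) \<le> ennreal R"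
    unfolding N_def R_def
  proof (intro nn_integral_add_le nn_integral_sum_le nn_integral_cmult_le ED)
    fix m assume m: "m \<in> L"
    show "(\<integral>\<^sup>+ y. ennreal (single_noise ?I th (e y) \<tau> m {1..d m}) \<partial>?P) \<le> ennreal (\<tau> * (6 * C + 1))"
      using L(2)[OF m] d[OF m] by (intro single_noise_expectation[OF nm]) auto
    show "(\<integral>\<^sup>+ y. ennreal (pair_noise ?I th (e y) l m) \<partial>?P) \<le> ennreal (\<tau> * 33)"
      using L(2)[OF m] L(2)[OF l] by (intro pair_noise_expectation[OF nm]) auto
  next
    show "(\<integral>\<^sup>+ y. ennreal (c0\<^sup>2) \<partial>?P) \<le> ennreal (c0\<^sup>2)"
      using prob_space.emeasure_space_1[OF PP] by simp
  qed (use nn nms Dm D0 A0 K0 L(1) fin in \<open>auto intro!: sum_nonneg add_nonneg_nonneg\<close>)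
  \<comment> \<open>Energy of the signal outside the first \<open>n\<close> basis functions: the
    part of the error that no choice of weights can change.\<close>
  define \<rho> where "\<rho> = (LINT s:{0..1}|lborel. (S s)\<^sup>2) - (\<Sum>j\<in>?I. (th j)\<^sup>2)"
  have \<rho>: "0 \<le> \<rho>" using orthonormal_expansion(2)[OF on Sm H] by (simp add: \<rho>_def th_def)
  define \<L> where "\<L> m y = loss ?I th (e y) m (shrinkage SI \<phi> n (c m) (d m) y) + \<rho>" for m y
  have est: "(\<integral>\<^sup>+ t\<in>{0..1}. ennreal ((shrinkage_estimator SI \<phi> n c d m y t - S t)\<^sup>2) \<partial>lborel) = ennreal (\<L> m y)" for m y
    unfolding \<L>_def \<rho>_def e_def th_def using H by (intro estimator_loss(1)[OF on Sm _ \<tau>]) auto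
  have cost: "cost_fun SI \<phi> n c d \<delta> y m = penalised_cost ?I th (e y) \<delta> (sigma_hat SI n y / real n) m (shrinkage SI \<phi> n (c m) (d m) y)" for m y
    unfolding e_def th_def using H by (intro estimator_loss(2)[OF on Sm _ \<tau>]) auto
  have \<L>0: "0 \<le> \<L> m y" for m y
    unfolding \<L>_def loss_def[OF fin(1,2)] using \<rho> by (intro add_nonneg_nonneg sum_nonneg) auto
  have \<L>m: "\<L> m \<in> borel_measurable ?P" if "m \<in> L" for m
  proof -
    have [measurable]: "(\<lambda>y. theta_hat SI \<phi> n j y) \<in> borel_measurable ?P" if "j \<in> ?I" for j
    proof -
      have "(\<lambda>y. e y j) \<in> borel_measurable ?P" using nm that unfolding noise_moments_def by blast
      then have "(\<lambda>y. e y j + th j) \<in> borel_measurable ?P" by (intro borel_measurable_add) auto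
      then show ?thesis by (simp add: e_def)
    qed
    have [measurable]: "(\<lambda>y. shrinkage SI \<phi> n (c m) (d m) y j) \<in> borel_measurable ?P" if "j \<in> ?I" for j
      unfolding shrinkage_def using that d[OF \<open>m \<in> L\<close>] by (cases "1 \<le> j \<and> j \<le> d m") (auto intro!: borel_measurable_times borel_measurable_divide borel_measurable_sum measurable_compose[OF _ borel_measurable_sqrt] borel_measurable_power)
    show ?thesis unfolding \<L>_def[abs_def] loss_def[OF fin(1,2)] e_def by measurable
  qed
  have sw: "shrink_weights ?I m {1..d m} (shrinkage SI \<phi> n (c m) (d m) y) c0" if m: "m \<in> L" for m y
    unfolding shrink_weights_def[OF fin(1,2)]
    using d[OF m] L(2)[OF m] c[OF m] shrinkage_norm[of "d m" n "c m" c0 SI \<phi> y] by (auto simp: shrinkage_def)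
  define k1 where "k1 = (1 + 5 * \<delta>) / (1 - \<delta>)"
  have k1: "0 \<le> k1" using \<delta> by (simp add: k1_def)
  have path: "\<L> (sel y) y \<le> k1 * \<L> l y + 2 / \<delta> * N y" if y: "y \<in> space ?P" for y
  proof -
    have am: "is_arg_min (cost_fun SI \<phi> n c d \<delta> y) (\<lambda>l. l \<in> L) (sel y)" using sel y sp by simp
    then have m: "sel y \<in> L" and min: "cost_fun SI \<phi> n c d \<delta> y (sel y) \<le> cost_fun SI \<phi> n c d \<delta> y l"
      using l by (auto simp: is_arg_min_linorder)
    let ?l1 = "loss ?I th (e y) (sel y) (shrinkage SI \<phi> n (c (sel y)) (d (sel y)) y)"
    let ?l2 = "loss ?I th (e y) l (shrinkage SI \<phi> n (c l) (d l) y)"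
    let ?s = "\<lambda>m. single_noise ?I th (e y) \<tau> m {1..d m}"
    have o: "(1 - \<delta>/4) * ?l1 \<le> (1 + 11/4 * \<delta>) * ?l2
      + (1 / \<delta>) * (?s l + ?s (sel y) + pair_noise ?I th (e y) l (sel y) + 24 * c0\<^sup>2 + 3 * (D y * A))"
      unfolding D_def
      by (rule pathwise_oracle_inequality[OF fin(1,2) sw[OF l] sw[OF m] \<delta> A[OF l] A[OF m] min[unfolded cost]])
    have "?s k \<le> (\<Sum>m\<in>L. ?s m)" if "k \<in> L" for k
      by (rule member_le_sum[OF that _ L(1), where f="?s"], rule nn)
    from this[OF l] this[OF m]
    have "?s l \<le> (\<Sum>m\<in>L. ?s m)" "?s (sel y) \<le> (\<Sum>m\<in>L. ?s m)" .
    moreover have "pair_noise ?I th (e y) l (sel y) \<le> (\<Sum>m\<in>L. pair_noise ?I th (e y) l m)"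
      by (rule member_le_sum[OF m _ L(1), where f="pair_noise ?I th (e y) l"], rule nn)
    ultimately
    have "?s l + ?s (sel y) + pair_noise ?I th (e y) l (sel y) + 24 * c0\<^sup>2 + 3 * (D y * A) \<le> N y"
      unfolding N_def sum.distrib sum_distrib_left[symmetric] by (simp add: mult.commute)
    then have "(1 / \<delta>) * (?s l + ?s (sel y) + pair_noise ?I th (e y) l (sel y) + 24 * c0\<^sup>2 + 3 * (D y * A)) \<le> (1 / \<delta>) * N y"
      using \<delta> by (intro mult_left_mono) auto
    \<comment> \<open>The common residual is added to both losses; its factor on the right is the
      larger one.\<close>
    moreover have "(1 - \<delta>/4) * \<rho> \<le> (1 + 11/4 * \<delta>) * \<rho>" using \<delta> \<rho> by (intro mult_right_mono) auto
    ultimately have "(1 - \<delta>/4) * \<L> (sel y) y \<le> (1 + 11/4 * \<delta>) * \<L> l y + (1 / \<delta>) * N y"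
      unfolding \<L>_def distrib_left[of "1 - \<delta>/4"] distrib_left[of "1 + 11/4 * \<delta>"] using o by linarith
    then show ?thesis unfolding k1_def by (rule oracle_constants[OF \<delta> \<L>0 N0])
  qed
  have "risk n (noise_law M w z n \<sigma>1 \<sigma>2) (\<lambda>y. shrinkage_estimator SI \<phi> n c d (sel y) y) S = (\<integral>\<^sup>+ y. ennreal (\<L> (sel y) y) \<partial>?P)"
    by (simp add: risk_def est P_def)
  also have "\<dots> \<le> (\<integral>\<^sup>+ y. ennreal k1 * ennreal (\<L> l y) + ennreal (2 / \<delta>) * ennreal (N y) \<partial>?P)"
  proof (rule nn_integral_mono)
    fix y assume "y \<in> space ?P"
    then have "ennreal (\<L> (sel y) y) \<le> ennreal (k1 * \<L> l y + 2 / \<delta> * N y)" by (intro ennreal_leI path)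
    also have "\<dots> = ennreal k1 * ennreal (\<L> l y) + ennreal (2 / \<delta>) * ennreal (N y)"
      using k1 \<L>0 N0 \<delta> by (simp add: ennreal_plus ennreal_mult'[symmetric])
    finally show "ennreal (\<L> (sel y) y) \<le> ennreal k1 * ennreal (\<L> l y) + ennreal (2 / \<delta>) * ennreal (N y)" .
  qed
  also have "\<dots> = ennreal k1 * (\<integral>\<^sup>+ y. ennreal (\<L> l y) \<partial>?P) + ennreal (2 / \<delta>) * (\<integral>\<^sup>+ y. ennreal (N y) \<partial>?P)"
    using \<L>m[OF l] Nm by (simp add: nn_integral_add nn_integral_cmult)
  also have "\<dots> \<le> ennreal k1 * (\<integral>\<^sup>+ y. ennreal (\<L> l y) \<partial>?P) + ennreal (2 / \<delta>) * ennreal R"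
    using EN by (intro add_left_mono mult_left_mono) auto
  also have "(\<integral>\<^sup>+ y. ennreal (\<L> l y) \<partial>?P) = risk n (noise_law M w z n \<sigma>1 \<sigma>2) (shrinkage_estimator SI \<phi> n c d l) S"
    by (simp add: risk_def est P_def)
  also have "ennreal (2 / \<delta>) * ennreal R = ennreal (2 / \<delta> * R)" using \<delta> by (intro ennreal_mult'[symmetric]) simp
  also have "R = real (card L) * (\<sigma> / real n * (12 * C + 35)) + (24 * c0\<^sup>2 + 3 * A * K)"
    by (simp add: R_def \<tau>_def algebra_simps)
  finally show ?thesis
    unfolding K_def k1_def C_def C2_def s_def \<sigma>_def p4_def by simp
qed

end

text \<open>Writing \<open>A\<close> as \<open>a\<close> times sqrt n turns every term into a factor
  over \<open>n\<close>: the squared shrinkage bound becomes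
  \<open>(a * up / r)\<^sup>2 / n\<close>, and \<open>A\<close> cancels the extra root of
  \<open>n\<close> in the variance error. The factor \<open>1 + s\<close> is at least 1 and can be
  put on all terms.\<close>

lemma remainder_scaling:
  fixes k \<sigma> up C C2 s A r \<delta> :: real and n :: nat
  assumes \<sigma>: "0 < \<sigma>" "\<sigma> \<le> up" and p: "0 \<le> k" "0 \<le> C" "0 \<le> C2" "0 \<le> s" "0 \<le> A" "0 < \<delta>" and n: "0 < n"
  defines "a \<equiv> A / sqrt (real n)"
  shows "2 / \<delta> * (k * (\<sigma> / real n * (12 * C + 35)) + (24 * (A * up / (r * real n))\<^sup>2
        + 3 * A * ((1 + s) * (2 + 2 * \<sigma> + \<sigma>\<^sup>2 * C2) / (real n * sqrt (real n)))))
    \<le> (2 * (k * (up * (12 * C + 35)) + 24 * (a * up * (1 / r))\<^sup>2 + 3 * (a * (2 + 2 * up + up\<^sup>2 * C2)))) * (1 + s) / (real n * \<delta>)"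
proof -
  have a0: "0 \<le> a" using p n by (simp add: a_def)
  define x1 x2 x3 where "x1 = k * (up * (12 * C + 35))" and "x2 = 24 * (a * up * (1 / r))\<^sup>2"
    and "x3 = 3 * (a * (2 + 2 * up + up\<^sup>2 * C2))"
  have x: "0 \<le> x1" "0 \<le> x2" "0 \<le> x3" unfolding x1_def x2_def x3_def using \<sigma> p a0 by auto
  have m: "y \<le> y * (1 + s)" if "0 \<le> y" for y using that p(4) by (simp add: algebra_simps)
  have "k * (\<sigma> / real n * (12 * C + 35)) = k * (\<sigma> * (12 * C + 35)) / real n" by simp
  also have "\<dots> \<le> x1 / real n"
    unfolding x1_def using \<sigma> p by (intro divide_right_mono mult_left_mono mult_right_mono) auto
  also have "\<dots> \<le> x1 * (1 + s) / real n" using m[OF x(1)] by (intro divide_right_mono) auto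
  finally have b1: "k * (\<sigma> / real n * (12 * C + 35)) \<le> x1 * (1 + s) / real n" .
  have "24 * (A * up / (r * real n))\<^sup>2 = x2 / real n"
    unfolding x2_def a_def using n by (simp add: power_divide power_mult_distrib power2_eq_square field_simps)
  also have "\<dots> \<le> x2 * (1 + s) / real n" using m[OF x(2)] by (intro divide_right_mono) auto
  finally have b2: "24 * (A * up / (r * real n))\<^sup>2 \<le> x2 * (1 + s) / real n" .
  have "3 * A * ((1 + s) * (2 + 2 * \<sigma> + \<sigma>\<^sup>2 * C2) / (real n * sqrt (real n)))
      = 3 * (a * (2 + 2 * \<sigma> + \<sigma>\<^sup>2 * C2)) * (1 + s) / real n"
    unfolding a_def by (simp add: mult_ac)
  also have "\<dots> \<le> x3 * (1 + s) / real n"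
  proof -
    have "\<sigma>\<^sup>2 \<le> up\<^sup>2" using \<sigma> by (intro power_mono) auto
    then have "\<sigma>\<^sup>2 * C2 \<le> up\<^sup>2 * C2" using p by (intro mult_right_mono) auto
    then have "a * (2 + 2 * \<sigma> + \<sigma>\<^sup>2 * C2) \<le> a * (2 + 2 * up + up\<^sup>2 * C2)"
      using \<sigma> a0 by (intro mult_left_mono) auto
    then show ?thesis unfolding x3_def using p by (intro divide_right_mono mult_right_mono) auto
  qed
  finally have b3: "3 * A * ((1 + s) * (2 + 2 * \<sigma> + \<sigma>\<^sup>2 * C2) / (real n * sqrt (real n))) \<le> x3 * (1 + s) / real n" .
  have "2 / \<delta> * (k * (\<sigma> / real n * (12 * C + 35)) + (24 * (A * up / (r * real n))\<^sup>2
        + 3 * A * ((1 + s) * (2 + 2 * \<sigma> + \<sigma>\<^sup>2 * C2) / (real n * sqrt (real n)))))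
     \<le> 2 / \<delta> * (x1 * (1 + s) / real n + (x2 * (1 + s) / real n + x3 * (1 + s) / real n))"
    using p by (intro mult_left_mono add_mono b1 b2 b3) auto
  also have "\<dots> = (2 * (x1 + x2 + x3)) * (1 + s) / (real n * \<delta>)"
    using n p by (simp add: field_simps)
  finally show ?thesis by (simp only: x1_def x2_def x3_def)
qed

text \<open>For each law and each competitor the risk of the selected estimator is bounded with a
  remainder that is uniform over laws. Bounding the competitor's risk by its robust risk allows the
  supremum on the left; the competitor is chosen last.\<close>

theorem theorem4p3:
  fixes M :: "'a measure" and \<nu> :: "real measure"
    and w z :: "real \<Rightarrow> 'a \<Rightarrow> real" and N :: "'a \<Rightarrow> (real \<times> real) measure"
    and \<sigma>lo \<sigma>up r \<phi>bar :: "nat \<Rightarrow> real"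
    and SI :: "nat \<Rightarrow> (real \<Rightarrow> real) \<Rightarrow> (real \<Rightarrow> real) \<Rightarrow> real"
    and \<phi> :: "nat \<Rightarrow> real \<Rightarrow> real"
    and L :: "nat \<Rightarrow> (nat \<Rightarrow> real) set"
    and d :: "nat \<Rightarrow> (nat \<Rightarrow> real) \<Rightarrow> nat"
  assumes "prob_space M"
    and "levy_measure \<nu>"
    and "brownian_motion M w"
    and "poisson_random_measure M (jump_intensity \<nu>) N"
    and "indep_noise_sources M (jump_intensity \<nu>) w N"
    and "compensated_jump_process M \<nu> N z"
    and "\<And>n. n \<ge> 1 \<Longrightarrow> 0 < \<sigma>lo n \<and> \<sigma>lo n \<le> \<sigma>up n"
    and "\<And>\<epsilon>::real. \<epsilon> > 0 \<Longrightarrow> liminf (\<lambda>n. ereal (real n powr \<epsilon> * \<sigma>lo n)) > 0"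
    and "\<And>\<epsilon>::real. \<epsilon> > 0 \<Longrightarrow> (\<lambda>n. real n powr (- \<epsilon>) * \<sigma>up n) \<longlonglongrightarrow> 0"
    and "model_stoch_integrals M w z \<sigma>lo \<sigma>up SI"
    and "orthonormal_basis_L2 \<phi>"
    and "\<And>j t. j \<ge> 1 \<Longrightarrow> \<phi> j (t + 1) = \<phi> j t"
    and "\<And>n. n \<ge> 1 \<Longrightarrow> \<phi>bar n > 0"
    and "\<And>n j t. 1 \<le> j \<Longrightarrow> j \<le> n \<Longrightarrow> t \<in> {0..1} \<Longrightarrow> \<bar>\<phi> j t\<bar> \<le> \<phi>bar n"
    and "\<And>n. n \<ge> 1 \<Longrightarrow> finite (L n) \<and> L n \<noteq> {} \<and> L n \<subseteq> ({1..n} \<rightarrow>\<^sub>E {0..1})"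
    and "\<And>n l. n \<ge> 1 \<Longrightarrow> l \<in> L n \<Longrightarrow> 1 \<le> d n l \<and> d n l \<le> n \<and> (\<forall>j\<in>{1..d n l}. l j = 1)"
    and "\<And>n. n \<ge> 1 \<Longrightarrow> r n > 0"
    and "filterlim r at_top sequentially"
    and "\<And>\<epsilon>::real. \<epsilon> > 0 \<Longrightarrow> (\<lambda>n. r n / real n powr \<epsilon>) \<longlonglongrightarrow> 0"
    and "\<And>\<epsilon>::real. \<epsilon> > 0 \<Longrightarrow> (\<lambda>n. \<phi>bar n / real n powr \<epsilon>) \<longlonglongrightarrow> 0"
    and "\<And>\<epsilon>::real. \<epsilon> > 0 \<Longrightarrow> (\<lambda>n. real (card (L n)) / real n powr \<epsilon>) \<longlonglongrightarrow> 0"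
    and "\<And>\<epsilon>::real. \<epsilon> > 0 \<Longrightarrow>
           (\<lambda>n. (MAX l\<in>L n. \<Sum>j=1..n. l j) / real n powr (1/2 + \<epsilon>)) \<longlonglongrightarrow> 0"
  shows "\<exists>B :: nat \<Rightarrow> real.
      (\<forall>n\<ge>2. 0 \<le> B n) \<and>
      (\<forall>\<epsilon>>0. (\<lambda>n. B n / real n powr \<epsilon>) \<longlonglongrightarrow> 0) \<and>
      (\<forall>n\<ge>2. \<forall>\<delta> S sel. 0 < \<delta> \<and> \<delta> < 1/2 \<and> periodic_C1 S \<and>
         model_selector SI \<phi> n (\<lambda>l. shrink_const \<sigma>lo \<sigma>up r n (d n l)) (d n) (L n) \<delta> sel \<longrightarrow>
         robust_risk (noise_family M w z \<sigma>lo \<sigma>up n) n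
           (\<lambda>y. shrinkage_estimator SI \<phi> n (\<lambda>l. shrink_const \<sigma>lo \<sigma>up r n (d n l)) (d n) (sel y) y) S
         \<le> ennreal ((1 + 5 * \<delta>) / (1 - \<delta>)) *
             (MIN l\<in>L n. robust_risk (noise_family M w z \<sigma>lo \<sigma>up n) n
                (shrinkage_estimator SI \<phi> n (\<lambda>l. shrink_const \<sigma>lo \<sigma>up r n (d n l)) (d n) l) S)
           + ennreal (B n * (1 + (LINT t:{0..1}|lborel. (deriv S t)\<^sup>2)) / (real n * \<delta>)))"
proof -
  interpret levy_noise M \<nu> N w z
    by (intro levy_noise.intro jump_noise.intro jump_noise_axioms.intro levy_noise_axioms.intro) fact+
  define p4 where "p4 = (LINT x|\<nu>. x^4)"
  define A where "A n = (MAX l\<in>L n. \<Sum>j=1..n. l j)" for n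
  define a where "a n = A n / sqrt (real n)" for n
  define C where "C n = 2 + 16 * p4 * \<phi>bar n^4" for n
  define C2 where "C2 = 2 + 64 * p4"
  \<comment> \<open>Twice the three contributions of \<open>selected_risk_bound\<close> with the
    variance replaced by its upper bound: normalised noise over all weights, shrinkage, and variance
    estimation. Every ingredient is subpolynomial, and B is a polynomial in them.\<close>
  define B where "B n = 2 * (real (card (L n)) * (\<sigma>up n * (12 * C n + 35))
      + 24 * (a n * \<sigma>up n * (1 / r n))\<^sup>2 + 3 * (a n * (2 + 2 * \<sigma>up n + (\<sigma>up n)\<^sup>2 * C2)))" for n
  have p4: "0 \<le> p4" unfolding p4_def by (intro Bochner_Integration.integral_nonneg) auto
  have C0: "0 \<le> C n" "0 \<le> C2" for n using p4 by (simp_all add: C_def C2_def)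
  have LA: "(\<Sum>j=1..n. l j) \<le> A n" if "1 \<le> n" "l \<in> L n" for n l
    unfolding A_def using assms(15)[OF that(1)] that(2) by (intro Max_ge) auto
  have L01: "0 \<le> l j \<and> l j \<le> 1" if "1 \<le> n" "l \<in> L n" "j \<in> {1..n}" for n l j
    using assms(15)[OF that(1)] that(2,3) by (auto simp: PiE_iff subset_iff)
  have A0: "0 \<le> A n" if n: "1 \<le> n" for n
  proof -
    obtain l where l: "l \<in> L n" using assms(15)[OF n] by blast
    have "0 \<le> (\<Sum>j=1..n. l j)" using L01[OF n l] by (intro sum_nonneg) auto
    then show ?thesis using LA[OF n l] by simp
  qed
  have B0: "0 \<le> B n" if n: "1 \<le> n" for n
  proof -
    have "0 \<le> a n" using A0[OF n] by (simp add: a_def)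
    moreover have "0 \<le> \<sigma>up n" using assms(7)[OF n] by simp
    ultimately show ?thesis unfolding B_def using C0(1)[of n] C0(2) by auto
  qed
  have "subpolynomial \<sigma>up" unfolding subpolynomial_def
    using assms(9) by (simp add: powr_minus_divide)
  moreover have "subpolynomial \<phi>bar" unfolding subpolynomial_def using assms(20) by simp
  moreover have "subpolynomial (\<lambda>n. real (card (L n)))" unfolding subpolynomial_def using assms(21) by simp
  moreover have "subpolynomial a" unfolding subpolynomial_def
  proof (intro allI impI)
    fix \<epsilon> :: real assume "0 < \<epsilon>"
    from assms(22)[OF this] show "(\<lambda>n. a n / real n powr \<epsilon>) \<longlonglongrightarrow> 0"
      by (simp add: a_def A_def powr_add powr_half_sqrt)
  qed
  moreover have "subpolynomial (\<lambda>n. 1 / r n)" unfolding subpolynomial_def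
  proof (intro allI impI)
    fix \<epsilon> :: real assume "0 < \<epsilon>"
    then have "(\<lambda>n. real n powr (- \<epsilon>)) \<longlonglongrightarrow> 0"
      by (intro tendsto_neg_powr filterlim_real_sequentially) auto
    moreover have "(\<lambda>n. inverse (r n)) \<longlonglongrightarrow> 0" by (rule tendsto_inverse_0_at_top) fact
    ultimately have "(\<lambda>n. inverse (r n) * real n powr (- \<epsilon>)) \<longlonglongrightarrow> 0" using tendsto_mult_zero by blast
    then show "(\<lambda>n. 1 / r n / real n powr \<epsilon>) \<longlonglongrightarrow> 0"
      by (simp add: powr_minus_divide inverse_eq_divide)
  qed
  ultimately have "subpolynomial B"
    unfolding B_def[abs_def] C_def[abs_def]
    by (intro subpolynomial_add subpolynomial_mult subpolynomial_power subpolynomial_const)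
  then have lim: "\<forall>\<epsilon>>0. (\<lambda>n. B n / real n powr \<epsilon>) \<longlonglongrightarrow> 0" by (simp add: subpolynomial_def)
  have main: "robust_risk (noise_family M w z \<sigma>lo \<sigma>up n) n
           (\<lambda>y. shrinkage_estimator SI \<phi> n (\<lambda>l. shrink_const \<sigma>lo \<sigma>up r n (d n l)) (d n) (sel y) y) S
         \<le> ennreal ((1 + 5 * \<delta>) / (1 - \<delta>)) *
             (MIN l\<in>L n. robust_risk (noise_family M w z \<sigma>lo \<sigma>up n) n
                (shrinkage_estimator SI \<phi> n (\<lambda>l. shrink_const \<sigma>lo \<sigma>up r n (d n l)) (d n) l) S)
           + ennreal (B n * (1 + (LINT t:{0..1}|lborel. (deriv S t)\<^sup>2)) / (real n * \<delta>))"
    if n: "2 \<le> n" and \<delta>: "0 < \<delta>" "\<delta> < 1/2" and S: "periodic_C1 S"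
      and sel: "model_selector SI \<phi> n (\<lambda>l. shrink_const \<sigma>lo \<sigma>up r n (d n l)) (d n) (L n) \<delta> sel" for n \<delta> S sel
  proof -
    let ?c = "\<lambda>l. shrink_const \<sigma>lo \<sigma>up r n (d n l)" and ?Q = "noise_family M w z \<sigma>lo \<sigma>up n"
    let ?est = "shrinkage_estimator SI \<phi> n ?c (d n)"
    define s where "s = (LINT t:{0..1}|lborel. (deriv S t)\<^sup>2)"
    have s0: "0 \<le> s" unfolding s_def set_lebesgue_integral_def by (intro Bochner_Integration.integral_nonneg) auto
    have n1: "1 \<le> n" using n by simp
    note up = assms(7)[OF n1] and Ln = assms(15)[OF n1] and dn = assms(16)[OF n1]
    have r: "0 < r n" by (rule assms(17)[OF n1])
    \<comment> \<open>The weights are 1 up to \<open>d\<close>, so \<open>d\<close> is at most the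
      sum of the weights and hence at most \<open>A n\<close>; the lower variance bound is replaced
      by the upper one, and the root in the denominator is dropped.\<close>
    define c0 where "c0 = A n * \<sigma>up n / (r n * real n)"
    have c: "\<bar>?c l\<bar> \<le> c0" if l: "l \<in> L n" for l
    proof -
      have "real (d n l) = (\<Sum>j=1..d n l. l j)" using dn[OF l] by simp
      also have "\<dots> \<le> (\<Sum>j=1..n. l j)" using dn[OF l] L01[OF n1 l] by (intro sum_mono2) auto
      finally have "real (d n l) \<le> A n" using LA[OF n1 l] by simp
      moreover have d1: "1 \<le> real (d n l)" using dn[OF l] by simp
      ultimately have "(real (d n l) - 1) * \<sigma>lo n \<le> A n * \<sigma>up n" using up by (intro mult_mono) auto
      moreover have "r n * real n \<le> (r n + sqrt (real (d n l) * \<sigma>up n / real n)) * real n"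
        using up by (intro mult_right_mono) auto
      moreover have "0 \<le> (real (d n l) - 1) * \<sigma>lo n" using up d1 by (intro mult_nonneg_nonneg) auto
      ultimately have "?c l \<le> c0" "0 \<le> ?c l"
        unfolding shrink_const_def c0_def using r n up A0[OF n1]
        by (auto intro!: frac_le divide_nonneg_nonneg mult_nonneg_nonneg add_nonneg_nonneg)
      then show ?thesis by simp
    qed
    have on: "orthonormal_system {1..n} \<phi>"
      unfolding orthonormal_system_def
    proof (intro conjI)
      show "\<exists>C. \<forall>j\<in>{1..n}. \<forall>s\<in>{0..1}. \<bar>\<phi> j s\<bar> \<le> C"
        using assms(14)[of _ n] by (intro exI[of _ "\<phi>bar n"]) auto
    qed (use assms(11) in \<open>auto simp: orthonormal_basis_L2_def L2_on_def\<close>)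
    have sel': "is_arg_min (cost_fun SI \<phi> n ?c (d n) \<delta> y) (\<lambda>l. l \<in> L n) (sel y)" if "y \<in> space (skorokhod_space n)" for y
      using sel that by (simp add: model_selector_def)
    have le: "robust_risk ?Q n (\<lambda>y. ?est (sel y) y) S
        \<le> ennreal ((1 + 5 * \<delta>) / (1 - \<delta>)) * robust_risk ?Q n (?est l) S + ennreal (B n * (1 + s) / (real n * \<delta>))"
      if l: "l \<in> L n" for l
      unfolding robust_risk_def[of _ _ "\<lambda>y. ?est (sel y) y"]
    proof (rule SUP_least)
      fix Q assume Q: "Q \<in> ?Q"
      then obtain \<sigma>1 \<sigma>2 where Q_eq: "Q = noise_law M w z n \<sigma>1 \<sigma>2" and \<sigma>: "\<sigma>lo n \<le> \<sigma>1\<^sup>2" "\<sigma>1\<^sup>2 + \<sigma>2\<^sup>2 \<le> \<sigma>up n"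
        by (auto simp: noise_family_def)
      have \<sigma>0: "0 < \<sigma>1\<^sup>2 + \<sigma>2\<^sup>2" using \<sigma> up zero_le_power2[of \<sigma>2] by linarith
      have SI: "is_stoch_integral n (observation_law n (noise_law M w z n \<sigma>1 \<sigma>2) S) f (SI n f)" if "L2_on (real n) f" for f
        using assms(10) that Q S n1 unfolding model_stoch_integrals_def Q_eq by blast
      have "risk n Q (\<lambda>y. ?est (sel y) y) S \<le> ennreal ((1 + 5 * \<delta>) / (1 - \<delta>)) * risk n Q (?est l) S
        + ennreal (2 / \<delta> * (real (card (L n)) * ((\<sigma>1\<^sup>2 + \<sigma>2\<^sup>2) / real n * (12 * C n + 35))
          + (24 * c0\<^sup>2 + 3 * A n * ((1 + s) * (2 + 2 * (\<sigma>1\<^sup>2 + \<sigma>2\<^sup>2) + (\<sigma>1\<^sup>2 + \<sigma>2\<^sup>2)\<^sup>2 * C2) / (real n * sqrt (real n))))))"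
        unfolding Q_eq C_def C2_def p4_def s_def
        using Ln assms(13)[OF n1]
        by (intro selected_risk_bound[where SI=SI and sel=sel and c="?c" and d="d n" and L="L n"] n \<sigma>0 S SI on assms(12)
            assms(14)[of _ n] L01[OF n1] dn LA[OF n1] c \<delta> sel' l) auto
      also have "\<dots> \<le> ennreal ((1 + 5 * \<delta>) / (1 - \<delta>)) * robust_risk ?Q n (?est l) S + ennreal (B n * (1 + s) / (real n * \<delta>))"
      proof (intro add_mono mult_left_mono ennreal_leI)
        show "risk n Q (?est l) S \<le> robust_risk ?Q n (?est l) S"
          unfolding robust_risk_def by (rule SUP_upper[OF Q])
        show "2 / \<delta> * (real (card (L n)) * ((\<sigma>1\<^sup>2 + \<sigma>2\<^sup>2) / real n * (12 * C n + 35))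
          + (24 * c0\<^sup>2 + 3 * A n * ((1 + s) * (2 + 2 * (\<sigma>1\<^sup>2 + \<sigma>2\<^sup>2) + (\<sigma>1\<^sup>2 + \<sigma>2\<^sup>2)\<^sup>2 * C2) / (real n * sqrt (real n)))))
          \<le> B n * (1 + s) / (real n * \<delta>)"
          unfolding c0_def B_def a_def
          by (rule remainder_scaling[OF \<sigma>0 \<sigma>(2) _ C0 s0 A0[OF n1] \<delta>(1)]) (use n in auto)
      qed simp
      finally show "risk n Q (\<lambda>y. ?est (sel y) y) S
        \<le> ennreal ((1 + 5 * \<delta>) / (1 - \<delta>)) * robust_risk ?Q n (?est l) S + ennreal (B n * (1 + s) / (real n * \<delta>))" .
    qed
    \<comment> \<open>Finitely many weights: the minimum of the robust risks is attained, and the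
      bound for that competitor is the claim.\<close>
    have "(MIN l\<in>L n. robust_risk ?Q n (?est l) S) \<in> (\<lambda>l. robust_risk ?Q n (?est l) S) ` L n"
      using Ln by (intro Min_in) auto
    then obtain l where "l \<in> L n" "(MIN l\<in>L n. robust_risk ?Q n (?est l) S) = robust_risk ?Q n (?est l) S" by blast
    with le[of l] show ?thesis by (simp add: s_def)
  qed
  show ?thesis
    by (rule exI[of _ B]) (use B0 lim main in \<open>auto simp del: of_nat_numeral\<close>)
qed

end
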